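(* Let $m:\mathbb{R}^2\to\mathbb{C}$ be a Coifman–Meyer multiplier. Let $\frac1p=\frac1{p_1}+\frac1{p_2}$. (i) If $1<p_1,p_2<\infty$, then $\Lambda_m:L^{p_1}(\mathbb{T})\times L^{p_2}(\mathbb{T})\to L^p(\mathbb{T})$. (ii) If $p_1$ or $p_2$ or both are equal to $1$ (the other, if any, lying in $(1,\infty)$), this still holds with $L^p$ replaced by $L^{p,\infty}$.
   Context: $\mathbb{T}=\mathbb{R}/\mathbb{Z}$ with Lebesgue (probability) measure; $\widehat f(n)=\int_{\mathbb{T}}f(x)e^{-2\pi inx}\,dx$ for $n\in\mathbb{Z}$. For $0<p<\infty$, $\|f\|_p=(\int|f|^p)^{1/p}$ and $\|f\|_{p,\infty}=\sup_{\lambda>0}\lambda\,|\{|f|>\lambda\}|^{1/p}$; $L^p$ and $L^{p,\infty}$ are the spaces of functions for which these are finite. A function $m:\mathbb{R}^2\to\mathbb{C}$ that is smooth away from $0$ and uniformly bounded is a Coifman–Meyer multiplier if $|\partial^\alpha m(\vec t)|\lesssim\|\vec t\|^{-|\alpha|}$ for all multi-indices $\alpha$ with $|\alpha|\le10$, where $\|\cdot\|$ is the Euclidean norm on $\mathbb{R}^2$ and $A\lesssim B$ means $A\le CB$ for some constant $C$. For $L^1$ functions $f,g:\mathbb{T}\to\mathbb{C}$, the operator is defined by $\Lambda_m(f,g)(x)=\sum_{s,t\in\mathbb{Z}}m(s,t)\,\widehat f(s)\,\widehat g(t)\,e^{2\pi ix(s+t)}$. Writing $T:X_1\times X_2\to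 Y$ means that $T$ maps boundedly: there is a constant $C$ with $\|T(f,g)\|_Y\le C\|f\|_{X_1}\|g\|_{X_2}$ for all $f,g$. *)

theory Defs
  imports "HOL-Analysis.Analysis"
begin

section \<open>Coifman--Meyer multipliers\<close>

definition partial_fst :: "(real \<times> real \<Rightarrow> complex) \<Rightarrow> real \<times> real \<Rightarrow> complex" where
  "partial_fst F = (\<lambda>(x, y). vector_derivative (\<lambda>u. F (u, y)) (at x))"

definition partial_snd :: "(real \<times> real \<Rightarrow> complex) \<Rightarrow> real \<times> real \<Rightarrow> complex" where
  "partial_snd F = (\<lambda>(x, y). vector_derivative (\<lambda>v. F (x, v)) (at y))"

text \<open>
  For open \<open>S\<close>: all iterated partial derivatives of order at most \<open>k\<close>, taken in any order,
  exist and are continuous on \<open>S\<close>.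
\<close>

fun C_k_on :: "nat \<Rightarrow> (real \<times> real) set \<Rightarrow> (real \<times> real \<Rightarrow> complex) \<Rightarrow> bool" where
  "C_k_on 0 S F \<longleftrightarrow> continuous_on S F"
| "C_k_on (Suc k) S F \<longleftrightarrow>
     continuous_on S F \<and>
     (\<forall>(x, y)\<in>S. (\<lambda>u. F (u, y)) differentiable (at x) \<and> (\<lambda>v. F (x, v)) differentiable (at y)) \<and>
     C_k_on k S (partial_fst F) \<and> C_k_on k S (partial_snd F)"

definition C_infinity_on :: "(real \<times> real) set \<Rightarrow> (real \<times> real \<Rightarrow> complex) \<Rightarrow> bool" where
  "C_infinity_on S F \<longleftrightarrow> (\<forall>k. C_k_on k S F)"

text \<open>\<open>(a, b)\<close> is the multi-index; the norm on \<^typ>\<open>real \<times> real\<close> is the Euclidean one.\<close>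

definition coifman_meyer :: "(real \<times> real \<Rightarrow> complex) \<Rightarrow> bool" where
  "coifman_meyer m \<longleftrightarrow>
     C_infinity_on (- {0}) m \<and> bounded (range m) \<and>
     (\<forall>a b. a + b \<le> 10 \<longrightarrow>
        (\<exists>C. \<forall>t. t \<noteq> 0 \<longrightarrow>
           norm ((partial_fst ^^ a) ((partial_snd ^^ b) m) t) \<le> C / norm t ^ (a + b)))"


section \<open>Function spaces on the circle\<close>

text \<open>
  \<open>\<real>/\<int>\<close> is represented by its fundamental domain \<open>[0, 1)\<close>: a function on the circle is a
  function on the reals whose values outside \<open>[0, 1)\<close> play no role.  Functions that agree
  almost everywhere are not identified.
\<close>

definition circle :: "real measure" where
  "circle = lebesgue_on {0..<1}"

definition Lp :: "real \<Rightarrow> (real \<Rightarrow> complex) set" where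
  "Lp p = {f \<in> borel_measurable circle. integrable circle (\<lambda>x. norm (f x) powr p)}"

definition Lp_norm :: "real \<Rightarrow> (real \<Rightarrow> complex) \<Rightarrow> real" where
  "Lp_norm p f = (\<integral>x. norm (f x) powr p \<partial>circle) powr (1 / p)"

definition level_quantity :: "real \<Rightarrow> (real \<Rightarrow> complex) \<Rightarrow> real \<Rightarrow> real" where
  "level_quantity p f l = l * measure circle {x \<in> space circle. norm (f x) > l} powr (1 / p)"

definition weak_Lp :: "real \<Rightarrow> (real \<Rightarrow> complex) set" where
  "weak_Lp p = {f \<in> borel_measurable circle. bdd_above (level_quantity p f ` {0<..})}"

definition weak_Lp_norm :: "real \<Rightarrow> (real \<Rightarrow> complex) \<Rightarrow> real" where
  "weak_Lp_norm p f = (SUP l\<in>{0<..}. level_quantity p f l)"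


section \<open>The bilinear operator\<close>

definition fourier_coeff :: "(real \<Rightarrow> complex) \<Rightarrow> int \<Rightarrow> complex" where
  "fourier_coeff f n = (\<integral>x. f x * cis (- 2 * pi * of_int n * x) \<partial>circle)"

definition Lambda_term ::
  "(real \<times> real \<Rightarrow> complex) \<Rightarrow> (real \<Rightarrow> complex) \<Rightarrow> (real \<Rightarrow> complex) \<Rightarrow> real \<Rightarrow> int \<times> int \<Rightarrow> complex"
  where
  "Lambda_term m f g x = (\<lambda>(s, t).
     m (of_int s, of_int t) * fourier_coeff f s * fourier_coeff g t *
       cis (2 * pi * x * of_int (s + t)))"

definition fejer_weight :: "nat \<Rightarrow> int \<Rightarrow> real" where
  "fejer_weight N n = 1 - \<bar>of_int n\<bar> / (real N + 1)"

definition Lambda_mean ::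
  "(real \<times> real \<Rightarrow> complex) \<Rightarrow> (real \<Rightarrow> complex) \<Rightarrow> (real \<Rightarrow> complex) \<Rightarrow> nat \<Rightarrow> real \<Rightarrow> complex"
  where
  "Lambda_mean m f g N x =
     (\<Sum>s\<in>{- int N..int N}. \<Sum>t\<in>{- int N..int N}.
        of_real (fejer_weight N s * fejer_weight N t) * Lambda_term m f g x (s, t))"

definition converges_in_measure ::
  "(nat \<Rightarrow> real \<Rightarrow> complex) \<Rightarrow> (real \<Rightarrow> complex) \<Rightarrow> bool" where
  "converges_in_measure F h \<longleftrightarrow>
     h \<in> borel_measurable circle \<and>
     (\<forall>\<epsilon>>0. (\<lambda>N. measure circle {x \<in> space circle. norm (F N x - h x) > \<epsilon>}) \<longlonglongrightarrow> 0)"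

text \<open>
  For general integrable \<open>f\<close> and \<open>g\<close> the double series
  \<open>\<Sum>s t. m (s, t) * fourier_coeff f s * fourier_coeff g t * e(x * (s + t))\<close>
  need not converge at any point: already for \<open>m = 1\<close> and \<open>g = 1\<close> it is the Fourier series of
  \<open>f\<close>.  The series is therefore read as a Fourier series, summed by Fejer means (which replace
  \<open>f\<close> and \<open>g\<close> by trigonometric polynomials converging to them in the norm of \<open>L\<^sup>1\<close>), with the
  limit taken in measure.  \<open>has_Lambda m f g h\<close> says that \<open>h\<close> is a representative of the
  resulting function, which is unique up to null sets.
\<close>

definition has_Lambda ::
  "(real \<times> real \<Rightarrow> complex) \<Rightarrow> (real \<Rightarrow> complex) \<Rightarrow> (real \<Rightarrow> complex) \<Rightarrow> (real \<Rightarrow> complex) \<Rightarrow> bool"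
  where
  "has_Lambda m f g h \<longleftrightarrow> converges_in_measure (Lambda_mean m f g) h"

text \<open>
  Boundedness of an operator \<open>T : X\<^sub>1 \<times> X\<^sub>2 \<rightarrow> Y\<close> whose values are determined up to null sets;
  \<open>T f g h\<close> means that \<open>h\<close> represents the value at \<open>(f, g)\<close>.
\<close>

definition maps_boundedly ::
  "('a \<Rightarrow> 'b \<Rightarrow> 'c \<Rightarrow> bool) \<Rightarrow> 'a set \<Rightarrow> ('a \<Rightarrow> real) \<Rightarrow> 'b set \<Rightarrow> ('b \<Rightarrow> real) \<Rightarrow>
     'c set \<Rightarrow> ('c \<Rightarrow> real) \<Rightarrow> bool" where
  "maps_boundedly T X1 norm1 X2 norm2 Y normY \<longleftrightarrow>
     (\<exists>C. \<forall>f\<in>X1. \<forall>g\<in>X2.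
        (\<exists>h. T f g h) \<and>
        (\<forall>h. T f g h \<longrightarrow> h \<in> Y \<and> normY h \<le> C * norm1 f * norm2 g))"


text \<open>
  Whenever the double series converges absolutely (in particular for trigonometric polynomials)
  its sum is the value of the operator.
\<close>

lemma has_Lambda_infsum:
  assumes "(\<lambda>(s, t). norm (m (of_int s, of_int t) * fourier_coeff f s * fourier_coeff g t))
             summable_on UNIV"
  shows "has_Lambda m f g (\<lambda>x. \<Sum>\<^sub>\<infinity>z. Lambda_term m f g x z)"
proof -
  define a where "a = (\<lambda>(s, t). norm (m (of_int s, of_int t) * fourier_coeff f s * fourier_coeff g t))"
  define B where "B = (\<lambda>N. {- int N..int N} \<times> {- int N..int N})"
  define w where "w = (\<lambda>N (s, t). if (s, t) \<in> B N then fejer_weight N s * fejer_weight N t else 0)"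
  define D where "D = (\<lambda>N. \<integral>z. (1 - w N z) * a z \<partial>count_space UNIV)"
  define h where "h = (\<lambda>x. \<Sum>\<^sub>\<infinity>z. Lambda_term m f g x z)"
  have a_nonneg: "a z \<ge> 0" for z by (auto simp: a_def split: prod.splits)
  have norm_term: "norm (Lambda_term m f g x z) = a z" for x z
    by (auto simp: a_def Lambda_term_def norm_mult split: prod.splits)
  have a_sum: "a summable_on UNIV" using assms by (simp add: a_def)
  have a_int: "integrable (count_space UNIV) a"
    using a_sum a_nonneg
    by (metis abs_summable_equivalent abs_summable_on_def summable_on_cong real_norm_def abs_of_nonneg)
  have fw: "0 \<le> fejer_weight N s \<and> fejer_weight N s \<le> 1" if "s \<in> {- int N..int N}" for N s
    using that unfolding fejer_weight_def by (auto simp: divide_simps)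
  have w01: "0 \<le> w N z \<and> w N z \<le> 1" for N z
    using fw by (cases z) (auto simp: w_def B_def intro!: mult_le_one)
  have w_lim: "(\<lambda>N. w N z) \<longlonglongrightarrow> 1" for z
  proof (cases z)
    case (Pair s t)
    have fl: "(\<lambda>N. fejer_weight N n) \<longlonglongrightarrow> 1" for n
    proof -
      have "(\<lambda>N. 1 - \<bar>real_of_int n\<bar> * inverse (real (Suc N))) \<longlonglongrightarrow> 1 - \<bar>real_of_int n\<bar> * 0"
        by (intro tendsto_intros LIMSEQ_inverse_real_of_nat)
      then show ?thesis by (simp add: fejer_weight_def divide_inverse add.commute)
    qed
    have "(\<lambda>N. fejer_weight N s * fejer_weight N t) \<longlonglongrightarrow> 1"
      using tendsto_mult[OF fl[of s] fl[of t]] by simp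
    moreover have "\<forall>\<^sub>F N in sequentially. fejer_weight N s * fejer_weight N t = w N z"
      using eventually_ge_at_top[of "nat (max \<bar>s\<bar> \<bar>t\<bar>)"]
      by eventually_elim (auto simp: Pair w_def B_def)
    ultimately show ?thesis by (rule Lim_transform_eventually)
  qed
  have D_lim: "D \<longlonglongrightarrow> 0"
  proof -
    have "(\<lambda>N. \<integral>z. (1 - w N z) * a z \<partial>count_space UNIV) \<longlonglongrightarrow> (\<integral>z. 0 \<partial>count_space (UNIV :: (int \<times> int) set))"
    proof (rule integral_dominated_convergence[where w = a])
      show "AE z in count_space UNIV. (\<lambda>N. (1 - w N z) * a z) \<longlonglongrightarrow> 0"
      proof (intro AE_I2)
        fix z
        have "(\<lambda>N. (1 - w N z) * a z) \<longlonglongrightarrow> (1 - 1) * a z"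
          by (intro tendsto_intros w_lim)
        then show "(\<lambda>N. (1 - w N z) * a z) \<longlonglongrightarrow> 0" by simp
      qed
      show "AE z in count_space UNIV. norm ((1 - w N z) * a z) \<le> a z" for N
        using w01 a_nonneg by (intro AE_I2) (auto simp: abs_mult intro!: mult_left_le_one_le)
    qed (auto simp: a_int)
    then show ?thesis by (simp add: D_def)
  qed
  have bound: "norm (Lambda_mean m f g N x - h x) \<le> D N" for N x
  proof -
    let ?b = "\<lambda>z. Lambda_term m f g x z"
    have b_abs: "(\<lambda>z. norm (?b z)) summable_on UNIV"
      by (simp add: norm_term a_sum)
    have b_sum: "?b summable_on UNIV" by (rule abs_summable_summable[OF b_abs])
    have "Lambda_mean m f g N x = (\<Sum>z\<in>B N. of_real (w N z) * ?b z)"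
      unfolding Lambda_mean_def B_def sum.cartesian_product
      by (intro sum.cong) (auto simp: w_def B_def)
    also have "\<dots> = (\<Sum>\<^sub>\<infinity>z\<in>B N. of_real (w N z) * ?b z)"
      by (simp add: B_def)
    also have "\<dots> = (\<Sum>\<^sub>\<infinity>z. of_real (w N z) * ?b z)"
      by (intro infsum_cong_neutral) (auto simp: w_def)
    finally have mean: "Lambda_mean m f g N x = (\<Sum>\<^sub>\<infinity>z. of_real (w N z) * ?b z)" .
    have wa_sum: "(\<lambda>z. w N z * a z) summable_on UNIV"
      by (rule summable_on_comparison_test[OF a_sum])
         (use w01 a_nonneg in \<open>auto intro!: mult_left_le_one_le\<close>)
    have wb_sum: "(\<lambda>z. of_real (w N z) * ?b z) summable_on UNIV"
      by (rule abs_summable_summable) (use wa_sum w01 in \<open>simp add: norm_mult norm_term\<close>)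
    have ca_sum: "(\<lambda>z. (1 - w N z) * a z) summable_on UNIV"
      by (rule summable_on_comparison_test[OF a_sum])
         (use w01 a_nonneg in \<open>auto intro!: mult_left_le_one_le\<close>)
    have nrm: "norm (of_real (w N z) * ?b z - ?b z) = (1 - w N z) * a z" for z
    proof -
      have "of_real (w N z) * ?b z - ?b z = - (of_real (1 - w N z) * ?b z)"
        by (simp add: algebra_simps)
      then show ?thesis using w01[of N z]
        by (simp only: norm_minus_cancel norm_mult norm_of_real norm_term) simp
    qed
    have "Lambda_mean m f g N x - h x = (\<Sum>\<^sub>\<infinity>z. of_real (w N z) * ?b z - ?b z)"
      using infsum_add[OF wb_sum, of "\<lambda>z. - ?b z"] b_sum
      by (simp add: mean h_def infsum_uminus summable_on_uminus)
    also have "norm \<dots> \<le> (\<Sum>\<^sub>\<infinity>z. norm (of_real (w N z) * ?b z - ?b z))"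
      by (rule norm_infsum_bound) (use ca_sum in \<open>simp add: nrm\<close>)
    also have "\<dots> = (\<Sum>\<^sub>\<infinity>z. (1 - w N z) * a z)"
      by (simp add: nrm)
    also have "\<dots> = infsetsum (\<lambda>z. (1 - w N z) * a z) UNIV"
      by (rule infsetsum_infsum[symmetric])
         (use ca_sum w01 a_nonneg in \<open>simp add: abs_summable_equivalent[symmetric] abs_mult\<close>)
    also have "\<dots> = D N" by (simp add: D_def infsetsum_def)
    finally show ?thesis .
  qed
  have cis_meas: "(\<lambda>x. cis (2 * pi * x * c)) \<in> borel_measurable circle" for c
  proof -
    have "(\<lambda>x. cis (2 * pi * x * c)) \<in> borel_measurable borel"
      by (intro borel_measurable_continuous_onI continuous_intros)
    then show ?thesis
      unfolding circle_def by (intro measurable_restrict_space1 measurable_completion) simp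
  qed
  have mean_meas: "Lambda_mean m f g N \<in> borel_measurable circle" for N
    unfolding Lambda_mean_def Lambda_term_def prod.case
    by (intro borel_measurable_sum borel_measurable_times borel_measurable_const cis_meas)
  have ptw: "(\<lambda>N. Lambda_mean m f g N x) \<longlonglongrightarrow> h x" for x
    using tendsto_0_le[OF D_lim, of "\<lambda>N. Lambda_mean m f g N x - h x" 1] bound
      order_trans[OF norm_ge_zero bound]
    by (auto simp: LIM_zero_iff)
  have h_meas: "h \<in> borel_measurable circle"
    by (rule borel_measurable_LIMSEQ_metric[OF mean_meas ptw])
  have "(\<lambda>N. measure circle {x \<in> space circle. norm (Lambda_mean m f g N x - h x) > e}) \<longlonglongrightarrow> 0"
    if "e > 0" for e
  proof (rule tendsto_eventually)
    have "\<forall>\<^sub>F N in sequentially. D N < e"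
      using D_lim that by (rule order_tendstoD)
    then show "\<forall>\<^sub>F N in sequentially.
        measure circle {x \<in> space circle. norm (Lambda_mean m f g N x - h x) > e} = 0"
    proof eventually_elim
      case (elim N)
      then have "{x \<in> space circle. norm (Lambda_mean m f g N x - h x) > e} = {}"
        using bound[of N] by (auto simp: not_less) (meson less_trans not_less)
      then show ?case by (simp only: measure_empty)
    qed
  qed
  with h_meas show ?thesis
    by (simp add: has_Lambda_def converges_in_measure_def h_def)
qed

end

theory Submission imports Defs begin

text \<open>
  By periodicity the operator can be studied on the cyclic grid of \<open>2\<^sup>L\<close> points: there a
  trigonometric polynomial is determined by its samples, \<open>\<Lambda>\<^sub>m\<close> becomes a bilinear form with the
  kernel \<open>\<Sum>\<^sub>s\<^sub>,\<^sub>t m(s, t) e((s (x - y) + t (x - z)) / 2\<^sup>L)\<close>, and all estimates need only be uniform in \<open>L\<close>.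
  Splitting \<open>m\<close> into dyadic annuli and summing by parts four times in each frequency variable shows
  that the kernel satisfies bilinear Calderon--Zygmund estimates.  The cancellation comes from
  Plancherel: in the trilinear form two of the three frequencies \<open>s\<close>, \<open>t\<close>, \<open>- s - t\<close> are comparable to
  the scale of the annulus, so the sum over the scales is controlled by Cauchy--Schwarz and
  Bessel for two of the functions, the third one being bounded.

  The Calderon--Zygmund decomposition turns this into the weak type estimate
  \<open>L\<^sup>1 \<times> L\<^sup>1 \<rightarrow> L\<^sup>1\<^sup>/\<^sup>2\<^sup>,\<^sup>\<infinity>\<close>.  Its local form says that on each dyadic cell the bilinear form differs
  from a constant, off a small proportion of the cell, by at most a multiple of the product of the
  maximal functions of \<open>f\<close> and \<open>g\<close>.  A good-lambda inequality then controls the bilinear form by this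
  product, and the remaining weak and strong bounds follow from those for the maximal function.

  To pass to general \<open>f\<close> and \<open>g\<close>, the Fejer means are shown to be Cauchy in \<open>L\<^sup>1\<close>; the weak type
  estimate at \<open>(1, 1)\<close> makes the means of \<open>\<Lambda>\<^sub>m (f, g)\<close> Cauchy in measure, and the bounds are
  inherited by the limit.
\<close>

section \<open>Finite differences and discrete bumps\<close>

text \<open>On a finite grid, maximal functions, stopping cells and decompositions are finite
  combinatorics, and the number of grid points supplies the a priori bound that the good-lambda
  iteration needs. The target exponent may be below 1, where duality and convexity of the target
  fail. Mean oscillation and level sets treat all exponents alike, including the endpoint 1 of the
  arguments. The multiplier is only bounded at the origin, and differences taken across the origin
  do not decay. The lowest dyadic piece absorbs this: it lives at scale 1, where a bound on the size
  is already a bound on the differences. Order four is what makes the kernel of one annulus at most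
  a product of two weights of uniformly bounded mass, one in x - y and one in x - z. It also makes
  kernel differences summable over the scales: they grow like 8 ^ j up to the scale set by the
  distance of the points and decay like (1 / 2) ^ j beyond it.\<close>

definition fdiff :: "('a::{plus,one} \<Rightarrow> complex) \<Rightarrow> 'a \<Rightarrow> complex" where
  "fdiff a = (\<lambda>n. a (n + 1) - a n)"

lemma fdiff_funpow_Suc: "(fdiff ^^ Suc k) a n = (fdiff ^^ k) a (n + 1) - (fdiff ^^ k) a n"
  by (simp add: fdiff_def)

lemma fdiff_funpow_add:
  "(fdiff ^^ k) (\<lambda>n. a n + b n) = (\<lambda>n. (fdiff ^^ k) a n + (fdiff ^^ k) b n)"
  by (induction k) (auto simp: fdiff_def fun_eq_iff)

lemma fdiff_funpow_diff:
  "(fdiff ^^ k) (\<lambda>n. a n - b n) = (\<lambda>n. (fdiff ^^ k) a n - (fdiff ^^ k) b n)"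
  by (induction k) (auto simp: fdiff_def fun_eq_iff)

lemma fdiff_funpow_cmult: "(fdiff ^^ k) (\<lambda>n. c * a n) = (\<lambda>n. c * (fdiff ^^ k) a n)"
  by (induction k) (auto simp: fdiff_def fun_eq_iff algebra_simps)

lemma fdiff_funpow_cmult_right: "(fdiff ^^ k) (\<lambda>n. a n * c) = (\<lambda>n. (fdiff ^^ k) a n * c)"
  by (induction k) (auto simp: fdiff_def fun_eq_iff algebra_simps)

lemma fdiff_funpow_shift:
  fixes a :: "'a::semiring_1 \<Rightarrow> complex"
  shows "(fdiff ^^ k) (\<lambda>n. a (n + c)) = (\<lambda>n. (fdiff ^^ k) a (n + c))"
  by (induction k) (auto simp: fdiff_def fun_eq_iff ac_simps)

lemma fdiff_funpow_cong:
  fixes a b :: "int \<Rightarrow> complex"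
  assumes "\<And>m. n \<le> m \<Longrightarrow> m \<le> n + int k \<Longrightarrow> a m = b m"
  shows "(fdiff ^^ k) a n = (fdiff ^^ k) b n"
  using assms
proof (induction k arbitrary: n)
  case (Suc k)
  have "(fdiff ^^ k) a (n + 1) = (fdiff ^^ k) b (n + 1)" "(fdiff ^^ k) a n = (fdiff ^^ k) b n"
    by (rule Suc.IH; use Suc.prems in force)+
  then show ?case by (simp only: fdiff_funpow_Suc)
qed auto

lemma fdiff_funpow_0: "(fdiff ^^ k) (\<lambda>_. 0) n = 0"
  by (induction k arbitrary: n) (auto simp: fdiff_def)

lemma fdiff_funpow_const: "(fdiff ^^ Suc k) (\<lambda>_. c) n = 0"
  by (induction k arbitrary: n) (auto simp: fdiff_def)

text \<open>The window n, ..., n + k holds exactly the values that the \<open>k\<close>-th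
  difference at \<open>n\<close> reads. All differences inside it are controlled, so the notion
  passes to \<open>fdiff a\<close> and to shifts with \<open>k\<close> lowered by one, as the
  Leibniz induction needs.\<close>

definition smooth_seq :: "nat \<Rightarrow> (int \<Rightarrow> complex) \<Rightarrow> int \<Rightarrow> real \<Rightarrow> real \<Rightarrow> bool" where
  "smooth_seq k a n A r \<longleftrightarrow>
     (\<forall>i m. n \<le> m \<and> m + int i \<le> n + int k \<longrightarrow> norm ((fdiff ^^ i) a m) \<le> A * r ^ i)"

lemma smooth_seqD: "smooth_seq k a n A r \<Longrightarrow> norm ((fdiff ^^ k) a n) \<le> A * r ^ k"
  by (auto simp: smooth_seq_def)

lemma smooth_seq_nonneg: "smooth_seq k a n A r \<Longrightarrow> 0 \<le> A"
proof -
  assume "smooth_seq k a n A r"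
  then have "norm ((fdiff ^^ 0) a n) \<le> A * r ^ 0" unfolding smooth_seq_def by force
  then show "0 \<le> A" by (auto intro: order_trans[OF norm_ge_zero])
qed

lemma smooth_seq_mono:
  "smooth_seq k a n A r \<Longrightarrow> A \<le> A' \<Longrightarrow> r \<le> r' \<Longrightarrow> 0 \<le> r \<Longrightarrow> smooth_seq k a n A' r'"
proof -
  assume *: "smooth_seq k a n A r" "A \<le> A'" "r \<le> r'" "0 \<le> r"
  have "A * r ^ i \<le> A' * r' ^ i" for i
    using * smooth_seq_nonneg[OF *(1)] by (intro mult_mono power_mono) auto
  then show "smooth_seq k a n A' r'"
    using *(1) order_trans unfolding smooth_seq_def by blast
qed

lemma smooth_seq_subwindow:
  "smooth_seq k a n A r \<Longrightarrow> n \<le> m \<Longrightarrow> m + int i \<le> n + int k \<Longrightarrow> smooth_seq i a m A r"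
  unfolding smooth_seq_def by auto

lemma smooth_seq_diff:
  assumes "smooth_seq k a n A r" "smooth_seq k b n B r"
  shows "smooth_seq k (\<lambda>x. a x - b x) n (A + B) r"
  unfolding smooth_seq_def fdiff_funpow_diff
  by (intro allI impI, rule norm_triangle_le_diff)
     (use assms in \<open>auto simp: smooth_seq_def distrib_right intro!: add_mono\<close>)

lemma smooth_seq_const: "norm c \<le> A \<Longrightarrow> 0 \<le> r \<Longrightarrow> smooth_seq k (\<lambda>_. c) n A r"
  unfolding smooth_seq_def
proof (intro allI impI)
  fix i :: nat and m :: int assume *: "norm c \<le> A" "0 \<le> r"
  have "0 \<le> A" using * norm_ge_zero order_trans by blast
  then show "norm ((fdiff ^^ i) (\<lambda>_. c) m) \<le> A * r ^ i"
    using * by (cases i) (auto simp: fdiff_funpow_const simp del: funpow.simps)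
qed

lemma smooth_seq_cmult:
  assumes "smooth_seq k a n A r" "norm c \<le> B"
  shows "smooth_seq k (\<lambda>x. c * a x) n (B * A) r"
  unfolding smooth_seq_def fdiff_funpow_cmult norm_mult
  by (intro allI impI) (use assms in \<open>auto simp: smooth_seq_def mult.assoc intro!: mult_mono order_trans[OF norm_ge_zero assms(2)]\<close>)

lemma smooth_seq_fdiff:
  assumes "smooth_seq (Suc k) a n A r"
  shows "smooth_seq k (fdiff a) n (A * r) r"
  unfolding smooth_seq_def
proof (intro allI impI)
  fix i m assume "n \<le> m \<and> m + int i \<le> n + int k"
  then have "n \<le> m \<and> m + int (Suc i) \<le> n + int (Suc k)" by auto
  then have "norm ((fdiff ^^ Suc i) a m) \<le> A * r ^ Suc i"
    using assms unfolding smooth_seq_def by blast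
  then show "norm ((fdiff ^^ i) (fdiff a) m) \<le> A * r * r ^ i"
    by (simp only: funpow_Suc_right o_apply power_Suc mult.assoc)
qed

lemma smooth_seq_shift:
  assumes "smooth_seq (Suc k) a n A r"
  shows "smooth_seq k (\<lambda>x. a (x + 1)) n A r"
  unfolding smooth_seq_def fdiff_funpow_shift using assms unfolding smooth_seq_def by auto

text \<open>Discrete Leibniz rule: a difference of a product splits into two products with one
  difference each, and these two terms per step produce \<open>2 ^ k\<close>.\<close>

lemma norm_fdiff_funpow_mult:
  assumes "smooth_seq k a n A r" "smooth_seq k b n B r"
  shows "norm ((fdiff ^^ k) (\<lambda>x. a x * b x) n) \<le> A * B * (2 * r) ^ k"
  using assms
proof (induction k arbitrary: a b A B)
  case 0
  then show ?case
    using smooth_seqD[OF 0(1)] smooth_seqD[OF 0(2)] smooth_seq_nonneg[OF 0(1)]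
    by (auto simp: norm_mult intro!: mult_mono)
next
  case (Suc k)
  have eq: "fdiff (\<lambda>x. a x * b x) = (\<lambda>x. fdiff a x * b x + a (x + 1) * fdiff b x)"
    by (auto simp: fdiff_def algebra_simps)
  have sub: "smooth_seq k b n B r"
    using Suc.prems(2) by (rule smooth_seq_subwindow) auto
  have "norm ((fdiff ^^ Suc k) (\<lambda>x. a x * b x) n) \<le>
      norm ((fdiff ^^ k) (\<lambda>x. fdiff a x * b x) n) + norm ((fdiff ^^ k) (\<lambda>x. a (x + 1) * fdiff b x) n)"
    by (simp only: funpow_Suc_right o_apply eq fdiff_funpow_add norm_triangle_ineq)
  also have "\<dots> \<le> A * r * B * (2 * r) ^ k + A * (B * r) * (2 * r) ^ k"
    by (intro add_mono Suc.IH smooth_seq_fdiff smooth_seq_shift Suc.prems sub)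
  also have "\<dots> = A * B * (2 * r) ^ Suc k" by (simp add: algebra_simps)
  finally show ?case .
qed

lemma smooth_seq_mult:
  assumes "smooth_seq k a n A r" "smooth_seq k b n B r"
  shows "smooth_seq k (\<lambda>x. a x * b x) n (A * B) (2 * r)"
  unfolding smooth_seq_def
proof (intro allI impI)
  fix i m assume *: "n \<le> m \<and> m + int i \<le> n + int k"
  show "norm ((fdiff ^^ i) (\<lambda>x. a x * b x) m) \<le> A * B * (2 * r) ^ i"
    by (rule norm_fdiff_funpow_mult; rule smooth_seq_subwindow[where n = n and k = k]) (use assms * in auto)
qed

section \<open>Discrete bumps from iterated box averages\<close>

definition box_avg :: "nat \<Rightarrow> (int \<Rightarrow> complex) \<Rightarrow> int \<Rightarrow> complex" where
  "box_avg w a n = (\<Sum>i<w. a (n + int i)) / of_nat w"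

lemma norm_box_avg_le:
  assumes "\<And>n. norm (a n) \<le> A" "w > 0"
  shows "norm (box_avg w a n) \<le> A"
proof -
  have "norm (\<Sum>i<w. a (n + int i)) \<le> (\<Sum>i<w. A)"
    by (rule sum_norm_le) (use assms in auto)
  then show ?thesis
    using assms by (simp add: box_avg_def norm_divide divide_simps mult.commute)
qed

lemma fdiff_box_avg: "fdiff (box_avg w a) = (\<lambda>n. (a (n + int w) - a n) / of_nat w)"
proof
  fix n
  have "(\<Sum>i<w. a (n + 1 + int i)) + a n = (\<Sum>i<Suc w. a (n + int i))"
    by (subst sum.lessThan_Suc_shift) (simp add: ac_simps)
  then have "(\<Sum>i<w. a (n + 1 + int i)) - (\<Sum>i<w. a (n + int i)) = a (n + int w) - a n"
    by (simp add: algebra_simps)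
  then show "fdiff (box_avg w a) n = (a (n + int w) - a n) / of_nat w"
    by (simp add: fdiff_def box_avg_def diff_divide_distrib[symmetric])
qed

text \<open>By telescoping, a difference of a box average is a difference quotient of step
  \<open>w\<close>. Each of the \<open>l\<close> averages can pay for one difference with the factor
  \<open>2 / w\<close>, whence \<open>k \<le> l\<close>.\<close>

lemma norm_fdiff_box_avg_funpow:
  assumes "\<And>n. norm (a n) \<le> 1" "w > 0" "k \<le> l"
  shows "norm ((fdiff ^^ k) ((box_avg w ^^ l) a) n) \<le> (2 / w) ^ k"
  using assms(3)
proof (induction l arbitrary: k n)
  case 0
  then show ?case using assms by auto
next
  case (Suc l)
  show ?case
  proof (cases k)
    case 0
    have "norm ((box_avg w ^^ l) a n) \<le> 1" for n
      using Suc.IH[of 0 n] by simp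
    then show ?thesis using norm_box_avg_le assms(2) 0 by simp
  next
    case (Suc k')
    let ?b = "(box_avg w ^^ l) a"
    have "(fdiff ^^ k) ((box_avg w ^^ Suc l) a) n = (fdiff ^^ k') (\<lambda>n. (?b (n + int w) - ?b n) * (1 / of_nat w)) n"
      by (simp only: Suc funpow_Suc_right[of _ fdiff] o_apply funpow.simps(2)[of _ "box_avg w"] fdiff_box_avg) simp
    also have "\<dots> = ((fdiff ^^ k') ?b (n + int w) - (fdiff ^^ k') ?b n) * (1 / of_nat w)"
      by (simp only: fdiff_funpow_cmult_right fdiff_funpow_diff fdiff_funpow_shift)
    also have "norm \<dots> \<le> ((2 / w) ^ k' + (2 / w) ^ k') * (1 / w)"
      unfolding norm_mult
      by (intro mult_mono order_trans[OF norm_triangle_ineq4] add_mono Suc.IH)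
         (use Suc \<open>k \<le> Suc l\<close> in \<open>auto simp: norm_divide\<close>)
    also have "\<dots> = (2 / w) ^ k" by (simp add: Suc)
    finally show ?thesis .
  qed
qed

lemma box_avg_funpow_const:
  assumes "\<And>m. n \<le> m \<Longrightarrow> m \<le> n + int l * (int w - 1) \<Longrightarrow> a m = v" "w > 0"
  shows "(box_avg w ^^ l) a n = v"
  using assms(1)
proof (induction l arbitrary: n)
  case (Suc l)
  have "(box_avg w ^^ l) a (n + int i) = v" if "i < w" for i
  proof (rule Suc.IH)
    fix m assume "n + int i \<le> m" "m \<le> n + int i + int l * (int w - 1)"
    then show "a m = v" using that by (intro Suc.prems) (auto simp: algebra_simps)
  qed
  then have "box_avg w ((box_avg w ^^ l) a) n = v"
    using assms(2) by (subst box_avg_def) simp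
  then show ?case by simp
qed auto

text \<open>Averaging four times makes the differences up to order four of the size of a smooth bump's derivatives.\<close>

definition bump :: "nat \<Rightarrow> int \<Rightarrow> complex" where
  "bump w = (box_avg w ^^ 4) (\<lambda>n. if \<bar>n\<bar> \<le> 12 * int w then 1 else 0)"

text \<open>Four averages at \<open>n\<close> read the values from \<open>n\<close> to
  \<open>n + 4 * (w - 1)\<close>, so a margin of \<open>4 * w\<close> on either side of the jump at
  \<open>12 * w\<close> decides the value: 8 = 12 - 4 here, 16 = 12 + 4 in the next lemma.\<close>

lemma bump_eq_1: "\<bar>n\<bar> \<le> 8 * int w \<Longrightarrow> w > 0 \<Longrightarrow> bump w n = 1"
  unfolding bump_def by (rule box_avg_funpow_const) auto

lemma bump_eq_0: "\<bar>n\<bar> \<ge> 16 * int w \<Longrightarrow> w > 0 \<Longrightarrow> bump w n = 0"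
  unfolding bump_def by (rule box_avg_funpow_const) auto

lemma norm_fdiff_bump: "w > 0 \<Longrightarrow> k \<le> 4 \<Longrightarrow> norm ((fdiff ^^ k) (bump w) n) \<le> (2 / w) ^ k"
  unfolding bump_def by (rule norm_fdiff_box_avg_funpow) auto

lemma norm_bump_le: "w > 0 \<Longrightarrow> norm (bump w n) \<le> 1"
  using norm_fdiff_bump[of w 0 n] by simp

lemma smooth_seq_bump:
  assumes "w > 0" "k \<le> 4" "2 / w \<le> r"
  shows "smooth_seq k (bump w) n 1 r"
  unfolding smooth_seq_def
proof (intro allI impI)
  fix i m assume "n \<le> m \<and> m + int i \<le> n + int k"
  then have "norm ((fdiff ^^ i) (bump w) m) \<le> (2 / w) ^ i"
    using assms by (intro norm_fdiff_bump) auto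
  also have "\<dots> \<le> r ^ i" using assms by (intro power_mono) auto
  finally show "norm ((fdiff ^^ i) (bump w) m) \<le> 1 * r ^ i" by simp
qed

section \<open>Finite differences of a Coifman--Meyer multiplier\<close>

lemma norm_diff_le_vector_derivative:
  fixes f :: "real \<Rightarrow> complex"
  assumes "\<And>x. a \<le> x \<Longrightarrow> x \<le> b \<Longrightarrow> (f has_vector_derivative f' x) (at x)"
    and "\<And>x. a \<le> x \<Longrightarrow> x \<le> b \<Longrightarrow> norm (f' x) \<le> B" and "a \<le> b"
  shows "norm (f b - f a) \<le> B * (b - a)"
proof -
  have "norm (f b - f a) \<le> B * norm (b - a)"
  proof (rule differentiable_bound[where S = "{a..b}" and f' = "\<lambda>x h. h *\<^sub>R f' x"])
    show "onorm (\<lambda>h. h *\<^sub>R f' x) \<le> B" if "x \<in> {a..b}" for x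
      using assms(2)[of x] that by (intro onorm_le) (auto simp: mult.commute[of B] intro!: mult_left_mono)
  qed (use assms in \<open>auto simp: has_vector_derivative_def intro: has_derivative_at_withinI\<close>)
  then show ?thesis using assms by simp
qed

lemma fdiff_funpow_has_vector_derivative:
  fixes G :: "nat \<Rightarrow> real \<Rightarrow> complex"
  assumes "\<And>u. v \<le> u \<Longrightarrow> u \<le> v + real d \<Longrightarrow> (G i has_vector_derivative G (Suc i) u) (at u)"
  shows "((fdiff ^^ d) (G i) has_vector_derivative (fdiff ^^ d) (G (Suc i)) v) (at v)"
  using assms
proof (induction d arbitrary: v)
  case 0
  then show ?case by simp
next
  case (Suc d)
  have 1: "((fdiff ^^ d) (G i) has_vector_derivative (fdiff ^^ d) (G (Suc i)) v) (at v)"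
    by (rule Suc.IH) (use Suc.prems in auto)
  have 2: "((fdiff ^^ d) (G i) has_vector_derivative (fdiff ^^ d) (G (Suc i)) (v + 1)) (at (v + 1))"
    by (rule Suc.IH) (use Suc.prems in auto)
  have "(((fdiff ^^ d) (G i) \<circ> (\<lambda>v. v + 1)) has_vector_derivative 1 *\<^sub>R (fdiff ^^ d) (G (Suc i)) (v + 1)) (at v)"
    by (rule vector_diff_chain_at) (use 2 in \<open>auto intro!: derivative_eq_intros\<close>)
  from has_vector_derivative_diff[OF this 1]
  show ?case
    by (subst (1 2) fdiff_funpow_Suc[abs_def]) (simp add: o_def)
qed

text \<open>The mean value inequality is used \<open>k\<close> times, each time trading a difference
  for a derivative on an interval of length one. The points visited fill the real interval from
  \<open>v\<close> to \<open>v + k\<close>, so the derivative is bounded there and not only at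
  integers.\<close>

lemma norm_fdiff_funpow_le_derivative:
  fixes G :: "nat \<Rightarrow> real \<Rightarrow> complex"
  assumes "\<And>i u. i < k \<Longrightarrow> v \<le> u \<Longrightarrow> u \<le> v + real k \<Longrightarrow> (G i has_vector_derivative G (Suc i) u) (at u)"
    and "\<And>u. v \<le> u \<Longrightarrow> u \<le> v + real k \<Longrightarrow> norm (G k u) \<le> B"
  shows "norm ((fdiff ^^ k) (G 0) v) \<le> B"
proof -
  \<comment> \<open>Invariant of the trade: differences and derivatives together always number
    \<open>k\<close>.\<close>
  have "norm ((fdiff ^^ d) (G (k - d)) u) \<le> B" if "d \<le> k" "v \<le> u" "u + real d \<le> v + real k" for d u
    using that
  proof (induction d arbitrary: u)
    case 0
    then show ?case using assms(2) by simp
  next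
    case (Suc d)
    have e: "Suc (k - Suc d) = k - d" using Suc.prems by auto
    have "norm ((fdiff ^^ d) (G (k - Suc d)) (u + 1) - (fdiff ^^ d) (G (k - Suc d)) u) \<le> B * (u + 1 - u)"
    proof (rule norm_diff_le_vector_derivative)
      fix x assume x: "u \<le> x" "x \<le> u + 1"
      show "((fdiff ^^ d) (G (k - Suc d)) has_vector_derivative (fdiff ^^ d) (G (k - d)) x) (at x)"
        unfolding e[symmetric]
        by (rule fdiff_funpow_has_vector_derivative) (use Suc.prems x in \<open>auto intro!: assms(1)\<close>)
      show "norm ((fdiff ^^ d) (G (k - d)) x) \<le> B"
        by (rule Suc.IH) (use Suc.prems x in auto)
    qed auto
    then show ?case by (simp only: fdiff_funpow_Suc) simp
  qed
  from this[of k v] show ?thesis by simp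
qed

lemma fdiff_funpow_of_int:
  fixes a :: "real \<Rightarrow> complex"
  shows "(fdiff ^^ k) (\<lambda>n::int. a (of_int n)) n = (fdiff ^^ k) a (of_int n)"
  by (induction k arbitrary: n) (simp_all add: fdiff_def)

lemma C_k_on_partial:
  assumes "C_k_on (k + i) S F"
  shows "C_k_on k S ((partial_fst ^^ i) F)" "C_k_on k S ((partial_snd ^^ i) F)"
proof -
  have "\<forall>F k. C_k_on (k + i) S F \<longrightarrow> C_k_on k S ((partial_fst ^^ i) F) \<and> C_k_on k S ((partial_snd ^^ i) F)"
    by (induction i) (auto simp del: funpow.simps simp add: funpow_Suc_right)
  then show "C_k_on k S ((partial_fst ^^ i) F)" "C_k_on k S ((partial_snd ^^ i) F)"
    using assms by auto
qed

lemma coifman_meyer_derivatives: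
  assumes "coifman_meyer m" "(x, y) \<noteq> 0"
  shows "((\<lambda>u. (partial_fst ^^ i) m (u, y)) has_vector_derivative (partial_fst ^^ Suc i) m (x, y)) (at x)"
    and "((\<lambda>u. (partial_snd ^^ i) m (x, u)) has_vector_derivative (partial_snd ^^ Suc i) m (x, y)) (at y)"
proof -
  have "C_k_on (1 + i) (- {0}) m"
    using assms by (auto simp: coifman_meyer_def C_infinity_on_def)
  from C_k_on_partial[OF this] assms
  have "(\<lambda>u. (partial_fst ^^ i) m (u, y)) differentiable (at x)"
       "(\<lambda>u. (partial_snd ^^ i) m (x, u)) differentiable (at y)"
    by auto
  then show "((\<lambda>u. (partial_fst ^^ i) m (u, y)) has_vector_derivative (partial_fst ^^ Suc i) m (x, y)) (at x)"
    and "((\<lambda>u. (partial_snd ^^ i) m (x, u)) has_vector_derivative (partial_snd ^^ Suc i) m (x, y)) (at y)"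
    by (auto simp: partial_fst_def partial_snd_def vector_derivative_works)
qed

text \<open>\<open>R\<close> bounds the sup norm from below on the whole real segment spanned by the
  difference. This keeps the segment off the origin, where \<open>m\<close> need not be smooth, and
  bounds the Euclidean norm from below as well.\<close>

lemma coifman_meyer_fdiff_bound:
  assumes "coifman_meyer m"
  obtains C where "0 \<le> C"
    "\<And>k s t R. \<lbrakk>k \<le> 4; 0 < R; \<And>u. real_of_int s \<le> u \<Longrightarrow> u \<le> real_of_int s + real k \<Longrightarrow> R \<le> max \<bar>u\<bar> \<bar>real_of_int t\<bar>\<rbrakk>
       \<Longrightarrow> norm ((fdiff ^^ k) (\<lambda>s. m (of_int s, of_int t)) s) \<le> C / R ^ k"
    "\<And>k s t R. \<lbrakk>k \<le> 4; 0 < R; \<And>u. real_of_int t \<le> u \<Longrightarrow> u \<le> real_of_int t + real k \<Longrightarrow> R \<le> max \<bar>real_of_int s\<bar> \<bar>u\<bar>\<rbrakk>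
       \<Longrightarrow> norm ((fdiff ^^ k) (\<lambda>t. m (of_int s, of_int t)) t) \<le> C / R ^ k"
proof -
  have "\<forall>k\<le>10. \<exists>C. \<forall>t. t \<noteq> 0 \<longrightarrow> norm ((partial_fst ^^ k) m t) \<le> C / norm t ^ k"
  proof (intro allI impI)
    fix k :: nat assume "k \<le> 10"
    then have "k + 0 \<le> 10" by simp
    then have "\<exists>C. \<forall>t. t \<noteq> 0 \<longrightarrow> norm ((partial_fst ^^ k) ((partial_snd ^^ 0) m) t) \<le> C / norm t ^ (k + 0)"
      using assms unfolding coifman_meyer_def by blast
    then show "\<exists>C. \<forall>t. t \<noteq> 0 \<longrightarrow> norm ((partial_fst ^^ k) m t) \<le> C / norm t ^ k" by simp
  qed
  then obtain C1 where C1: "\<And>k t. k \<le> 10 \<Longrightarrow> t \<noteq> 0 \<Longrightarrow> norm ((partial_fst ^^ k) m t) \<le> C1 k / norm t ^ k"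
    by metis
  have "\<forall>k\<le>10. \<exists>C. \<forall>t. t \<noteq> 0 \<longrightarrow> norm ((partial_snd ^^ k) m t) \<le> C / norm t ^ k"
  proof (intro allI impI)
    fix k :: nat assume "k \<le> 10"
    then have "0 + k \<le> 10" by simp
    then have "\<exists>C. \<forall>t. t \<noteq> 0 \<longrightarrow> norm ((partial_fst ^^ 0) ((partial_snd ^^ k) m) t) \<le> C / norm t ^ (0 + k)"
      using assms unfolding coifman_meyer_def by blast
    then show "\<exists>C. \<forall>t. t \<noteq> 0 \<longrightarrow> norm ((partial_snd ^^ k) m t) \<le> C / norm t ^ k" by simp
  qed
  then obtain C2 where C2: "\<And>k t. k \<le> 10 \<Longrightarrow> t \<noteq> 0 \<Longrightarrow> norm ((partial_snd ^^ k) m t) \<le> C2 k / norm t ^ k"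
    by metis
  define C where "C = (\<Sum>k\<le>4. \<bar>C1 k\<bar> + \<bar>C2 k\<bar>)"
  have C: "C1 k \<le> C" "C2 k \<le> C" if "k \<le> 4" for k
  proof -
    have "\<bar>C1 k\<bar> + \<bar>C2 k\<bar> \<le> C"
      unfolding C_def using that by (intro member_le_sum) auto
    then show "C1 k \<le> C" "C2 k \<le> C" by auto
  qed
  have "0 \<le> C" by (auto simp: C_def intro!: sum_nonneg)
  have est: "c / norm p ^ k \<le> C / R ^ k"
    if "c \<le> C" "0 < R" "R \<le> max \<bar>fst p\<bar> \<bar>snd p\<bar>" for c R k and p :: "real \<times> real"
  proof -
    have "\<bar>fst p\<bar> \<le> norm p" "\<bar>snd p\<bar> \<le> norm p"
      using norm_fst_le[of "fst p" "snd p"] norm_snd_le[of "snd p" "fst p"] by auto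
    then have "R \<le> norm p" using that(3) by auto
    then have "c / norm p ^ k \<le> C / norm p ^ k" "C / norm p ^ k \<le> C / R ^ k"
      using that \<open>0 \<le> C\<close> by (auto intro!: divide_right_mono divide_left_mono power_mono zero_less_power mult_pos_pos)
    then show ?thesis by simp
  qed
  have ne: "p \<noteq> 0" if "0 < R" "R \<le> max \<bar>fst p\<bar> \<bar>snd p\<bar>" for R and p :: "real \<times> real"
    using that by auto
  show ?thesis
  proof (rule that[OF \<open>0 \<le> C\<close>])
    fix k :: nat and s t :: int and R :: real
    assume k: "k \<le> 4" "0 < R"
    {
      assume *: "\<And>u. real_of_int s \<le> u \<Longrightarrow> u \<le> real_of_int s + real k \<Longrightarrow> R \<le> max \<bar>u\<bar> \<bar>real_of_int t\<bar>"
      have "norm ((fdiff ^^ k) (\<lambda>u. (partial_fst ^^ 0) m (u, of_int t)) (of_int s)) \<le> C / R ^ k"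
      proof (rule norm_fdiff_funpow_le_derivative[where G = "\<lambda>i u. (partial_fst ^^ i) m (u, of_int t)"])
        fix i u assume u: "real_of_int s \<le> u" "u \<le> real_of_int s + real k"
        have "(u, real_of_int t) \<noteq> 0" using ne[of R "(u, real_of_int t)"] *[OF u] k by simp
        then show "((\<lambda>u. (partial_fst ^^ i) m (u, of_int t)) has_vector_derivative (partial_fst ^^ Suc i) m (u, of_int t)) (at u)"
          by (rule coifman_meyer_derivatives[OF assms])
        show "norm ((partial_fst ^^ k) m (u, real_of_int t)) \<le> C / R ^ k"
          using C1[of k "(u, real_of_int t)"] \<open>(u, real_of_int t) \<noteq> 0\<close> k
            est[OF C(1)[OF k(1)] k(2), of "(u, real_of_int t)" k] *[OF u] by simp
      qed
      then show "norm ((fdiff ^^ k) (\<lambda>s. m (of_int s, of_int t)) s) \<le> C / R ^ k"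
        by (simp add: fdiff_funpow_of_int[of k "\<lambda>u. m (u, of_int t)"])
    }
    {
      assume *: "\<And>u. real_of_int t \<le> u \<Longrightarrow> u \<le> real_of_int t + real k \<Longrightarrow> R \<le> max \<bar>real_of_int s\<bar> \<bar>u\<bar>"
      have "norm ((fdiff ^^ k) (\<lambda>u. (partial_snd ^^ 0) m (of_int s, u)) (of_int t)) \<le> C / R ^ k"
      proof (rule norm_fdiff_funpow_le_derivative[where G = "\<lambda>i u. (partial_snd ^^ i) m (of_int s, u)"])
        fix i u assume u: "real_of_int t \<le> u" "u \<le> real_of_int t + real k"
        have "(real_of_int s, u) \<noteq> 0" using ne[of R "(real_of_int s, u)"] *[OF u] k by simp
        then show "((\<lambda>u. (partial_snd ^^ i) m (of_int s, u)) has_vector_derivative (partial_snd ^^ Suc i) m (of_int s, u)) (at u)"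
          by (rule coifman_meyer_derivatives[OF assms])
        show "norm ((partial_snd ^^ k) m (real_of_int s, u)) \<le> C / R ^ k"
          using C2[of k "(real_of_int s, u)"] \<open>(real_of_int s, u) \<noteq> 0\<close> k
            est[OF C(2)[OF k(1)] k(2), of "(real_of_int s, u)" k] *[OF u] by simp
      qed
      then show "norm ((fdiff ^^ k) (\<lambda>t. m (of_int s, of_int t)) t) \<le> C / R ^ k"
        by (simp add: fdiff_funpow_of_int[of k "\<lambda>u. m (of_int s, u)"])
    }
  qed
qed

section \<open>Kernels on the dyadic grid\<close>

definition unit_root :: "nat \<Rightarrow> int \<Rightarrow> complex" where
  "unit_root L n = cis (2 * pi * of_int n / 2 ^ L)"

lemma unit_root_add: "unit_root L (a + b) = unit_root L a * unit_root L b"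
  by (simp add: unit_root_def cis_mult distrib_left add_divide_distrib)

lemma unit_root_0 [simp]: "unit_root L 0 = 1"
  by (simp add: unit_root_def)

lemma norm_unit_root [simp]: "norm (unit_root L n) = 1"
  by (simp add: unit_root_def)

lemma cnj_unit_root: "cnj (unit_root L n) = unit_root L (- n)"
  by (simp add: unit_root_def cis_cnj)

lemma norm_unit_root_minus_1: "norm (1 - unit_root L n) = 2 * \<bar>sin (pi * of_int n / 2 ^ L)\<bar>"
  using dist_exp_i_1[of "2 * pi * of_int n / 2 ^ L"]
  by (simp add: unit_root_def cis_conv_exp norm_minus_commute)

lemma norm_unit_root_minus_1_le: "norm (1 - unit_root L n) \<le> 2 * pi * \<bar>of_int n\<bar> / 2 ^ L"
proof -
  have "\<bar>sin (pi * of_int n / 2 ^ L)\<bar> \<le> \<bar>pi * real_of_int n / 2 ^ L\<bar>"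
    by (rule abs_sin_x_le_abs_x)
  then show ?thesis
    unfolding norm_unit_root_minus_1 by (simp add: abs_mult)
qed

lemma norm_unit_root_minus_1_uminus: "norm (1 - unit_root L (- n)) = norm (1 - unit_root L n)"
  by (simp add: norm_unit_root_minus_1)

lemma fdiff_funpow_unit_root:
  "(fdiff ^^ k) (\<lambda>s. unit_root L (h * s)) s = (unit_root L h - 1) ^ k * unit_root L (h * s)"
proof (induction k arbitrary: s)
  case (Suc k)
  show ?case
    by (simp only: fdiff_funpow_Suc Suc) (simp add: algebra_simps unit_root_add)
qed simp

lemma fdiff_funpow_eq_0:
  fixes b :: "int \<Rightarrow> complex"
  assumes "\<And>s. \<bar>s\<bar> \<ge> M \<Longrightarrow> b s = 0" "\<bar>s\<bar> \<ge> M + int k" "M \<ge> 0"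
  shows "(fdiff ^^ k) b s = 0"
proof -
  have "(fdiff ^^ k) b s = (fdiff ^^ k) (\<lambda>_. 0) s"
  proof (rule fdiff_funpow_cong)
    fix m assume "s \<le> m" "m \<le> s + int k"
    then have "\<bar>m\<bar> \<ge> M" using assms(2,3) by linarith
    then show "b m = 0" by (rule assms(1))
  qed
  then show ?thesis by (simp only: fdiff_funpow_0)
qed

text \<open>Summation by parts: shifting the summation index costs a root of unity, and the support
  inside the box kills the boundary terms.\<close>

lemma sum_fdiff_unit_root:
  assumes "\<And>s. \<bar>s\<bar> \<ge> M \<Longrightarrow> b s = 0" "M \<le> B" "0 \<le> M"
  shows "(\<Sum>s\<in>{- B..B}. fdiff b s * unit_root L (s * u)) =
    (unit_root L (- u) - 1) * (\<Sum>s\<in>{- B..B}. b s * unit_root L (s * u))"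
proof -
  have 1: "unit_root L (s * u) = unit_root L (- u) * unit_root L ((s + 1) * u)" for s
    by (simp flip: unit_root_add add: algebra_simps)
  have "(\<Sum>s\<in>{- B..B}. b (s + 1) * unit_root L (s * u)) =
      unit_root L (- u) * (\<Sum>s\<in>{- B..B}. b (s + 1) * unit_root L ((s + 1) * u))"
    unfolding sum_distrib_left by (rule sum.cong[OF refl], subst 1) (simp only: mult.left_commute)
  also have "(\<Sum>s\<in>{- B..B}. b (s + 1) * unit_root L ((s + 1) * u)) =
      (\<Sum>s\<in>{- B + 1..B + 1}. b s * unit_root L (s * u))"
    by (rule sum.reindex_bij_witness[of _ "\<lambda>s. s - 1" "\<lambda>s. s + 1"]) auto
  also have "\<dots> = (\<Sum>s\<in>{- B..B + 1}. b s * unit_root L (s * u))"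
    by (rule sum.mono_neutral_left) (use assms in auto)
  also have "\<dots> = (\<Sum>s\<in>{- B..B}. b s * unit_root L (s * u))"
    by (rule sum.mono_neutral_right) (use assms in auto)
  finally show ?thesis
    by (simp add: fdiff_def left_diff_distrib sum_subtractf)
qed

lemma sum_fdiff_funpow_unit_root:
  assumes "\<And>s. \<bar>s\<bar> \<ge> M \<Longrightarrow> b s = 0" "M + int k \<le> B" "0 \<le> M"
  shows "(\<Sum>s\<in>{- B..B}. (fdiff ^^ k) b s * unit_root L (s * u)) =
    (unit_root L (- u) - 1) ^ k * (\<Sum>s\<in>{- B..B}. b s * unit_root L (s * u))"
  using assms(2)
proof (induction k)
  case (Suc k)
  have "(\<Sum>s\<in>{- B..B}. fdiff ((fdiff ^^ k) b) s * unit_root L (s * u)) =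
    (unit_root L (- u) - 1) * (\<Sum>s\<in>{- B..B}. (fdiff ^^ k) b s * unit_root L (s * u))"
    by (rule sum_fdiff_unit_root[of "M + int k"])
       (use Suc.prems assms in \<open>auto intro: fdiff_funpow_eq_0[of M]\<close>)
  then show ?case using Suc by simp
qed simp

text \<open>Symbols at frequency scale \<open>R\<close>. The rate \<open>c\<close> doubles with
  every product. The number 128 is where the cutoff \<open>bump (8 * R)\<close> has become
  0.\<close>

definition symbol :: "real \<Rightarrow> real \<Rightarrow> nat \<Rightarrow> (int \<Rightarrow> int \<Rightarrow> complex) \<Rightarrow> bool" where
  "symbol c A R a \<longleftrightarrow>
     (\<forall>s t. \<bar>s\<bar> \<ge> 128 * int R \<or> \<bar>t\<bar> \<ge> 128 * int R \<longrightarrow> a s t = 0) \<and>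
     (\<forall>s t. smooth_seq 4 (\<lambda>s. a s t) s A (c / R)) \<and> (\<forall>s t. smooth_seq 4 (\<lambda>t. a s t) t A (c / R))"

lemma symbol_swap: "symbol c A R a \<Longrightarrow> symbol c A R (\<lambda>s t. a t s)"
  by (auto simp: symbol_def)

lemma symbol_norm_le: "symbol c A R a \<Longrightarrow> norm (a s t) \<le> A"
proof -
  assume "symbol c A R a"
  then have "smooth_seq 0 (\<lambda>s. a s t) s A (c / R)"
    by (intro smooth_seq_subwindow[of 4 "\<lambda>s. a s t" s A "c / R" s 0]) (auto simp: symbol_def)
  from smooth_seqD[OF this] show ?thesis by simp
qed

definition grid_kernel :: "int \<Rightarrow> nat \<Rightarrow> (int \<Rightarrow> int \<Rightarrow> complex) \<Rightarrow> int \<Rightarrow> int \<Rightarrow> complex" where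
  "grid_kernel B L a u v = (\<Sum>s\<in>{- B..B}. \<Sum>t\<in>{- B..B}. a s t * unit_root L (s * u + t * v))"

lemma kernel_swap: "grid_kernel B L (\<lambda>s t. a t s) u v = grid_kernel B L a v u"
  unfolding grid_kernel_def by (subst sum.swap) (simp add: add.commute)

lemma kernel_sum: "grid_kernel B L (\<lambda>s t. \<Sum>j\<in>S. a j s t) u v = (\<Sum>j\<in>S. grid_kernel B L (a j) u v)"
proof -
  have "grid_kernel B L (\<lambda>s t. \<Sum>j\<in>S. a j s t) u v =
      (\<Sum>s\<in>{- B..B}. \<Sum>t\<in>{- B..B}. \<Sum>j\<in>S. a j s t * unit_root L (s * u + t * v))"
    by (simp add: grid_kernel_def sum_distrib_right)
  also have "\<dots> = (\<Sum>s\<in>{- B..B}. \<Sum>j\<in>S. \<Sum>t\<in>{- B..B}. a j s t * unit_root L (s * u + t * v))"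
    by (rule sum.cong[OF refl], rule sum.swap)
  also have "\<dots> = (\<Sum>j\<in>S. grid_kernel B L (a j) u v)"
    unfolding grid_kernel_def by (rule sum.swap)
  finally show ?thesis .
qed

text \<open>132 = 128 + 4 allows for the four steps by which differences widen the support. The box
  has \<open>264 * R + 1\<close> points per side, at most \<open>265 * R\<close>, and 70225 is the
  square of 265.\<close>

lemma sum_box_norm_le:
  assumes "\<And>s t. \<bar>s\<bar> \<ge> 132 * int R \<or> \<bar>t\<bar> \<ge> 132 * int R \<Longrightarrow> c s t = (0::complex)"
    and "\<And>s t. norm (c s t) \<le> D" and "R \<ge> 1"
  shows "(\<Sum>s\<in>{- B..B}. \<Sum>t\<in>{- B..B}. norm (c s t)) \<le> 70225 * D * real R ^ 2"
proof -
  let ?I = "{- (132 * int R)..132 * int R}"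
  have D: "0 \<le> D" using assms(2) norm_ge_zero order_trans by blast
  have "(\<Sum>s\<in>{- B..B}. \<Sum>t\<in>{- B..B}. norm (c s t)) = (\<Sum>p\<in>{- B..B} \<times> {- B..B}. norm (c (fst p) (snd p)))"
    by (simp add: sum.cartesian_product case_prod_unfold)
  also have "\<dots> = (\<Sum>p\<in>({- B..B} \<times> {- B..B}) \<inter> (?I \<times> ?I). norm (c (fst p) (snd p)))"
  proof (rule sum.mono_neutral_right; (intro ballI)?)
    fix p assume "p \<in> {- B..B} \<times> {- B..B} - {- B..B} \<times> {- B..B} \<inter> ?I \<times> ?I"
    then have "\<bar>fst p\<bar> \<ge> 132 * int R \<or> \<bar>snd p\<bar> \<ge> 132 * int R" by (cases p) auto
    then show "norm (c (fst p) (snd p)) = 0" using assms(1) by simp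
  qed auto
  also have "\<dots> \<le> (\<Sum>p\<in>?I \<times> ?I. norm (c (fst p) (snd p)))"
    by (rule sum_mono2) auto
  also have "\<dots> \<le> (\<Sum>p\<in>?I \<times> ?I. D)"
    by (rule sum_mono) (use assms in auto)
  also have "\<dots> = (264 * real R + 1) ^ 2 * D"
    by (simp add: power2_eq_square)
  also have "\<dots> \<le> (265 * real R) ^ 2 * D"
    using assms D by (intro mult_right_mono power_mono) auto
  finally show ?thesis by (simp add: power_mult_distrib ac_simps)
qed

text \<open>Summation by parts in \<open>s\<close>: a power of 1 - e(u) in front of the kernel
  becomes a difference of that order of the symbol, and the differences are then summed in absolute
  value.\<close>

lemma kernel_decay_aux:
  assumes "symbol c A R a" "R \<ge> 1" "132 * int R \<le> B" "k \<le> 4" "c \<ge> 1"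
  shows "norm (grid_kernel B L a u v) * norm (1 - unit_root L u) ^ k \<le> 70225 * A * (c / R) ^ k * real R ^ 2"
proof -
  have sup: "a s t = 0" if "\<bar>s\<bar> \<ge> 128 * int R \<or> \<bar>t\<bar> \<ge> 128 * int R" for s t
    using assms(1) that by (auto simp: symbol_def)
  have sm: "smooth_seq k (\<lambda>s. a s t) s A (c / R)" for s t
    using assms(1,4) by (intro smooth_seq_subwindow[of 4 "\<lambda>s. a s t" s A "c / R" s k]) (auto simp: symbol_def)
  let ?d = "\<lambda>s t. (fdiff ^^ k) (\<lambda>s. a s t) s"
  have "grid_kernel B L a u v = (\<Sum>t\<in>{- B..B}. unit_root L (t * v) * (\<Sum>s\<in>{- B..B}. a s t * unit_root L (s * u)))"
    unfolding grid_kernel_def by (subst sum.swap) (simp add: unit_root_add sum_distrib_left ac_simps)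
  then have "(unit_root L (- u) - 1) ^ k * grid_kernel B L a u v =
      (\<Sum>t\<in>{- B..B}. unit_root L (t * v) *
        ((unit_root L (- u) - 1) ^ k * (\<Sum>s\<in>{- B..B}. a s t * unit_root L (s * u))))"
    by (simp add: sum_distrib_left ac_simps)
  also have "\<dots> = (\<Sum>t\<in>{- B..B}. unit_root L (t * v) * (\<Sum>s\<in>{- B..B}. ?d s t * unit_root L (s * u)))"
    by (subst sum_fdiff_funpow_unit_root[of "128 * int R"]) (use assms sup in auto)
  also have "norm \<dots> \<le> (\<Sum>t\<in>{- B..B}. \<Sum>s\<in>{- B..B}. norm (?d s t))"
    by (intro order_trans[OF norm_sum] sum_mono) (simp add: norm_mult order_trans[OF norm_sum])
  also have "\<dots> \<le> 70225 * (A * (c / R) ^ k) * real R ^ 2"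
  proof (rule sum_box_norm_le[OF _ _ assms(2)])
    show "norm (?d s t) \<le> A * (c / R) ^ k" for s t by (rule smooth_seqD[OF sm])
    fix t s :: int assume *: "\<bar>t\<bar> \<ge> 132 * int R \<or> \<bar>s\<bar> \<ge> 132 * int R"
    show "?d s t = 0"
    proof (cases "\<bar>s\<bar> \<ge> 132 * int R")
      case True
      then show ?thesis using sup assms by (intro fdiff_funpow_eq_0[of "128 * int R"]) auto
    next
      case False
      then have "(\<lambda>s. a s t) = (\<lambda>_. 0)" using * sup by auto
      then show ?thesis by (simp only: fdiff_funpow_0)
    qed
  qed
  also have "norm ((unit_root L (- u) - 1) ^ k * grid_kernel B L a u v) =
      norm (grid_kernel B L a u v) * norm (1 - unit_root L u) ^ k"
    by (simp add: norm_mult norm_power norm_minus_commute[of _ 1] norm_unit_root_minus_1_uminus)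
  finally show ?thesis by (simp add: ac_simps)
qed

lemma kernel_decay:
  assumes "symbol c A R a" "R \<ge> 1" "132 * int R \<le> B" "c \<ge> 1"
    and "d \<le> norm (1 - unit_root L u) \<or> d \<le> norm (1 - unit_root L v)" "0 \<le> d"
  shows "norm (grid_kernel B L a u v) \<le> 70225 * A * c ^ 4 * real R ^ 2"
    and "norm (grid_kernel B L a u v) * (real R * d) ^ 4 \<le> 70225 * A * c ^ 4 * real R ^ 2"
proof -
  have A: "0 \<le> A" using symbol_norm_le[OF assms(1), of 0 0] norm_ge_zero order_trans by blast
  have "norm (grid_kernel B L a u v) \<le> 70225 * A * 1 * real R ^ 2"
    using kernel_decay_aux[OF assms(1-3), of 0] assms by simp
  also have "\<dots> \<le> 70225 * A * c ^ 4 * real R ^ 2"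
    using A assms by (intro mult_right_mono mult_left_mono one_le_power) auto
  finally show "norm (grid_kernel B L a u v) \<le> 70225 * A * c ^ 4 * real R ^ 2" .
  have "norm (grid_kernel B L a u v) * d ^ 4 \<le> 70225 * A * (c / R) ^ 4 * real R ^ 2"
    using assms(5)
  proof
    assume "d \<le> norm (1 - unit_root L u)"
    then have "norm (grid_kernel B L a u v) * d ^ 4 \<le> norm (grid_kernel B L a u v) * norm (1 - unit_root L u) ^ 4"
      using assms by (intro mult_left_mono power_mono) auto
    then show ?thesis using kernel_decay_aux[OF assms(1-3), of 4 L u v] assms by simp
  next
    assume "d \<le> norm (1 - unit_root L v)"
    then have "norm (grid_kernel B L a u v) * d ^ 4 \<le> norm (grid_kernel B L a u v) * norm (1 - unit_root L v) ^ 4"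
      using assms by (intro mult_left_mono power_mono) auto
    then show ?thesis using kernel_decay_aux[OF symbol_swap[OF assms(1)] assms(2,3), of 4 L v u] assms
      by (simp add: kernel_swap[of B L a v u])
  qed
  then have "norm (grid_kernel B L a u v) * d ^ 4 * real R ^ 4 \<le> 70225 * A * (c / R) ^ 4 * real R ^ 2 * real R ^ 4"
    by (rule mult_right_mono) auto
  also have "\<dots> = 70225 * A * c ^ 4 * real R ^ 2"
    using assms(2) by (simp add: power_divide)
  finally show "norm (grid_kernel B L a u v) * (real R * d) ^ 4 \<le> 70225 * A * c ^ 4 * real R ^ 2"
    by (simp add: power_mult_distrib ac_simps)
qed

text \<open>Decay of order four in each variable separately yields a product of two quadratic
  decays: with \<open>X\<close> and \<open>Y\<close> the squared rescaled distances, (1 + X) (1 + Y)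
  is at most 2 + X^2 + Y^2. The leading factor is 4 = 2 + 1 + 1.\<close>

lemma kernel_product_bound:
  assumes "symbol c A R a" "R \<ge> 1" "132 * int R \<le> B" "c \<ge> 1"
  shows "norm (grid_kernel B L a u v) \<le> 4 * 70225 * A * c ^ 4 *
     (real R / (1 + (real R * norm (1 - unit_root L u))\<^sup>2)) * (real R / (1 + (real R * norm (1 - unit_root L v))\<^sup>2))"
proof -
  define X where "X = (real R * norm (1 - unit_root L u))\<^sup>2"
  define Y where "Y = (real R * norm (1 - unit_root L v))\<^sup>2"
  define n where "n = norm (grid_kernel B L a u v)"
  define K where "K = 70225 * A * c ^ 4 * real R ^ 2"
  have pow4: "z ^ 4 = (z\<^sup>2)\<^sup>2" for z :: real by simp
  have "n \<le> K" "n * X\<^sup>2 \<le> K" "n * Y\<^sup>2 \<le> K"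
    using kernel_decay[OF assms, of "norm (1 - unit_root L u)" L u v]
      kernel_decay(2)[OF assms, of "norm (1 - unit_root L v)" L u v]
    by (auto simp: n_def K_def X_def Y_def)
  moreover have "(1 + X) * (1 + Y) \<le> 2 + X\<^sup>2 + Y\<^sup>2"
    using sum_squares_bound[of X Y] sum_squares_bound[of 1 X] sum_squares_bound[of 1 Y]
    by (simp add: algebra_simps power2_eq_square)
  then have "n * ((1 + X) * (1 + Y)) \<le> n * (2 + X\<^sup>2 + Y\<^sup>2)"
    by (intro mult_left_mono) (auto simp: n_def)
  ultimately have "n * ((1 + X) * (1 + Y)) \<le> 4 * K"
    by (simp add: algebra_simps)
  moreover have "X \<ge> 0" "Y \<ge> 0" by (auto simp: X_def Y_def)
  ultimately have "n \<le> 4 * K / ((1 + X) * (1 + Y))"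
    by (simp add: pos_le_divide_eq)
  also have "\<dots> = 4 * 70225 * A * c ^ 4 * (real R / (1 + X)) * (real R / (1 + Y))"
    by (simp add: K_def power2_eq_square)
  finally show ?thesis by (simp add: X_def Y_def n_def)
qed

lemma kernel_shift_diff:
  "grid_kernel B L a (u + h) v - grid_kernel B L a u v = grid_kernel B L (\<lambda>s t. a s t * (unit_root L (h * s) - 1)) u v"
proof -
  have "grid_kernel B L a (u + h) v - grid_kernel B L a u v =
    (\<Sum>s\<in>{- B..B}. \<Sum>t\<in>{- B..B}. a s t * unit_root L (s * (u + h) + t * v) - a s t * unit_root L (s * u + t * v))"
    by (simp add: grid_kernel_def sum_subtractf)
  also have "\<dots> = grid_kernel B L (\<lambda>s t. a s t * (unit_root L (h * s) - 1)) u v"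
    unfolding grid_kernel_def by (intro sum.cong refl) (simp add: algebra_simps unit_root_add)
  finally show ?thesis .
qed

text \<open>Shifting the kernel by \<open>h\<close> multiplies the symbol by e(h s). On the support
  of \<open>a\<close> the factor e(h s) - 1 has size \<open>q\<close>, the shift measured in
  wavelengths, so the product is a symbol of the same scale with the gain \<open>q\<close>.\<close>

lemma symbol_shift_multiplier:
  assumes a: "symbol c A R a" and R: "R \<ge> 1" and c: "c \<ge> 8" and q: "q = real R * \<bar>of_int h\<bar> / 2 ^ L" "q \<le> 1"
  shows "symbol (2 * c) (A * (1088 * q)) R (\<lambda>s t. a s t * (unit_root L (h * s) - 1))"
proof -
  have q0: "0 \<le> q" using q by simp
  have A: "0 \<le> A" using symbol_norm_le[OF a, of 0 0] norm_ge_zero order_trans by blast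
  have sup: "a s t = 0" if "\<bar>s\<bar> \<ge> 128 * int R \<or> \<bar>t\<bar> \<ge> 128 * int R" for s t
    using a that by (auto simp: symbol_def)
  have h1: "norm (unit_root L h - 1) \<le> 8 / R * q"
  proof -
    have "norm (unit_root L h - 1) \<le> 2 * pi * \<bar>of_int h\<bar> / 2 ^ L"
      using norm_unit_root_minus_1_le[of L h] by (simp add: norm_minus_commute)
    also have "\<dots> = 2 * pi / R * q" using R by (simp add: q)
    also have "\<dots> \<le> 8 / R * q" using pi_less_4 q0 by (intro mult_right_mono divide_right_mono) auto
    finally show ?thesis .
  qed
  \<comment> \<open>136 = 132 + 4: a window of four steps starting within \<open>132 * R\<close>
    stays within \<open>136 * R\<close>. With 2 pi at most 8 this gives 1088 = 8 * 136.\<close>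
  have hs: "norm (unit_root L (h * s) - 1) \<le> 1088 * q" if "\<bar>s\<bar> \<le> 136 * int R" for s
  proof -
    have "norm (unit_root L (h * s) - 1) \<le> 2 * pi * \<bar>of_int (h * s)\<bar> / 2 ^ L"
      using norm_unit_root_minus_1_le[of L "h * s"] by (simp add: norm_minus_commute)
    also have "\<dots> = 2 * pi * (\<bar>of_int s\<bar> * (\<bar>of_int h\<bar> / 2 ^ L))" by (simp add: abs_mult)
    also have "\<dots> \<le> 2 * 4 * ((136 * real R) * (\<bar>of_int h\<bar> / 2 ^ L))"
    proof (intro mult_mono)
      have "real_of_int \<bar>s\<bar> \<le> real_of_int (136 * int R)" using that by (simp only: of_int_le_iff)
      then show "\<bar>real_of_int s\<bar> \<le> 136 * real R" by simp
    qed (use pi_less_4 in auto)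
    also have "\<dots> = 1088 * q" by (simp add: q)
    finally show ?thesis .
  qed
  have rw: "(fdiff ^^ Suc i) (\<lambda>s. unit_root L (h * s) - 1) m = (unit_root L h - 1) ^ Suc i * unit_root L (h * m)" for i m
    by (subst fdiff_funpow_diff) (simp only: fdiff_funpow_const fdiff_funpow_unit_root diff_zero)
  have hsm: "smooth_seq 4 (\<lambda>s. unit_root L (h * s) - 1) n (1088 * q) (c / R)" if "\<bar>n\<bar> \<le> 132 * int R" for n
    unfolding smooth_seq_def
  proof (intro allI impI)
    fix i m assume *: "n \<le> m \<and> m + int i \<le> n + int 4"
    show "norm ((fdiff ^^ i) (\<lambda>s. unit_root L (h * s) - 1) m) \<le> 1088 * q * (c / R) ^ i"
    proof (cases i)
      case 0
      have "\<bar>m\<bar> \<le> 136 * int R" using * that R by linarith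
      then show ?thesis using hs[of m] 0 by simp
    next
      case (Suc i')
      have "norm ((fdiff ^^ i) (\<lambda>s. unit_root L (h * s) - 1) m) = norm (unit_root L h - 1) ^ Suc i'"
        unfolding Suc rw by (simp add: norm_mult norm_power)
      also have "\<dots> \<le> (8 / R * q) ^ Suc i'"
        by (rule power_mono[OF h1]) simp
      also have "\<dots> = (8 / R) ^ Suc i' * (q * q ^ i')"
        by (simp only: power_mult_distrib power_Suc mult.assoc mult.commute mult.left_commute)
      \<comment> \<open>Only one factor \<open>q\<close> is kept; the others are at most 1 because
        \<open>q \<le> 1\<close>.\<close>
      also have "\<dots> \<le> (c / R) ^ Suc i' * (1088 * q)"
      proof (rule mult_mono)
        show "(8 / real R) ^ Suc i' \<le> (c / real R) ^ Suc i'"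
          using c by (intro power_mono divide_right_mono) auto
        have "q * q ^ i' \<le> q * 1" using q0 q(2) by (intro mult_left_mono power_le_one) auto
        then show "q * q ^ i' \<le> 1088 * q" using q0 by simp
      qed (use c q0 in auto)
      finally show ?thesis by (simp add: Suc ac_simps)
    qed
  qed
  show ?thesis unfolding symbol_def
  proof (intro conjI allI impI)
    fix s t :: int assume "\<bar>s\<bar> \<ge> 128 * int R \<or> \<bar>t\<bar> \<ge> 128 * int R"
    then show "a s t * (unit_root L (h * s) - 1) = 0" using sup by simp
  next
    fix s t :: int
    show "smooth_seq 4 (\<lambda>s. a s t * (unit_root L (h * s) - 1)) s (A * (1088 * q)) (2 * c / R)"
    proof (cases "\<bar>s\<bar> \<le> 132 * int R")
      case True
      have "smooth_seq 4 (\<lambda>s. a s t) s A (c / R)" using a by (auto simp: symbol_def)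
      from smooth_seq_mult[OF this hsm[OF True]] show ?thesis by simp
    next
      case False
      show ?thesis unfolding smooth_seq_def
      proof (intro allI impI)
        fix i m assume *: "s \<le> m \<and> m + int i \<le> s + int 4"
        \<comment> \<open>The window starts beyond \<open>132 * R\<close> and is too short to come
          back to the support of \<open>a\<close>.\<close>
        have "(fdiff ^^ i) (\<lambda>s. a s t * (unit_root L (h * s) - 1)) m = (fdiff ^^ i) (\<lambda>_. 0) m"
        proof (rule fdiff_funpow_cong)
          fix m' assume "m \<le> m'" "m' \<le> m + int i"
          then have "\<bar>m'\<bar> \<ge> 128 * int R" using * False R by auto
          then show "a m' t * (unit_root L (h * m') - 1) = 0" using sup by simp
        qed
        then show "norm ((fdiff ^^ i) (\<lambda>s. a s t * (unit_root L (h * s) - 1)) m) \<le> A * (1088 * q) * (2 * c / R) ^ i"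
          using A q0 c by (simp only: fdiff_funpow_0 norm_zero) simp
      qed
    qed
    show "smooth_seq 4 (\<lambda>t. a s t * (unit_root L (h * s) - 1)) t (A * (1088 * q)) (2 * c / R)"
    proof (cases "\<bar>s\<bar> \<le> 136 * int R")
      case True
      have "smooth_seq 4 (\<lambda>t. a s t) t A (c / R)" using a by (auto simp: symbol_def)
      from smooth_seq_cmult[OF this hs[OF True]]
      have "smooth_seq 4 (\<lambda>t. a s t * (unit_root L (h * s) - 1)) t (1088 * q * A) (c / R)"
        by (simp add: mult.commute)
      then show ?thesis
        by (rule smooth_seq_mono) (use c in \<open>auto intro: divide_right_mono\<close>)
    next
      case False
      then have "(\<lambda>t. a s t * (unit_root L (h * s) - 1)) = (\<lambda>t. 0)" using sup R by auto
      then show ?thesis using A q0 c by (simp only:) (auto intro!: smooth_seq_const)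
    qed
  qed
qed

text \<open>For a shift of at most one wavelength the difference is itself a kernel with the gain
  \<open>q\<close>. For a longer shift, \<open>q > 1\<close>, the two kernels are bounded separately
  and the claim is weaker than that.\<close>

lemma kernel_difference:
  assumes a: "symbol c A R a" and R: "R \<ge> 1" "132 * int R \<le> B" and c: "c \<ge> 8"
    and d: "(d \<le> norm (1 - unit_root L u) \<and> d \<le> norm (1 - unit_root L (u + h))) \<or> d \<le> norm (1 - unit_root L v)"
    and d0: "0 \<le> d"
  defines "K \<equiv> 70225 * (A * 1088) * (2 * c) ^ 4"
  shows "norm (grid_kernel B L a (u + h) v - grid_kernel B L a u v) \<le> K * (\<bar>of_int h\<bar> / 2 ^ L) * real R ^ 3"
    and "norm (grid_kernel B L a (u + h) v - grid_kernel B L a u v) * d ^ 4 * real R \<le> K * (\<bar>of_int h\<bar> / 2 ^ L)"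
proof -
  define q where "q = real R * \<bar>of_int h\<bar> / 2 ^ L"
  define D where "D = norm (grid_kernel B L a (u + h) v - grid_kernel B L a u v)"
  have A: "0 \<le> A" using symbol_norm_le[OF a, of 0 0] norm_ge_zero order_trans by blast
  have "D \<le> K * q * real R ^ 2 \<and> D * (real R * d) ^ 4 \<le> K * q * real R ^ 2"
  proof (cases "q \<le> 1")
    case True
    have "symbol (2 * c) (A * (1088 * q)) R (\<lambda>s t. a s t * (unit_root L (h * s) - 1))"
      by (rule symbol_shift_multiplier[OF a R(1) c q_def True])
    from kernel_decay[OF this R(1,2), of d L u v] c d d0
    have "D \<le> 70225 * (A * (1088 * q)) * (2 * c) ^ 4 * real R ^ 2"
      "D * (real R * d) ^ 4 \<le> 70225 * (A * (1088 * q)) * (2 * c) ^ 4 * real R ^ 2"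
      unfolding D_def kernel_shift_diff by auto
    moreover have "70225 * (A * (1088 * q)) * (2 * c) ^ 4 * real R ^ 2 = K * q * real R ^ 2"
      unfolding K_def by (simp only: mult.assoc mult.commute mult.left_commute)
    ultimately show ?thesis by metis
  next
    case False
    define k where "k = 70225 * A * c ^ 4 * real R ^ 2"
    define n1 where "n1 = norm (grid_kernel B L a (u + h) v)"
    define n2 where "n2 = norm (grid_kernel B L a u v)"
    have "n1 \<le> k" "n2 \<le> k" "n1 * (real R * d) ^ 4 \<le> k" "n2 * (real R * d) ^ 4 \<le> k"
      using kernel_decay[OF a R(1,2), of d L u v] kernel_decay[OF a R(1,2), of d L "u + h" v] c d d0
      by (auto simp: k_def n1_def n2_def)
    moreover have "D \<le> n1 + n2" unfolding D_def n1_def n2_def by (rule norm_triangle_ineq4)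
    moreover from this have "D * (real R * d) ^ 4 \<le> (n1 + n2) * (real R * d) ^ 4"
      by (rule mult_right_mono) simp
    moreover have "2 * k \<le> K * q * real R ^ 2"
    proof -
      have "2 * k = 70225 * (A * 2) * c ^ 4 * 1 * real R ^ 2" by (simp add: k_def)
      also have "\<dots> \<le> 70225 * (A * 1088) * (2 * c) ^ 4 * q * real R ^ 2"
        using False A c by (intro mult_mono power_mono) auto
      finally show ?thesis by (simp add: K_def)
    qed
    ultimately show ?thesis unfolding distrib_right by linarith
  qed
  then have *: "D \<le> K * q * real R ^ 2" "D * (real R * d) ^ 4 \<le> K * q * real R ^ 2" by auto
  have e: "K * q * real R ^ 2 = K * (\<bar>of_int h\<bar> / 2 ^ L) * real R ^ 3"
    by (simp add: q_def power3_eq_cube power2_eq_square)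
  from *(1) show "norm (grid_kernel B L a (u + h) v - grid_kernel B L a u v) \<le> K * (\<bar>of_int h\<bar> / 2 ^ L) * real R ^ 3"
    unfolding D_def e .
  have "(D * d ^ 4 * real R) * real R ^ 3 \<le> (K * (\<bar>of_int h\<bar> / 2 ^ L)) * real R ^ 3"
  proof -
    have "(D * d ^ 4 * real R) * real R ^ 3 = D * (real R * d) ^ 4"
      by (simp add: power_mult_distrib power3_eq_cube power4_eq_xxxx)
    also note *(2)
    also note e
    finally show ?thesis .
  qed
  moreover have "0 < real R ^ 3" using R(1) by simp
  ultimately show "norm (grid_kernel B L a (u + h) v - grid_kernel B L a u v) * d ^ 4 * real R \<le> K * (\<bar>of_int h\<bar> / 2 ^ L)"
    unfolding D_def by (rule mult_right_le_imp_le)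
qed

section \<open>Dyadic cells\<close>

definition grid :: "nat \<Rightarrow> int set" where
  "grid L = {0..<2 ^ L}"

text \<open>Level 0 is the whole grid, and the cells of level \<open>L\<close> are single
  points.\<close>

definition cell :: "nat \<Rightarrow> nat \<Rightarrow> int \<Rightarrow> int" where
  "cell L k x = x div 2 ^ (L - k)"

text \<open>The second disjunct accounts for the wrap-around of the cyclic grid.\<close>

definition near :: "nat \<Rightarrow> nat \<Rightarrow> int \<Rightarrow> int \<Rightarrow> bool" where
  "near L k x y \<longleftrightarrow> \<bar>cell L k x - cell L k y\<bar> \<le> 1 \<or> \<bar>cell L k x - cell L k y\<bar> \<ge> 2 ^ k - 1"

lemma finite_grid [simp]: "finite (grid L)"
  by (simp add: grid_def)

lemma card_grid [simp]: "card (grid L) = 2 ^ L"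
  by (simp add: grid_def nat_power_eq)

lemma cell_bounds:
  assumes "x \<in> grid L" "k \<le> L"
  shows "0 \<le> cell L k x" "cell L k x < 2 ^ k"
proof -
  have "(2::int) ^ L = 2 ^ k * 2 ^ (L - k)" using assms by (simp flip: power_add)
  then have "x < 2 ^ k * 2 ^ (L - k)" "0 \<le> x" using assms by (auto simp: grid_def)
  moreover have "x div 2 ^ (L - k) * 2 ^ (L - k) \<le> x"
    using pos_mod_sign[of "2 ^ (L - k)" x] div_mult_mod_eq[of x "2 ^ (L - k)"]
      zero_less_power[of "2::int" "L - k"] by linarith
  ultimately have "x div 2 ^ (L - k) * 2 ^ (L - k) < 2 ^ k * 2 ^ (L - k)" by linarith
  then have "x div 2 ^ (L - k) < 2 ^ k" by (rule mult_right_less_imp_less) simp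
  then show "0 \<le> cell L k x" "cell L k x < 2 ^ k"
    using \<open>0 \<le> x\<close> by (simp_all add: cell_def pos_imp_zdiv_nonneg_iff)
qed

lemma cell_coarser:
  assumes "i \<le> k" "k \<le> L"
  shows "cell L i x = cell L k x div 2 ^ (k - i)"
proof -
  have "(2::int) ^ (L - i) = 2 ^ (L - k) * 2 ^ (k - i)" using assms by (simp flip: power_add)
  then show ?thesis by (simp add: cell_def zdiv_zmult2_eq)
qed

lemma cell_eq_mono: "cell L k x = cell L k y \<Longrightarrow> i \<le> k \<Longrightarrow> k \<le> L \<Longrightarrow> cell L i x = cell L i y"
  by (simp add: cell_coarser[of i k])

lemma cell_top [simp]: "cell L L x = x"
  by (simp add: cell_def)

lemma cell_0: "x \<in> grid L \<Longrightarrow> cell L 0 x = 0"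
  using cell_bounds[of x L 0] by simp

lemma near_sym: "near L k x y \<longleftrightarrow> near L k y x"
  by (simp add: near_def abs_minus_commute)

lemma near_cong: "cell L k x = cell L k x' \<Longrightarrow> near L k x y \<longleftrightarrow> near L k x' y"
  by (simp add: near_def)

lemma near_cong2: "cell L k y = cell L k y' \<Longrightarrow> near L k x y \<longleftrightarrow> near L k x y'"
  by (simp add: near_def)

lemma near_0 [simp]: "near L 0 x y"
  by (simp add: near_def)

lemma near_refl [simp]: "near L k x x"
  by (simp add: near_def)

text \<open>Passing to parents halves the indices: neighbours have equal or neighbouring parents.
  Indices at distance \<open>2 * 2 ^ k - 1\<close> are the first and the last one, and so are the
  indices of their parents.\<close>

lemma near_Suc:
  assumes "near L (Suc k) x y" "x \<in> grid L" "y \<in> grid L" "Suc k \<le> L"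
  shows "near L k x y"
proof -
  define a where "a = cell L (Suc k) x"
  define b where "b = cell L (Suc k) y"
  have ab: "cell L k x = a div 2" "cell L k y = b div 2"
    using cell_coarser[of k "Suc k" L] assms(4) by (auto simp: a_def b_def)
  have "0 \<le> a" "a < 2 * 2 ^ k" "0 \<le> b" "b < 2 * 2 ^ k"
    using cell_bounds[OF assms(2,4)] cell_bounds[OF assms(3,4)] by (auto simp: a_def b_def)
  moreover have "\<bar>a - b\<bar> \<le> 1 \<or> \<bar>a - b\<bar> \<ge> 2 * 2 ^ k - 1"
    using assms(1) by (simp add: near_def a_def b_def)
  moreover define P :: int where "P = 2 ^ k"
  moreover have "2 * (a div 2) \<le> a" "a \<le> 2 * (a div 2) + 1" "2 * (b div 2) \<le> b" "b \<le> 2 * (b div 2) + 1"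
    by auto
  ultimately have "\<bar>a div 2 - b div 2\<bar> \<le> 1 \<or> P - 1 \<le> \<bar>a div 2 - b div 2\<bar>"
    by (smt (verit))
  then show ?thesis unfolding near_def ab P_def .
qed

lemma near_mono:
  assumes "near L k x y" "x \<in> grid L" "y \<in> grid L" "i \<le> k" "k \<le> L"
  shows "near L i x y"
  using assms(4,1,5)
proof (induction k rule: dec_induct)
  case (step n)
  then show ?case using near_Suc[of L n x y] assms by auto
qed auto

lemma card_cell:
  assumes "0 \<le> c" "c < 2 ^ k" "k \<le> L"
  shows "card {y \<in> grid L. cell L k y = c} = 2 ^ (L - k)"
proof -
  have e: "(2::int) ^ L = 2 ^ k * 2 ^ (L - k)" using assms by (simp flip: power_add)
  have pos: "(0::int) < 2 ^ (L - k)" by simp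
  have "{y \<in> grid L. cell L k y = c} = {c * 2 ^ (L - k)..<(c + 1) * 2 ^ (L - k)}"
  proof (intro equalityI subsetI)
    fix y assume "y \<in> {y \<in> grid L. cell L k y = c}"
    then have "y div 2 ^ (L - k) = c" by (simp add: cell_def)
    moreover have "y = y div 2 ^ (L - k) * 2 ^ (L - k) + y mod 2 ^ (L - k)"
      by (simp only: div_mult_mod_eq)
    ultimately show "y \<in> {c * 2 ^ (L - k)..<(c + 1) * 2 ^ (L - k)}"
      using pos_mod_bound[OF pos, of y] pos_mod_sign[OF pos, of y]
      unfolding atLeastLessThan_iff distrib_right by (intro conjI; simp only: mult_1; linarith)
  next
    fix y assume y: "y \<in> {c * 2 ^ (L - k)..<(c + 1) * 2 ^ (L - k)}"
    then have "y div 2 ^ (L - k) = c" by (intro int_div_pos_eq[where r = "y - c * 2 ^ (L - k)"]) (auto simp: algebra_simps)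
    moreover have "0 \<le> c * 2 ^ (L - k)" using assms by simp
    moreover have "(c + 1) * 2 ^ (L - k) \<le> 2 ^ k * 2 ^ (L - k)" using assms by (intro mult_right_mono) auto
    ultimately show "y \<in> {y \<in> grid L. cell L k y = c}"
      using y unfolding cell_def grid_def e mem_Collect_eq atLeastLessThan_iff by linarith
  qed
  then show ?thesis by (simp add: algebra_simps nat_power_eq)
qed

lemma card_own_cell:
  assumes "x \<in> grid L" "k \<le> L"
  shows "card {y \<in> grid L. cell L k y = cell L k x} = 2 ^ (L - k)"
  using card_cell cell_bounds[OF assms] assms by simp

lemma sum_near_le:
  assumes x: "x \<in> grid L" and k: "k \<le> L"
    and b: "\<And>y. y \<in> grid L \<Longrightarrow> near L k x y \<Longrightarrow> (\<Sum>w\<in>{w \<in> grid L. cell L k w = cell L k y}. F w) \<le> (b::real)"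
    and b0: "0 \<le> b"
  shows "(\<Sum>y\<in>{y \<in> grid L. near L k x y}. F y) \<le> 3 * b"
proof -
  define c0 where "c0 = cell L k x"
  \<comment> \<open>The own cell and its two cyclic neighbours; at coarse levels they may coincide,
    hence only an inequality for \<open>card C\<close>.\<close>
  define C where "C = {c0, if c0 + 1 < 2 ^ k then c0 + 1 else 0, if c0 > 0 then c0 - 1 else 2 ^ k - 1}"
  have c0: "0 \<le> c0" "c0 < 2 ^ k" using cell_bounds[OF x k] by (auto simp: c0_def)
  have "card C \<le> 3" unfolding C_def by (simp add: card_insert_if)
  have sub: "cell L k ` {y \<in> grid L. near L k x y} \<subseteq> C"
  proof clarify
    fix y assume y: "y \<in> grid L" "near L k x y"
    have "0 \<le> cell L k y" "cell L k y < 2 ^ k" using cell_bounds[OF y(1) k] by auto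
    then show "cell L k y \<in> C"
      using y(2) c0 unfolding near_def C_def c0_def[symmetric] by (auto split: if_splits)
  qed
  have "(\<Sum>y\<in>{y \<in> grid L. near L k x y}. F y) =
      (\<Sum>c\<in>C. \<Sum>y\<in>{y \<in> {y \<in> grid L. near L k x y}. cell L k y = c}. F y)"
    by (rule sum.group[symmetric]) (use sub in \<open>auto simp: C_def\<close>)
  also have "\<dots> \<le> (\<Sum>c\<in>C. b)"
  proof (rule sum_mono)
    fix c assume "c \<in> C"
    show "(\<Sum>y\<in>{y \<in> {y \<in> grid L. near L k x y}. cell L k y = c}. F y) \<le> b"
    proof (cases "\<exists>y. y \<in> grid L \<and> near L k x y \<and> cell L k y = c")
      case True
      then obtain y where y: "y \<in> grid L" "near L k x y" "cell L k y = c" by auto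
      have "{y \<in> {y \<in> grid L. near L k x y}. cell L k y = c} = {w \<in> grid L. cell L k w = cell L k y}"
        using y by (auto simp: near_def)
      then show ?thesis using b[OF y(1,2)] by simp
    next
      case False
      then have e: "{y \<in> {y \<in> grid L. near L k x y}. cell L k y = c} = {}" by auto
      show ?thesis unfolding e using b0 by simp
    qed
  qed
  also have "\<dots> \<le> 3 * b"
    using \<open>card C \<le> 3\<close> b0 by (simp add: mult_right_mono)
  finally show ?thesis .
qed

lemma card_near:
  assumes "x \<in> grid L" "k \<le> L"
  shows "real (card {y \<in> grid L. near L k x y}) \<le> 3 * 2 ^ (L - k)"
  using sum_near_le[OF assms, of "\<lambda>_. 1" "2 ^ (L - k)"] card_own_cell assms by simp

text \<open>Both bounds together say that the cyclic distance of \<open>x\<close> and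
  \<open>y\<close> is at least the length of one cell.\<close>

lemma not_near_dist:
  assumes "\<not> near L k x y" "x \<in> grid L" "y \<in> grid L" "k \<le> L"
  shows "2 ^ (L - k) \<le> \<bar>x - y\<bar>" "\<bar>x - y\<bar> \<le> 2 ^ L - 2 ^ (L - k)"
proof -
  define P where "P = (2::int) ^ (L - k)"
  define a where "a = cell L k x"
  define b where "b = cell L k y"
  have P: "0 < P" by (simp add: P_def)
  have e: "(2::int) ^ L = 2 ^ k * P" using assms by (simp add: P_def flip: power_add)
  have x: "a * P \<le> x" "x < (a + 1) * P" and y: "b * P \<le> y" "y < (b + 1) * P"
    using pos_mod_bound[OF P, of x] pos_mod_sign[OF P, of x] div_mult_mod_eq[of x P]
      pos_mod_bound[OF P, of y] pos_mod_sign[OF P, of y] div_mult_mod_eq[of y P]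
    unfolding a_def b_def cell_def P_def[symmetric] distrib_right by linarith+
  have ab: "\<bar>a - b\<bar> \<ge> 2" "\<bar>a - b\<bar> \<le> 2 ^ k - 2"
    using assms(1) by (auto simp: near_def a_def b_def)
  have "P \<le> \<bar>x - y\<bar> \<and> \<bar>x - y\<bar> \<le> 2 ^ k * P - P"
  proof (cases "a \<ge> b")
    case True
    then have "(b + 2) * P \<le> a * P" "a * P \<le> (2 ^ k - 2 + b) * P"
      using ab P by (auto intro!: mult_right_mono)
    then show ?thesis using x y by (simp add: algebra_simps)
  next
    case False
    then have "(a + 2) * P \<le> b * P" "b * P \<le> (2 ^ k - 2 + a) * P"
      using ab P by (auto intro!: mult_right_mono)
    then show ?thesis using x y by (simp add: algebra_simps)
  qed
  then show "2 ^ (L - k) \<le> \<bar>x - y\<bar>" "\<bar>x - y\<bar> \<le> 2 ^ L - 2 ^ (L - k)"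
    by (auto simp: P_def[symmetric] e)
qed

lemma obtain_last_level:
  assumes "P (0::nat)" "\<not> P k"
  obtains i where "i < k" "P i" "\<not> P (Suc i)"
proof -
  have "\<not> P k \<longrightarrow> (\<exists>i<k. P i \<and> \<not> P (Suc i))"
    by (induction k) (use assms(1) less_Suc_eq in auto)
  then show thesis using assms that by auto
qed

text \<open>In truncated subtraction \<open>(i - j) + (j - i)\<close> is the distance of
  \<open>i\<close> and \<open>j\<close>. The induction carries a separate remainder on each side of
  \<open>i\<close>: twice the last term while the terms rise, and 3 minus the last term once they
  fall.\<close>

lemma sum_half_dist: "(\<Sum>j\<le>n. (1 / 2) ^ ((i - j) + (j - i))) \<le> (3::real)"
proof -
  have "(n \<le> i \<longrightarrow> (\<Sum>j\<le>n. (1 / 2) ^ ((i - j) + (j - i))) \<le> 2 * (1 / 2 :: real) ^ (i - n)) \<and>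
    (i \<le> n \<longrightarrow> (\<Sum>j\<le>n. (1 / 2) ^ ((i - j) + (j - i))) \<le> 3 - (1 / 2 :: real) ^ (n - i))"
  proof (induction n)
    case 0
    then show ?case by auto
  next
    case (Suc n)
    show ?case
    proof (cases "Suc n \<le> i")
      case True
      then have e: "i - n = Suc (i - Suc n)" by auto
      have "(\<Sum>j\<le>Suc n. (1 / 2) ^ ((i - j) + (j - i))) \<le> 2 * (1 / 2 :: real) ^ (i - Suc n)"
        using Suc True by (simp add: e)
      then show ?thesis using True by auto
    next
      case False
      then have e: "Suc n - i = Suc (n - i)" and "i \<le> n" by auto
      then show ?thesis using Suc False by (simp add: e)
    qed
  qed
  note * = this
  show ?thesis
  proof (cases "n \<le> i")
    case True
    have "2 * (1 / 2 :: real) ^ (i - n) \<le> 3"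
      using power_le_one[of "1 / 2 :: real" "i - n"] by simp
    with * True show ?thesis by (blast intro: order_trans)
  next
    case False
    have "3 - (1 / 2 :: real) ^ (n - i) \<le> 3" by simp
    with * False show ?thesis by (meson linear order_trans)
  qed
qed

section \<open>The maximal function and stopping cells\<close>

text \<open>The Hardy--Littlewood maximal function over a cell with its neighbours, divided by the
  size of one cell only; a value can thus reach three times the supremum of \<open>f\<close>.
  Neighbours are included because the tails of the kernel are measured by
  \<open>near\<close>.\<close>

definition maxfun :: "nat \<Rightarrow> (int \<Rightarrow> complex) \<Rightarrow> int \<Rightarrow> real" where
  "maxfun L f x = Max ((\<lambda>k. 2 ^ k / 2 ^ L * (\<Sum>y\<in>{y \<in> grid L. near L k x y}. norm (f y))) ` {..L})"

lemma maxfun_ge: "k \<le> L \<Longrightarrow> 2 ^ k / 2 ^ L * (\<Sum>y\<in>{y \<in> grid L. near L k x y}. norm (f y)) \<le> maxfun L f x"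
  unfolding maxfun_def by (rule Max_ge) auto

lemma maxfun_gr_iff:
  "maxfun L f x > c \<longleftrightarrow> (\<exists>k\<le>L. 2 ^ k / 2 ^ L * (\<Sum>y\<in>{y \<in> grid L. near L k x y}. norm (f y)) > c)"
  unfolding maxfun_def by (subst Max_gr_iff) auto

lemma maxfun_le:
  "(\<And>k. k \<le> L \<Longrightarrow> 2 ^ k / 2 ^ L * (\<Sum>y\<in>{y \<in> grid L. near L k x y}. norm (f y)) \<le> c) \<Longrightarrow> maxfun L f x \<le> c"
  unfolding maxfun_def by (subst Max_le_iff) auto

lemma sum_near_le_maxfun:
  assumes "k \<le> L"
  shows "(\<Sum>y\<in>{y \<in> grid L. near L k x y}. norm (f y)) \<le> 2 ^ (L - k) * maxfun L f x"
proof -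
  have e: "(2::real) ^ L = 2 ^ k * 2 ^ (L - k)" using assms by (simp flip: power_add)
  show ?thesis using maxfun_ge[OF assms, of f x] by (simp add: e divide_simps mult.commute)
qed

lemma maxfun_nonneg: "0 \<le> maxfun L f x"
  by (rule order_trans[OF _ maxfun_ge[of 0]]) (auto intro!: divide_nonneg_pos sum_nonneg)

lemma maxfun_le_sup:
  assumes "\<And>y. y \<in> grid L \<Longrightarrow> norm (f y) \<le> c" "x \<in> grid L"
  shows "maxfun L f x \<le> 3 * c"
proof (rule maxfun_le)
  fix k assume k: "k \<le> L"
  have e: "(2::real) ^ L = 2 ^ k * 2 ^ (L - k)" using k by (simp flip: power_add)
  have c: "0 \<le> c" using assms norm_ge_zero order_trans by blast
  have "(\<Sum>y\<in>{y \<in> grid L. near L k x y}. norm (f y)) \<le> 3 * (2 ^ (L - k) * c)"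
  proof (rule sum_near_le[OF assms(2) k])
    fix y assume "y \<in> grid L" "near L k x y"
    have "(\<Sum>w\<in>{w \<in> grid L. cell L k w = cell L k y}. norm (f w)) \<le> (\<Sum>w\<in>{w \<in> grid L. cell L k w = cell L k y}. c)"
      by (rule sum_mono) (use assms in auto)
    then show "(\<Sum>w\<in>{w \<in> grid L. cell L k w = cell L k y}. norm (f w)) \<le> 2 ^ (L - k) * c"
      using card_own_cell[OF \<open>y \<in> grid L\<close> k] by simp
  qed (use c in auto)
  then show "2 ^ k / 2 ^ L * (\<Sum>y\<in>{y \<in> grid L. near L k x y}. norm (f y)) \<le> 3 * c"
    by (simp add: e divide_simps ac_simps)
qed

section \<open>Stopping cells of a cell-wise property\<close>

definition stop_set :: "nat \<Rightarrow> (nat \<Rightarrow> int \<Rightarrow> bool) \<Rightarrow> int set" where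
  "stop_set L S = {x \<in> grid L. \<exists>k\<le>L. S k x}"

definition stop_level :: "(nat \<Rightarrow> int \<Rightarrow> bool) \<Rightarrow> int \<Rightarrow> nat" where
  "stop_level S x = (LEAST k. S k x)"

definition stop_cell :: "nat \<Rightarrow> (nat \<Rightarrow> int \<Rightarrow> bool) \<Rightarrow> int \<Rightarrow> int set" where
  "stop_cell L S x = {y \<in> grid L. cell L (stop_level S x) y = cell L (stop_level S x) x}"

text \<open>\<open>S k\<close> is a property of the cells of level \<open>k\<close>. The coarsest
  cells having it are disjoint and cover \<open>stop_set\<close>, so local estimates add up. It
  serves both for the heavy cells of a function and for the cells on which the approximating
  constant is large.\<close>

locale stopping =
  fixes L :: nat and S :: "nat \<Rightarrow> int \<Rightarrow> bool"
  assumes S_cong: "k \<le> L \<Longrightarrow> cell L k x = cell L k y \<Longrightarrow> S k x \<Longrightarrow> S k y"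
begin

lemma stop_level:
  assumes "x \<in> stop_set L S"
  shows "S (stop_level S x) x" "stop_level S x \<le> L" "x \<in> grid L" "x \<in> stop_cell L S x"
proof -
  obtain k where k: "k \<le> L" "S k x" and x: "x \<in> grid L" using assms by (auto simp: stop_set_def)
  show "S (stop_level S x) x" unfolding stop_level_def using k(2) by (rule LeastI)
  show "stop_level S x \<le> L" unfolding stop_level_def using Least_le[of "\<lambda>k. S k x", OF k(2)] k(1) by simp
  show "x \<in> grid L" "x \<in> stop_cell L S x" using x by (auto simp: stop_cell_def)
qed

lemma stop_level_le: "S k x \<Longrightarrow> stop_level S x \<le> k"
  unfolding stop_level_def by (rule Least_le)

lemma not_before_stop: "k < stop_level S x \<Longrightarrow> \<not> S k x"
  unfolding stop_level_def by (rule not_less_Least)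

lemma stop_cell_same:
  assumes "x \<in> stop_set L S" "y \<in> stop_cell L S x"
  shows "stop_level S y = stop_level S x" "y \<in> stop_set L S" "x \<in> stop_cell L S y"
proof -
  let ?k = "stop_level S x"
  note x = stop_level[OF assms(1)]
  have y: "y \<in> grid L" "cell L ?k y = cell L ?k x" using assms(2) by (auto simp: stop_cell_def)
  have Sy: "S ?k y" using S_cong[OF x(2) y(2)[symmetric] x(1)] .
  then show "y \<in> stop_set L S" using x(2) y(1) by (auto simp: stop_set_def)
  have "\<not> S i y" if "i < ?k" for i
  proof
    assume "S i y"
    moreover have "cell L i y = cell L i x"
      by (rule cell_eq_mono[OF y(2)]) (use that x in auto)
    ultimately have "S i x" using S_cong[of i y x] that x(2) by auto
    then show False using not_before_stop[OF that] by simp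
  qed
  then show lev: "stop_level S y = stop_level S x"
    unfolding stop_level_def[of S y] using Sy by (intro Least_equality) (auto simp: not_less[symmetric])
  show "x \<in> stop_cell L S y" using x y lev by (auto simp: stop_cell_def)
qed

lemma card_stop_cell: "x \<in> stop_set L S \<Longrightarrow> card (stop_cell L S x) = 2 ^ (L - stop_level S x)"
  unfolding stop_cell_def using stop_level[of x] by (intro card_own_cell) auto

lemma finite_stop [simp]: "finite (stop_set L S)" "finite (stop_cell L S x)"
  by (auto simp: stop_set_def stop_cell_def)

text \<open>Substitute for a sum over the family of stopping cells: every point stands for its cell
  with weight one over the cell size, so no representatives of the partition have to be
  chosen.\<close>

lemma sum_stop_average:
  fixes \<phi> :: "int \<Rightarrow> 'a::real_vector"
  shows "(\<Sum>x\<in>stop_set L S. \<phi> x) =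
    (\<Sum>x\<in>stop_set L S. (1 / 2 ^ (L - stop_level S x)) *\<^sub>R (\<Sum>y\<in>stop_cell L S x. \<phi> y))"
proof -
  let ?U = "stop_set L S" and ?c = "\<lambda>x. 1 / 2 ^ (L - stop_level S x) :: real"
  have sub: "{y \<in> ?U. y \<in> stop_cell L S x} = stop_cell L S x" if "x \<in> ?U" for x
    using stop_cell_same[OF that] by auto
  have "(\<Sum>x\<in>?U. ?c x *\<^sub>R (\<Sum>y\<in>stop_cell L S x. \<phi> y)) =
      (\<Sum>x\<in>?U. \<Sum>y\<in>?U. if y \<in> stop_cell L S x then ?c x *\<^sub>R \<phi> y else 0)"
    by (intro sum.cong refl) (simp add: sum.If_cases scaleR_right.sum sub Int_def)
  also have "\<dots> = (\<Sum>y\<in>?U. \<Sum>x\<in>?U. if y \<in> stop_cell L S x then ?c x *\<^sub>R \<phi> y else 0)"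
    by (rule sum.swap)
  also have "\<dots> = (\<Sum>y\<in>?U. \<Sum>x\<in>?U. if x \<in> stop_cell L S y then ?c y *\<^sub>R \<phi> y else 0)"
  proof (intro sum.cong refl)
    fix y x assume "y \<in> ?U" "x \<in> ?U"
    then have "y \<in> stop_cell L S x \<longleftrightarrow> x \<in> stop_cell L S y"
      and "x \<in> stop_cell L S y \<Longrightarrow> stop_level S x = stop_level S y"
      using stop_cell_same(1,3) by blast+
    then show "(if y \<in> stop_cell L S x then ?c x *\<^sub>R \<phi> y else 0) =
        (if x \<in> stop_cell L S y then ?c y *\<^sub>R \<phi> y else 0)" by simp
  qed
  also have "\<dots> = (\<Sum>y\<in>?U. \<Sum>x\<in>stop_cell L S y. ?c y *\<^sub>R \<phi> y)"
    by (rule sum.cong[OF refl]) (simp add: sum.If_cases sub Int_def)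
  also have "\<dots> = (\<Sum>y\<in>?U. \<phi> y)"
    by (intro sum.cong refl) (simp add: card_stop_cell sum_constant_scaleR)
  finally show ?thesis by simp
qed

lemma sum_stop_mono:
  fixes \<phi> \<psi> :: "int \<Rightarrow> real"
  assumes "\<And>x. x \<in> stop_set L S \<Longrightarrow> (\<Sum>y\<in>stop_cell L S x. \<phi> y) \<le> (\<Sum>y\<in>stop_cell L S x. \<psi> y)"
  shows "(\<Sum>x\<in>stop_set L S. \<phi> x) \<le> (\<Sum>x\<in>stop_set L S. \<psi> x)"
  by (subst (1 2) sum_stop_average, intro sum_mono) (simp add: assms divide_right_mono)

lemma sum_stop_0:
  fixes \<phi> :: "int \<Rightarrow> complex"
  assumes "\<And>x. x \<in> stop_set L S \<Longrightarrow> (\<Sum>y\<in>stop_cell L S x. \<phi> y) = 0"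
  shows "(\<Sum>x\<in>stop_set L S. \<phi> x) = 0"
  by (subst sum_stop_average) (simp add: assms)

definition enlarged :: "int set" where
  "enlarged = {x \<in> grid L. \<exists>y\<in>stop_set L S. near L (stop_level S y) x y}"

lemma finite_enlarged [simp]: "finite enlarged"
  by (simp add: enlarged_def)

text \<open>Double counting of near pairs, each weighted by one over the size of the stopping cell
  of \<open>y\<close>: an enlarged point receives at least the total weight 1 of one stopping cell,
  and a stopped point hands out at most 3.\<close>

lemma card_enlarged: "real (card enlarged) \<le> 3 * card (stop_set L S)"
proof -
  let ?U = "stop_set L S" and ?c = "\<lambda>x. 1 / 2 ^ (L - stop_level S x) :: real"
  have "real (card enlarged) = (\<Sum>x\<in>enlarged. 1)" by simp
  also have "\<dots> \<le> (\<Sum>x\<in>enlarged. \<Sum>y\<in>?U. if near L (stop_level S y) x y then ?c y else 0)"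
  proof (rule sum_mono)
    fix x assume "x \<in> enlarged"
    then obtain y where y: "y \<in> ?U" "near L (stop_level S y) x y" by (auto simp: enlarged_def)
    have "1 = (\<Sum>w\<in>stop_cell L S y. ?c y)" using card_stop_cell[OF y(1)] by simp
    also have "(\<Sum>w\<in>stop_cell L S y. ?c y) = (\<Sum>w\<in>stop_cell L S y. if near L (stop_level S w) x w then ?c w else 0)"
    proof (rule sum.cong[OF refl])
      fix w assume w: "w \<in> stop_cell L S y"
      have "near L (stop_level S w) x w"
        using y(2) near_cong2[of L "stop_level S y" w y x] w stop_cell_same[OF y(1) w]
        by (simp add: stop_cell_def)
      then show "?c y = (if near L (stop_level S w) x w then ?c w else 0)"
        using stop_cell_same[OF y(1) w] by simp
    qed
    also have "\<dots> \<le> (\<Sum>w\<in>?U. if near L (stop_level S w) x w then ?c w else 0)"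
      by (rule sum_mono2) (use stop_cell_same[OF y(1)] in auto)
    finally show "1 \<le> (\<Sum>w\<in>?U. if near L (stop_level S w) x w then ?c w else 0)" by simp
  qed
  also have "\<dots> = (\<Sum>y\<in>?U. \<Sum>x\<in>enlarged. if near L (stop_level S y) x y then ?c y else 0)"
    by (rule sum.swap)
  also have "\<dots> \<le> (\<Sum>y\<in>?U. 3)"
  proof (rule sum_mono)
    fix y assume y: "y \<in> ?U"
    let ?k = "stop_level S y"
    have "(\<Sum>x\<in>enlarged. if near L ?k x y then ?c y else 0) \<le> (\<Sum>x\<in>grid L. if near L ?k x y then ?c y else 0)"
      by (rule sum_mono2) (auto simp: enlarged_def)
    also have "\<dots> = card {x \<in> grid L. near L ?k y x} * ?c y"
      by (simp add: sum.If_cases Int_def near_sym[of L _ _ y])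
    also have "\<dots> \<le> 3 * 2 ^ (L - ?k) * ?c y"
      by (intro mult_right_mono card_near stop_level y) auto
    finally show "(\<Sum>x\<in>enlarged. if near L ?k x y then ?c y else 0) \<le> 3" by simp
  qed
  finally show ?thesis by simp
qed

end

definition heavy :: "nat \<Rightarrow> (int \<Rightarrow> complex) \<Rightarrow> real \<Rightarrow> nat \<Rightarrow> int \<Rightarrow> bool" where
  "heavy L f l k x \<longleftrightarrow> (\<Sum>y\<in>{y \<in> grid L. cell L k y = cell L k x}. norm (f y)) > l * 2 ^ (L - k)"

lemma stopping_heavy: "stopping L (heavy L f l)"
  by unfold_locales (simp add: heavy_def)

lemma card_stop_heavy:
  "l * card (stop_set L (heavy L f l)) \<le> (\<Sum>x\<in>stop_set L (heavy L f l). norm (f x))"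
proof -
  interpret stopping L "heavy L f l" by (rule stopping_heavy)
  have "(\<Sum>x\<in>stop_set L (heavy L f l). l) \<le> (\<Sum>x\<in>stop_set L (heavy L f l). norm (f x))"
  proof (rule sum_stop_mono)
    fix x assume x: "x \<in> stop_set L (heavy L f l)"
    from stop_level(1)[OF x] card_stop_cell[OF x]
    show "(\<Sum>y\<in>stop_cell L (heavy L f l) x. l) \<le> (\<Sum>y\<in>stop_cell L (heavy L f l) x. norm (f y))"
      by (simp add: heavy_def stop_cell_def mult.commute)
  qed
  then show ?thesis by (simp add: mult.commute)
qed

text \<open>A heavy cell near \<open>x\<close> lies in a stopping cell that is at least as coarse,
  and nearness passes to coarser levels. So outside the enlargement none of the at most three near
  cells is heavy, at any level.\<close>

lemma maxfun_le_outside_enlarged: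
  assumes x: "x \<in> grid L" "x \<notin> stopping.enlarged L (heavy L f l)" and l: "0 \<le> l"
  shows "maxfun L f x \<le> 3 * l"
proof (rule maxfun_le)
  interpret stopping L "heavy L f l" by (rule stopping_heavy)
  fix k assume k: "k \<le> L"
  have e: "(2::real) ^ L = 2 ^ k * 2 ^ (L - k)" using k by (simp flip: power_add)
  have "(\<Sum>y\<in>{y \<in> grid L. near L k x y}. norm (f y)) \<le> 3 * (l * 2 ^ (L - k))"
  proof (rule sum_near_le[OF x(1) k])
    fix y assume y: "y \<in> grid L" "near L k x y"
    show "(\<Sum>w\<in>{w \<in> grid L. cell L k w = cell L k y}. norm (f w)) \<le> l * 2 ^ (L - k)"
    proof (rule ccontr)
      assume "\<not> ?thesis"
      then have h: "heavy L f l k y" by (simp add: heavy_def)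
      then have "y \<in> stop_set L (heavy L f l)" using y k by (auto simp: stop_set_def)
      moreover have "near L (stop_level (heavy L f l) y) x y"
        by (rule near_mono[OF y(2) x(1) y(1) stop_level_le[OF h] k])
      ultimately show False using x by (auto simp: enlarged_def)
    qed
  qed (use l in auto)
  then show "2 ^ k / 2 ^ L * (\<Sum>y\<in>{y \<in> grid L. near L k x y}. norm (f y)) \<le> 3 * l"
    by (simp add: e divide_simps ac_simps)
qed

lemma card_enlarged_heavy:
  assumes "0 < l"
  shows "l * card (stopping.enlarged L (heavy L f l)) \<le> 3 * (\<Sum>x\<in>grid L. norm (f x))"
proof -
  interpret stopping L "heavy L f l" by (rule stopping_heavy)
  have "l * card enlarged \<le> 3 * (l * card (stop_set L (heavy L f l)))"
    using mult_left_mono[OF card_enlarged, of l] assms by (simp add: ac_simps)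
  also have "\<dots> \<le> 3 * (\<Sum>x\<in>stop_set L (heavy L f l). norm (f x))"
    using card_stop_heavy by simp
  also have "\<dots> \<le> 3 * (\<Sum>x\<in>grid L. norm (f x))"
    by (intro mult_left_mono sum_mono2) (auto simp: stop_set_def)
  finally show ?thesis .
qed

text \<open>Heavy cells are taken at height \<open>l / 3\<close>. One factor 3 comes from the
  neighbours in the maximal function, the other from the enlargement.\<close>

lemma maxfun_weak:
  assumes "0 < l"
  shows "l * card {x \<in> grid L. maxfun L f x > l} \<le> 9 * (\<Sum>x\<in>grid L. norm (f x))"
proof -
  have "{x \<in> grid L. maxfun L f x > l} \<subseteq> stopping.enlarged L (heavy L f (l / 3))"
  proof clarify
    fix x assume x: "x \<in> grid L" "maxfun L f x > l"
    show "x \<in> stopping.enlarged L (heavy L f (l / 3))"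
    proof (rule ccontr)
      assume "x \<notin> stopping.enlarged L (heavy L f (l / 3))"
      from maxfun_le_outside_enlarged[OF x(1) this] x assms show False by simp
    qed
  qed
  then have "card {x \<in> grid L. maxfun L f x > l} \<le> card (stopping.enlarged L (heavy L f (l / 3)))"
    using stopping.finite_enlarged[OF stopping_heavy] by (intro card_mono) auto
  then have "l / 3 * card {x \<in> grid L. maxfun L f x > l} \<le> l / 3 * card (stopping.enlarged L (heavy L f (l / 3)))"
    using assms by (intro mult_left_mono) auto
  also have "\<dots> \<le> 3 * (\<Sum>x\<in>grid L. norm (f x))"
    by (rule card_enlarged_heavy) (use assms in simp)
  finally show ?thesis by simp
qed

section \<open>The Calderon--Zygmund decomposition\<close>

definition bilin :: "nat \<Rightarrow> (int \<Rightarrow> int \<Rightarrow> int \<Rightarrow> complex) \<Rightarrow> (int \<Rightarrow> complex) \<Rightarrow> (int \<Rightarrow> complex) \<Rightarrow> int \<Rightarrow> complex" where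
  "bilin L Kr f g x = (\<Sum>y\<in>grid L. \<Sum>z\<in>grid L. Kr x y z * f y * g z) / (2 ^ L)\<^sup>2"

definition near_weight :: "nat \<Rightarrow> nat \<Rightarrow> int \<Rightarrow> int \<Rightarrow> int \<Rightarrow> real" where
  "near_weight L k x y z = (\<Sum>i<k. 8 ^ i * of_bool (near L i x y) * of_bool (near L i x z))"

text \<open>
  Near weights play the role of \<open>(\<bar>x - y\<bar> + \<bar>x - z\<bar>)\<^sup>-\<^sup>3\<close>, so the first three conditions are the usual
  regularity estimates of a bilinear Calderon--Zygmund kernel; the last one is an estimate
  of \<open>L\<^sup>\<infinity> \<times> L\<^sup>2 \<times> L\<^sup>2\<close> type, symmetrised and normalised.
\<close>

definition cz_kernel :: "real \<Rightarrow> nat \<Rightarrow> (int \<Rightarrow> int \<Rightarrow> int \<Rightarrow> complex) \<Rightarrow> bool" where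
  "cz_kernel C L Kr \<longleftrightarrow> 0 \<le> C \<and>
    (\<forall>k\<le>L. \<forall>x\<in>grid L. \<forall>y\<in>grid L. \<forall>z\<in>grid L. \<forall>w\<in>grid L.
       (cell L k y = cell L k w \<and> \<not> near L k x y \<longrightarrow>
          norm (Kr x y z - Kr x w z) \<le> C / 2 ^ k * near_weight L k x y z) \<and>
       (cell L k z = cell L k w \<and> \<not> near L k x z \<longrightarrow>
          norm (Kr x y z - Kr x y w) \<le> C / 2 ^ k * near_weight L k x y z) \<and>
       (cell L k x = cell L k w \<and> \<not> (near L k x y \<and> near L k x z) \<longrightarrow>
          norm (Kr x y z - Kr w y z) \<le> C / 2 ^ k * near_weight L k x y z)) \<and>
    (\<forall>f g h. (\<forall>x\<in>grid L. norm (f x) \<le> 1 \<and> norm (g x) \<le> 1 \<and> norm (h x) \<le> 1) \<longrightarrow>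
       norm (\<Sum>x\<in>grid L. bilin L Kr f g x * h x) \<le>
         C * (\<Sum>x\<in>grid L. (norm (f x))\<^sup>2 + (norm (g x))\<^sup>2 + (norm (h x))\<^sup>2))"

lemma near_weight_swap: "near_weight L k x y z = near_weight L k x z y"
  by (simp add: near_weight_def ac_simps)

lemma near_weight_nonneg: "0 \<le> near_weight L k x y z"
  by (auto simp: near_weight_def intro!: sum_nonneg)

lemma bilin_swap: "bilin L (\<lambda>x y z. Kr x z y) g f = bilin L Kr f g"
proof
  fix x
  show "bilin L (\<lambda>x y z. Kr x z y) g f x = bilin L Kr f g x"
    unfolding bilin_def by (subst sum.swap) (simp add: ac_simps)
qed

lemma cz_kernelD:
  assumes "cz_kernel C L Kr"
  shows "0 \<le> C"
    and "\<lbrakk>k \<le> L; x \<in> grid L; y \<in> grid L; z \<in> grid L; w \<in> grid L; cell L k y = cell L k w; \<not> near L k x y\<rbrakk>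
      \<Longrightarrow> norm (Kr x y z - Kr x w z) \<le> C / 2 ^ k * near_weight L k x y z"
    and "\<lbrakk>k \<le> L; x \<in> grid L; y \<in> grid L; z \<in> grid L; w \<in> grid L; cell L k z = cell L k w; \<not> near L k x z\<rbrakk>
      \<Longrightarrow> norm (Kr x y z - Kr x y w) \<le> C / 2 ^ k * near_weight L k x y z"
    and "\<lbrakk>k \<le> L; x \<in> grid L; y \<in> grid L; z \<in> grid L; w \<in> grid L; cell L k x = cell L k w; \<not> (near L k x y \<and> near L k x z)\<rbrakk>
      \<Longrightarrow> norm (Kr x y z - Kr w y z) \<le> C / 2 ^ k * near_weight L k x y z"
    and "(\<And>x. x \<in> grid L \<Longrightarrow> norm (f x) \<le> 1 \<and> norm (g x) \<le> 1 \<and> norm (h x) \<le> 1) \<Longrightarrow>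
       norm (\<Sum>x\<in>grid L. bilin L Kr f g x * h x) \<le>
         C * (\<Sum>x\<in>grid L. (norm (f x))\<^sup>2 + (norm (g x))\<^sup>2 + (norm (h x))\<^sup>2)"
  using assms unfolding cz_kernel_def by blast+

lemma bilin_add_left: "bilin L Kr (\<lambda>y. f y + f' y) g x = bilin L Kr f g x + bilin L Kr f' g x"
  by (simp add: bilin_def add_divide_distrib[symmetric] sum.distrib[symmetric] algebra_simps)

lemma bilin_add_right: "bilin L Kr f (\<lambda>y. g y + g' y) x = bilin L Kr f g x + bilin L Kr f g' x"
  by (simp add: bilin_def add_divide_distrib[symmetric] sum.distrib[symmetric] algebra_simps)

lemma bilin_scale: "bilin L Kr (\<lambda>y. a * f y) (\<lambda>y. b * g y) x = a * b * bilin L Kr f g x"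
  by (simp add: bilin_def sum_distrib_left ac_simps)

lemma sum_of_bool_near_le:
  assumes "x \<in> grid L" "k \<le> L"
  shows "(\<Sum>y\<in>grid L. of_bool (near L k x y)) \<le> 3 * (2::real) ^ (L - k)"
  using card_near[OF assms] by (simp add: sum.If_cases Int_def of_bool_def)

lemma sum_of_bool_near_maxfun:
  assumes "k \<le> L"
  shows "(\<Sum>y\<in>grid L. of_bool (near L k x y) * norm (f y)) \<le> 2 ^ (L - k) * maxfun L f x"
proof -
  have "(\<Sum>y\<in>grid L. of_bool (near L k x y) * norm (f y)) = (\<Sum>y\<in>{y \<in> grid L. near L k x y}. norm (f y))"
    by (rule sum.mono_neutral_cong_right) auto
  then show ?thesis using sum_near_le_maxfun[OF assms] by simp
qed

lemma sum_powers_of_two_le: "(\<Sum>i<k. 2 ^ i) \<le> (2::real) ^ k"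
  by (induction k) auto

text \<open>Summing one variable over the points near \<open>x\<close> at level \<open>i\<close>
  costs \<open>2 ^ (L - i)\<close> and lowers \<open>8 ^ i\<close> to \<open>4 ^ i\<close>. The
  second summation, in the next lemma, lowers it to \<open>2 ^ i\<close>; the sum over
  \<open>i\<close> is then at most \<open>2 ^ k\<close>, which cancels the factor
  \<open>1 / 2 ^ k\<close> in the kernel regularity.\<close>

lemma sum_near_weight_one_le:
  assumes "k \<le> L" "maxfun L g x \<le> m"
  shows "(\<Sum>z\<in>grid L. near_weight L k x y z * norm (g z)) \<le> 2 ^ L * m * (\<Sum>i<k. 4 ^ i * of_bool (near L i x y))"
proof -
  have "(\<Sum>z\<in>grid L. near_weight L k x y z * norm (g z)) =
      (\<Sum>z\<in>grid L. \<Sum>i<k. 8 ^ i * of_bool (near L i x y) * (of_bool (near L i x z) * norm (g z)))"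
    by (simp add: near_weight_def sum_distrib_right mult.assoc)
  also have "\<dots> = (\<Sum>i<k. \<Sum>z\<in>grid L. 8 ^ i * of_bool (near L i x y) * (of_bool (near L i x z) * norm (g z)))"
    by (rule sum.swap)
  also have "\<dots> = (\<Sum>i<k. 8 ^ i * of_bool (near L i x y) * (\<Sum>z\<in>grid L. of_bool (near L i x z) * norm (g z)))"
    by (simp only: sum_distrib_left)
  also have "\<dots> \<le> (\<Sum>i<k. 2 ^ L * m * (4 ^ i * of_bool (near L i x y)))"
  proof (rule sum_mono)
    fix i assume "i \<in> {..<k}"
    then have i: "i \<le> L" using assms by simp
    then have e: "(2::real) ^ L = 2 ^ i * 2 ^ (L - i)" by (simp flip: power_add)
    have e8: "(8::real) ^ i = 4 ^ i * 2 ^ i" by (simp flip: power_mult_distrib)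
    have "(\<Sum>z\<in>grid L. of_bool (near L i x z) * norm (g z)) \<le> 2 ^ (L - i) * m"
      by (rule order_trans[OF sum_of_bool_near_maxfun[OF i]]) (use assms in simp)
    then have "8 ^ i * of_bool (near L i x y) * (\<Sum>z\<in>grid L. of_bool (near L i x z) * norm (g z)) \<le>
        8 ^ i * of_bool (near L i x y) * (2 ^ (L - i) * m)"
      by (intro mult_left_mono) auto
    also have "\<dots> = 2 ^ L * m * (4 ^ i * of_bool (near L i x y))" by (simp add: e e8)
    finally show "8 ^ i * of_bool (near L i x y) * (\<Sum>z\<in>grid L. of_bool (near L i x z) * norm (g z)) \<le> \<dots>" .
  qed
  finally show ?thesis by (simp only: sum_distrib_left)
qed

lemma sum_near_weight_le:
  assumes "k \<le> L"
  shows "(\<Sum>y\<in>grid L. \<Sum>z\<in>grid L. near_weight L k x y z * norm (f y) * norm (g z)) \<le>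
    2 ^ k * (2 ^ L)\<^sup>2 * maxfun L f x * maxfun L g x"
proof -
  have "(\<Sum>y\<in>grid L. \<Sum>z\<in>grid L. near_weight L k x y z * norm (f y) * norm (g z)) =
      (\<Sum>y\<in>grid L. norm (f y) * (\<Sum>z\<in>grid L. near_weight L k x y z * norm (g z)))"
    by (simp add: sum_distrib_left ac_simps)
  also have "\<dots> \<le> (\<Sum>y\<in>grid L. norm (f y) * (2 ^ L * maxfun L g x * (\<Sum>i<k. 4 ^ i * of_bool (near L i x y))))"
    by (intro sum_mono mult_left_mono sum_near_weight_one_le assms) auto
  also have "\<dots> = (\<Sum>y\<in>grid L. \<Sum>i<k. 2 ^ L * maxfun L g x * 4 ^ i * (of_bool (near L i x y) * norm (f y)))"
    by (simp only: sum_distrib_left mult.assoc mult.commute mult.left_commute)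
  also have "\<dots> = (\<Sum>i<k. \<Sum>y\<in>grid L. 2 ^ L * maxfun L g x * 4 ^ i * (of_bool (near L i x y) * norm (f y)))"
    by (rule sum.swap)
  also have "\<dots> = (\<Sum>i<k. 2 ^ L * maxfun L g x * 4 ^ i * (\<Sum>y\<in>grid L. of_bool (near L i x y) * norm (f y)))"
    by (simp only: sum_distrib_left)
  also have "\<dots> \<le> (\<Sum>i<k. (2 ^ L)\<^sup>2 * maxfun L f x * maxfun L g x * 2 ^ i)"
  proof (rule sum_mono)
    fix i assume "i \<in> {..<k}"
    then have i: "i \<le> L" using assms by simp
    then have e: "(2::real) ^ L = 2 ^ i * 2 ^ (L - i)" by (simp flip: power_add)
    have e4: "(4::real) ^ i = 2 ^ i * 2 ^ i" by (simp flip: power_mult_distrib)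
    have "2 ^ L * maxfun L g x * 4 ^ i * (\<Sum>y\<in>grid L. of_bool (near L i x y) * norm (f y)) \<le>
        2 ^ L * maxfun L g x * 4 ^ i * (2 ^ (L - i) * maxfun L f x)"
      by (intro mult_left_mono sum_of_bool_near_maxfun i) (auto simp: maxfun_nonneg)
    also have "\<dots> = (2 ^ L)\<^sup>2 * maxfun L f x * maxfun L g x * 2 ^ i"
      by (simp add: power2_eq_square e e4)
    finally show "2 ^ L * maxfun L g x * 4 ^ i * (\<Sum>y\<in>grid L. of_bool (near L i x y) * norm (f y)) \<le> \<dots>" .
  qed
  also have "\<dots> = (2 ^ L)\<^sup>2 * maxfun L f x * maxfun L g x * (\<Sum>i<k. 2 ^ i)"
    by (simp add: sum_distrib_left)
  also have "\<dots> \<le> (2 ^ L)\<^sup>2 * maxfun L f x * maxfun L g x * 2 ^ k"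
    by (intro mult_left_mono sum_powers_of_two_le) (auto simp: maxfun_nonneg)
  finally show ?thesis by (simp add: ac_simps)
qed

text \<open>The stopping height is fixed at 1; other heights are reached by rescaling in
  \<open>cz_weak_type\<close>.\<close>

definition good_part :: "nat \<Rightarrow> (int \<Rightarrow> complex) \<Rightarrow> int \<Rightarrow> complex" where
  "good_part L f x = (if x \<in> stop_set L (heavy L f 1)
     then (\<Sum>y\<in>stop_cell L (heavy L f 1) x. f y) / 2 ^ (L - stop_level (heavy L f 1) x) else f x)"

definition bad_part :: "nat \<Rightarrow> (int \<Rightarrow> complex) \<Rightarrow> int \<Rightarrow> complex" where
  "bad_part L f x = f x - good_part L f x"

context
  fixes L :: nat and f :: "int \<Rightarrow> complex"
begin

interpretation stopping L "heavy L f 1" by (rule stopping_heavy)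

abbreviation "heavy_set \<equiv> stop_set L (heavy L f 1)"
abbreviation "heavy_cell \<equiv> stop_cell L (heavy L f 1)"
abbreviation "heavy_level \<equiv> stop_level (heavy L f 1)"

lemma stop_cell_eq: "x \<in> heavy_set \<Longrightarrow> y \<in> heavy_cell x \<Longrightarrow> heavy_cell y = heavy_cell x"
  using stop_cell_same[of x y] by (auto simp: stop_cell_def)

lemma good_part_cell: "x \<in> heavy_set \<Longrightarrow> y \<in> heavy_cell x \<Longrightarrow> good_part L f y = (\<Sum>y\<in>heavy_cell x. f y) / 2 ^ (L - heavy_level x)"
  using stop_cell_same[of x y] stop_cell_eq[of x y] by (simp add: good_part_def)

lemma sum_norm_good_part_le: "(\<Sum>x\<in>grid L. norm (good_part L f x)) \<le> (\<Sum>x\<in>grid L. norm (f x))"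
proof -
  have heavy_set: "heavy_set \<subseteq> grid L" by (auto simp: stop_set_def)
  have "(\<Sum>x\<in>heavy_set. norm (good_part L f x)) \<le> (\<Sum>x\<in>heavy_set. norm (f x))"
  proof (rule sum_stop_mono)
    fix x assume x: "x \<in> heavy_set"
    have "(\<Sum>y\<in>heavy_cell x. norm (good_part L f y)) = (\<Sum>y\<in>heavy_cell x. norm ((\<Sum>y\<in>heavy_cell x. f y) / 2 ^ (L - heavy_level x)))"
      by (rule sum.cong[OF refl]) (simp add: good_part_cell[OF x])
    also have "\<dots> = norm (\<Sum>y\<in>heavy_cell x. f y)"
      using card_stop_cell[OF x] by (simp add: norm_divide norm_power)
    also have "\<dots> \<le> (\<Sum>y\<in>heavy_cell x. norm (f y))" by (rule norm_sum)
    finally show "(\<Sum>y\<in>heavy_cell x. norm (good_part L f y)) \<le> (\<Sum>y\<in>heavy_cell x. norm (f y))" .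
  qed
  moreover have "(\<Sum>x\<in>grid L - heavy_set. norm (good_part L f x)) = (\<Sum>x\<in>grid L - heavy_set. norm (f x))"
    by (rule sum.cong) (auto simp: good_part_def)
  ultimately show ?thesis
    using sum.subset_diff[OF heavy_set, of "\<lambda>x. norm (good_part L f x)"] sum.subset_diff[OF heavy_set, of "\<lambda>x. norm (f x)"]
    by simp
qed

lemma bad_part_outside: "x \<notin> heavy_set \<Longrightarrow> bad_part L f x = 0"
  by (simp add: bad_part_def good_part_def)

lemma sum_norm_bad_part_le: "(\<Sum>x\<in>heavy_set. norm (bad_part L f x)) \<le> 2 * (\<Sum>x\<in>grid L. norm (f x))"
proof -
  have "(\<Sum>x\<in>heavy_set. norm (bad_part L f x)) \<le> (\<Sum>x\<in>grid L. norm (bad_part L f x))"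
    by (rule sum_mono2) (auto simp: stop_set_def)
  also have "\<dots> \<le> (\<Sum>x\<in>grid L. norm (f x) + norm (good_part L f x))"
    by (rule sum_mono) (simp add: bad_part_def norm_triangle_ineq4)
  finally show ?thesis using sum_norm_good_part_le by (simp add: sum.distrib)
qed

lemma sum_bad_part_cell: "x \<in> heavy_set \<Longrightarrow> (\<Sum>y\<in>heavy_cell x. bad_part L f y) = 0"
  using card_stop_cell[of x] by (simp add: bad_part_def sum_subtractf good_part_cell)

text \<open>The parent of a stopping cell is not heavy and is twice as large, so the average over
  the cell is at most 2. A parent exists because \<open>avg\<close> says that the root is not heavy.
  Outside the stopping cells, single points are themselves cells of level \<open>L\<close> that are
  not heavy.\<close>

lemma norm_good_part_le:
  assumes avg: "(\<Sum>x\<in>grid L. norm (f x)) \<le> 2 ^ L" and x: "x \<in> grid L"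
  shows "norm (good_part L f x) \<le> 2"
proof (cases "x \<in> heavy_set")
  case True
  note lx = stop_level[OF True]
  have "\<not> heavy L f 1 0 x"
    using avg cell_0 x by (simp add: heavy_def not_less cell_0 cong: conj_cong)
  then have pos: "heavy_level x > 0" using lx(1) by (cases "heavy_level x") auto
  define k where "k = heavy_level x - 1"
  have k: "heavy_level x = Suc k" "Suc k \<le> L" using pos lx by (auto simp: k_def)
  have e: "(2::real) ^ (L - k) = 2 * 2 ^ (L - Suc k)"
    using k by (simp flip: power_Suc add: Suc_diff_Suc)
  have "\<not> heavy L f 1 k x" by (rule not_before_stop) (simp add: k)
  then have h: "(\<Sum>y\<in>{y \<in> grid L. cell L k y = cell L k x}. norm (f y)) \<le> 2 ^ (L - k)"
    by (simp add: heavy_def not_less)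
  have "norm (\<Sum>y\<in>heavy_cell x. f y) \<le> (\<Sum>y\<in>heavy_cell x. norm (f y))" by (rule norm_sum)
  also have "\<dots> \<le> (\<Sum>y\<in>{y \<in> grid L. cell L k y = cell L k x}. norm (f y))"
  proof (rule sum_mono2)
    show "heavy_cell x \<subseteq> {y \<in> grid L. cell L k y = cell L k x}"
    proof
      fix y assume "y \<in> heavy_cell x"
      then have y: "y \<in> grid L" "cell L (Suc k) y = cell L (Suc k) x" by (simp_all add: stop_cell_def k)
      with cell_eq_mono[OF y(2), of k] k show "y \<in> {y \<in> grid L. cell L k y = cell L k x}" by simp
    qed
  qed auto
  also have "\<dots> \<le> 2 * 2 ^ (L - heavy_level x)" using h e k by simp
  finally show ?thesis
    using True by (simp add: good_part_def norm_divide norm_power divide_simps)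
next
  case False
  then have "\<not> heavy L f 1 L x" using x by (auto simp: stop_set_def)
  moreover have "{y \<in> grid L. cell L L y = cell L L x} = {x}" using x by auto
  ultimately have "norm (f x) \<le> 1" by (simp add: heavy_def)
  then show ?thesis using False by (simp add: good_part_def)
qed

text \<open>
  The mean value zero of the bad part lets one subtract the kernel at a fixed point of each stopping cell.
\<close>

lemma sum_bilin_bad_part_le:
  assumes C: "0 \<le> C"
    and Kr: "\<And>k x y z w. \<lbrakk>k \<le> L; x \<in> grid L; y \<in> grid L; z \<in> grid L; w \<in> grid L; cell L k y = cell L k w; \<not> near L k x y\<rbrakk>
      \<Longrightarrow> norm (Kr x y z - Kr x w z) \<le> C / 2 ^ k * near_weight L k x y z"
    and X: "X \<subseteq> grid L - enlarged" "\<And>x. x \<in> X \<Longrightarrow> maxfun L g x \<le> m" and m: "0 \<le> m"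
  shows "(\<Sum>x\<in>X. norm (bilin L Kr (bad_part L f) g x)) \<le> 6 * C * m * (\<Sum>x\<in>grid L. norm (f x))"
proof -
  let ?b = "bad_part L f"
  \<comment> \<open>A point that depends only on the stopping cell of \<open>y\<close>; any choice
    constant on these cells would do.\<close>
  define r where "r y = Min (heavy_cell y)" for y
  have r: "r y \<in> heavy_cell y" if "y \<in> heavy_set" for y
    unfolding r_def by (rule Min_in) (use stop_level(4)[OF that] in auto)
  define I where "I x y = (\<Sum>z\<in>grid L. Kr x y z * g z)" for x y
  have ptw: "norm (\<Sum>y\<in>grid L. \<Sum>z\<in>grid L. Kr x y z * ?b y * g z) \<le>
      (\<Sum>y\<in>heavy_set. norm (?b y) * (C / 2 ^ heavy_level y * (2 ^ L * m * (\<Sum>i<heavy_level y. 4 ^ i * of_bool (near L i x y)))))"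
    if x: "x \<in> X" for x
  proof -
    have "(\<Sum>y\<in>grid L. \<Sum>z\<in>grid L. Kr x y z * ?b y * g z) = (\<Sum>y\<in>grid L. I x y * ?b y)"
      by (simp add: I_def sum_distrib_left sum_distrib_right ac_simps)
    also have "\<dots> = (\<Sum>y\<in>heavy_set. I x y * ?b y)"
      by (rule sum.mono_neutral_right) (auto simp: bad_part_outside stop_set_def)
    \<comment> \<open>The subtracted sum vanishes cell by cell: \<open>I x (r y)\<close> is constant
      on a stopping cell and the bad part has mean zero there.\<close>
    also have "\<dots> = (\<Sum>y\<in>heavy_set. I x y * ?b y) - (\<Sum>y\<in>heavy_set. I x (r y) * ?b y)"
    proof -
      have "(\<Sum>y\<in>heavy_set. I x (r y) * ?b y) = 0"
      proof (rule sum_stop_0)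
        fix y assume y: "y \<in> heavy_set"
        have "(\<Sum>w\<in>heavy_cell y. I x (r w) * ?b w) = (\<Sum>w\<in>heavy_cell y. I x (r y) * ?b w)"
          by (rule sum.cong[OF refl]) (simp add: r_def stop_cell_eq[OF y])
        then show "(\<Sum>w\<in>heavy_cell y. I x (r w) * ?b w) = 0"
          by (simp add: sum_distrib_left[symmetric] sum_bad_part_cell[OF y])
      qed
      then show ?thesis by simp
    qed
    also have "\<dots> = (\<Sum>y\<in>heavy_set. (I x y - I x (r y)) * ?b y)"
      by (simp add: sum_subtractf left_diff_distrib)
    also have "norm \<dots> \<le> (\<Sum>y\<in>heavy_set. norm ((I x y - I x (r y)) * ?b y))" by (rule norm_sum)
    also have "\<dots> \<le> (\<Sum>y\<in>heavy_set. norm (?b y) * (C / 2 ^ heavy_level y * (2 ^ L * m * (\<Sum>i<heavy_level y. 4 ^ i * of_bool (near L i x y)))))"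
    proof (rule sum_mono)
      fix y assume y: "y \<in> heavy_set"
      have "norm (I x y - I x (r y)) \<le> (\<Sum>z\<in>grid L. norm ((Kr x y z - Kr x (r y) z) * g z))"
        unfolding I_def sum_subtractf[symmetric] left_diff_distrib by (rule norm_sum)
      also have "\<dots> \<le> (\<Sum>z\<in>grid L. C / 2 ^ heavy_level y * near_weight L (heavy_level y) x y z * norm (g z))"
        unfolding norm_mult
      proof (intro sum_mono mult_right_mono Kr)
        show "\<not> near L (heavy_level y) x y" using X(1) x y by (auto simp: enlarged_def)
      qed (use r[OF y] stop_level[OF y] X(1) x in \<open>auto simp: stop_cell_def\<close>)
      also have "\<dots> = C / 2 ^ heavy_level y * (\<Sum>z\<in>grid L. near_weight L (heavy_level y) x y z * norm (g z))"
        by (simp add: sum_distrib_left mult.assoc)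
      also have "\<dots> \<le> C / 2 ^ heavy_level y * (2 ^ L * m * (\<Sum>i<heavy_level y. 4 ^ i * of_bool (near L i x y)))"
        by (intro mult_left_mono sum_near_weight_one_le) (use stop_level[OF y] X(2)[OF x] C in auto)
      finally show "norm ((I x y - I x (r y)) * ?b y) \<le>
          norm (?b y) * (C / 2 ^ heavy_level y * (2 ^ L * m * (\<Sum>i<heavy_level y. 4 ^ i * of_bool (near L i x y))))"
        unfolding norm_mult mult.commute[of "norm (I x y - I x (r y))"] by (rule mult_left_mono) simp
    qed
    finally show ?thesis .
  qed
  have "(2 ^ L)\<^sup>2 * (\<Sum>x\<in>X. norm (bilin L Kr ?b g x)) =
      (\<Sum>x\<in>X. norm (\<Sum>y\<in>grid L. \<Sum>z\<in>grid L. Kr x y z * ?b y * g z))"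
    by (simp add: bilin_def norm_divide norm_power sum_distrib_left)
  also have "\<dots> \<le> (\<Sum>x\<in>X. \<Sum>y\<in>heavy_set. norm (?b y) * (C / 2 ^ heavy_level y * (2 ^ L * m * (\<Sum>i<heavy_level y. 4 ^ i * of_bool (near L i x y)))))"
    by (rule sum_mono) (rule ptw)
  also have "\<dots> = (\<Sum>y\<in>heavy_set. \<Sum>x\<in>X. norm (?b y) * (C / 2 ^ heavy_level y * (2 ^ L * m * (\<Sum>i<heavy_level y. 4 ^ i * of_bool (near L i x y)))))"
    by (rule sum.swap)
  also have "\<dots> = (\<Sum>y\<in>heavy_set. norm (?b y) * (C / 2 ^ heavy_level y * (2 ^ L * m * (\<Sum>x\<in>X. \<Sum>i<heavy_level y. 4 ^ i * of_bool (near L i x y)))))"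
    by (simp add: sum_distrib_left)
  also have "\<dots> \<le> (\<Sum>y\<in>heavy_set. norm (?b y) * (C / 2 ^ heavy_level y * (2 ^ L * m * (3 * 2 ^ L * 2 ^ heavy_level y))))"
  proof (intro sum_mono mult_left_mono)
    fix y assume y: "y \<in> heavy_set"
    \<comment> \<open>The roles change: for fixed \<open>y\<close> at most 3 * 2 ^ (L - i) points
      \<open>x\<close> are near at level \<open>i\<close>, which turns \<open>4 ^ i\<close> into
      \<open>2 ^ i\<close> once more.\<close>
    have "(\<Sum>x\<in>X. \<Sum>i<heavy_level y. 4 ^ i * of_bool (near L i x y)) \<le> (\<Sum>x\<in>grid L. \<Sum>i<heavy_level y. 4 ^ i * of_bool (near L i x y) :: real)"
      by (rule sum_mono2) (use X in \<open>auto intro!: sum_nonneg\<close>)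
    also have "\<dots> = (\<Sum>i<heavy_level y. \<Sum>x\<in>grid L. 4 ^ i * of_bool (near L i x y))" by (rule sum.swap)
    also have "\<dots> = (\<Sum>i<heavy_level y. 4 ^ i * (\<Sum>x\<in>grid L. of_bool (near L i y x)))"
      by (simp only: sum_distrib_left near_sym[of L _ _ y])
    also have "\<dots> \<le> (\<Sum>i<heavy_level y. 3 * 2 ^ L * 2 ^ i)"
    proof (rule sum_mono)
      fix i assume "i \<in> {..<heavy_level y}"
      then have i: "i \<le> L" using stop_level(2)[OF y] by simp
      then have e: "(2::real) ^ L = 2 ^ i * 2 ^ (L - i)" by (simp flip: power_add)
      have e4: "(4::real) ^ i = 2 ^ i * 2 ^ i" by (simp flip: power_mult_distrib)
      have "4 ^ i * (\<Sum>x\<in>grid L. of_bool (near L i y x)) \<le> 4 ^ i * (3 * (2::real) ^ (L - i))"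
        by (intro mult_left_mono sum_of_bool_near_le i) (use stop_level(3)[OF y] in auto)
      also have "\<dots> = 3 * 2 ^ L * 2 ^ i" by (simp add: e e4)
      finally show "4 ^ i * (\<Sum>x\<in>grid L. of_bool (near L i y x)) \<le> 3 * (2::real) ^ L * 2 ^ i" .
    qed
    also have "\<dots> = 3 * 2 ^ L * (\<Sum>i<heavy_level y. 2 ^ i)" by (simp add: sum_distrib_left)
    also have "\<dots> \<le> 3 * 2 ^ L * 2 ^ heavy_level y" by (intro mult_left_mono sum_powers_of_two_le) auto
    finally show "(\<Sum>x\<in>X. \<Sum>i<heavy_level y. 4 ^ i * of_bool (near L i x y)) \<le> 3 * (2::real) ^ L * 2 ^ heavy_level y" .
  qed (use C m in auto)
  also have "\<dots> = (2 ^ L)\<^sup>2 * (3 * C * m * (\<Sum>y\<in>heavy_set. norm (?b y)))"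
    by (simp add: sum_distrib_left power2_eq_square ac_simps)
  also have "\<dots> \<le> (2 ^ L)\<^sup>2 * (3 * C * m * (2 * (\<Sum>x\<in>grid L. norm (f x))))"
    by (intro mult_left_mono sum_norm_bad_part_le) (use C m in auto)
  finally show ?thesis by (simp add: mult_le_cancel_left_pos)
qed

end

section \<open>The weak type estimate\<close>

lemma card_level_le:
  fixes F :: "'a \<Rightarrow> real"
  assumes "finite X" "(\<Sum>x\<in>X. F x) \<le> S" "\<And>x. x \<in> X \<Longrightarrow> 0 \<le> F x" "0 < l"
  shows "l * card {x \<in> X. F x > l} \<le> S"
proof -
  have "l * card {x \<in> X. F x > l} = (\<Sum>x\<in>{x \<in> X. F x > l}. l)" by simp
  also have "\<dots> \<le> (\<Sum>x\<in>{x \<in> X. F x > l}. F x)" by (rule sum_mono) auto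
  also have "\<dots> \<le> (\<Sum>x\<in>X. F x)" by (rule sum_mono2) (use assms in auto)
  finally show ?thesis using assms by simp
qed

text \<open>The height is shared as (8 C + 1) + 1 + 1 among good with good, good with bad, and bad
  with the whole of \<open>g\<close>. In the size of the exceptional set, 7 = 1 + 3 + 3 counts
  \<open>E\<close> and the two enlargements, and 54 = 18 + 36 the two terms with a bad part.\<close>

lemma cz_weak_type_normalised:
  fixes C :: real
  assumes cz: "cz_kernel C L Kr"
    and f: "(\<Sum>x\<in>grid L. norm (f x)) \<le> \<mu> * 2 ^ L" and g: "(\<Sum>x\<in>grid L. norm (g x)) \<le> \<mu> * 2 ^ L"
    and mu: "0 < \<mu>"
  shows "card {x \<in> grid L. norm (bilin L Kr f g x) > 8 * C + 3} \<le> (54 * C + 7) * \<mu> * 2 ^ L"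
\<comment> \<open>For larger \<mu> the right-hand side exceeds the number of grid points.\<close>
proof (cases "\<mu> \<le> 1")
  case False
  have C: "0 \<le> C" using cz_kernelD(1)[OF cz] .
  have "card {x \<in> grid L. norm (bilin L Kr f g x) > 8 * C + 3} \<le> card (grid L)"
    by (rule card_mono) auto
  then have "real (card {x \<in> grid L. norm (bilin L Kr f g x) > 8 * C + 3}) \<le> 1 * 2 ^ L"
    using of_nat_mono by fastforce
  also have "1 * 1 \<le> (54 * C + 7) * \<mu>" using False C by (intro mult_mono) auto
  then have "1 * 2 ^ L \<le> (54 * C + 7) * \<mu> * 2 ^ L" by (intro mult_right_mono) auto
  finally show ?thesis .
next
  case True
  note C = cz_kernelD(1)[OF cz]
  define fg where "fg = good_part L f"
  define gg where "gg = good_part L g"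
  have "\<mu> * 2 ^ L \<le> 1 * 2 ^ L" using True by (intro mult_right_mono) auto
  then have f1: "(\<Sum>x\<in>grid L. norm (f x)) \<le> 2 ^ L" and g1: "(\<Sum>x\<in>grid L. norm (g x)) \<le> 2 ^ L"
    using f g by linarith+
  have fg2: "norm (fg x) \<le> 2" and gg2: "norm (gg x) \<le> 2" if "x \<in> grid L" for x
    using norm_good_part_le[OF f1 that] norm_good_part_le[OF g1 that] by (auto simp: fg_def gg_def)
  have fgs: "(\<Sum>x\<in>grid L. norm (fg x)) \<le> \<mu> * 2 ^ L" and ggs: "(\<Sum>x\<in>grid L. norm (gg x)) \<le> \<mu> * 2 ^ L"
    using sum_norm_good_part_le[of L f] sum_norm_good_part_le[of L g] f g by (auto simp: fg_def gg_def)
  let ?Ef = "stopping.enlarged L (heavy L f 1)" and ?Eg = "stopping.enlarged L (heavy L g 1)"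
  have Ef: "real (card ?Ef) \<le> 3 * (\<mu> * 2 ^ L)" and Eg: "real (card ?Eg) \<le> 3 * (\<mu> * 2 ^ L)"
    using card_enlarged_heavy[of 1 L f] card_enlarged_heavy[of 1 L g] f g by auto
  have fin: "finite ?Ef" "finite ?Eg"
    using stopping.finite_enlarged[OF stopping_heavy] by auto
  define E where "E = {x \<in> grid L. norm (bilin L Kr fg gg x) > 8 * C + 1}"
  have cE: "card E \<le> \<mu> * 2 ^ L"
  proof -
    \<comment> \<open>Dualisation: pairing with \<open>h\<close> turns the form into the sum of its
      norms over \<open>E\<close>.\<close>
    define h where "h x = (if x \<in> E then cnj (sgn (bilin L Kr fg gg x)) else 0)" for x
    have hb: "norm (h x) = of_bool (x \<in> E)" for x
      using C by (auto simp: h_def E_def norm_sgn)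
    \<comment> \<open>The good parts are bounded by 2; halving both makes them admissible in the
      estimate for functions bounded by 1.\<close>
    have e: "bilin L Kr fg gg x = 4 * bilin L Kr (\<lambda>x. 1 / 2 * fg x) (\<lambda>x. 1 / 2 * gg x) x" for x
      by (subst bilin_scale) simp
    have hm: "bilin L Kr fg gg x * h x = of_real (of_bool (x \<in> E) * norm (bilin L Kr fg gg x))" for x
    proof (cases "x \<in> E")
      case True
      have "z * cnj (sgn z) = of_real (norm z)" for z :: complex
        by (cases "z = 0") (auto simp: sgn_eq complex_norm_square[symmetric] power2_eq_square)
      then show ?thesis using True by (simp add: h_def)
    qed (simp add: h_def)
    have "(8 * C + 1) * card E = (\<Sum>x\<in>E. 8 * C + 1)" by simp
    also have "\<dots> \<le> (\<Sum>x\<in>E. norm (bilin L Kr fg gg x))"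
      by (rule sum_mono) (auto simp: E_def)
    also have "\<dots> = (\<Sum>x\<in>grid L. of_bool (x \<in> E) * norm (bilin L Kr fg gg x))"
      by (rule sum.mono_neutral_cong_left) (auto simp: E_def)
    also have "\<dots> = norm (\<Sum>x\<in>grid L. bilin L Kr fg gg x * h x)"
      by (simp only: hm of_real_sum[symmetric] norm_of_real) (intro abs_of_nonneg[symmetric] sum_nonneg, simp)
    also have "\<dots> = 4 * norm (\<Sum>x\<in>grid L. bilin L Kr (\<lambda>x. 1 / 2 * fg x) (\<lambda>x. 1 / 2 * gg x) x * h x)"
      by (subst e) (simp add: sum_distrib_left[symmetric] mult.assoc norm_mult)
    also have "\<dots> \<le> 4 * (C * (\<Sum>x\<in>grid L. (norm (1 / 2 * fg x))\<^sup>2 + (norm (1 / 2 * gg x))\<^sup>2 + (norm (h x))\<^sup>2))"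
      by (intro mult_left_mono cz_kernelD(5)[OF cz]) (auto simp: norm_mult hb fg2 gg2)
    \<comment> \<open>For bounded functions squares are dominated by first powers, whose mean is
      controlled by \<mu>.\<close>
    also have "\<dots> \<le> 4 * (C * (\<Sum>x\<in>grid L. norm (fg x) / 2 + norm (gg x) / 2 + of_bool (x \<in> E)))"
    proof (intro mult_left_mono sum_mono add_mono)
      fix x assume x: "x \<in> grid L"
      have sq: "(norm (1 / 2 * z))\<^sup>2 \<le> norm z / 2" if "norm z \<le> 2" for z :: complex
        using that mult_mono[of "norm z" 2 "norm z" "norm z"]
        by (simp add: norm_mult power2_eq_square divide_simps)
      show "(norm (1 / 2 * fg x))\<^sup>2 \<le> norm (fg x) / 2" "(norm (1 / 2 * gg x))\<^sup>2 \<le> norm (gg x) / 2"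
        using sq fg2[OF x] gg2[OF x] by auto
      show "(norm (h x))\<^sup>2 \<le> of_bool (x \<in> E)" by (simp add: hb)
    qed (use C in auto)
    also have "(\<Sum>x\<in>grid L. of_bool (x \<in> E)) = real (card E)"
    proof -
      have "grid L \<inter> E = E" by (auto simp: E_def)
      then show ?thesis by (simp add: of_bool_def sum.If_cases Int_def[symmetric])
    qed
    then have "4 * (C * (\<Sum>x\<in>grid L. norm (fg x) / 2 + norm (gg x) / 2 + of_bool (x \<in> E)))
        = 4 * (C * ((\<Sum>x\<in>grid L. norm (fg x)) / 2 + (\<Sum>x\<in>grid L. norm (gg x)) / 2 + card E))"
      by (simp add: sum.distrib sum_divide_distrib)
    also have "\<dots> \<le> 4 * (C * (\<mu> * 2 ^ L + card E))"
      using fgs ggs C by (intro mult_left_mono) auto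
    \<comment> \<open>The term 4 C card E on the right is absorbed by 8 C card E on the left; this
      is the reason for the height in the definition of \<open>E\<close>.\<close>
    finally have "(4 * C + 1) * card E \<le> 4 * C * (\<mu> * 2 ^ L)"
      by (simp add: algebra_simps)
    also have "\<dots> \<le> (4 * C + 1) * (\<mu> * 2 ^ L)"
      using mu by (intro mult_right_mono) auto
    finally show ?thesis using C by (simp add: mult_le_cancel_left_pos)
  qed
  define X1 where "X1 = grid L - ?Ef - ?Eg"
  have Mg: "maxfun L g x \<le> 3" if "x \<in> X1" for x
    using maxfun_le_outside_enlarged[of x L g 1] that by (auto simp: X1_def)
  have Mf: "maxfun L fg x \<le> 6" if "x \<in> X1" for x
    using maxfun_le_sup[of L fg 2 x] fg2 that by (auto simp: X1_def)
  have s1: "(\<Sum>x\<in>X1. norm (bilin L Kr (bad_part L f) g x)) \<le> 18 * C * (\<mu> * 2 ^ L)"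
  proof -
    have "(\<Sum>x\<in>X1. norm (bilin L Kr (bad_part L f) g x)) \<le> 6 * C * 3 * (\<Sum>x\<in>grid L. norm (f x))"
      by (rule sum_bilin_bad_part_le[OF C cz_kernelD(2)[OF cz] _ Mg]) (auto simp: X1_def)
    also have "\<dots> \<le> 6 * C * 3 * (\<mu> * 2 ^ L)" by (intro mult_left_mono f) (use C in auto)
    finally show ?thesis by simp
  qed
  have s2: "(\<Sum>x\<in>X1. norm (bilin L Kr fg (bad_part L g) x)) \<le> 36 * C * (\<mu> * 2 ^ L)"
  proof -
    \<comment> \<open>The same estimate with the arguments exchanged: \<open>fg\<close> is now the
      fixed function, with maximal function at most 3 * 2.\<close>
    have "(\<Sum>x\<in>X1. norm (bilin L (\<lambda>x y z. Kr x z y) (bad_part L g) fg x)) \<le> 6 * C * 6 * (\<Sum>x\<in>grid L. norm (g x))"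
    proof (rule sum_bilin_bad_part_le[OF C _ _ Mf])
      fix k x y z w
      assume "k \<le> L" "x \<in> grid L" "y \<in> grid L" "z \<in> grid L" "w \<in> grid L" "cell L k y = cell L k w" "\<not> near L k x y"
      then show "norm (Kr x z y - Kr x z w) \<le> C / 2 ^ k * near_weight L k x y z"
        using cz_kernelD(3)[OF cz, of k x z y w] by (simp add: near_weight_swap[of L k x y z])
    qed (auto simp: X1_def)
    also have "\<dots> \<le> 6 * C * 6 * (\<mu> * 2 ^ L)" by (intro mult_left_mono g) (use C in auto)
    finally show ?thesis by (simp add: bilin_swap[of L Kr])
  qed
  define B1 where "B1 = {x \<in> X1. norm (bilin L Kr (bad_part L f) g x) > 1}"
  define B2 where "B2 = {x \<in> X1. norm (bilin L Kr fg (bad_part L g) x) > 1}"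
  have fX: "finite X1" by (simp add: X1_def)
  have B1: "card B1 \<le> 18 * C * (\<mu> * 2 ^ L)" and B2: "card B2 \<le> 36 * C * (\<mu> * 2 ^ L)"
    using card_level_le[OF fX s1, of 1] card_level_le[OF fX s2, of 1] by (auto simp: B1_def B2_def)
  have dec: "bilin L Kr f g x = bilin L Kr fg gg x + bilin L Kr fg (bad_part L g) x + bilin L Kr (bad_part L f) g x" for x
  proof -
    have "bilin L Kr f g x = bilin L Kr (\<lambda>x. fg x + bad_part L f x) g x"
      by (simp add: bad_part_def fg_def)
    also have "\<dots> = bilin L Kr fg g x + bilin L Kr (bad_part L f) g x" by (rule bilin_add_left)
    also have "bilin L Kr fg g x = bilin L Kr fg (\<lambda>x. gg x + bad_part L g x) x"
      by (simp add: bad_part_def gg_def)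
    also have "\<dots> = bilin L Kr fg gg x + bilin L Kr fg (bad_part L g) x" by (rule bilin_add_right)
    finally show ?thesis .
  qed
  have "{x \<in> grid L. norm (bilin L Kr f g x) > 8 * C + 3} \<subseteq> E \<union> (?Ef \<union> (?Eg \<union> (B1 \<union> B2)))"
  proof (intro subsetI, rule ccontr)
    fix x assume "x \<in> {x \<in> grid L. norm (bilin L Kr f g x) > 8 * C + 3}" "x \<notin> E \<union> (?Ef \<union> (?Eg \<union> (B1 \<union> B2)))"
    then have x: "x \<in> grid L" "norm (bilin L Kr f g x) > 8 * C + 3" "x \<notin> B2" "x \<notin> B1" "x \<notin> ?Eg" "x \<notin> ?Ef" "x \<notin> E"
      by auto
    then have "norm (bilin L Kr fg (bad_part L g) x) \<le> 1" "norm (bilin L Kr (bad_part L f) g x) \<le> 1"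
      by (auto simp: B1_def B2_def X1_def)
    moreover have "norm (bilin L Kr f g x) \<le> norm (bilin L Kr fg gg x) + norm (bilin L Kr fg (bad_part L g) x)
        + norm (bilin L Kr (bad_part L f) g x)"
      unfolding dec by (meson norm_triangle_ineq norm_triangle_mono order_refl)
    ultimately show False using x by (auto simp: E_def)
  qed
  then have "card {x \<in> grid L. norm (bilin L Kr f g x) > 8 * C + 3} \<le> card (E \<union> (?Ef \<union> (?Eg \<union> (B1 \<union> B2))))"
    by (rule card_mono[rotated]) (use fin fX in \<open>auto simp: E_def B1_def B2_def\<close>)
  also have "\<dots> \<le> card E + (card ?Ef + (card ?Eg + (card B1 + card B2)))"
    by (meson add_le_mono card_Un_le le_refl order_trans)
  finally have "real (card {x \<in> grid L. norm (bilin L Kr f g x) > 8 * C + 3}) \<le>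
      real (card E + (card ?Ef + (card ?Eg + (card B1 + card B2))))"
    by (rule of_nat_mono)
  then show ?thesis using cE Ef Eg B1 B2 by (simp add: algebra_simps)
qed

lemma cz_weak_type:
  fixes C :: real
  assumes cz: "cz_kernel C L Kr"
    and f: "(\<Sum>x\<in>grid L. norm (f x)) \<le> a * 2 ^ L" and g: "(\<Sum>x\<in>grid L. norm (g x)) \<le> b * 2 ^ L"
    and pos: "0 < a" "0 < b" "0 < l"
  shows "card {x \<in> grid L. norm (bilin L Kr f g x) > l} \<le> (54 * C + 7) * sqrt ((8 * C + 3) * a * b / l) * 2 ^ L"
proof -
  note C = cz_kernelD(1)[OF cz]
  define K where "K = 8 * C + 3"
  \<comment> \<open>Scaling \<open>f\<close> by \<mu> / a and \<open>g\<close> by \<mu> / b makes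
    both means at most \<mu> and multiplies the form by \<mu>^2 / (a b). This \<mu> moves the level
    \<open>l\<close> to \<open>K\<close>.\<close>
  define \<mu> where "\<mu> = sqrt (K * a * b / l)"
  have K: "0 < K" using C by (simp add: K_def)
  have mu: "0 < \<mu>" and mu2: "\<mu> * \<mu> = K * a * b / l" using pos K by (auto simp: \<mu>_def)
  let ?f = "\<lambda>x. of_real (\<mu> / a) * f x" and ?g = "\<lambda>x. of_real (\<mu> / b) * g x"
  have scl: "(\<Sum>x\<in>grid L. norm (of_real (\<mu> / c) * F x)) \<le> \<mu> * 2 ^ L"
    if "(\<Sum>x\<in>grid L. norm (F x)) \<le> c * 2 ^ L" "0 < c" for F :: "int \<Rightarrow> complex" and c
  proof -
    have "(\<Sum>x\<in>grid L. norm (of_real (\<mu> / c) * F x)) = \<mu> / c * (\<Sum>x\<in>grid L. norm (F x))"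
      using mu that by (simp add: norm_mult norm_divide sum_distrib_left)
    also have "\<dots> \<le> \<mu> / c * (c * 2 ^ L)" using mu that by (intro mult_left_mono) auto
    finally show ?thesis using that by simp
  qed
  have "{x \<in> grid L. norm (bilin L Kr f g x) > l} = {x \<in> grid L. norm (bilin L Kr ?f ?g x) > K}"
  proof (intro Collect_cong conj_cong refl)
    fix x
    have "norm (bilin L Kr ?f ?g x) = \<mu> * \<mu> / (a * b) * norm (bilin L Kr f g x)"
      unfolding bilin_scale using mu pos by (simp add: norm_mult norm_divide)
    also have "\<dots> = K * (norm (bilin L Kr f g x) / l)" using mu2 pos by simp
    finally have e: "norm (bilin L Kr ?f ?g x) = K * (norm (bilin L Kr f g x) / l)" .
    show "norm (bilin L Kr f g x) > l \<longleftrightarrow> norm (bilin L Kr ?f ?g x) > K"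
      unfolding e using K pos by (simp add: less_divide_eq)
  qed
  then have "card {x \<in> grid L. norm (bilin L Kr f g x) > l} \<le> (54 * C + 7) * \<mu> * 2 ^ L"
    using cz_weak_type_normalised[OF cz scl[OF f pos(1)] scl[OF g pos(2)] mu] by (simp add: K_def)
  then show ?thesis by (simp add: \<mu>_def K_def)
qed

section \<open>Mean oscillation and the good-lambda inequality\<close>

definition cell_rep :: "nat \<Rightarrow> nat \<Rightarrow> int \<Rightarrow> int" where
  "cell_rep L k x = cell L k x * 2 ^ (L - k)"

lemma cell_rep:
  assumes "x \<in> grid L" "k \<le> L"
  shows "cell_rep L k x \<in> grid L" "cell L k (cell_rep L k x) = cell L k x"
proof -
  show c: "cell L k (cell_rep L k x) = cell L k x"
    by (simp add: cell_rep_def cell_def)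
  have "cell_rep L k x \<le> x"
    using pos_mod_sign[of "2 ^ (L - k)" x] div_mult_mod_eq[of x "2 ^ (L - k)"]
      zero_less_power[of "2::int" "L - k"] unfolding cell_rep_def cell_def by linarith
  moreover have "0 \<le> cell_rep L k x"
    using cell_bounds[OF assms] by (simp add: cell_rep_def)
  ultimately show "cell_rep L k x \<in> grid L" using assms by (auto simp: grid_def)
qed

definition localise :: "nat \<Rightarrow> nat \<Rightarrow> int \<Rightarrow> (int \<Rightarrow> complex) \<Rightarrow> int \<Rightarrow> complex" where
  "localise L k x f y = (if near L k x y then f y else 0)"

text \<open>
  The value of the bilinear form at the left end of the cell of \<open>x\<close>, without the contribution in which
  both arguments live close to the cell; it is the constant approximating the form on the cell.
\<close>

definition far_value :: "nat \<Rightarrow> (int \<Rightarrow> int \<Rightarrow> int \<Rightarrow> complex) \<Rightarrow> (int \<Rightarrow> complex) \<Rightarrow> (int \<Rightarrow> complex) \<Rightarrow> nat \<Rightarrow> int \<Rightarrow> complex" where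
  "far_value L Kr f g k x = (let r = cell_rep L k x in
     bilin L Kr f g r - bilin L Kr (localise L k x f) (localise L k x g) r)"

lemma localise_cong: "cell L k x = cell L k x' \<Longrightarrow> localise L k x f = localise L k x' f"
  by (auto simp: localise_def near_def)

lemma far_value_cong: "cell L k x = cell L k x' \<Longrightarrow> far_value L Kr f g k x = far_value L Kr f g k x'"
  using localise_cong[of L k x x'] by (simp add: far_value_def cell_rep_def)

lemma far_value_0: "far_value L Kr f g 0 x = 0"
  by (simp add: far_value_def localise_def[abs_def])

text \<open>After the subtraction only pairs \<open>y\<close>, \<open>z\<close> that are not both
  near survive, and for these the kernel is regular in its centre. Any point \<xi> of the cell may
  be used for the maximal functions, since \<open>near_weight L k\<close> is constant on it.\<close>

lemma far_difference:
  assumes cz: "cz_kernel C L Kr" and k: "k \<le> L" and x: "x \<in> grid L" "w \<in> grid L" "\<xi> \<in> grid L"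
    and c: "cell L k x = cell L k \<xi>" "cell L k w = cell L k \<xi>"
  shows "norm ((bilin L Kr f g x - bilin L Kr (localise L k \<xi> f) (localise L k \<xi> g) x) -
      (bilin L Kr f g w - bilin L Kr (localise L k \<xi> f) (localise L k \<xi> g) w)) \<le> C * (maxfun L f \<xi> * maxfun L g \<xi>)"
    (is "norm ?D \<le> _")
proof -
  have C: "0 \<le> C" using cz_kernelD(1)[OF cz] .
  define far where "far y z = (of_bool (\<not> (near L k \<xi> y \<and> near L k \<xi> z)) :: complex)" for y z
  have H: "bilin L Kr f g v - bilin L Kr (localise L k \<xi> f) (localise L k \<xi> g) v =
      (\<Sum>y\<in>grid L. \<Sum>z\<in>grid L. far y z * Kr v y z * f y * g z) / (2 ^ L)\<^sup>2" for v
    unfolding bilin_def diff_divide_distrib[symmetric] sum_subtractf[symmetric]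
    by (intro arg_cong[where f = "\<lambda>t. t / _"] sum.cong refl) (simp add: far_def localise_def)
  have "?D = (\<Sum>y\<in>grid L. \<Sum>z\<in>grid L. far y z * (Kr x y z - Kr w y z) * f y * g z) / (2 ^ L)\<^sup>2"
    unfolding H diff_divide_distrib[symmetric] sum_subtractf[symmetric]
    by (intro arg_cong[where f = "\<lambda>t. t / _"] sum.cong refl) (simp add: algebra_simps)
  then have "norm ?D * (2 ^ L)\<^sup>2 = norm (\<Sum>y\<in>grid L. \<Sum>z\<in>grid L. far y z * (Kr x y z - Kr w y z) * f y * g z)"
    by (simp add: norm_divide norm_power)
  also have "\<dots> \<le> (\<Sum>y\<in>grid L. \<Sum>z\<in>grid L. norm (far y z * (Kr x y z - Kr w y z) * f y * g z))"
    by (intro order_trans[OF norm_sum] sum_mono norm_sum)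
  also have "\<dots> \<le> (\<Sum>y\<in>grid L. \<Sum>z\<in>grid L. C / 2 ^ k * (near_weight L k \<xi> y z * norm (f y) * norm (g z)))"
  proof (intro sum_mono)
    fix y z assume yz: "y \<in> grid L" "z \<in> grid L"
    have "norm (far y z * (Kr x y z - Kr w y z)) \<le> C / 2 ^ k * near_weight L k \<xi> y z"
    proof (cases "near L k \<xi> y \<and> near L k \<xi> z")
      case True
      then show ?thesis using C near_weight_nonneg[of L k \<xi> y z] by (simp add: far_def)
    next
      case False
      have n: "near L i x v \<longleftrightarrow> near L i \<xi> v" if "i \<le> k" for i v
        by (rule near_cong, rule cell_eq_mono[OF c(1)]) (use that k in auto)
      have "near_weight L k x y z = near_weight L k \<xi> y z"
        unfolding near_weight_def by (intro sum.cong refl) (simp add: n)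
      then show ?thesis
        using cz_kernelD(4)[OF cz k x(1) yz x(2)] c False n[of k] by (simp add: far_def)
    qed
    then have "norm (far y z * (Kr x y z - Kr w y z)) * (norm (f y) * norm (g z)) \<le>
        C / 2 ^ k * near_weight L k \<xi> y z * (norm (f y) * norm (g z))"
      by (rule mult_right_mono) simp
    then show "norm (far y z * (Kr x y z - Kr w y z) * f y * g z) \<le>
        C / 2 ^ k * (near_weight L k \<xi> y z * norm (f y) * norm (g z))"
      by (simp add: norm_mult mult.assoc)
  qed
  also have "\<dots> = C / 2 ^ k * (\<Sum>y\<in>grid L. \<Sum>z\<in>grid L. near_weight L k \<xi> y z * norm (f y) * norm (g z))"
    by (simp only: sum_distrib_left)
  also have "\<dots> \<le> C / 2 ^ k * (2 ^ k * (2 ^ L)\<^sup>2 * maxfun L f \<xi> * maxfun L g \<xi>)"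
    by (intro mult_left_mono sum_near_weight_le k) (use C in auto)
  also have "\<dots> = C * (maxfun L f \<xi> * maxfun L g \<xi>) * (2 ^ L)\<^sup>2" by simp
  finally show ?thesis by (simp add: mult_le_cancel_right_pos)
qed

lemma sum_localise_le:
  assumes "k \<le> L"
  shows "(\<Sum>y\<in>grid L. norm (localise L k x f y)) \<le> maxfun L f x / 2 ^ k * 2 ^ L"
proof -
  have e: "(2::real) ^ L = 2 ^ k * 2 ^ (L - k)" using assms by (simp flip: power_add)
  have "(\<Sum>y\<in>grid L. norm (localise L k x f y)) = (\<Sum>y\<in>{y \<in> grid L. near L k x y}. norm (f y))"
    by (rule sum.mono_neutral_cong_right) (auto simp: localise_def)
  then show ?thesis using sum_near_le_maxfun[OF assms, of f x] by (simp add: e mult.commute)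
qed

text \<open>The far part varies little on the cell by \<open>far_difference\<close>, which costs the
  summand \<open>C\<close>. The near part is the form of the localised functions; the second summand
  of \<open>A\<close> is the level at which the weak type estimate leaves just the share \<epsilon>
  of the cell.\<close>

lemma cz_oscillation:
  fixes C \<epsilon> :: real
  assumes cz: "cz_kernel C L Kr" and k: "k \<le> L" and \<xi>: "\<xi> \<in> grid L" and eps: "0 < \<epsilon>"
  defines "A \<equiv> C + (8 * C + 3) * ((54 * C + 7) / \<epsilon>)\<^sup>2"
  shows "card {x \<in> grid L. cell L k x = cell L k \<xi> \<and>
      norm (bilin L Kr f g x - far_value L Kr f g k \<xi>) > A * (maxfun L f \<xi> * maxfun L g \<xi>)} \<le> \<epsilon> * 2 ^ (L - k)"
    (is "real (card ?B) \<le> _")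
proof -
  have C: "0 \<le> C" using cz_kernelD(1)[OF cz] .
  let ?f = "localise L k \<xi> f" and ?g = "localise L k \<xi> g"
  define G where "G = maxfun L f \<xi> * maxfun L g \<xi>"
  define a where "a = maxfun L f \<xi> / 2 ^ k"
  define b where "b = maxfun L g \<xi> / 2 ^ k"
  define D where "D = (8 * C + 3) * ((54 * C + 7) / \<epsilon>)\<^sup>2"
  have D: "0 < D" unfolding D_def using C eps by (intro mult_pos_pos zero_less_power divide_pos_pos) auto
  have ab: "(\<Sum>y\<in>grid L. norm (?f y)) \<le> a * 2 ^ L" "(\<Sum>y\<in>grid L. norm (?g y)) \<le> b * 2 ^ L"
    using sum_localise_le[OF k, of \<xi>] by (auto simp: a_def b_def)
  have sub: "?B \<subseteq> {x \<in> grid L. norm (bilin L Kr ?f ?g x) > D * G}"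
  proof clarify
    fix x assume x: "x \<in> grid L" "cell L k x = cell L k \<xi>"
      "norm (bilin L Kr f g x - far_value L Kr f g k \<xi>) > A * (maxfun L f \<xi> * maxfun L g \<xi>)"
    let ?r = "cell_rep L k \<xi>"
    have "norm (bilin L Kr f g x - far_value L Kr f g k \<xi>) \<le> norm (bilin L Kr ?f ?g x) +
        norm ((bilin L Kr f g x - bilin L Kr ?f ?g x) - (bilin L Kr f g ?r - bilin L Kr ?f ?g ?r))"
      unfolding far_value_def Let_def by (rule order_trans[OF _ norm_triangle_ineq]) (simp add: algebra_simps)
    also have "\<dots> \<le> norm (bilin L Kr ?f ?g x) + C * G"
      unfolding G_def by (intro add_left_mono far_difference[OF cz k x(1) cell_rep(1)[OF \<xi> k] \<xi> x(2) cell_rep(2)[OF \<xi> k]])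
    finally show "norm (bilin L Kr ?f ?g x) > D * G"
      using x(3) by (simp add: A_def D_def G_def algebra_simps)
  qed
  show ?thesis
  \<comment> \<open>The weak type estimate asks for positive means. If \<open>G\<close> vanishes,
    one of the localised functions is 0 on the grid, and so is the near part.\<close>
  proof (cases "G = 0")
    case True
    then have "a = 0 \<or> b = 0" by (auto simp: G_def a_def b_def)
    moreover have "\<forall>y\<in>grid L. h y = 0" if "(\<Sum>y\<in>grid L. norm (h y)) \<le> 0 * 2 ^ L" for h :: "int \<Rightarrow> complex"
    proof -
      have "(\<Sum>y\<in>grid L. norm (h y)) = 0" using that by (intro antisym sum_nonneg) auto
      then show ?thesis by (subst (asm) sum_nonneg_eq_0_iff) auto
    qed
    ultimately have "(\<forall>y\<in>grid L. ?f y = 0) \<or> (\<forall>y\<in>grid L. ?g y = 0)"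
      using ab by metis
    then have "bilin L Kr ?f ?g x = 0" for x by (auto simp: bilin_def)
    then have B: "?B = {}" using sub True by auto
    show ?thesis unfolding B using eps by simp
  next
    case False
    have "0 < maxfun L f \<xi>" "0 < maxfun L g \<xi>"
      using False maxfun_nonneg[of L f \<xi>] maxfun_nonneg[of L g \<xi>] by (auto simp: G_def less_le)
    then have pos: "0 < a" "0 < b" "0 < D * G" and G: "0 < G" using D by (auto simp: a_def b_def G_def)
    have "card ?B \<le> card {x \<in> grid L. norm (bilin L Kr ?f ?g x) > D * G}"
      by (rule card_mono[OF _ sub]) auto
    also have "real \<dots> \<le> (54 * C + 7) * sqrt ((8 * C + 3) * a * b / (D * G)) * 2 ^ L"
      by (rule cz_weak_type[OF cz ab pos])
    also have "(8 * C + 3) * a * b / (D * G) = (\<epsilon> / (54 * C + 7) / 2 ^ k)\<^sup>2"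
    proof -
      have nz: "8 * C + 3 \<noteq> 0" "54 * C + 7 \<noteq> 0" "maxfun L f \<xi> \<noteq> 0" "maxfun L g \<xi> \<noteq> 0" "\<epsilon> \<noteq> 0"
        using C eps \<open>0 < maxfun L f \<xi>\<close> \<open>0 < maxfun L g \<xi>\<close> by auto
      have "a * b / G = (1 / 2 ^ k)\<^sup>2" using nz by (simp add: a_def b_def G_def power2_eq_square)
      moreover have "(8 * C + 3) / D = (\<epsilon> / (54 * C + 7))\<^sup>2"
        using nz by (simp add: D_def power_divide)
      moreover have "(8 * C + 3) * a * b / (D * G) = (8 * C + 3) / D * (a * b / G)" by simp
      ultimately show ?thesis by (simp only: power_mult_distrib[symmetric]) simp
    qed
    also have "sqrt ((\<epsilon> / (54 * C + 7) / 2 ^ k)\<^sup>2) = \<epsilon> / (54 * C + 7) / 2 ^ k"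
      using eps C by simp
    also have "(54 * C + 7) * (\<epsilon> / (54 * C + 7) / 2 ^ k) * 2 ^ L = \<epsilon> * 2 ^ (L - k)"
    proof -
      have e: "(2::real) ^ L = 2 ^ k * 2 ^ (L - k)" using k by (simp flip: power_add)
      have "54 * C + 7 \<noteq> 0" using C by simp
      then show ?thesis by (simp add: e)
    qed
    finally show ?thesis by simp
  qed
qed

text \<open>
  Modelled on \<open>F = bilin L Kr f g\<close>, \<open>c = far_value L Kr f g\<close>, and \<open>G\<close> the product of the maximal functions.
\<close>

locale oscillation =
  fixes L :: nat and F :: "int \<Rightarrow> complex" and c :: "nat \<Rightarrow> int \<Rightarrow> complex" and G :: "int \<Rightarrow> real" and A \<epsilon> :: real
  assumes c_cong: "k \<le> L \<Longrightarrow> cell L k x = cell L k y \<Longrightarrow> c k x = c k y"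
    and c_0: "c 0 x = 0"
    and A_pos: "0 < A" and eps: "0 < \<epsilon>" "\<epsilon> < 1 / 3"
    and G_nonneg: "0 \<le> G x"
    and osc: "k \<le> L \<Longrightarrow> \<xi> \<in> grid L \<Longrightarrow>
      card {x \<in> grid L. cell L k x = cell L k \<xi> \<and> norm (F x - c k \<xi>) > A * G \<xi>} \<le> \<epsilon> * 2 ^ (L - k)"
begin

text \<open>A cell of level \<open>L\<close> is a single point, and an exceptional set with fewer
  than one element is empty.\<close>

lemma top_level:
  assumes "x \<in> grid L"
  shows "norm (F x) \<le> norm (c L x) + A * G x"
proof -
  let ?B = "{y \<in> grid L. cell L L y = cell L L x \<and> norm (F y - c L x) > A * G x}"
  have B: "real (card ?B) < 1"
    by (rule order_le_less_trans[OF osc[OF order_refl assms]]) (use eps in simp)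
  have "x \<notin> ?B"
  proof
    assume "x \<in> ?B"
    then have "card {x} \<le> card ?B" by (intro card_mono) auto
    moreover have "card {x} = 1" by simp
    ultimately show False using B by linarith
  qed
  then have "norm (F x - c L x) \<le> A * G x" using assms by auto
  then show ?thesis using norm_triangle_sub[of "F x" "c L x"] by simp
qed

text \<open>Measured in the child cell, the exceptional sets of child and parent have shares at most
  \<epsilon> and 2 \<epsilon>. As \<epsilon> < 1 / 3, some point of the child is exceptional for
  neither, and both constants are close to \<open>F\<close> there.\<close>

lemma parent_level:
  assumes "x \<in> grid L" "Suc k \<le> L"
  shows "norm (c (Suc k) x) \<le> norm (c k x) + 2 * A * G x"
proof -
  let ?I = "{y \<in> grid L. cell L (Suc k) y = cell L (Suc k) x}"
  let ?B1 = "{y \<in> grid L. cell L (Suc k) y = cell L (Suc k) x \<and> norm (F y - c (Suc k) x) > A * G x}"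
  let ?B2 = "{y \<in> grid L. cell L k y = cell L k x \<and> norm (F y - c k x) > A * G x}"
  have e: "(2::real) ^ (L - k) = 2 * 2 ^ (L - Suc k)"
    using assms by (simp flip: power_Suc add: Suc_diff_Suc)
  have "\<not> ?I \<subseteq> ?B1 \<union> ?B2"
  proof
    assume "?I \<subseteq> ?B1 \<union> ?B2"
    then have "card ?I \<le> card (?B1 \<union> ?B2)" by (intro card_mono) auto
    also have "\<dots> \<le> card ?B1 + card ?B2" by (rule card_Un_le)
    finally have "real (card ?I) \<le> real (card ?B1) + real (card ?B2)" by linarith
    also have "\<dots> \<le> \<epsilon> * 2 ^ (L - Suc k) + \<epsilon> * 2 ^ (L - k)"
      using osc[of "Suc k" x] osc[of k x] assms by (intro add_mono) auto
    also have "\<dots> = (3 * \<epsilon>) * 2 ^ (L - Suc k)" by (simp add: e)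
    also have "\<dots> < 1 * 2 ^ (L - Suc k)" using eps by (intro mult_strict_right_mono) auto
    finally show False using card_own_cell[OF assms(1,2)] by simp
  qed
  then obtain y where y: "y \<in> grid L" "cell L (Suc k) y = cell L (Suc k) x" "y \<notin> ?B1" "y \<notin> ?B2" by auto
  have "cell L k y = cell L k x" by (rule cell_eq_mono[OF y(2)]) (use assms in auto)
  then have "norm (F y - c (Suc k) x) \<le> A * G x" "norm (F y - c k x) \<le> A * G x" using y by auto
  moreover have "c k x + ((F y - c k x) - (F y - c (Suc k) x)) = c (Suc k) x" by simp
  then have "norm (c (Suc k) x) \<le> norm (c k x) + (norm (F y - c k x) + norm (F y - c (Suc k) x))"
    using norm_triangle_ineq[of "c k x" "(F y - c k x) - (F y - c (Suc k) x)"]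
      norm_triangle_ineq4[of "F y - c k x" "F y - c (Suc k) x"] by (simp only:)
  ultimately show ?thesis by linarith
qed

definition large :: "real \<Rightarrow> nat \<Rightarrow> int \<Rightarrow> bool" where
  "large l k x \<longleftrightarrow> norm (c k x) > l"

lemma stopping_large: "stopping L (large l)"
  by unfold_locales (metis large_def c_cong)

abbreviation D :: "real \<Rightarrow> int set" where
  "D l \<equiv> stop_set L (large l)"

lemma finite_D [simp]: "finite (D l)"
  by (simp add: stop_set_def)

lemma D_subset_grid: "D l \<subseteq> grid L"
  by (auto simp: stop_set_def)

text \<open>\<open>V\<close> is the union of the stopping cells of \<open>D (2 * l)\<close> that
  contain a point with A G at most l / 5. There the constant exceeds 2 l, so most points lie in
  \<open>H\<close>. On the enclosing stopping cell of \<open>D l\<close> the constant is at most l +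
  2 l / 5, because its parent was not stopped, so few points lie in \<open>H\<close>. Comparing the
  two counts bounds \<open>V\<close>.\<close>

lemma good_lambda:
  assumes l: "0 < l"
  shows "card (D (2 * l)) \<le> 2 * \<epsilon> * card (D l) + card {x \<in> grid L. G x > l / (5 * A)}"
proof -
  interpret S2: stopping L "large (2 * l)" by (rule stopping_large)
  interpret S1: stopping L "large l" by (rule stopping_large)
  let ?J2 = "stop_cell L (large (2 * l))" and ?J1 = "stop_cell L (large l)"
  let ?k2 = "stop_level (large (2 * l))" and ?k1 = "stop_level (large l)"
  define \<Gamma> where "\<Gamma> = {x \<in> grid L. G x \<le> l / (5 * A)}"
  have \<Gamma>: "A * G x \<le> l / 5" if "x \<in> \<Gamma>" for x
    using that A_pos by (auto simp: \<Gamma>_def field_simps)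
  define V where "V = {x \<in> D (2 * l). ?J2 x \<inter> \<Gamma> \<noteq> {}}"
  \<comment> \<open>9 / 5 = 2 - 1 / 5 is what remains on a cell of \<open>D (2 * l)\<close>, while 7
    / 5 + 1 / 5 on a cell of \<open>D l\<close> stays below it.\<close>
  define H where "H = {x \<in> grid L. norm (F x) > 9 / 5 * l}"
  have VD: "V \<subseteq> D (2 * l)" by (auto simp: V_def)
  have finV: "finite V" using finite_subset[OF VD] by simp
  have D2: "D (2 * l) \<subseteq> D l" using l by (auto simp: stop_set_def large_def intro: order_less_trans[of l "2 * l"])
  have levs: "?k1 x \<le> ?k2 x" if "x \<in> D (2 * l)" for x
  proof (rule S1.stop_level_le)
    show "large l (?k2 x) x" using S2.stop_level(1)[OF that] l by (auto simp: large_def)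
  qed
  have step1: "(1 - \<epsilon>) * card V \<le> card (V \<inter> H)"
  proof -
    have "(\<Sum>x\<in>D (2 * l). (1 - \<epsilon>) * of_bool (x \<in> V)) \<le> (\<Sum>x\<in>D (2 * l). of_bool (x \<in> V \<inter> H) :: real)"
    proof (rule S2.sum_stop_mono)
      fix x assume x: "x \<in> D (2 * l)"
      have same: "?J2 y = ?J2 x" "y \<in> D (2 * l)" if "y \<in> ?J2 x" for y
        using S2.stop_cell_same[OF x that] that by (auto simp: stop_cell_def)
      then have inV: "y \<in> V \<longleftrightarrow> ?J2 x \<inter> \<Gamma> \<noteq> {}" if "y \<in> ?J2 x" for y
        using that by (auto simp: V_def)
      show "(\<Sum>y\<in>?J2 x. (1 - \<epsilon>) * of_bool (y \<in> V)) \<le> (\<Sum>y\<in>?J2 x. of_bool (y \<in> V \<inter> H))"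
      proof (cases "?J2 x \<inter> \<Gamma> = {}")
        case True
        then have "(\<Sum>y\<in>?J2 x. (1 - \<epsilon>) * of_bool (y \<in> V)) = (\<Sum>y\<in>?J2 x. 0)"
          by (intro sum.cong refl) (simp add: inV)
        also have "\<dots> \<le> (\<Sum>y\<in>?J2 x. of_bool (y \<in> V \<inter> H))" by (rule sum_mono) simp
        finally show ?thesis .
      next
        case False
        then obtain \<xi> where xi: "\<xi> \<in> ?J2 x" "\<xi> \<in> \<Gamma>" by auto
        define k where "k = ?k2 x"
        have k: "k \<le> L" using S2.stop_level(2)[OF x] by (simp add: k_def)
        have xi': "\<xi> \<in> grid L" "cell L k \<xi> = cell L k x" using xi by (auto simp: stop_cell_def k_def)
        have "c k \<xi> = c k x" by (rule c_cong[OF k xi'(2)])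
        then have big: "norm (c k \<xi>) > 2 * l" using S2.stop_level(1)[OF x] by (simp add: large_def k_def)
        let ?B = "{y \<in> grid L. cell L k y = cell L k \<xi> \<and> norm (F y - c k \<xi>) > A * G \<xi>}"
        have J2: "?J2 x = {y \<in> grid L. cell L k y = cell L k \<xi>}" using xi' by (auto simp: stop_cell_def k_def)
        have "?J2 x - H \<subseteq> ?B"
        proof
          fix y assume y: "y \<in> ?J2 x - H"
          then have "norm (F y) \<le> 9 / 5 * l" "y \<in> grid L" "cell L k y = cell L k \<xi>" by (auto simp: H_def J2)
          moreover have "norm (c k \<xi>) \<le> norm (F y) + norm (F y - c k \<xi>)"
            by (metis norm_minus_commute norm_triangle_sub)
          ultimately show "y \<in> ?B" using big \<Gamma>[OF xi(2)] by auto
        qed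
        then have "card (?J2 x - H) \<le> card ?B" by (intro card_mono) auto
        then have b: "card (?J2 x - H) \<le> \<epsilon> * 2 ^ (L - k)"
          using osc[OF k xi'(1)] by (meson of_nat_mono order_trans)
        have "(\<Sum>y\<in>?J2 x. (1 - \<epsilon>) * of_bool (y \<in> V)) = (\<Sum>y\<in>?J2 x. 1 - \<epsilon>)"
          by (intro sum.cong refl) (simp add: inV False)
        also have "\<dots> = 2 ^ (L - k) - \<epsilon> * 2 ^ (L - k)"
          using S2.card_stop_cell[OF x] by (simp add: k_def algebra_simps)
        also have "\<dots> \<le> real (card (?J2 x)) - card (?J2 x - H)"
          using b S2.card_stop_cell[OF x] by (simp add: k_def)
        also have "\<dots> = card (?J2 x \<inter> H)"
          using card_Diff_subset_Int[of "?J2 x" H] card_mono[of "?J2 x" "?J2 x \<inter> H"] by (simp add: H_def)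
        also have "\<dots> = (\<Sum>y\<in>?J2 x. of_bool (y \<in> H))"
          by (simp add: of_bool_def sum.If_cases Int_def)
        also have "\<dots> = (\<Sum>y\<in>?J2 x. of_bool (y \<in> V \<inter> H))"
          by (intro sum.cong refl) (simp add: inV False)
        finally show ?thesis .
      qed
    qed
    moreover have "(\<Sum>x\<in>D (2 * l). (1 - \<epsilon>) * of_bool (x \<in> V)) = (1 - \<epsilon>) * card V"
      using VD by (simp add: of_bool_def sum.If_cases sum_distrib_left[symmetric] Int_absorb1 Int_def[symmetric])
    moreover have "(\<Sum>x\<in>D (2 * l). of_bool (x \<in> V \<inter> H) :: real) = card (V \<inter> H)"
    proof -
      have "D (2 * l) \<inter> (V \<inter> H) = V \<inter> H" using VD by auto
      then show ?thesis by (simp add: of_bool_def sum.If_cases Int_def)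
    qed
    ultimately show ?thesis by simp
  qed
  have step2: "card (V \<inter> H) \<le> \<epsilon> * card (D l)"
  proof -
    have "(\<Sum>x\<in>D l. of_bool (x \<in> V \<inter> H)) \<le> (\<Sum>x\<in>D l. \<epsilon>)"
    proof (rule S1.sum_stop_mono)
      fix x assume x: "x \<in> D l"
      define k where "k = ?k1 x"
      have k: "k \<le> L" using S1.stop_level(2)[OF x] by (simp add: k_def)
      show "(\<Sum>y\<in>?J1 x. of_bool (y \<in> V \<inter> H)) \<le> (\<Sum>y\<in>?J1 x. \<epsilon>)"
      proof (cases "?J1 x \<inter> V = {}")
        case True
        then have "(\<Sum>y\<in>?J1 x. of_bool (y \<in> V \<inter> H)) = (\<Sum>y\<in>?J1 x. 0::real)"
          by (intro sum.cong refl) auto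
        also have "\<dots> \<le> (\<Sum>y\<in>?J1 x. \<epsilon>)" by (rule sum_mono) (use eps in simp)
        finally show ?thesis .
      next
        case False
        then obtain w where w: "w \<in> ?J1 x" "w \<in> V" by auto
        then obtain \<xi> where xi: "\<xi> \<in> ?J2 w" "\<xi> \<in> \<Gamma>" by (auto simp: V_def)
        have wD: "w \<in> D (2 * l)" using w VD by auto
        have kw: "?k1 w = k" using S1.stop_cell_same[OF x w(1)] by (simp add: k_def)
        have xg: "\<xi> \<in> grid L" and "cell L (?k2 w) \<xi> = cell L (?k2 w) w" using xi by (auto simp: stop_cell_def)
        then have "cell L k \<xi> = cell L k w"
          using levs[OF wD] kw S2.stop_level(2)[OF wD] by (metis cell_eq_mono)
        then have cx: "cell L k \<xi> = cell L k x" using w by (simp add: stop_cell_def k_def)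
        then have "\<xi> \<in> ?J1 x" using xg by (simp add: stop_cell_def k_def)
        then have kxi: "?k1 \<xi> = k" and xiD: "\<xi> \<in> D l" using S1.stop_cell_same[OF x] by (auto simp: k_def)
        have "large l k \<xi>" using S1.stop_level(1)[OF xiD] kxi by simp
        \<comment> \<open>The constant at level 0 is 0, so a stopping cell always has a
          parent.\<close>
        then have "k \<noteq> 0" using l by (cases "k = 0") (auto simp: large_def c_0)
        then obtain k' where k': "k = Suc k'" using not0_implies_Suc by blast
        have "\<not> large l k' \<xi>" by (rule S1.not_before_stop) (simp add: kxi k')
        then have "norm (c k' \<xi>) \<le> l" by (simp add: large_def)
        then have small: "norm (c k \<xi>) \<le> 7 / 5 * l"
          using parent_level[OF xg, of k'] k k' \<Gamma>[OF xi(2)] by simp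
        let ?B = "{y \<in> grid L. cell L k y = cell L k \<xi> \<and> norm (F y - c k \<xi>) > A * G \<xi>}"
        have "?J1 x \<inter> (V \<inter> H) \<subseteq> ?B"
        proof
          fix y assume y: "y \<in> ?J1 x \<inter> (V \<inter> H)"
          then have "norm (F y) > 9 / 5 * l" "y \<in> grid L" "cell L k y = cell L k \<xi>"
            using cx by (auto simp: H_def stop_cell_def k_def)
          moreover have "norm (F y) \<le> norm (c k \<xi>) + norm (F y - c k \<xi>)" by (rule norm_triangle_sub)
          ultimately show "y \<in> ?B" using small \<Gamma>[OF xi(2)] l by auto
        qed
        then have "card (?J1 x \<inter> (V \<inter> H)) \<le> card ?B" by (intro card_mono) auto
        then have "card (?J1 x \<inter> (V \<inter> H)) \<le> \<epsilon> * 2 ^ (L - k)"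
          using osc[OF k xg] by (meson of_nat_mono order_trans)
        moreover have "(\<Sum>y\<in>?J1 x. of_bool (y \<in> V \<inter> H)) = real (card (?J1 x \<inter> (V \<inter> H)))"
          by (simp add: of_bool_def sum.If_cases Int_def)
        ultimately show ?thesis using S1.card_stop_cell[OF x] by (simp add: k_def mult.commute)
      qed
    qed
    moreover have "(\<Sum>x\<in>D l. of_bool (x \<in> V \<inter> H) :: real) = card (V \<inter> H)"
    proof -
      have "D l \<inter> (V \<inter> H) = V \<inter> H" using VD D2 by auto
      then show ?thesis by (simp add: of_bool_def sum.If_cases Int_def)
    qed
    ultimately show ?thesis by (simp add: mult.commute)
  qed
  have "2 / 3 * card V \<le> (1 - \<epsilon>) * card V" using eps by (intro mult_right_mono) auto
  then have V: "card V \<le> 3 / 2 * (\<epsilon> * card (D l))" using step1 step2 by simp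
  have "D (2 * l) \<subseteq> V \<union> {x \<in> grid L. G x > l / (5 * A)}"
  proof
    fix x assume x: "x \<in> D (2 * l)"
    then show "x \<in> V \<union> {x \<in> grid L. G x > l / (5 * A)}"
      using S2.stop_level(3,4)[OF x] by (auto simp: V_def \<Gamma>_def not_less)
  qed
  then have "card (D (2 * l)) \<le> card (V \<union> {x \<in> grid L. G x > l / (5 * A)})"
    by (intro card_mono) (use finV in auto)
  also have "\<dots> \<le> card V + card {x \<in> grid L. G x > l / (5 * A)}" by (rule card_Un_le)
  finally have "real (card (D (2 * l))) \<le> card V + card {x \<in> grid L. G x > l / (5 * A)}" by linarith
  moreover have "0 \<le> \<epsilon> * card (D l)" using eps by simp
  ultimately show ?thesis using V by linarith
qed

end

section \<open>Bounds on the grid\<close>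

lemma two_power_powr: "(2 ^ n :: real) powr q = (2 powr q) ^ n"
  by (induction n) (simp_all add: powr_mult)

text \<open>A layer-cake bound with finitely many levels: what lies below \<tau> is charged to
  \<tau> powr p, and \<open>le_of_le_add_powr\<close> later sends \<tau> to 0.\<close>

lemma powr_le_layers:
  fixes x \<tau> p :: real
  assumes "0 \<le> x" "0 < \<tau>" "0 < p" "x \<le> \<tau> * 2 ^ M"
  shows "x powr p \<le> \<tau> powr p + 2 powr p * (\<Sum>n<M. (\<tau> * 2 ^ n) powr p * of_bool (\<tau> * 2 ^ n < x))"
proof (cases "\<tau> < x")
  case False
  then have "x powr p \<le> \<tau> powr p" using assms by (intro powr_mono2) auto
  moreover have "0 \<le> (\<Sum>n<M. (\<tau> * 2 ^ n) powr p * of_bool (\<tau> * 2 ^ n < x))"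
    by (intro sum_nonneg) simp
  ultimately show ?thesis by (simp add: add_increasing2)
next
  case True
  obtain n where n: "n < M" "\<tau> * 2 ^ n < x" "\<not> \<tau> * 2 ^ Suc n < x"
    using obtain_last_level[of "\<lambda>n. \<tau> * 2 ^ n < x" M] True assms by auto
  have "x powr p \<le> (2 * (\<tau> * 2 ^ n)) powr p" using n assms by (intro powr_mono2) auto
  also have "\<dots> = 2 powr p * ((\<tau> * 2 ^ n) powr p * of_bool (\<tau> * 2 ^ n < x))"
    using n assms by (simp add: powr_mult)
  also have "\<dots> \<le> 2 powr p * (\<Sum>n<M. (\<tau> * 2 ^ n) powr p * of_bool (\<tau> * 2 ^ n < x))"
    using n by (intro mult_left_mono member_le_sum[of n "{..<M}" "\<lambda>n. (\<tau> * 2 ^ n) powr p * of_bool (\<tau> * 2 ^ n < x)"]) auto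
  finally show ?thesis by (simp add: add_increasing)
qed

text \<open>The converse direction: the levels below \<open>X\<close> form a geometric progression,
  which is dominated by its largest term.\<close>

lemma layers_le_powr:
  fixes X \<tau> q :: real
  assumes "0 \<le> X" "0 < \<tau>" "0 < q"
  shows "(\<Sum>n<M. (\<tau> * 2 ^ n) powr q * of_bool (\<tau> * 2 ^ n < X)) \<le> 2 powr q / (2 powr q - 1) * X powr q"
proof -
  define r where "r = (2::real) powr q"
  have r: "1 < r" using assms by (simp add: r_def)
  have t: "(\<tau> * 2 ^ n) powr q = \<tau> powr q * r ^ n" for n
    using assms by (simp add: powr_mult two_power_powr r_def)
  show ?thesis
  proof (induction M)
    case 0
    then show ?case using r by (simp add: r_def[symmetric])
  next
    case (Suc M)
    show ?case
    proof (cases "\<tau> * 2 ^ M < X")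
      case False
      then show ?thesis using Suc by simp
    next
      case True
      have "(\<Sum>n<Suc M. (\<tau> * 2 ^ n) powr q * of_bool (\<tau> * 2 ^ n < X)) \<le> (\<Sum>n<Suc M. \<tau> powr q * r ^ n)"
        by (rule sum_mono) (use r in \<open>auto simp: t\<close>)
      also have "\<dots> = \<tau> powr q * ((r ^ Suc M - 1) / (r - 1))"
        using r by (simp only: sum_distrib_left[symmetric] geometric_sum)
      also have "\<dots> \<le> \<tau> powr q * (r ^ Suc M / (r - 1))"
        using r by (intro mult_left_mono divide_right_mono) auto
      also have "\<dots> = r / (r - 1) * (\<tau> * 2 ^ M) powr q" by (simp add: t)
      also have "\<dots> \<le> r / (r - 1) * X powr q"
        using True r assms by (intro mult_left_mono powr_mono2) auto
      finally show ?thesis by (simp add: r_def)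
    qed
  qed
qed

lemma finite_dominated_by_power:
  fixes f :: "'a \<Rightarrow> real"
  assumes "finite X" "0 < \<tau>"
  obtains M where "\<And>x. x \<in> X \<Longrightarrow> f x \<le> \<tau> * 2 ^ M"
proof -
  obtain b where b: "\<And>x. x \<in> X \<Longrightarrow> f x \<le> b"
    using bdd_above_finite[OF finite_imageI[OF assms(1), of f]] by (auto simp: bdd_above_def)
  obtain M where "b / \<tau> < 2 ^ M" using real_arch_pow[of 2 "b / \<tau>"] by auto
  then have "b \<le> \<tau> * 2 ^ M" using assms by (simp add: divide_simps mult.commute)
  then show thesis using that[of M] b order_trans by blast
qed

lemma powr_le_sum_powr:
  fixes a b p :: real
  assumes "0 \<le> a" "0 \<le> b" "0 < p"
  shows "(a + b) powr p \<le> 2 powr p * (a powr p + b powr p)"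
proof -
  have "(a + b) powr p \<le> (2 * max a b) powr p" using assms by (intro powr_mono2) auto
  also have "\<dots> = 2 powr p * (max a b) powr p" using assms by (simp add: powr_mult)
  also have "\<dots> \<le> 2 powr p * (a powr p + b powr p)"
    using assms by (intro mult_left_mono) (auto simp: max_def)
  finally show ?thesis .
qed

lemma le_of_le_add_powr:
  fixes a b d p :: real
  assumes "\<And>\<tau>. 0 < \<tau> \<Longrightarrow> a \<le> b + d * \<tau> powr p" "0 < p" "0 \<le> d"
  shows "a \<le> b"
proof (rule field_le_epsilon)
  fix e :: real assume e: "0 < e"
  have "a \<le> b + d * ((e / (d + 1)) powr (1 / p)) powr p"
    by (intro assms(1)) (use e assms(3) in auto)
  also have "((e / (d + 1)) powr (1 / p)) powr p = e / (d + 1)"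
    using e assms(2,3) by (simp only: powr_powr) simp
  also have "d * (e / (d + 1)) \<le> e" using e assms by (simp add: divide_simps)
  finally show "a \<le> b + e" by simp
qed

lemma card_as_sum: "finite X \<Longrightarrow> real (card {x \<in> X. P x}) = (\<Sum>x\<in>X. of_bool (P x))"
  by (simp add: of_bool_def sum.If_cases Int_def)

context oscillation
begin

text \<open>For l powr p times the size of \<open>D l\<close>, the good-lambda inequality says that
  doubling \<open>l\<close> at most halves the quantity up to the error \<open>V\<close>. It is
  iterated towards small \<open>l\<close>; the remainder tends to 0 because \<open>D\<close> is
  never larger than the grid.\<close>

lemma weak_bound:
  assumes p: "0 < p" and eps2: "4 * \<epsilon> * 2 powr p \<le> 1"
    and W: "\<And>l. 0 < l \<Longrightarrow> l powr p * card {x \<in> grid L. G x > l} \<le> W" and l: "0 < l"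
  shows "l powr p * card {x \<in> grid L. norm (F x) > l} \<le> 3 * (20 * A) powr p * W"
proof -
  define a where "a l = l powr p * card (D l)" for l
  define V where "V = (10 * A) powr p * W"
  have W0: "0 \<le> W" using W[of 1] by (auto intro: order_trans[rotated])
  have V0: "0 \<le> V" using W0 by (simp add: V_def)
  have scaled: "l powr p * card {x \<in> grid L. G x > l / s} \<le> s powr p * W" if "0 < l" "0 < s" for l s
  proof -
    have "l powr p = s powr p * (l / s) powr p" using that by (simp add: powr_divide)
    then have "l powr p * card {x \<in> grid L. G x > l / s} = s powr p * ((l / s) powr p * card {x \<in> grid L. G x > l / s})"
      by simp
    also have "\<dots> \<le> s powr p * W" by (intro mult_left_mono W) (use that in auto)
    finally show ?thesis .
  qed
  have step: "a (2 * l) \<le> a l / 2 + V" if l: "0 < l" for l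
  proof -
    have "a (2 * l) = 2 powr p * l powr p * card (D (2 * l))" using l by (simp add: a_def powr_mult)
    also have "\<dots> \<le> 2 powr p * l powr p * (2 * \<epsilon> * card (D l) + card {x \<in> grid L. G x > l / (5 * A)})"
      by (intro mult_left_mono good_lambda l) auto
    also have "\<dots> = 4 * \<epsilon> * 2 powr p * (a l / 2) + 2 powr p * (l powr p * card {x \<in> grid L. G x > l / (5 * A)})"
      by (simp add: a_def algebra_simps)
    also have "\<dots> \<le> 1 * (a l / 2) + 2 powr p * ((5 * A) powr p * W)"
      by (intro add_mono mult_mono eps2 mult_left_mono scaled) (use l A_pos in \<open>auto simp: a_def\<close>)
    also have "2 powr p * ((5 * A) powr p * W) = V"
      using A_pos by (simp add: V_def powr_mult[symmetric] flip: mult.assoc)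
    finally show ?thesis by simp
  qed
  have iter: "a l \<le> 2 * V * (1 - 1 / 2 ^ n) + a (l / 2 ^ n) / 2 ^ n" if l: "0 < l" for l n
  proof (induction n)
    case (Suc n)
    have "a (2 * (l / 2 ^ Suc n)) \<le> a (l / 2 ^ Suc n) / 2 + V" by (rule step) (use l in simp)
    then have "a (l / 2 ^ n) \<le> a (l / 2 ^ Suc n) / 2 + V" by simp
    then have "a (l / 2 ^ n) / 2 ^ n \<le> (a (l / 2 ^ Suc n) / 2 + V) / 2 ^ n"
      by (rule divide_right_mono) simp
    then show ?case using Suc by (simp add: algebra_simps add_divide_distrib)
  qed simp
  have aV: "a l \<le> 2 * V" if l: "0 < l" for l
  proof (rule LIMSEQ_le_const)
    have "(\<lambda>n. l powr p * 2 ^ L * (1 / 2) ^ n + 2 * V) \<longlonglongrightarrow> l powr p * 2 ^ L * 0 + 2 * V"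
      by (intro tendsto_intros LIMSEQ_realpow_zero) auto
    then show "(\<lambda>n. l powr p * 2 ^ L * (1 / 2) ^ n + 2 * V) \<longlonglongrightarrow> 2 * V" by simp
    have "a l \<le> l powr p * 2 ^ L * (1 / 2) ^ n + 2 * V" for n
    proof -
      have "card (D (l / 2 ^ n)) \<le> card (grid L)" by (rule card_mono[OF finite_grid D_subset_grid])
      then have "real (card (D (l / 2 ^ n))) \<le> 2 ^ L" using of_nat_mono by fastforce
      moreover have "(l / 2 ^ n) powr p \<le> l powr p" using l p by (intro powr_mono2) (auto simp: divide_simps)
      ultimately have "a (l / 2 ^ n) \<le> l powr p * 2 ^ L" unfolding a_def by (intro mult_mono) auto
      then have "a (l / 2 ^ n) / 2 ^ n \<le> l powr p * 2 ^ L / 2 ^ n" by (rule divide_right_mono) simp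
      moreover have "2 * V * (1 - 1 / 2 ^ n) \<le> 2 * V * 1" using V0 by (intro mult_left_mono) auto
      moreover have "l powr p * 2 ^ L / 2 ^ n = l powr p * 2 ^ L * (1 / 2) ^ n" by (simp add: power_one_over)
      ultimately show ?thesis using iter[OF l, of n] by linarith
    qed
    then show "\<exists>N. \<forall>n\<ge>N. a l \<le> l powr p * 2 ^ L * (1 / 2) ^ n + 2 * V" by blast
  qed
  \<comment> \<open>At level \<open>L\<close> the constant is within A G of \<open>F\<close>, so the
    constant or A G exceeds l / 2.\<close>
  have "{x \<in> grid L. norm (F x) > l} \<subseteq> D (l / 2) \<union> {x \<in> grid L. G x > l / (2 * A)}"
  proof (intro subsetI, rule ccontr)
    fix x assume "x \<in> {x \<in> grid L. norm (F x) > l}" "x \<notin> D (l / 2) \<union> {x \<in> grid L. G x > l / (2 * A)}"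
    then have x: "x \<in> grid L" "norm (F x) > l" "norm (c L x) \<le> l / 2" "G x \<le> l / (2 * A)"
      by (auto simp: stop_set_def large_def not_less)
    have "A * G x \<le> l / 2" using x(4) A_pos by (simp add: field_simps)
    then show False using top_level[OF x(1)] x by linarith
  qed
  then have "card {x \<in> grid L. norm (F x) > l} \<le> card (D (l / 2) \<union> {x \<in> grid L. G x > l / (2 * A)})"
    by (intro card_mono) auto
  also have "\<dots> \<le> card (D (l / 2)) + card {x \<in> grid L. G x > l / (2 * A)}" by (rule card_Un_le)
  finally have "l powr p * card {x \<in> grid L. norm (F x) > l} \<le>
      l powr p * real (card (D (l / 2)) + card {x \<in> grid L. G x > l / (2 * A)})"
    by (intro mult_left_mono) (auto simp only: of_nat_le_iff powr_ge_zero)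
  also have "\<dots> = 2 powr p * a (l / 2) + l powr p * card {x \<in> grid L. G x > l / (2 * A)}"
    using l by (simp add: a_def powr_divide distrib_left)
  also have "\<dots> \<le> 2 powr p * (2 * V) + (2 * A) powr p * W"
    by (intro add_mono mult_left_mono aV scaled) (use l A_pos in auto)
  also have "\<dots> \<le> 2 powr p * (2 * V) + (20 * A) powr p * W"
    using A_pos p W0 by (intro add_left_mono mult_right_mono powr_mono2) auto
  also have "2 powr p * (2 * V) = 2 * (20 * A) powr p * W"
    using A_pos by (simp add: V_def powr_mult[symmetric] flip: mult.assoc)
  finally show ?thesis by (simp add: ac_simps)
qed

text \<open>The good-lambda inequality is summed over finitely many dyadic levels and half of the
  sum \<open>S\<close> is absorbed. Only the lowest level has no predecessor; it contributes a
  multiple of \<tau> powr p, which disappears with \<tau>.\<close>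

lemma strong_bound:
  assumes p: "0 < p" and eps2: "4 * \<epsilon> * 2 powr p \<le> 1"
  defines "\<kappa> \<equiv> 2 powr p / (2 powr p - 1)"
  shows "(\<Sum>x\<in>grid L. norm (F x) powr p) \<le>
    2 powr p * (2 * (4 powr p) * \<kappa> * (5 * A) powr p + A powr p) * (\<Sum>x\<in>grid L. G x powr p)"
proof (rule le_of_le_add_powr[OF _ p, where d = "2 powr p * (1 + 2 * 2 powr p) * 2 ^ L"])
  fix \<tau> :: real assume tau: "0 < \<tau>"
  define t where "t n = \<tau> * 2 ^ n" for n :: nat
  have t: "0 < t n" "t (Suc n) = 2 * t n" for n using tau by (auto simp: t_def)
  obtain M where M: "\<And>x. x \<in> grid L \<Longrightarrow> norm (c L x) \<le> \<tau> * 2 ^ M"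
    by (rule finite_dominated_by_power[where f = "\<lambda>x. norm (c L x)", OF finite_grid tau]) (use that in blast)
  define a where "a n = t n powr p * card (D (t n))" for n
  define S where "S = (\<Sum>n<M. a n)"
  define GG where "GG = (\<Sum>x\<in>grid L. G x powr p)"
  have G5: "(\<Sum>n<M. t n powr p * card {x \<in> grid L. G x > t n / (5 * A)}) \<le> \<kappa> * (5 * A) powr p * GG"
  proof -
    have "(\<Sum>n<M. t n powr p * card {x \<in> grid L. G x > t n / (5 * A)}) =
        (\<Sum>n<M. \<Sum>x\<in>grid L. t n powr p * of_bool (t n < 5 * A * G x))"
      using A_pos by (intro sum.cong refl)
        (simp only: card_as_sum[OF finite_grid] sum_distrib_left pos_divide_less_eq mult_pos_pos zero_less_numeral mult.commute mult.left_commute)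
    also have "\<dots> = (\<Sum>x\<in>grid L. \<Sum>n<M. t n powr p * of_bool (t n < 5 * A * G x))" by (rule sum.swap)
    also have "\<dots> \<le> (\<Sum>x\<in>grid L. \<kappa> * (5 * A * G x) powr p)"
      unfolding t_def \<kappa>_def by (intro sum_mono layers_le_powr) (use tau p A_pos G_nonneg in auto)
    also have "\<dots> = \<kappa> * (5 * A) powr p * GG"
      using A_pos G_nonneg by (simp add: powr_mult GG_def sum_distrib_left mult.assoc)
    finally show ?thesis .
  qed
  have step: "a (Suc n) \<le> a n / 2 + 2 powr p * (t n powr p * card {x \<in> grid L. G x > t n / (5 * A)})" for n
  proof -
    have "a (Suc n) = 2 powr p * t n powr p * card (D (2 * t n))" using t[of n] by (simp add: a_def t(2) powr_mult)
    also have "\<dots> \<le> 2 powr p * t n powr p * (2 * \<epsilon> * card (D (t n)) + card {x \<in> grid L. G x > t n / (5 * A)})"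
      by (intro mult_left_mono good_lambda t) auto
    also have "\<dots> = 4 * \<epsilon> * 2 powr p * (a n / 2) + 2 powr p * (t n powr p * card {x \<in> grid L. G x > t n / (5 * A)})"
      by (simp add: a_def algebra_simps)
    also have "\<dots> \<le> 1 * (a n / 2) + 2 powr p * (t n powr p * card {x \<in> grid L. G x > t n / (5 * A)})"
      by (intro add_right_mono mult_right_mono eps2) (auto simp: a_def)
    finally show ?thesis by simp
  qed
  have "card (D (t 0)) \<le> card (grid L)" by (rule card_mono[OF finite_grid D_subset_grid])
  then have "real (card (D (t 0))) \<le> 2 ^ L" using of_nat_mono by fastforce
  then have a0: "a 0 \<le> \<tau> powr p * 2 ^ L" unfolding a_def by (simp add: t_def mult_left_mono)
  have "S \<le> (\<Sum>n<Suc M. a n)" unfolding S_def by (simp add: a_def)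
  also have "\<dots> = a 0 + (\<Sum>n<M. a (Suc n))" by (rule sum.lessThan_Suc_shift)
  also have "\<dots> \<le> a 0 + (\<Sum>n<M. a n / 2 + 2 powr p * (t n powr p * card {x \<in> grid L. G x > t n / (5 * A)}))"
    by (intro add_left_mono sum_mono step)
  also have "\<dots> = a 0 + S / 2 + 2 powr p * (\<Sum>n<M. t n powr p * card {x \<in> grid L. G x > t n / (5 * A)})"
    by (simp add: S_def sum.distrib sum_divide_distrib sum_distrib_left)
  also have "\<dots> \<le> \<tau> powr p * 2 ^ L + S / 2 + 2 powr p * (\<kappa> * (5 * A) powr p * GG)"
    by (intro add_mono mult_left_mono a0 G5) auto
  finally have S: "S \<le> 2 * \<tau> powr p * 2 ^ L + 2 * 2 powr p * (\<kappa> * (5 * A) powr p * GG)" by simp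
  have "(\<Sum>x\<in>grid L. norm (c L x) powr p) \<le>
      (\<Sum>x\<in>grid L. \<tau> powr p + 2 powr p * (\<Sum>n<M. t n powr p * of_bool (t n < norm (c L x))))"
    unfolding t_def by (intro sum_mono powr_le_layers M) (use tau p in auto)
  also have "\<dots> = \<tau> powr p * 2 ^ L + 2 powr p * (\<Sum>x\<in>grid L. \<Sum>n<M. t n powr p * of_bool (t n < norm (c L x)))"
    by (simp add: sum.distrib sum_distrib_left)
  also have "(\<Sum>x\<in>grid L. \<Sum>n<M. t n powr p * of_bool (t n < norm (c L x))) =
      (\<Sum>n<M. \<Sum>x\<in>grid L. t n powr p * of_bool (t n < norm (c L x)))" by (rule sum.swap)
  also have "\<dots> \<le> S"
    unfolding S_def
  proof (rule sum_mono)
    fix n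
    have "{x \<in> grid L. t n < norm (c L x)} \<subseteq> D (t n)" by (auto simp: stop_set_def large_def)
    then have "card {x \<in> grid L. t n < norm (c L x)} \<le> card (D (t n))" by (intro card_mono) auto
    then have "t n powr p * card {x \<in> grid L. t n < norm (c L x)} \<le> a n"
      unfolding a_def by (intro mult_left_mono) auto
    then show "(\<Sum>x\<in>grid L. t n powr p * of_bool (t n < norm (c L x))) \<le> a n"
      by (simp only: card_as_sum[OF finite_grid] sum_distrib_left)
  qed
  finally have cL: "(\<Sum>x\<in>grid L. norm (c L x) powr p) \<le> \<tau> powr p * 2 ^ L + 2 powr p * S" by simp
  have "(\<Sum>x\<in>grid L. norm (F x) powr p) \<le> (\<Sum>x\<in>grid L. (norm (c L x) + A * G x) powr p)"
    by (intro sum_mono powr_mono2 top_level) (use p in auto)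
  also have "\<dots> \<le> (\<Sum>x\<in>grid L. 2 powr p * (norm (c L x) powr p + (A * G x) powr p))"
    by (intro sum_mono powr_le_sum_powr) (use p A_pos G_nonneg in auto)
  also have "\<dots> = 2 powr p * ((\<Sum>x\<in>grid L. norm (c L x) powr p) + A powr p * GG)"
    using A_pos G_nonneg by (simp add: sum.distrib sum_distrib_left[symmetric] powr_mult GG_def)
  also have "\<dots> \<le> 2 powr p * (\<tau> powr p * 2 ^ L + 2 powr p *
      (2 * \<tau> powr p * 2 ^ L + 2 * 2 powr p * (\<kappa> * (5 * A) powr p * GG)) + A powr p * GG)"
    by (intro mult_left_mono add_right_mono order_trans[OF cL] add_left_mono S) auto
  also have "\<dots> = 2 powr p * (2 * (2 powr p * 2 powr p) * \<kappa> * (5 * A) powr p + A powr p) * GG +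
      2 powr p * (1 + 2 * 2 powr p) * 2 ^ L * \<tau> powr p"
    by (simp add: algebra_simps)
  also have "2 powr p * 2 powr p = (4::real) powr p" by (simp flip: powr_mult)
  finally show "(\<Sum>x\<in>grid L. norm (F x) powr p) \<le>
      2 powr p * (2 * (4 powr p) * \<kappa> * (5 * A) powr p + A powr p) * (\<Sum>x\<in>grid L. G x powr p) +
      2 powr p * (1 + 2 * 2 powr p) * 2 ^ L * \<tau> powr p" by (simp add: GG_def)
qed simp

end

text \<open>Values up to l / 6 contribute at most 3 * l / 6 = l / 2 to the maximal function. The
  remaining part \<open>f1\<close> is treated by the weak type bound at height l / 2, whence 18 = 2
  * 9.\<close>

lemma maxfun_weak_truncated:
  assumes l: "0 < l"
  shows "l * card {x \<in> grid L. maxfun L f x > l} \<le> 18 * (\<Sum>x\<in>grid L. norm (f x) * of_bool (l < 6 * norm (f x)))"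
proof -
  define f1 where "f1 x = (if l < 6 * norm (f x) then f x else 0)" for x
  have "{x \<in> grid L. maxfun L f x > l} \<subseteq> {x \<in> grid L. maxfun L f1 x > l / 2}"
  proof clarify
    fix x assume x: "x \<in> grid L" "maxfun L f x > l"
    define f2 where "f2 x = f x - f1 x" for x
    have f2: "norm (f2 y) \<le> l / 6" for y by (auto simp: f2_def f1_def l less_imp_le)
    obtain k where k: "k \<le> L" "2 ^ k / 2 ^ L * (\<Sum>y\<in>{y \<in> grid L. near L k x y}. norm (f y)) > l"
      using x by (auto simp: maxfun_gr_iff)
    have "2 ^ k / 2 ^ L * (\<Sum>y\<in>{y \<in> grid L. near L k x y}. norm (f y)) \<le>
        2 ^ k / 2 ^ L * (\<Sum>y\<in>{y \<in> grid L. near L k x y}. norm (f1 y) + norm (f2 y))"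
      by (intro mult_left_mono sum_mono) (auto simp: f2_def f1_def)
    also have "\<dots> = 2 ^ k / 2 ^ L * (\<Sum>y\<in>{y \<in> grid L. near L k x y}. norm (f1 y)) +
        2 ^ k / 2 ^ L * (\<Sum>y\<in>{y \<in> grid L. near L k x y}. norm (f2 y))"
      by (simp add: sum.distrib distrib_left)
    also have "\<dots> \<le> maxfun L f1 x + maxfun L f2 x"
      by (intro add_mono maxfun_ge k)
    also have "maxfun L f2 x \<le> 3 * (l / 6)"
      by (rule maxfun_le_sup[OF f2 x(1)])
    finally show "maxfun L f1 x > l / 2" using k by simp
  qed
  then have "card {x \<in> grid L. maxfun L f x > l} \<le> card {x \<in> grid L. maxfun L f1 x > l / 2}"
    by (intro card_mono) auto
  then have "l * card {x \<in> grid L. maxfun L f x > l} \<le> 2 * (l / 2 * card {x \<in> grid L. maxfun L f1 x > l / 2})"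
    using l by simp
  also have "\<dots> \<le> 2 * (9 * (\<Sum>x\<in>grid L. norm (f1 x)))"
    by (intro mult_left_mono maxfun_weak) (use l in auto)
  also have "(\<Sum>x\<in>grid L. norm (f1 x)) = (\<Sum>x\<in>grid L. norm (f x) * of_bool (l < 6 * norm (f x)))"
    by (intro sum.cong refl) (simp add: f1_def)
  finally show ?thesis by simp
qed

text \<open>Marcinkiewicz interpolation by hand: one power of the level is spent on the truncated
  weak bound, and the remaining p - 1 > 0 powers sum geometrically.\<close>

lemma maxfun_strong:
  fixes p :: real
  assumes p: "1 < p"
  obtains K where "0 < K" "\<And>L f. (\<Sum>x\<in>grid L. maxfun L f x powr p) \<le> K * (\<Sum>x\<in>grid L. norm (f x) powr p)"
proof
  define q where "q = p - 1"
  define \<kappa> where "\<kappa> = 2 powr q / (2 powr q - 1)"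
  have q: "0 < q" using p by (simp add: q_def)
  have kap: "0 < \<kappa>" using q by (simp add: \<kappa>_def)
  show "0 < 2 powr p * 18 * \<kappa> * 6 powr q" using kap by simp
  fix L and f :: "int \<Rightarrow> complex"
  show "(\<Sum>x\<in>grid L. maxfun L f x powr p) \<le> 2 powr p * 18 * \<kappa> * 6 powr q * (\<Sum>x\<in>grid L. norm (f x) powr p)"
  proof (rule le_of_le_add_powr[where d = "2 ^ L" and p = p])
    fix \<tau> :: real assume tau: "0 < \<tau>"
    define t where "t n = \<tau> * 2 ^ n" for n :: nat
    have t: "0 < t n" for n using tau by (auto simp: t_def)
    obtain M where M: "\<And>x. x \<in> grid L \<Longrightarrow> maxfun L f x \<le> \<tau> * 2 ^ M"
      by (rule finite_dominated_by_power[where f = "maxfun L f", OF finite_grid tau]) (use that in blast)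
    have pq: "x powr p = x powr q * x" if "0 \<le> x" for x :: real
      using that p by (cases "x = 0") (auto simp: q_def powr_diff)
    have "(\<Sum>x\<in>grid L. maxfun L f x powr p) \<le>
        (\<Sum>x\<in>grid L. \<tau> powr p + 2 powr p * (\<Sum>n<M. t n powr p * of_bool (t n < maxfun L f x)))"
      unfolding t_def by (intro sum_mono powr_le_layers M) (use tau p in \<open>auto simp: maxfun_nonneg\<close>)
    also have "\<dots> = \<tau> powr p * 2 ^ L + 2 powr p * (\<Sum>x\<in>grid L. \<Sum>n<M. t n powr p * of_bool (t n < maxfun L f x))"
      by (simp add: sum.distrib sum_distrib_left)
    also have "(\<Sum>x\<in>grid L. \<Sum>n<M. t n powr p * of_bool (t n < maxfun L f x)) =
        (\<Sum>n<M. t n powr p * card {x \<in> grid L. t n < maxfun L f x})"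
      by (subst sum.swap) (simp only: card_as_sum[OF finite_grid] sum_distrib_left)
    also have "\<dots> \<le> (\<Sum>n<M. t n powr q * (18 * (\<Sum>x\<in>grid L. norm (f x) * of_bool (t n < 6 * norm (f x)))))"
    proof (rule sum_mono)
      fix n
      have "t n powr p * card {x \<in> grid L. t n < maxfun L f x} = t n powr q * (t n * card {x \<in> grid L. t n < maxfun L f x})"
        using t[of n] by (simp add: pq)
      also have "\<dots> \<le> t n powr q * (18 * (\<Sum>x\<in>grid L. norm (f x) * of_bool (t n < 6 * norm (f x))))"
        by (intro mult_left_mono maxfun_weak_truncated t) auto
      finally show "t n powr p * card {x \<in> grid L. t n < maxfun L f x} \<le> \<dots>" .
    qed
    also have "\<dots> = 18 * (\<Sum>n<M. \<Sum>x\<in>grid L. norm (f x) * (t n powr q * of_bool (t n < 6 * norm (f x))))"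
      by (simp only: sum_distrib_left mult.assoc mult.commute mult.left_commute)
    also have "(\<Sum>n<M. \<Sum>x\<in>grid L. norm (f x) * (t n powr q * of_bool (t n < 6 * norm (f x)))) =
        (\<Sum>x\<in>grid L. norm (f x) * (\<Sum>n<M. t n powr q * of_bool (t n < 6 * norm (f x))))"
      by (subst sum.swap) (simp only: sum_distrib_left)
    also have "\<dots> \<le> (\<Sum>x\<in>grid L. norm (f x) * (\<kappa> * (6 * norm (f x)) powr q))"
      unfolding t_def \<kappa>_def by (intro sum_mono mult_left_mono layers_le_powr) (use tau q in auto)
    also have "\<dots> = \<kappa> * 6 powr q * (\<Sum>x\<in>grid L. norm (f x) powr p)"
      by (simp add: pq powr_mult sum_distrib_left ac_simps)
    finally show "(\<Sum>x\<in>grid L. maxfun L f x powr p) \<le>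
        2 powr p * 18 * \<kappa> * 6 powr q * (\<Sum>x\<in>grid L. norm (f x) powr p) + 2 ^ L * \<tau> powr p"
      by (simp add: algebra_simps)
  qed (use p in auto)
qed

lemma maxfun_weak_powr:
  fixes p :: real
  assumes p: "1 \<le> p"
  obtains K where "0 < K"
    "\<And>L f l. 0 < l \<Longrightarrow> l powr p * card {x \<in> grid L. maxfun L f x > l} \<le> K * (\<Sum>x\<in>grid L. norm (f x) powr p)"
proof (cases "p = 1")
  case True
  show thesis
    by (rule that[of 9]) (use maxfun_weak True in auto)
next
  case False
  then have "1 < p" using p by simp
  from maxfun_strong[OF this] obtain K where K: "0 < K"
    "\<And>L f. (\<Sum>x\<in>grid L. maxfun L f x powr p) \<le> K * (\<Sum>x\<in>grid L. norm (f x) powr p)" by blast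
  show thesis
  proof (rule that[OF K(1)])
    fix L f and l :: real assume l: "0 < l"
    have "{x \<in> grid L. maxfun L f x > l} \<subseteq> {x \<in> grid L. maxfun L f x powr p > l powr p}"
      using l p by (auto intro: powr_less_mono2)
    then have "card {x \<in> grid L. maxfun L f x > l} \<le> card {x \<in> grid L. maxfun L f x powr p > l powr p}"
      by (intro card_mono) auto
    then have "l powr p * card {x \<in> grid L. maxfun L f x > l} \<le> l powr p * card {x \<in> grid L. maxfun L f x powr p > l powr p}"
      by (intro mult_left_mono) auto
    also have "\<dots> \<le> K * (\<Sum>x\<in>grid L. norm (f x) powr p)"
      by (rule card_level_le[OF finite_grid K(2)]) (use l in auto)
    finally show "l powr p * card {x \<in> grid L. maxfun L f x > l} \<le> K * (\<Sum>x\<in>grid L. norm (f x) powr p)" .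
  qed
qed

section \<open>From the maximal function to the bilinear form\<close>

lemma oscillation_bilin:
  assumes cz: "cz_kernel C L Kr" and eps: "0 < \<epsilon>" "\<epsilon> < 1 / 3"
  shows "oscillation L (bilin L Kr f g) (far_value L Kr f g) (\<lambda>x. maxfun L f x * maxfun L g x)
    (C + (8 * C + 3) * ((54 * C + 7) / \<epsilon>)\<^sup>2) \<epsilon>"
proof
  have C: "0 \<le> C" using cz_kernelD(1)[OF cz] .
  have "0 < (8 * C + 3) * ((54 * C + 7) / \<epsilon>)\<^sup>2"
    using C eps by (intro mult_pos_pos zero_less_power divide_pos_pos) auto
  then show "0 < C + (8 * C + 3) * ((54 * C + 7) / \<epsilon>)\<^sup>2" using C by simp
  show "card {x \<in> grid L. cell L k x = cell L k \<xi> \<and> norm (bilin L Kr f g x - far_value L Kr f g k \<xi>) >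
      (C + (8 * C + 3) * ((54 * C + 7) / \<epsilon>)\<^sup>2) * (maxfun L f \<xi> * maxfun L g \<xi>)} \<le> \<epsilon> * 2 ^ (L - k)"
    if "k \<le> L" "\<xi> \<in> grid L" for k \<xi>
    by (rule cz_oscillation[OF cz that eps(1)])
qed (use eps in \<open>auto simp: far_value_0 maxfun_nonneg intro: far_value_cong\<close>)

text \<open>Division by 0 yields 0 in HOL, so the positive right-hand side also excludes
  \<open>p = 0\<close>.\<close>

lemma hoelder_exponents:
  fixes p p1 p2 :: real
  assumes "1 / p = 1 / p1 + 1 / p2" "1 \<le> p1" "1 \<le> p2"
  shows "0 < p" "p / p1 + p / p2 = 1"
proof -
  have "0 < 1 / p" using assms by (simp add: add_pos_pos)
  then show p: "0 < p" by simp
  have "p / p1 + p / p2 = p * (1 / p)" unfolding assms(1) by (simp add: distrib_left)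
  then show "p / p1 + p / p2 = 1" using p by simp
qed

lemma bilin_normalise:
  fixes f :: "int \<Rightarrow> complex"
  assumes "0 < a" "0 < b" "0 < p1" "(\<Sum>x\<in>grid L. norm (f x) powr p1) \<le> a powr p1 * 2 ^ L"
  shows "(\<Sum>x\<in>grid L. norm (of_real (1 / a) * f x) powr p1) \<le> 2 ^ L"
proof -
  have "(\<Sum>x\<in>grid L. norm (of_real (1 / a) * f x) powr p1) = (1 / a) powr p1 * (\<Sum>x\<in>grid L. norm (f x) powr p1)"
    using assms by (simp add: norm_mult norm_divide powr_divide sum_divide_distrib)
  also have "\<dots> \<le> (1 / a) powr p1 * (a powr p1 * 2 ^ L)" by (intro mult_left_mono assms) simp
  finally show ?thesis using assms by (simp add: powr_divide)
qed

theorem grid_weak_bound: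
  fixes C p p1 p2 :: real
  assumes pp: "1 / p = 1 / p1 + 1 / p2" "1 \<le> p1" "1 \<le> p2"
  obtains K where "0 < K"
    "\<And>L Kr f g a b l. \<lbrakk>cz_kernel C L Kr; 0 < a; 0 < b; 0 < l;
       (\<Sum>x\<in>grid L. norm (f x) powr p1) \<le> a powr p1 * 2 ^ L;
       (\<Sum>x\<in>grid L. norm (g x) powr p2) \<le> b powr p2 * 2 ^ L\<rbrakk> \<Longrightarrow>
       card {x \<in> grid L. norm (bilin L Kr f g x) > l} \<le> K * (a * b / l) powr p * 2 ^ L"
proof -
  note p = hoelder_exponents[OF pp]
  obtain K1 where K1: "0 < K1" "\<And>L f l. 0 < l \<Longrightarrow> l powr p1 * card {x \<in> grid L. maxfun L f x > l} \<le> K1 * (\<Sum>x\<in>grid L. norm (f x) powr p1)"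
    using maxfun_weak_powr[OF pp(2)] by blast
  obtain K2 where K2: "0 < K2" "\<And>L f l. 0 < l \<Longrightarrow> l powr p2 * card {x \<in> grid L. maxfun L f x > l} \<le> K2 * (\<Sum>x\<in>grid L. norm (f x) powr p2)"
    using maxfun_weak_powr[OF pp(3)] by blast
  \<comment> \<open>The largest value for which the good-lambda factor times 2 powr p is at most 1 /
    2; it is below 1 / 4.\<close>
  define \<epsilon> where "\<epsilon> = 1 / (4 * 2 powr p)"
  have "1 < 2 powr p" using p by simp
  then have small: "0 < \<epsilon>" "\<epsilon> < 1 / 3" "4 * \<epsilon> * 2 powr p \<le> 1" by (auto simp: \<epsilon>_def divide_simps)
  define A where "A = C + (8 * C + 3) * ((54 * C + 7) / \<epsilon>)\<^sup>2"
  define K where "K = 3 * (20 * A) powr p * (K1 + K2)"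
  have norm_case: "l powr p * card {x \<in> grid L. norm (bilin L Kr f g x) > l} \<le> K * 2 ^ L"
    if cz: "cz_kernel C L Kr" and l: "0 < l"
      and f: "(\<Sum>x\<in>grid L. norm (f x) powr p1) \<le> 2 ^ L" and g: "(\<Sum>x\<in>grid L. norm (g x) powr p2) \<le> 2 ^ L"
    for L Kr f g l
  proof -
    interpret oscillation L "bilin L Kr f g" "far_value L Kr f g" "\<lambda>x. maxfun L f x * maxfun L g x" A \<epsilon>
      unfolding A_def by (rule oscillation_bilin[OF cz small(1,2)])
    have W: "l powr p * card {x \<in> grid L. maxfun L f x * maxfun L g x > l} \<le> (K1 + K2) * 2 ^ L" if l: "0 < l" for l
    proof -
      \<comment> \<open>The level is split so that both factors receive the same power: l1 * l2 = l
        and l1 powr p1 = l2 powr p2 = l powr p.\<close>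
      define l1 where "l1 = l powr (p / p1)"
      define l2 where "l2 = l powr (p / p2)"
      have l12: "0 < l1" "0 < l2" "l1 * l2 = l" "l1 powr p1 = l powr p" "l2 powr p2 = l powr p"
        using l p pp by (auto simp: l1_def l2_def powr_powr powr_add[symmetric])
      have "{x \<in> grid L. maxfun L f x * maxfun L g x > l} \<subseteq> {x \<in> grid L. maxfun L f x > l1} \<union> {x \<in> grid L. maxfun L g x > l2}"
      proof (intro subsetI, rule ccontr)
        fix x assume x: "x \<in> {x \<in> grid L. maxfun L f x * maxfun L g x > l}"
          "x \<notin> {x \<in> grid L. maxfun L f x > l1} \<union> {x \<in> grid L. maxfun L g x > l2}"
        then have "maxfun L f x * maxfun L g x \<le> l1 * l2"
          using l12 by (intro mult_mono) (auto simp: maxfun_nonneg)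
        then show False using x l12 by simp
      qed
      then have "card {x \<in> grid L. maxfun L f x * maxfun L g x > l} \<le>
          card ({x \<in> grid L. maxfun L f x > l1} \<union> {x \<in> grid L. maxfun L g x > l2})"
        by (intro card_mono) auto
      also have "\<dots> \<le> card {x \<in> grid L. maxfun L f x > l1} + card {x \<in> grid L. maxfun L g x > l2}"
        by (rule card_Un_le)
      finally have "l powr p * card {x \<in> grid L. maxfun L f x * maxfun L g x > l} \<le>
          l powr p * real (card {x \<in> grid L. maxfun L f x > l1} + card {x \<in> grid L. maxfun L g x > l2})"
        by (intro mult_left_mono) (auto simp only: of_nat_le_iff powr_ge_zero)
      also have "\<dots> = l1 powr p1 * card {x \<in> grid L. maxfun L f x > l1} + l2 powr p2 * card {x \<in> grid L. maxfun L g x > l2}"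
        by (simp add: l12 distrib_left)
      also have "\<dots> \<le> K1 * (\<Sum>x\<in>grid L. norm (f x) powr p1) + K2 * (\<Sum>x\<in>grid L. norm (g x) powr p2)"
        by (intro add_mono K1 K2 l12)
      also have "\<dots> \<le> K1 * 2 ^ L + K2 * 2 ^ L"
        using K1 K2 f g by (intro add_mono mult_left_mono) auto
      finally show ?thesis by (simp add: distrib_right)
    qed
    from weak_bound[OF p(1) small(3) W l] show ?thesis by (simp add: K_def mult.assoc)
  qed
  show thesis
  \<comment> \<open>\<open>C\<close> is an arbitrary real here, so \<open>A\<close>, and with it
    \<open>K\<close>, may be 0.\<close>
  proof (rule that[of "K + 1"])
    show "0 < K + 1" using K1 K2 by (simp add: K_def add_nonneg_pos)
    fix L Kr and f g :: "int \<Rightarrow> complex" and a b l :: real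
    assume *: "cz_kernel C L Kr" "0 < a" "0 < b" "0 < l"
      "(\<Sum>x\<in>grid L. norm (f x) powr p1) \<le> a powr p1 * 2 ^ L"
      "(\<Sum>x\<in>grid L. norm (g x) powr p2) \<le> b powr p2 * 2 ^ L"
    let ?f = "\<lambda>x. of_real (1 / a) * f x" and ?g = "\<lambda>x. of_real (1 / b) * g x"
    have "(l / (a * b)) powr p * card {x \<in> grid L. norm (bilin L Kr ?f ?g x) > l / (a * b)} \<le> K * 2 ^ L"
      by (rule norm_case[OF *(1)]; (rule bilin_normalise)?) (use * pp in auto)
    also have "{x \<in> grid L. norm (bilin L Kr ?f ?g x) > l / (a * b)} = {x \<in> grid L. norm (bilin L Kr f g x) > l}"
      unfolding bilin_scale using * by (auto simp: norm_mult norm_divide divide_simps)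
    finally have "card {x \<in> grid L. norm (bilin L Kr f g x) > l} \<le> K * 2 ^ L / (l / (a * b)) powr p"
      using * by (simp add: pos_le_divide_eq mult.commute)
    also have "\<dots> = K * ((a * b / l) powr p * 2 ^ L)"
      using * by (simp add: powr_divide)
    also have "\<dots> \<le> (K + 1) * ((a * b / l) powr p * 2 ^ L)" by (intro mult_right_mono) auto
    finally show "card {x \<in> grid L. norm (bilin L Kr f g x) > l} \<le> (K + 1) * (a * b / l) powr p * 2 ^ L"
      by (simp add: mult.assoc)
  qed
qed

theorem grid_strong_bound:
  fixes C p p1 p2 :: real
  assumes pp: "1 / p = 1 / p1 + 1 / p2" "1 < p1" "1 < p2"
  obtains K where "0 < K"
    "\<And>L Kr f g a b. \<lbrakk>cz_kernel C L Kr; 0 < a; 0 < b;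
       (\<Sum>x\<in>grid L. norm (f x) powr p1) \<le> a powr p1 * 2 ^ L;
       (\<Sum>x\<in>grid L. norm (g x) powr p2) \<le> b powr p2 * 2 ^ L\<rbrakk> \<Longrightarrow>
       (\<Sum>x\<in>grid L. norm (bilin L Kr f g x) powr p) \<le> K * (a * b) powr p * 2 ^ L"
proof -
  have "1 \<le> p1" "1 \<le> p2" using pp by auto
  note p = hoelder_exponents[OF pp(1) this]
  obtain K1 where K1: "0 < K1" "\<And>L f. (\<Sum>x\<in>grid L. maxfun L f x powr p1) \<le> K1 * (\<Sum>x\<in>grid L. norm (f x) powr p1)"
    using maxfun_strong[OF pp(2)] by blast
  obtain K2 where K2: "0 < K2" "\<And>L f. (\<Sum>x\<in>grid L. maxfun L f x powr p2) \<le> K2 * (\<Sum>x\<in>grid L. norm (f x) powr p2)"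
    using maxfun_strong[OF pp(3)] by blast
  define \<epsilon> where "\<epsilon> = 1 / (4 * 2 powr p)"
  have "1 < 2 powr p" using p by simp
  then have small: "0 < \<epsilon>" "\<epsilon> < 1 / 3" "4 * \<epsilon> * 2 powr p \<le> 1" by (auto simp: \<epsilon>_def divide_simps)
  define A where "A = C + (8 * C + 3) * ((54 * C + 7) / \<epsilon>)\<^sup>2"
  define Q where "Q = 2 powr p * (2 * (4 powr p) * (2 powr p / (2 powr p - 1)) * (5 * A) powr p + A powr p)"
  have Q: "0 \<le> Q" using \<open>1 < 2 powr p\<close> by (simp add: Q_def)
  define K where "K = Q * (K1 + K2)"
  have norm_case: "(\<Sum>x\<in>grid L. norm (bilin L Kr f g x) powr p) \<le> K * 2 ^ L"
    if cz: "cz_kernel C L Kr"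
      and f: "(\<Sum>x\<in>grid L. norm (f x) powr p1) \<le> 2 ^ L" and g: "(\<Sum>x\<in>grid L. norm (g x) powr p2) \<le> 2 ^ L"
    for L Kr f g
  proof -
    interpret oscillation L "bilin L Kr f g" "far_value L Kr f g" "\<lambda>x. maxfun L f x * maxfun L g x" A \<epsilon>
      unfolding A_def by (rule oscillation_bilin[OF cz small(1,2)])
    \<comment> \<open>A crude form of Young's inequality through the larger of the two powers; the
      normalisation of \<open>f\<close> and \<open>g\<close> makes the sum of powers good
      enough.\<close>
    have young: "(u * v) powr p \<le> u powr p1 + v powr p2" if "0 \<le> u" "0 \<le> v" for u v :: real
    proof (cases "u = 0 \<or> v = 0")
      case False
      define X where "X = max (u powr p1) (v powr p2)"
      have "(u * v) powr p = (u powr p1) powr (p / p1) * (v powr p2) powr (p / p2)"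
        using that pp by (simp add: powr_mult powr_powr)
      also have "\<dots> \<le> X powr (p / p1) * X powr (p / p2)"
        using p pp by (intro mult_mono powr_mono2) (auto simp: X_def)
      also have "\<dots> = X" using p False that by (simp add: powr_add[symmetric] X_def max_def)
      also have "\<dots> \<le> u powr p1 + v powr p2" by (simp add: X_def)
      finally show ?thesis .
    qed auto
    have "(\<Sum>x\<in>grid L. norm (bilin L Kr f g x) powr p) \<le> Q * (\<Sum>x\<in>grid L. (maxfun L f x * maxfun L g x) powr p)"
      unfolding Q_def by (rule strong_bound[OF p(1) small(3)])
    also have "\<dots> \<le> Q * (\<Sum>x\<in>grid L. maxfun L f x powr p1 + maxfun L g x powr p2)"
      by (intro mult_left_mono sum_mono young Q) (auto simp: maxfun_nonneg)
    also have "\<dots> \<le> Q * (K1 * 2 ^ L + K2 * 2 ^ L)"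
      unfolding sum.distrib
    proof (intro mult_left_mono add_mono Q)
      show "(\<Sum>x\<in>grid L. maxfun L f x powr p1) \<le> K1 * 2 ^ L"
        by (rule order_trans[OF K1(2)]) (use K1 f in auto)
      show "(\<Sum>x\<in>grid L. maxfun L g x powr p2) \<le> K2 * 2 ^ L"
        by (rule order_trans[OF K2(2)]) (use K2 g in auto)
    qed
    finally show ?thesis by (simp add: K_def algebra_simps)
  qed
  show thesis
  proof (rule that[of "K + 1"])
    show "0 < K + 1" using K1 K2 Q by (simp add: K_def add_nonneg_pos)
    fix L Kr and f g :: "int \<Rightarrow> complex" and a b :: real
    assume *: "cz_kernel C L Kr" "0 < a" "0 < b"
      "(\<Sum>x\<in>grid L. norm (f x) powr p1) \<le> a powr p1 * 2 ^ L"
      "(\<Sum>x\<in>grid L. norm (g x) powr p2) \<le> b powr p2 * 2 ^ L"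
    let ?f = "\<lambda>x. of_real (1 / a) * f x" and ?g = "\<lambda>x. of_real (1 / b) * g x"
    have e: "bilin L Kr f g x = of_real (a * b) * bilin L Kr ?f ?g x" for x
      unfolding bilin_scale using * by simp
    have "(\<Sum>x\<in>grid L. norm (bilin L Kr f g x) powr p) = (a * b) powr p * (\<Sum>x\<in>grid L. norm (bilin L Kr ?f ?g x) powr p)"
      unfolding sum_distrib_left
    proof (intro sum.cong refl)
      fix x
      have "norm (bilin L Kr f g x) = (a * b) * norm (bilin L Kr ?f ?g x)"
        using * by (subst e) (simp only: norm_mult norm_of_real, simp)
      then show "norm (bilin L Kr f g x) powr p = (a * b) powr p * norm (bilin L Kr ?f ?g x) powr p"
        using * by (simp only: powr_mult mult_nonneg_nonneg less_imp_le norm_ge_zero)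
    qed
    also have "\<dots> \<le> (a * b) powr p * (K * 2 ^ L)"
      by (intro mult_left_mono norm_case[OF *(1)]; (rule bilin_normalise)?) (use * pp in auto)
    also have "\<dots> \<le> (a * b) powr p * ((K + 1) * 2 ^ L)"
      by (intro mult_left_mono mult_right_mono) auto
    finally show "(\<Sum>x\<in>grid L. norm (bilin L Kr f g x) powr p) \<le> (K + 1) * (a * b) powr p * 2 ^ L"
      by (simp add: ac_simps)
  qed
qed

section \<open>Dyadic decomposition of the multiplier\<close>

text \<open>The factor 8 lets the cutoff equal 1 up to 64 * 2 ^ j, which leaves room for windows of
  four differences at every scale.\<close>

definition cutoff :: "nat \<Rightarrow> int \<Rightarrow> int \<Rightarrow> complex" where
  "cutoff j s t = bump (8 * 2 ^ j) s * bump (8 * 2 ^ j) t"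

text \<open>Piece 0 keeps a whole neighbourhood of the origin; all further pieces vanish near
  it.\<close>

fun piece :: "(int \<Rightarrow> int \<Rightarrow> complex) \<Rightarrow> nat \<Rightarrow> int \<Rightarrow> int \<Rightarrow> complex" where
  "piece mm 0 = (\<lambda>s t. mm s t * cutoff 0 s t)"
| "piece mm (Suc j) = (\<lambda>s t. mm s t * (cutoff (Suc j) s t - cutoff j s t))"

definition truncated :: "(int \<Rightarrow> int \<Rightarrow> complex) \<Rightarrow> nat \<Rightarrow> int \<Rightarrow> int \<Rightarrow> complex" where
  "truncated mm J s t = mm s t * cutoff J s t"

lemma truncated_eq_sum: "truncated mm J s t = (\<Sum>j\<le>J. piece mm j s t)"
  by (induction J) (simp_all add: truncated_def algebra_simps)

lemma cutoff_swap: "cutoff j s t = cutoff j t s"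
  by (simp add: cutoff_def)

lemma cutoff_eq_1: "\<bar>s\<bar> \<le> 64 * 2 ^ j \<Longrightarrow> \<bar>t\<bar> \<le> 64 * 2 ^ j \<Longrightarrow> cutoff j s t = 1"
  using bump_eq_1[of s "8 * 2 ^ j"] bump_eq_1[of t "8 * 2 ^ j"] by (simp add: cutoff_def)

lemma cutoff_eq_0: "\<bar>s\<bar> \<ge> 128 * 2 ^ j \<or> \<bar>t\<bar> \<ge> 128 * 2 ^ j \<Longrightarrow> cutoff j s t = 0"
  using bump_eq_0[of "8 * 2 ^ j" s] bump_eq_0[of "8 * 2 ^ j" t] by (auto simp: cutoff_def)

lemma norm_cutoff_le: "norm (cutoff j s t) \<le> 1"
  unfolding cutoff_def norm_mult by (intro mult_le_one norm_bump_le) auto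

lemma piece_eq_0_outside: "\<bar>s\<bar> \<ge> 128 * 2 ^ j \<or> \<bar>t\<bar> \<ge> 128 * 2 ^ j \<Longrightarrow> piece mm j s t = 0"
proof (cases j)
  case (Suc i)
  assume *: "\<bar>s\<bar> \<ge> 128 * 2 ^ j \<or> \<bar>t\<bar> \<ge> 128 * 2 ^ j"
  have "(0::int) \<le> 2 ^ i" by simp
  then have "\<bar>s\<bar> \<ge> 128 * 2 ^ i \<or> \<bar>t\<bar> \<ge> 128 * 2 ^ i" using * unfolding Suc power_Suc by linarith
  then show ?thesis using cutoff_eq_0[of j s t, OF *] cutoff_eq_0[of i s t] Suc by simp
qed (simp add: cutoff_eq_0)

lemma piece_eq_0_inside: "\<bar>s\<bar> \<le> 64 * 2 ^ j \<Longrightarrow> \<bar>t\<bar> \<le> 64 * 2 ^ j \<Longrightarrow> piece mm (Suc j) s t = 0"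
proof -
  assume *: "\<bar>s\<bar> \<le> 64 * 2 ^ j" "\<bar>t\<bar> \<le> 64 * 2 ^ j"
  have "(0::int) \<le> 2 ^ j" by simp
  then have "\<bar>s\<bar> \<le> 64 * 2 ^ Suc j" "\<bar>t\<bar> \<le> 64 * 2 ^ Suc j" using * unfolding power_Suc by linarith+
  then show ?thesis using cutoff_eq_1[OF *] cutoff_eq_1[of s "Suc j" t] by simp
qed

lemma piece_swap: "piece (\<lambda>s t. mm t s) j s t = piece mm j t s"
  by (cases j) (simp_all add: cutoff_swap[of _ s t])

definition fdiff_decay :: "real \<Rightarrow> (int \<Rightarrow> int \<Rightarrow> complex) \<Rightarrow> bool" where
  "fdiff_decay C mm \<longleftrightarrow> (\<forall>k s t R. k \<le> 4 \<and> 0 < R \<and>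
      (\<forall>u. real_of_int s \<le> u \<and> u \<le> real_of_int s + real k \<longrightarrow> R \<le> max \<bar>u\<bar> \<bar>real_of_int t\<bar>) \<longrightarrow>
      norm ((fdiff ^^ k) (\<lambda>s. mm s t) s) \<le> C / R ^ k)"

text \<open>Either all integers of the window are far from the origin, and the decay of
  \<open>mm\<close> applies at scale \<open>2 ^ Suc j\<close>; or one is close, and then both
  cutoffs are 1 on the whole window, so the piece is 0 there. The Leibniz rule gives 2 C = C (1 + 1)
  and the rate 4 = 2 * 2.\<close>

lemma smooth_seq_piece_Suc:
  assumes C: "0 \<le> C" and mm: "fdiff_decay C mm"
  shows "smooth_seq 4 (\<lambda>s. piece mm (Suc j) s t) n (2 * C) (4 / 2 ^ Suc j)"
proof (cases "\<forall>s. n \<le> s \<and> s \<le> n + 4 \<longrightarrow> 16 * 2 ^ Suc j < \<bar>s\<bar> \<or> 16 * 2 ^ Suc j < \<bar>t\<bar>")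
  case True
  define R where "R = (2::real) ^ Suc j"
  have R: "0 < R" "2 \<le> R" by (auto simp: R_def)
  have win: "R \<le> max \<bar>u\<bar> \<bar>real_of_int t\<bar>" if u: "real_of_int n \<le> u" "u \<le> real_of_int n + 4" for u
  proof -
    \<comment> \<open>The case assumption speaks of integers. A real point is within 1 of its floor,
      and 16 R is far enough above R to absorb this.\<close>
    have "n \<le> \<lfloor>u\<rfloor>" "\<lfloor>u\<rfloor> \<le> n + 4" using u by (auto simp: le_floor_iff floor_le_iff)
    then have "16 * 2 ^ Suc j < \<bar>\<lfloor>u\<rfloor>\<bar> \<or> 16 * 2 ^ Suc j < \<bar>t\<bar>" using True by blast
    then have "real_of_int (16 * 2 ^ Suc j) < real_of_int \<bar>\<lfloor>u\<rfloor>\<bar> \<or> real_of_int (16 * 2 ^ Suc j) < real_of_int \<bar>t\<bar>"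
      by (simp only: of_int_less_iff)
    then have "16 * R < \<bar>real_of_int \<lfloor>u\<rfloor>\<bar> \<or> 16 * R < \<bar>real_of_int t\<bar>" by (simp add: R_def)
    moreover have "real_of_int \<lfloor>u\<rfloor> \<le> u" "u \<le> real_of_int \<lfloor>u\<rfloor> + 1" by linarith+
    ultimately have "R \<le> \<bar>u\<bar> \<or> R \<le> \<bar>real_of_int t\<bar>" using R by linarith
    then show ?thesis by (simp add: le_max_iff_disj)
  qed
  have 1: "smooth_seq 4 (\<lambda>s. mm s t) n C (2 / R)"
  proof (rule smooth_seq_mono[of 4 _ n C "1 / R"])
    show "smooth_seq 4 (\<lambda>s. mm s t) n C (1 / R)"
      unfolding smooth_seq_def
    proof (intro allI impI)
      fix i m assume im: "n \<le> m \<and> m + int i \<le> n + int 4"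
      have "norm ((fdiff ^^ i) (\<lambda>s. mm s t) m) \<le> C / R ^ i"
      proof -
        have "\<forall>u. real_of_int m \<le> u \<and> u \<le> real_of_int m + real i \<longrightarrow> R \<le> max \<bar>u\<bar> \<bar>real_of_int t\<bar>"
        proof (intro allI impI win)
          fix u assume u: "real_of_int m \<le> u \<and> u \<le> real_of_int m + real i"
          have "real_of_int n \<le> real_of_int m" "real_of_int (m + int i) \<le> real_of_int (n + 4)"
            using im by (simp_all only: of_int_le_iff of_nat_numeral)
          then show "real_of_int n \<le> u" "u \<le> real_of_int n + 4" using u by auto
        qed
        then show ?thesis using mm R im unfolding fdiff_decay_def by auto
      qed
      then show "norm ((fdiff ^^ i) (\<lambda>s. mm s t) m) \<le> C * (1 / R) ^ i" by (simp add: power_one_over)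
    qed
  qed (use R in \<open>auto simp: divide_right_mono\<close>)
  have b: "smooth_seq 4 (\<lambda>s. cutoff i s t) n 1 (2 / R)" if "2 ^ Suc j \<le> 2 * (2::real) ^ i" for i
  proof -
    have "R \<le> 8 * 2 ^ i" unfolding R_def by (rule order_trans[OF that]) simp
    then have le: "2 / real (8 * 2 ^ i) \<le> 2 / R" using R by (intro divide_left_mono) auto
    have "smooth_seq 4 (bump (8 * 2 ^ i)) n 1 (2 / R)"
      by (rule smooth_seq_bump) (use le in auto)
    then have "smooth_seq 4 (\<lambda>s. bump (8 * 2 ^ i) t * bump (8 * 2 ^ i) s) n (1 * 1) (2 / R)"
      by (rule smooth_seq_cmult) (simp add: norm_bump_le)
    then show ?thesis by (simp add: cutoff_def mult.commute)
  qed
  have 2: "smooth_seq 4 (\<lambda>s. cutoff (Suc j) s t - cutoff j s t) n (1 + 1) (2 / R)"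
    by (intro smooth_seq_diff b) auto
  from smooth_seq_mult[OF 1 2] show ?thesis by (simp add: R_def mult.commute)
next
  case False
  then obtain s0 where s0: "n \<le> s0" "s0 \<le> n + 4" "\<bar>s0\<bar> \<le> 16 * 2 ^ Suc j" "\<bar>t\<bar> \<le> 16 * 2 ^ Suc j" by force
  have one: "(1::int) \<le> 2 ^ j" by simp
  show ?thesis unfolding smooth_seq_def
  proof (intro allI impI)
    fix i m assume im: "n \<le> m \<and> m + int i \<le> n + int 4"
    have "(fdiff ^^ i) (\<lambda>s. piece mm (Suc j) s t) m = (fdiff ^^ i) (\<lambda>_. 0) m"
    proof (rule fdiff_funpow_cong, rule piece_eq_0_inside)
      fix m' assume m': "m \<le> m'" "m' \<le> m + int i"
      have "\<bar>m'\<bar> \<le> \<bar>s0\<bar> + 4" using s0(1,2) im m' by linarith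
      then show "\<bar>m'\<bar> \<le> 64 * 2 ^ j" using s0(3) one unfolding power_Suc by linarith
      show "\<bar>t\<bar> \<le> 64 * 2 ^ j" using s0(4) one unfolding power_Suc by linarith
    qed
    then show "norm ((fdiff ^^ i) (\<lambda>s. piece mm (Suc j) s t) m) \<le> 2 * C * (4 / 2 ^ Suc j) ^ i"
      using C by (simp only: fdiff_funpow_0 norm_zero) simp
  qed
qed

lemma norm_fdiff_funpow_le:
  fixes a :: "int \<Rightarrow> complex"
  assumes "\<And>n. norm (a n) \<le> A"
  shows "norm ((fdiff ^^ k) a n) \<le> 2 ^ k * A"
proof (induction k arbitrary: n)
  case (Suc k)
  have "norm ((fdiff ^^ Suc k) a n) \<le> norm ((fdiff ^^ k) a (n + 1)) + norm ((fdiff ^^ k) a n)"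
    unfolding fdiff_funpow_Suc by (rule norm_triangle_ineq4)
  also have "\<dots> \<le> 2 ^ k * A + 2 ^ k * A" by (intro add_mono Suc)
  finally show ?case by (simp add: ac_simps)
qed (use assms in simp)

text \<open>At j = 0 the scale is 1: an i-th difference of a bounded sequence is at most 2 ^ i times
  the bound, which is all that is asked.\<close>

lemma symbol_piece:
  assumes C: "0 \<le> C" and mm: "fdiff_decay C mm" "fdiff_decay C (\<lambda>s t. mm t s)"
    and B: "\<And>s t. norm (mm s t) \<le> C"
  shows "symbol 4 (2 * C) (2 ^ j) (piece mm j)"
proof (cases j)
  case 0
  have bd: "norm (piece mm 0 s t) \<le> C" for s t
  proof -
    have "norm (mm s t) * norm (cutoff 0 s t) \<le> C * 1" by (intro mult_mono B norm_cutoff_le) (use C in auto)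
    then show ?thesis by (simp add: norm_mult)
  qed
  have sm: "smooth_seq 4 a n (2 * C) 4" if "\<And>n. norm (a n) \<le> C" for a n
    unfolding smooth_seq_def
  proof (intro allI impI)
    fix i m
    have "norm ((fdiff ^^ i) a m) \<le> 2 ^ i * C" by (rule norm_fdiff_funpow_le[OF that])
    also have "\<dots> \<le> 4 ^ i * (2 * C)" using C by (intro mult_mono power_mono) auto
    finally show "norm ((fdiff ^^ i) a m) \<le> 2 * C * 4 ^ i" by (simp add: mult.commute)
  qed
  have "smooth_seq 4 (\<lambda>s. piece mm 0 s t) s (2 * C) 4" "smooth_seq 4 (\<lambda>t. piece mm 0 s t) t (2 * C) 4" for s t
    by (rule sm, rule bd)+
  then show ?thesis unfolding symbol_def 0
    using piece_eq_0_outside[where j = 0 and mm = mm] by (simp del: piece.simps)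
next
  case (Suc i)
  have "smooth_seq 4 (\<lambda>t. piece mm j s t) t (2 * C) (4 / 2 ^ j)" for s t
    using smooth_seq_piece_Suc[OF C mm(2), of i s t] unfolding piece_swap[of mm] Suc .
  then show ?thesis unfolding symbol_def
    using smooth_seq_piece_Suc[OF C mm(1), of i] piece_eq_0_outside[where j = j and mm = mm]
    by (simp add: Suc del: piece.simps power_Suc)
qed

lemma symbol_mono:
  assumes "symbol c A R a" "c \<le> c'" "0 \<le> c"
  shows "symbol c' A R a"
proof -
  have "smooth_seq 4 b n A (c' / R)" if "smooth_seq 4 b n A (c / R)" for b n
    by (rule smooth_seq_mono[OF that order_refl divide_right_mono]) (use assms in auto)
  then show ?thesis using assms(1) unfolding symbol_def by blast
qed

text \<open>In each variable one of the two extra factors is constant, so the Leibniz rule is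
  applied once: the rate doubles from 4 to 8 and the bound grows by 2 * 2.\<close>

lemma symbol_mult_bumps:
  assumes a: "symbol 4 A R a" and R: "R \<ge> 1"
    and b: "\<And>n. smooth_seq 4 b n 2 (4 / R)" and c: "\<And>n. smooth_seq 4 c n 2 (4 / R)"
  shows "symbol 8 (4 * A) R (\<lambda>s t. a s t * b s * c t)"
proof -
  have n2: "norm (f n) \<le> 2" if "\<And>n. smooth_seq 4 f n 2 (4 / R)" for f n
    using smooth_seqD[OF smooth_seq_subwindow[OF that[of n], of n 0]] by simp
  have "smooth_seq 4 (\<lambda>s. a s t * b s * c t) s (4 * A) (8 / R)"
    "smooth_seq 4 (\<lambda>t. a s t * b s * c t) t (4 * A) (8 / R)" for s t
  proof -
    have "smooth_seq 4 (\<lambda>s. a s t) s A (4 / R)" "smooth_seq 4 (\<lambda>t. a s t) t A (4 / R)"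
      using a by (auto simp: symbol_def)
    from smooth_seq_cmult[OF smooth_seq_mult[OF this(1) b] n2[OF c, of t]]
      smooth_seq_cmult[OF smooth_seq_mult[OF this(2) c] n2[OF b, of s]]
    show "smooth_seq 4 (\<lambda>s. a s t * b s * c t) s (4 * A) (8 / R)"
      "smooth_seq 4 (\<lambda>t. a s t * b s * c t) t (4 * A) (8 / R)" by (simp_all add: ac_simps)
  qed
  then show ?thesis using a by (auto simp: symbol_def)
qed

lemma smooth_seq_bump_2:
  assumes "R \<ge> 1"
  shows "smooth_seq 4 (bump R) n 2 (4 / R)" "smooth_seq 4 (\<lambda>s. 1 - bump R s) n 2 (4 / R)" "smooth_seq 4 (\<lambda>_. 1) n 2 (4 / R)"
proof -
  have b: "smooth_seq 4 (bump R) n 1 (4 / R)"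
    by (rule smooth_seq_bump) (use assms in \<open>auto simp: divide_right_mono\<close>)
  have one: "smooth_seq 4 (\<lambda>_. 1) n 1 (4 / R)" by (rule smooth_seq_const) auto
  show "smooth_seq 4 (bump R) n 2 (4 / R)" "smooth_seq 4 (\<lambda>_. 1) n 2 (4 / R)"
    using b one by (auto elim!: smooth_seq_mono)
  from smooth_seq_diff[OF one b] show "smooth_seq 4 (\<lambda>s. 1 - bump R s) n 2 (4 / R)" by simp
qed

section \<open>Regularity of the kernel\<close>

text \<open>Halving the angle loses at most half of the sine, by the double angle formula; the start
  is sin (pi / 2) = 1.\<close>

lemma sin_dyadic_ge: "(1 / 2) ^ Suc i \<le> sin (pi * (1 / 2) ^ Suc i)"
proof (induction i)
  case (Suc i)
  let ?x = "pi * (1 / 2) ^ Suc (Suc i)"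
  have "sin (pi * (1 / 2) ^ Suc i) = 2 * sin ?x * cos ?x"
    using sin_double[of ?x] by (simp add: field_simps)
  also have "\<dots> \<le> 2 * sin ?x * 1"
  proof (rule mult_left_mono)
    have "(1 / 2 :: real) ^ Suc (Suc i) \<le> 1" by (rule power_le_one) auto
    then have "?x \<le> pi * 1" by (intro mult_left_mono) auto
    then show "0 \<le> 2 * sin ?x" using sin_ge_zero[of ?x] by simp
  qed simp
  finally show ?case using Suc by simp
qed simp

text \<open>The norm is twice the sine of half the angle \<theta> between the points. The cyclic
  distance keeps \<theta> between \<alpha> and pi - \<alpha>, where the sine is at least sin
  \<alpha>.\<close>

lemma not_near_unit_root:
  assumes "\<not> near L i x y" "x \<in> grid L" "y \<in> grid L" "i \<le> L"
  shows "(1 / 2) ^ i \<le> norm (1 - unit_root L (x - y))"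
proof -
  have "i \<noteq> 0" using assms(1) by (metis near_0)
  then obtain i' where i': "i = Suc i'" using not0_implies_Suc by blast
  define \<theta> where "\<theta> = pi * real_of_int \<bar>x - y\<bar> / 2 ^ L"
  define \<alpha> where "\<alpha> = pi * (1 / 2) ^ i"
  have e: "2 ^ (L - i) / (2::real) ^ L = (1 / 2) ^ i"
    using assms(4) by (simp add: power_diff power_one_over)
  have r: "real_of_int (2 ^ (L - i)) \<le> real_of_int \<bar>x - y\<bar>" "real_of_int \<bar>x - y\<bar> \<le> real_of_int (2 ^ L - 2 ^ (L - i))"
    using not_near_dist[OF assms] by (simp_all only: of_int_le_iff)
  have "\<alpha> = pi * real_of_int (2 ^ (L - i)) / 2 ^ L"
    unfolding \<alpha>_def e[symmetric] by simp
  also have "\<dots> \<le> \<theta>" unfolding \<theta>_def using r(1) by (intro divide_right_mono mult_left_mono) auto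
  finally have lo: "\<alpha> \<le> \<theta>" .
  have "\<theta> \<le> pi * real_of_int (2 ^ L - 2 ^ (L - i)) / 2 ^ L"
    unfolding \<theta>_def using r(2) by (intro divide_right_mono mult_left_mono) auto
  also have "\<dots> = pi - \<alpha>"
    unfolding \<alpha>_def e[symmetric] by (simp add: field_simps)
  finally have hi: "\<theta> \<le> pi - \<alpha>" .
  have a0: "0 \<le> \<alpha>" by (simp add: \<alpha>_def)
  have "(1 / 2 :: real) ^ i \<le> sin \<alpha>" unfolding \<alpha>_def i' by (rule sin_dyadic_ge)
  also have "\<dots> \<le> sin \<theta>"
  proof (cases "\<theta> \<le> pi / 2")
    case True
    then show ?thesis using lo a0 by (intro sin_monotone_2pi_le) auto
  next
    case False
    have "sin \<alpha> \<le> sin (pi - \<theta>)"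
      using False hi a0 by (intro sin_monotone_2pi_le) auto
    then show ?thesis by simp
  qed
  also have "\<dots> \<le> \<bar>sin \<theta>\<bar>" by simp
  also have "\<dots> \<le> 2 * \<bar>sin \<theta>\<bar>" by simp
  also have "\<dots> = norm (1 - unit_root L (x - y))"
  proof -
    have "\<theta> = pi * real_of_int (x - y) / 2 ^ L \<or> \<theta> = - (pi * real_of_int (x - y) / 2 ^ L)"
      by (auto simp: \<theta>_def abs_if field_simps)
    then have "\<bar>sin \<theta>\<bar> = \<bar>sin (pi * real_of_int (x - y) / 2 ^ L)\<bar>" by (metis abs_minus_cancel sin_minus)
    then show ?thesis unfolding norm_unit_root_minus_1 by simp
  qed
  finally show ?thesis .
qed

lemma kernel_truncated: "grid_kernel B L (truncated mm J) u v = (\<Sum>j\<le>J. grid_kernel B L (piece mm j) u v)"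
proof -
  have "truncated mm J = (\<lambda>s t. \<Sum>j\<le>J. piece mm j s t)" by (simp add: fun_eq_iff truncated_eq_sum)
  then show ?thesis by (simp only: kernel_sum)
qed

text \<open>Two bounds for a kernel difference at scale \<open>j\<close>: growth below the critical
  scale \<open>i\<close> and decay above it. Together they decay geometrically away from
  \<open>i\<close>, so the sum over all scales is comparable to the critical term.\<close>

lemma dyadic_pow_le:
  assumes "0 \<le> K" "D \<le> K * 8 ^ j" "D * ((1 / 2) ^ Suc i) ^ 4 * 2 ^ j \<le> K"
  shows "D \<le> 16 * K * 8 ^ i * (1 / 2 :: real) ^ ((i - j) + (j - i))"
proof (cases "j \<le> i")
  case True
  then obtain l where l: "i = j + l" using le_Suc_ex by blast
  have "(1::real) \<le> 16 * 4 ^ l" using one_le_power[of "4::real" l] by linarith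
  have "D \<le> K * 8 ^ j * 1" using assms by simp
  also have "\<dots> \<le> K * 8 ^ j * (16 * 4 ^ l)"
    using assms(1) \<open>1 \<le> 16 * 4 ^ l\<close> by (intro mult_left_mono) auto
  also have "(4::real) ^ l = 8 ^ l * (1 / 2) ^ l" by (simp flip: power_mult_distrib)
  finally show ?thesis by (simp add: l power_add ac_simps)
next
  case False
  then obtain l where l: "j = i + l" using le_Suc_ex[of i j] by auto
  have "D * ((1 / 2) ^ Suc i) ^ 4 * 2 ^ j = D * (1 / (16 * 8 ^ i) * 2 ^ l)"
  proof -
    have "((1 / 2 :: real) ^ Suc i) ^ 4 = ((1 / 2) ^ 4) ^ Suc i" by (simp only: power_mult[symmetric] mult.commute)
    also have "\<dots> = 1 / (16 * 16 ^ i)" by (simp add: power_one_over)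
    also have "(16::real) ^ i = 8 ^ i * 2 ^ i" by (simp flip: power_mult_distrib)
    finally show ?thesis by (simp add: l power_add)
  qed
  then have "D * (1 / (16 * 8 ^ i) * 2 ^ l) \<le> K" using assms(3) by simp
  then have "D \<le> K * (16 * 8 ^ i) / 2 ^ l" by (simp add: field_simps)
  then show ?thesis using False by (simp add: l power_one_over ac_simps)
qed

text \<open>48 = 16 * 3 comes from \<open>dyadic_pow_le\<close> and \<open>sum_half_dist\<close>.
  The bracket is the constant of \<open>kernel_difference\<close> for symbols of size 2 C and rate
  8, with 16 = 2 * 8.\<close>

definition kernel_const :: "real \<Rightarrow> real" where
  "kernel_const C = 48 * (70225 * (2 * C * 1088) * 16 ^ 4)"

lemma kernel_const_nonneg: "0 \<le> C \<Longrightarrow> 0 \<le> kernel_const C"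
  by (simp add: kernel_const_def)

lemma kernel_total_difference:
  assumes C: "0 \<le> C" and mm: "fdiff_decay C mm" "fdiff_decay C (\<lambda>s t. mm t s)" "\<And>s t. norm (mm s t) \<le> C"
    and B: "132 * 2 ^ J \<le> B"
    and d: "((1 / 2) ^ Suc i \<le> norm (1 - unit_root L u) \<and> (1 / 2) ^ Suc i \<le> norm (1 - unit_root L (u + h))) \<or>
      (1 / 2) ^ Suc i \<le> norm (1 - unit_root L v)"
  shows "norm (grid_kernel B L (truncated mm J) (u + h) v - grid_kernel B L (truncated mm J) u v) \<le>
    kernel_const C * (\<bar>of_int h\<bar> / 2 ^ L) * 8 ^ i"
proof -
  define K0 where "K0 = 70225 * (2 * C * 1088) * 16 ^ 4 * (\<bar>of_int h\<bar> / 2 ^ L)"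
  have K0: "0 \<le> K0" using C by (simp add: K0_def)
  have "norm (grid_kernel B L (truncated mm J) (u + h) v - grid_kernel B L (truncated mm J) u v) \<le>
      (\<Sum>j\<le>J. norm (grid_kernel B L (piece mm j) (u + h) v - grid_kernel B L (piece mm j) u v))"
    unfolding kernel_truncated sum_subtractf[symmetric] by (rule norm_sum)
  also have "\<dots> \<le> (\<Sum>j\<le>J. 16 * K0 * 8 ^ i * (1 / 2) ^ ((i - j) + (j - i)))"
  proof (intro sum_mono dyadic_pow_le K0)
    fix j assume j: "j \<in> {..J}"
    have s: "symbol 8 (2 * C) (2 ^ j) (piece mm j)"
      by (rule symbol_mono[OF symbol_piece[OF C mm]]) auto
    have "(2::int) ^ j \<le> 2 ^ J" using j by (intro power_increasing) auto
    then have jB: "132 * int (2 ^ j) \<le> B"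
      using B unfolding of_nat_power of_nat_numeral by linarith
    have e: "real (2 ^ j) ^ 3 = 8 ^ j" by (simp add: power3_eq_cube flip: power_mult_distrib)
    have "(1::nat) \<le> 2 ^ j" "(8::real) \<le> 8" "(0::real) \<le> (1 / 2) ^ Suc i" by auto
    note kd = kernel_difference[OF s this(1) jB this(2) d this(3)]
    show "norm (grid_kernel B L (piece mm j) (u + h) v - grid_kernel B L (piece mm j) u v) \<le> K0 * 8 ^ j"
      using kd(1) unfolding K0_def e by (simp add: mult.assoc)
    show "norm (grid_kernel B L (piece mm j) (u + h) v - grid_kernel B L (piece mm j) u v) * ((1 / 2) ^ Suc i) ^ 4 * 2 ^ j \<le> K0"
      using kd(2) unfolding K0_def by (simp add: mult.assoc)
  qed
  also have "\<dots> = 16 * K0 * 8 ^ i * (\<Sum>j\<le>J. (1 / 2) ^ ((i - j) + (j - i)))"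
    by (simp only: sum_distrib_left)
  also have "\<dots> \<le> 16 * K0 * 8 ^ i * 3"
    by (intro mult_left_mono sum_half_dist) (use K0 in auto)
  also have "\<dots> = kernel_const C * (\<bar>of_int h\<bar> / 2 ^ L) * 8 ^ i" by (simp add: kernel_const_def K0_def)
  finally show ?thesis .
qed

lemma truncated_swap: "truncated (\<lambda>s t. mm t s) J = (\<lambda>s t. truncated mm J t s)"
  by (intro ext) (simp only: truncated_def cutoff_swap[of J])

definition circle_kernel :: "int \<Rightarrow> nat \<Rightarrow> (int \<Rightarrow> int \<Rightarrow> complex) \<Rightarrow> int \<Rightarrow> int \<Rightarrow> int \<Rightarrow> complex" where
  "circle_kernel B L a x y z = grid_kernel B L a (x - y) (x - z)"

lemma circle_kernel_swap: "circle_kernel B L (\<lambda>s t. a t s) x z y = circle_kernel B L a x y z"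
  unfolding circle_kernel_def by (rule kernel_swap)

lemma same_cell_dist:
  assumes "cell L k y = cell L k w"
  shows "\<bar>real_of_int (y - w)\<bar> / 2 ^ L \<le> 1 / 2 ^ k \<or> L < k"
proof (cases "k \<le> L")
  case True
  have pos: "(0::int) < 2 ^ (L - k)" by simp
  have "y div 2 ^ (L - k) = w div 2 ^ (L - k)" using assms by (simp add: cell_def)
  then have "\<bar>y - w\<bar> \<le> 2 ^ (L - k)"
    using pos_mod_bound[OF pos, of y] pos_mod_sign[OF pos, of y] div_mult_mod_eq[of y "2 ^ (L - k)"]
      pos_mod_bound[OF pos, of w] pos_mod_sign[OF pos, of w] div_mult_mod_eq[of w "2 ^ (L - k)"]
    by (smt (verit))
  then have "real_of_int \<bar>y - w\<bar> \<le> real_of_int (2 ^ (L - k))" by (simp only: of_int_le_iff)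
  then have "\<bar>real_of_int (y - w)\<bar> / 2 ^ L \<le> 2 ^ (L - k) / 2 ^ L" by (intro divide_right_mono) auto
  also have "2 ^ (L - k) / (2::real) ^ L = 1 / 2 ^ k" using True by (simp add: power_diff)
  finally show ?thesis by simp
qed simp

text \<open>The critical scale: the last level at which both \<open>y\<close> and \<open>z\<close>
  are near \<open>x\<close>. Its term in the near weight is \<open>8 ^ i\<close>, the size of the
  kernel difference at that scale.\<close>

lemma obtain_scale:
  assumes "\<not> (near L k x y \<and> near L k x z)"
  obtains i where "i < k" "\<not> (near L (Suc i) x y \<and> near L (Suc i) x z)" "8 ^ i \<le> near_weight L k x y z"
proof -
  obtain i where i: "i < k" "near L i x y \<and> near L i x z" "\<not> (near L (Suc i) x y \<and> near L (Suc i) x z)"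
    using obtain_last_level[of "\<lambda>i. near L i x y \<and> near L i x z" k] assms by auto
  have "8 ^ i * of_bool (near L i x y) * of_bool (near L i x z) \<le> near_weight L k x y z"
    unfolding near_weight_def
    by (rule member_le_sum[of i "{..<k}" "\<lambda>i. 8 ^ i * of_bool (near L i x y) * of_bool (near L i x z)"]) (use i in auto)
  then show thesis using that[of i] i by simp
qed

context
  fixes C :: real and mm :: "int \<Rightarrow> int \<Rightarrow> complex" and L J :: nat and B :: int
  assumes C: "0 \<le> C" and mm: "fdiff_decay C mm" "fdiff_decay C (\<lambda>s t. mm t s)" "\<And>s t. norm (mm s t) \<le> C"
    and B: "132 * 2 ^ J \<le> B"
begin

lemma circle_kernel_difference_scaled:
  assumes k: "k \<le> L" "\<bar>real_of_int h\<bar> / 2 ^ L \<le> 1 / 2 ^ k" and n: "8 ^ i \<le> n"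
    and d: "((1 / 2) ^ Suc i \<le> norm (1 - unit_root L u) \<and> (1 / 2) ^ Suc i \<le> norm (1 - unit_root L (u + h))) \<or>
      (1 / 2) ^ Suc i \<le> norm (1 - unit_root L v)"
  shows "norm (grid_kernel B L (truncated mm J) (u + h) v - grid_kernel B L (truncated mm J) u v) \<le> kernel_const C / 2 ^ k * n"
proof -
  have "norm (grid_kernel B L (truncated mm J) (u + h) v - grid_kernel B L (truncated mm J) u v) \<le>
      kernel_const C * (\<bar>of_int h\<bar> / 2 ^ L) * 8 ^ i"
    by (rule kernel_total_difference[OF C mm B d])
  also have "\<dots> \<le> kernel_const C * (1 / 2 ^ k) * n"
    using kernel_const_nonneg[OF C] k n by (intro mult_mono) auto
  finally show ?thesis by simp
qed

lemma circle_kernel_first_difference: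
  assumes "k \<le> L" "x \<in> grid L" "y \<in> grid L" "z \<in> grid L" "w \<in> grid L" "cell L k y = cell L k w" "\<not> near L k x y"
  shows "norm (circle_kernel B L (truncated mm J) x y z - circle_kernel B L (truncated mm J) x w z) \<le> kernel_const C / 2 ^ k * near_weight L k x y z"
proof -
  obtain i where i: "i < k" "\<not> (near L (Suc i) x y \<and> near L (Suc i) x z)" "8 ^ i \<le> near_weight L k x y z"
    using obtain_scale[of L k x y z] assms(7) by blast
  have i': "Suc i \<le> L" using i assms by simp
  have "cell L (Suc i) y = cell L (Suc i) w"
    by (rule cell_eq_mono[OF assms(6)]) (use i assms in auto)
  then have nw: "near L (Suc i) x y \<longleftrightarrow> near L (Suc i) x w" by (rule near_cong2)
  have "norm (grid_kernel B L (truncated mm J) ((x - w) + (w - y)) (x - z) - grid_kernel B L (truncated mm J) (x - w) (x - z))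
      \<le> kernel_const C / 2 ^ k * near_weight L k x y z"
  proof (rule circle_kernel_difference_scaled[OF assms(1) _ i(3)])
    show "\<bar>real_of_int (w - y)\<bar> / 2 ^ L \<le> 1 / 2 ^ k"
      using same_cell_dist[OF assms(6)[symmetric]] assms(1) by auto
    show "((1 / 2) ^ Suc i \<le> norm (1 - unit_root L (x - w)) \<and> (1 / 2) ^ Suc i \<le> norm (1 - unit_root L (x - w + (w - y)))) \<or>
      (1 / 2) ^ Suc i \<le> norm (1 - unit_root L (x - z))"
      using i(2) nw not_near_unit_root[OF _ assms(2,3) i'] not_near_unit_root[OF _ assms(2,4) i']
        not_near_unit_root[OF _ assms(2,5) i'] by auto
  qed
  then show ?thesis by (simp add: circle_kernel_def)
qed

text \<open>The centre moves in the first slot only. The centre \<open>x'\<close> in the second slot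
  may be the old or the new one, so two such steps, one for each slot, lead from \<open>x\<close> to
  \<open>w\<close>.\<close>

lemma circle_kernel_centre_difference_half:
  assumes "k \<le> L" "x \<in> grid L" "y \<in> grid L" "z \<in> grid L" "w \<in> grid L" "cell L k x = cell L k w"
    and xx: "x' \<in> grid L" "cell L k x = cell L k x'" and "\<not> (near L k x y \<and> near L k x z)"
  shows "norm (grid_kernel B L (truncated mm J) (x - y) (x' - z) - grid_kernel B L (truncated mm J) (w - y) (x' - z))
    \<le> kernel_const C / 2 ^ k * near_weight L k x y z"
proof -
  obtain i where i: "i < k" "\<not> (near L (Suc i) x y \<and> near L (Suc i) x z)" "8 ^ i \<le> near_weight L k x y z"
    using obtain_scale[OF assms(9)] by blast
  have i': "Suc i \<le> L" using i assms by simp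
  have "cell L (Suc i) x = cell L (Suc i) w" "cell L (Suc i) x = cell L (Suc i) x'"
    using cell_eq_mono[OF assms(6), of "Suc i"] cell_eq_mono[OF xx(2), of "Suc i"] i assms(1) by auto
  then have nw: "near L (Suc i) x y \<longleftrightarrow> near L (Suc i) w y" "near L (Suc i) x z \<longleftrightarrow> near L (Suc i) x' z"
    using near_cong by blast+
  have "norm (grid_kernel B L (truncated mm J) ((w - y) + (x - w)) (x' - z) - grid_kernel B L (truncated mm J) (w - y) (x' - z))
      \<le> kernel_const C / 2 ^ k * near_weight L k x y z"
  proof (rule circle_kernel_difference_scaled[OF assms(1) _ i(3)])
    show "\<bar>real_of_int (x - w)\<bar> / 2 ^ L \<le> 1 / 2 ^ k"
      using same_cell_dist[OF assms(6)] assms(1) by auto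
    show "((1 / 2) ^ Suc i \<le> norm (1 - unit_root L (w - y)) \<and> (1 / 2) ^ Suc i \<le> norm (1 - unit_root L (w - y + (x - w)))) \<or>
      (1 / 2) ^ Suc i \<le> norm (1 - unit_root L (x' - z))"
      using i(2) nw not_near_unit_root[OF _ assms(2,3) i'] not_near_unit_root[OF _ xx(1) assms(4) i']
        not_near_unit_root[OF _ assms(5,3) i'] by auto
  qed
  then show ?thesis by simp
qed

end

lemma circle_kernel_regular:
  fixes C :: real
  assumes C: "0 \<le> C" and mm: "fdiff_decay C mm" "fdiff_decay C (\<lambda>s t. mm t s)" "\<And>s t. norm (mm s t) \<le> C"
    and B: "132 * 2 ^ J \<le> B"
    and k: "k \<le> L" and g: "x \<in> grid L" "y \<in> grid L" "z \<in> grid L" "w \<in> grid L"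
  defines "Kr \<equiv> circle_kernel B L (truncated mm J)"
  shows "cell L k y = cell L k w \<Longrightarrow> \<not> near L k x y \<Longrightarrow>
      norm (Kr x y z - Kr x w z) \<le> 2 * kernel_const C / 2 ^ k * near_weight L k x y z"
    and "cell L k z = cell L k w \<Longrightarrow> \<not> near L k x z \<Longrightarrow>
      norm (Kr x y z - Kr x y w) \<le> 2 * kernel_const C / 2 ^ k * near_weight L k x y z"
    and "cell L k x = cell L k w \<Longrightarrow> \<not> (near L k x y \<and> near L k x z) \<Longrightarrow>
      norm (Kr x y z - Kr w y z) \<le> 2 * kernel_const C / 2 ^ k * near_weight L k x y z"
proof -
  let ?W = "near_weight L k x y z"
  have W: "kernel_const C / 2 ^ k * ?W \<le> 2 * kernel_const C / 2 ^ k * ?W"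
    using kernel_const_nonneg[OF C] near_weight_nonneg[of L k x y z] by (intro mult_right_mono divide_right_mono) auto
  have mm': "norm (mm t s) \<le> C" for s t by (rule mm(3))
  have sw: "circle_kernel B L (truncated (\<lambda>s t. mm t s) J) x z y = Kr x y z" for x y z
    unfolding truncated_swap[of mm J] Kr_def by (rule circle_kernel_swap)
  show "norm (Kr x y z - Kr x w z) \<le> 2 * kernel_const C / 2 ^ k * ?W" if "cell L k y = cell L k w" "\<not> near L k x y"
    using circle_kernel_first_difference[OF C mm B k g that] W unfolding Kr_def by linarith
  show "norm (Kr x y z - Kr x y w) \<le> 2 * kernel_const C / 2 ^ k * ?W" if "cell L k z = cell L k w" "\<not> near L k x z"
    using circle_kernel_first_difference[OF C mm(2,1) mm' B k g(1,3,2,4) that] W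
    unfolding sw near_weight_swap[of L k x z y] by linarith
  show "norm (Kr x y z - Kr w y z) \<le> 2 * kernel_const C / 2 ^ k * ?W" if that: "cell L k x = cell L k w" "\<not> (near L k x y \<and> near L k x z)"
  proof -
    let ?G = "grid_kernel B L (truncated mm J)"
    have 1: "norm (?G (x - y) (x - z) - ?G (w - y) (x - z)) \<le> kernel_const C / 2 ^ k * ?W"
      by (rule circle_kernel_centre_difference_half[OF C mm B k g that(1) g(1) refl that(2)])
    have sw': "grid_kernel B L (truncated (\<lambda>s t. mm t s) J) u v = ?G v u" for u v
      unfolding truncated_swap[of mm J] by (rule kernel_swap)
    have "\<not> (near L k x z \<and> near L k x y)" using that by auto
    from circle_kernel_centre_difference_half[OF C mm(2,1) mm' B k g(1,3,2,4) that(1) g(4) that(1) this]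
    have 2: "norm (?G (w - y) (x - z) - ?G (w - y) (w - z)) \<le> kernel_const C / 2 ^ k * ?W"
      unfolding sw' near_weight_swap[of L k x z y] .
    have "norm (Kr x y z - Kr w y z) \<le>
        norm (?G (x - y) (x - z) - ?G (w - y) (x - z)) + norm (?G (w - y) (x - z) - ?G (w - y) (w - z))"
      unfolding Kr_def circle_kernel_def
      by (rule order_trans[OF _ norm_triangle_ineq]) simp
    then show ?thesis using 1 2 by simp
  qed
qed

section \<open>The discrete Fourier transform\<close>

definition dft :: "nat \<Rightarrow> (int \<Rightarrow> complex) \<Rightarrow> int \<Rightarrow> complex" where
  "dft L f s = (\<Sum>x\<in>grid L. f x * unit_root L (- (s * x))) / 2 ^ L"

lemma sum_unit_root:
  assumes "\<bar>n\<bar> < 2 ^ L"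
  shows "(\<Sum>x\<in>grid L. unit_root L (n * x)) = (if n = 0 then 2 ^ L else 0)"
proof (cases "n = 0")
  case False
  have tel: "(\<Sum>x\<in>{0..<int m}. unit_root L (n * x) * (unit_root L n - 1)) = unit_root L (n * int m) - 1" for m
  proof (induction m)
    case (Suc m)
    have "{0..<int (Suc m)} = insert (int m) {0..<int m}" by auto
    then show ?case using Suc by (simp add: algebra_simps unit_root_add)
  qed simp
  have N: "unit_root L (n * 2 ^ L) = 1"
  proof -
    have "2 * pi * of_int (n * 2 ^ L) / 2 ^ L = 2 * pi * of_int n" by simp
    then have "unit_root L (n * 2 ^ L) = cis (2 * pi * of_int n)" by (simp only: unit_root_def)
    also have "\<dots> = 1" by (rule cis_multiple_2pi) simp
    finally show ?thesis .
  qed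
  have "(\<Sum>x\<in>grid L. unit_root L (n * x)) * (unit_root L n - 1) = 0"
    using tel[of "2 ^ L"] by (simp add: grid_def sum_distrib_right N)
  moreover have "unit_root L n \<noteq> 1"
  proof
    assume "unit_root L n = 1"
    then have "sin (pi * of_int n / 2 ^ L) = 0" using norm_unit_root_minus_1[of L n] by simp
    then have s0: "sin (pi * \<bar>of_int n\<bar> / 2 ^ L) = 0" by (cases "n \<ge> 0") (auto simp: abs_if)
    have "real_of_int \<bar>n\<bar> < real_of_int (2 ^ L)" using assms by (simp only: of_int_less_iff)
    then have "pi * \<bar>of_int n\<bar> / 2 ^ L < pi" by (simp add: divide_less_eq)
    moreover have "0 < pi * \<bar>of_int n\<bar> / 2 ^ L" using False by simp
    ultimately show False using sin_gt_zero s0 by force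
  qed
  ultimately show ?thesis using False by simp
qed simp

definition freq_proj :: "nat \<Rightarrow> int set \<Rightarrow> (int \<Rightarrow> complex) \<Rightarrow> int \<Rightarrow> complex" where
  "freq_proj L T f x = (\<Sum>s\<in>T. dft L f s * unit_root L (s * x))"

text \<open>\<open>T\<close> is a set of integers, not of residues; the condition on differences
  excludes aliasing modulo \<open>2 ^ L\<close>.\<close>

lemma dft_trig_poly:
  assumes "finite T" "\<And>s. s \<in> T \<Longrightarrow> \<bar>s - r\<bar> < 2 ^ L"
  shows "dft L (\<lambda>x. \<Sum>s\<in>T. c s * unit_root L (s * x)) r = (if r \<in> T then c r else 0)"
proof -
  have "(\<Sum>x\<in>grid L. (\<Sum>s\<in>T. c s * unit_root L (s * x)) * unit_root L (- (r * x))) =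
      (\<Sum>x\<in>grid L. \<Sum>s\<in>T. c s * unit_root L ((s - r) * x))"
    unfolding sum_distrib_right
    by (intro sum.cong refl) (simp add: mult.assoc unit_root_add[symmetric] left_diff_distrib)
  also have "\<dots> = (\<Sum>s\<in>T. \<Sum>x\<in>grid L. c s * unit_root L ((s - r) * x))" by (rule sum.swap)
  also have "\<dots> = (\<Sum>s\<in>T. c s * (\<Sum>x\<in>grid L. unit_root L ((s - r) * x)))"
    by (simp only: sum_distrib_left)
  also have "\<dots> = (\<Sum>s\<in>T. if s = r then c s * 2 ^ L else 0)"
    by (rule sum.cong[OF refl], subst sum_unit_root) (use assms in auto)
  also have "\<dots> = (if r \<in> T then c r * 2 ^ L else 0)"
    using assms(1) by simp
  finally show ?thesis by (simp add: dft_def)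
qed

lemma dft_freq_proj:
  assumes "finite T" "\<And>s. s \<in> T \<Longrightarrow> \<bar>s - r\<bar> < 2 ^ L"
  shows "dft L (freq_proj L T f) r = (if r \<in> T then dft L f r else 0)"
  unfolding freq_proj_def[abs_def] by (rule dft_trig_poly[OF assms])

lemma sum_mult_cnj_trig_poly:
  "(\<Sum>x\<in>grid L. f x * cnj (\<Sum>s\<in>T. c s * unit_root L (s * x))) = 2 ^ L * (\<Sum>s\<in>T. dft L f s * cnj (c s))"
proof -
  have "(\<Sum>x\<in>grid L. f x * cnj (\<Sum>s\<in>T. c s * unit_root L (s * x))) =
      (\<Sum>x\<in>grid L. \<Sum>s\<in>T. cnj (c s) * (f x * unit_root L (- (s * x))))"
    by (simp add: sum_distrib_left cnj_unit_root ac_simps)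
  also have "\<dots> = (\<Sum>s\<in>T. \<Sum>x\<in>grid L. cnj (c s) * (f x * unit_root L (- (s * x))))" by (rule sum.swap)
  also have "\<dots> = (\<Sum>s\<in>T. 2 ^ L * (dft L f s * cnj (c s)))"
    by (simp add: dft_def sum_distrib_left[symmetric] mult.commute)
  finally show ?thesis by (simp only: sum_distrib_left)
qed

lemma parseval_trig_poly:
  assumes "finite T" "\<And>s r. s \<in> T \<Longrightarrow> r \<in> T \<Longrightarrow> \<bar>s - r\<bar> < 2 ^ L"
  shows "(\<Sum>x\<in>grid L. (norm (\<Sum>s\<in>T. c s * unit_root L (s * x)))\<^sup>2) = 2 ^ L * (\<Sum>s\<in>T. (norm (c s))\<^sup>2)"
proof -
  let ?P = "\<lambda>x. \<Sum>s\<in>T. c s * unit_root L (s * x)"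
  have "complex_of_real (\<Sum>x\<in>grid L. (norm (?P x))\<^sup>2) = (\<Sum>x\<in>grid L. ?P x * cnj (?P x))"
    by (simp only: of_real_sum complex_norm_square)
  also have "\<dots> = 2 ^ L * (\<Sum>s\<in>T. dft L ?P s * cnj (c s))" by (rule sum_mult_cnj_trig_poly)
  also have "(\<Sum>s\<in>T. dft L ?P s * cnj (c s)) = (\<Sum>s\<in>T. c s * cnj (c s))"
    by (rule sum.cong[OF refl], subst dft_trig_poly) (use assms in auto)
  also have "\<dots> = complex_of_real (\<Sum>s\<in>T. (norm (c s))\<^sup>2)"
    by (simp only: of_real_sum complex_norm_square)
  finally have "complex_of_real (\<Sum>x\<in>grid L. (norm (?P x))\<^sup>2) = complex_of_real (2 ^ L * (\<Sum>s\<in>T. (norm (c s))\<^sup>2))"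
    by simp
  then show ?thesis by (simp only: of_real_eq_iff)
qed

lemma sum_norm_freq_proj:
  assumes "finite T" "\<And>s r. s \<in> T \<Longrightarrow> r \<in> T \<Longrightarrow> \<bar>s - r\<bar> < 2 ^ L"
  shows "(\<Sum>x\<in>grid L. (norm (freq_proj L T f x))\<^sup>2) = 2 ^ L * (\<Sum>s\<in>T. (norm (dft L f s))\<^sup>2)"
  unfolding freq_proj_def by (rule parseval_trig_poly[OF assms])

text \<open>Expand the square of the distance from \<open>f\<close> to its frequency projection; the
  cross term is the energy of the projection.\<close>

lemma bessel_dft:
  assumes "finite T" "\<And>s r. s \<in> T \<Longrightarrow> r \<in> T \<Longrightarrow> \<bar>s - r\<bar> < 2 ^ L"
  shows "2 ^ L * (\<Sum>s\<in>T. (norm (dft L f s))\<^sup>2) \<le> (\<Sum>x\<in>grid L. (norm (f x))\<^sup>2)"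
proof -
  let ?P = "freq_proj L T f"
  define E where "E = 2 ^ L * (\<Sum>s\<in>T. (norm (dft L f s))\<^sup>2)"
  have cross: "(\<Sum>x\<in>grid L. Re (f x * cnj (?P x))) = E"
  proof -
    have "complex_of_real E = 2 ^ L * (\<Sum>s\<in>T. dft L f s * cnj (dft L f s))"
      by (simp add: E_def complex_norm_square[symmetric])
    also have "\<dots> = (\<Sum>x\<in>grid L. f x * cnj (?P x))"
      unfolding freq_proj_def by (rule sum_mult_cnj_trig_poly[symmetric])
    finally have "Re (complex_of_real E) = Re (\<Sum>x\<in>grid L. f x * cnj (?P x))" by simp
    then show ?thesis by (simp only: Re_sum Re_complex_of_real)
  qed
  have sq: "(norm (a - b))\<^sup>2 = (norm a)\<^sup>2 - 2 * Re (a * cnj b) + (norm b)\<^sup>2" for a b :: complex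
    by (simp only: cmod_power2) (simp add: power2_eq_square algebra_simps)
  have "0 \<le> (\<Sum>x\<in>grid L. (norm (f x - ?P x))\<^sup>2)" by (intro sum_nonneg) simp
  also have "\<dots> = (\<Sum>x\<in>grid L. (norm (f x))\<^sup>2) - 2 * (\<Sum>x\<in>grid L. Re (f x * cnj (?P x))) + (\<Sum>x\<in>grid L. (norm (?P x))\<^sup>2)"
    by (simp only: sq sum.distrib sum_subtractf sum_distrib_left)
  also have "\<dots> = (\<Sum>x\<in>grid L. (norm (f x))\<^sup>2) - E"
    by (simp only: cross sum_norm_freq_proj[OF assms]) (simp add: E_def)
  finally show ?thesis by (simp add: E_def)
qed

section \<open>The trilinear form\<close>

lemma sum4_swap:
  "(\<Sum>s\<in>S. \<Sum>t\<in>T. \<Sum>y\<in>Y. \<Sum>z\<in>Z. F s t y z) = (\<Sum>y\<in>Y. \<Sum>z\<in>Z. \<Sum>s\<in>S. \<Sum>t\<in>T. F s t y z)"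
proof -
  have "(\<Sum>s\<in>S. \<Sum>t\<in>T. \<Sum>y\<in>Y. \<Sum>z\<in>Z. F s t y z) = (\<Sum>s\<in>S. \<Sum>y\<in>Y. \<Sum>t\<in>T. \<Sum>z\<in>Z. F s t y z)"
    by (rule sum.cong[OF refl], rule sum.swap)
  also have "\<dots> = (\<Sum>y\<in>Y. \<Sum>s\<in>S. \<Sum>t\<in>T. \<Sum>z\<in>Z. F s t y z)" by (rule sum.swap)
  also have "\<dots> = (\<Sum>y\<in>Y. \<Sum>s\<in>S. \<Sum>z\<in>Z. \<Sum>t\<in>T. F s t y z)"
    by (rule sum.cong[OF refl], rule sum.cong[OF refl], rule sum.swap)
  also have "\<dots> = (\<Sum>y\<in>Y. \<Sum>z\<in>Z. \<Sum>s\<in>S. \<Sum>t\<in>T. F s t y z)"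
    by (rule sum.cong[OF refl], rule sum.swap)
  finally show ?thesis .
qed

definition trilinear :: "int \<Rightarrow> nat \<Rightarrow> (int \<Rightarrow> int \<Rightarrow> complex) \<Rightarrow> (int \<Rightarrow> complex) \<Rightarrow> (int \<Rightarrow> complex) \<Rightarrow> (int \<Rightarrow> complex) \<Rightarrow> complex" where
  "trilinear B L a f g h = (\<Sum>s\<in>{- B..B}. \<Sum>t\<in>{- B..B}. a s t * dft L f s * dft L g t * dft L h (- s - t))"

lemma bilin_circle_kernel:
  "bilin L (circle_kernel B L a) f g x =
    (\<Sum>s\<in>{- B..B}. \<Sum>t\<in>{- B..B}. a s t * dft L f s * dft L g t * unit_root L ((s + t) * x))"
proof -
  let ?F = "\<lambda>s t y z. a s t * unit_root L (s * (x - y) + t * (x - z)) * f y * g z"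
  have ur: "unit_root L (s * (x - y) + t * (x - z)) = unit_root L ((s + t) * x) * unit_root L (- (s * y)) * unit_root L (- (t * z))" for s t y z
    by (simp add: unit_root_add[symmetric] algebra_simps)
  have "(\<Sum>y\<in>grid L. \<Sum>z\<in>grid L. circle_kernel B L a x y z * f y * g z) =
      (\<Sum>y\<in>grid L. \<Sum>z\<in>grid L. \<Sum>s\<in>{- B..B}. \<Sum>t\<in>{- B..B}. ?F s t y z)"
    by (simp only: circle_kernel_def grid_kernel_def sum_distrib_right)
  also have "\<dots> = (\<Sum>s\<in>{- B..B}. \<Sum>t\<in>{- B..B}. \<Sum>y\<in>grid L. \<Sum>z\<in>grid L. ?F s t y z)"
    by (rule sum4_swap[symmetric])
  also have "\<dots> = (\<Sum>s\<in>{- B..B}. \<Sum>t\<in>{- B..B}. (2 ^ L)\<^sup>2 * (a s t * dft L f s * dft L g t * unit_root L ((s + t) * x)))"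
  proof (intro sum.cong refl)
    fix s t
    have "(\<Sum>y\<in>grid L. \<Sum>z\<in>grid L. ?F s t y z) =
        (\<Sum>y\<in>grid L. \<Sum>z\<in>grid L. (a s t * unit_root L ((s + t) * x)) * ((f y * unit_root L (- (s * y))) * (g z * unit_root L (- (t * z)))))"
      by (intro sum.cong refl) (simp only: ur mult.assoc mult.commute mult.left_commute)
    also have "\<dots> = (a s t * unit_root L ((s + t) * x)) *
        ((\<Sum>y\<in>grid L. f y * unit_root L (- (s * y))) * (\<Sum>z\<in>grid L. g z * unit_root L (- (t * z))))"
      by (subst sum_product) (simp only: sum_distrib_left)
    also have "\<dots> = (2 ^ L)\<^sup>2 * (a s t * dft L f s * dft L g t * unit_root L ((s + t) * x))"
      by (simp add: dft_def power2_eq_square)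
    finally show "(\<Sum>y\<in>grid L. \<Sum>z\<in>grid L. ?F s t y z) = (2 ^ L)\<^sup>2 * (a s t * dft L f s * dft L g t * unit_root L ((s + t) * x))" .
  qed
  also have "\<dots> = (2 ^ L)\<^sup>2 * (\<Sum>s\<in>{- B..B}. \<Sum>t\<in>{- B..B}. a s t * dft L f s * dft L g t * unit_root L ((s + t) * x))"
    by (simp only: sum_distrib_left)
  finally show ?thesis by (simp add: bilin_def)
qed

lemma sum_bilin_circle_kernel:
  "(\<Sum>x\<in>grid L. bilin L (circle_kernel B L a) f g x * h x) = 2 ^ L * trilinear B L a f g h"
proof -
  have "(\<Sum>x\<in>grid L. bilin L (circle_kernel B L a) f g x * h x) =
      (\<Sum>x\<in>grid L. \<Sum>s\<in>{- B..B}. \<Sum>t\<in>{- B..B}. a s t * dft L f s * dft L g t * (h x * unit_root L ((s + t) * x)))"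
    unfolding bilin_circle_kernel sum_distrib_right
    by (intro sum.cong refl) (simp only: mult.assoc mult.commute mult.left_commute)
  also have "\<dots> = (\<Sum>s\<in>{- B..B}. \<Sum>x\<in>grid L. \<Sum>t\<in>{- B..B}. a s t * dft L f s * dft L g t * (h x * unit_root L ((s + t) * x)))"
    by (rule sum.swap)
  also have "\<dots> = (\<Sum>s\<in>{- B..B}. \<Sum>t\<in>{- B..B}. \<Sum>x\<in>grid L. a s t * dft L f s * dft L g t * (h x * unit_root L ((s + t) * x)))"
    by (rule sum.cong[OF refl], rule sum.swap)
  also have "\<dots> = (\<Sum>s\<in>{- B..B}. \<Sum>t\<in>{- B..B}. 2 ^ L * (a s t * dft L f s * dft L g t * dft L h (- s - t)))"
  proof (intro sum.cong refl)
    fix s t :: int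
    have e: "(s + t) * x = - ((- s - t) * x)" for x by (simp add: algebra_simps)
    have "(\<Sum>x\<in>grid L. h x * unit_root L ((s + t) * x)) = 2 ^ L * dft L h (- s - t)"
      by (simp only: e dft_def) simp
    then show "(\<Sum>x\<in>grid L. a s t * dft L f s * dft L g t * (h x * unit_root L ((s + t) * x))) =
        2 ^ L * (a s t * dft L f s * dft L g t * dft L h (- s - t))"
      by (simp add: sum_distrib_left[symmetric])
  qed
  finally show ?thesis by (simp only: trilinear_def sum_distrib_left)
qed

text \<open>An approximate identity of width 1 / R on the circle; its mass is bounded uniformly in
  the scale by \<open>sum_scale_weight_le\<close>.\<close>

definition scale_weight :: "nat \<Rightarrow> nat \<Rightarrow> int \<Rightarrow> real" where
  "scale_weight R L u = real R / (1 + (real R * norm (1 - unit_root L u))\<^sup>2)"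

lemma scale_weight_nonneg: "0 \<le> scale_weight R L u"
  by (simp add: scale_weight_def)

lemma scale_weight_uminus: "scale_weight R L (x - y) = scale_weight R L (y - x)"
  using norm_unit_root_minus_1_uminus[of L "x - y"] by (simp add: scale_weight_def)

text \<open>The last level \<open>i\<close> at which the points are near fixes their distance from
  below. Quadratic decay turns 2 ^ j into 2 ^ i with a loss geometric in j - i; for
  \<open>j \<le> i\<close> the trivial bound 2 ^ j is enough.\<close>

lemma scale_weight_le_near:
  assumes "j \<le> L" "x \<in> grid L" "y \<in> grid L"
  shows "scale_weight (2 ^ j) L (x - y) \<le> (\<Sum>i\<le>L. 4 * 2 ^ i * (1 / 2) ^ ((i - j) + (j - i)) * of_bool (near L i x y))"
proof -
  let ?w = "scale_weight (2 ^ j) L (x - y)" and ?c = "\<lambda>i. 4 * 2 ^ i * (1 / 2 :: real) ^ ((i - j) + (j - i))"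
  have wj: "?w \<le> 2 ^ j"
    by (simp add: scale_weight_def divide_le_eq add_pos_nonneg)
  have below: "2 ^ j \<le> ?c i" if "j \<le> i" for i
  proof -
    obtain l where l: "i = j + l" using \<open>j \<le> i\<close> le_Suc_ex by blast
    have "(2::real) ^ l * (1 / 2) ^ l = 1" by (simp flip: power_mult_distrib)
    then have "?c i = 4 * 2 ^ j" by (simp add: l power_add)
    then show ?thesis using zero_le_power[of "2::real" j] by linarith
  qed
  have "\<exists>i\<le>L. near L i x y \<and> ?w \<le> ?c i"
  proof (cases "near L L x y")
    case True
    then show ?thesis using wj below[OF assms(1)] by (intro exI[of _ L]) auto
  next
    case False
    obtain i where i: "i < L" "near L i x y" "\<not> near L (Suc i) x y"
      using obtain_last_level[of "\<lambda>i. near L i x y" L] False by auto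
    have "?w \<le> ?c i"
    proof (cases "j \<le> i")
      case True
      then show ?thesis using wj below by fastforce
    next
      case False
      then obtain l where l: "j = i + l" using le_Suc_ex[of i j] by auto
      have d: "(1 / 2) ^ Suc i \<le> norm (1 - unit_root L (x - y))"
        by (rule not_near_unit_root[OF i(3) assms(2,3)]) (use i in simp)
      have "2 ^ j * (1 / 2 :: real) ^ Suc i = 2 ^ l / 2"
        by (simp add: l power_add power_one_over)
      then have "2 ^ l / 2 \<le> 2 ^ j * norm (1 - unit_root L (x - y))"
        using d by (metis mult_left_mono zero_le_numeral zero_le_power)
      then have "(2 ^ l / 2)\<^sup>2 \<le> (2 ^ j * norm (1 - unit_root L (x - y)))\<^sup>2" by (intro power_mono) auto
      then have "?w \<le> 2 ^ j / (2 ^ l / 2)\<^sup>2"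
        unfolding scale_weight_def by (intro frac_le) (auto simp: add_increasing)
      also have "\<dots> = ?c i"
        by (simp add: l power_add power2_eq_square power_one_over field_simps)
      finally show ?thesis .
    qed
    then show ?thesis using i by (intro exI[of _ i]) auto
  qed
  then obtain i where i: "i \<le> L" "near L i x y" "?w \<le> ?c i" by blast
  have "?c i * of_bool (near L i x y) \<le> (\<Sum>i\<le>L. ?c i * of_bool (near L i x y))"
    by (rule member_le_sum[of i "{..L}" "\<lambda>i. ?c i * of_bool (near L i x y)"]) (use i in auto)
  then show ?thesis using i by simp
qed

lemma sum_scale_weight_le:
  assumes "j \<le> L" "x \<in> grid L"
  shows "(\<Sum>y\<in>grid L. scale_weight (2 ^ j) L (x - y)) \<le> 36 * 2 ^ L"
proof -
  let ?c = "\<lambda>i. 4 * 2 ^ i * (1 / 2 :: real) ^ ((i - j) + (j - i))"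
  have "(\<Sum>y\<in>grid L. scale_weight (2 ^ j) L (x - y)) \<le> (\<Sum>y\<in>grid L. \<Sum>i\<le>L. ?c i * of_bool (near L i x y))"
    by (intro sum_mono scale_weight_le_near assms)
  also have "\<dots> = (\<Sum>i\<le>L. \<Sum>y\<in>grid L. ?c i * of_bool (near L i x y))" by (rule sum.swap)
  also have "\<dots> = (\<Sum>i\<le>L. ?c i * (\<Sum>y\<in>grid L. of_bool (near L i x y)))" by (simp only: sum_distrib_left)
  also have "\<dots> \<le> (\<Sum>i\<le>L. 12 * 2 ^ L * (1 / 2) ^ ((i - j) + (j - i)))"
  proof (rule sum_mono)
    fix i assume "i \<in> {..L}"
    then have i: "i \<le> L" by simp
    then have e: "(2::real) ^ L = 2 ^ i * 2 ^ (L - i)" by (simp flip: power_add)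
    have "?c i * (\<Sum>y\<in>grid L. of_bool (near L i x y)) \<le> ?c i * (3 * 2 ^ (L - i))"
      by (intro mult_left_mono sum_of_bool_near_le assms i) auto
    also have "\<dots> = 12 * 2 ^ L * (1 / 2) ^ ((i - j) + (j - i))" by (simp add: e)
    finally show "?c i * (\<Sum>y\<in>grid L. of_bool (near L i x y)) \<le> 12 * 2 ^ L * (1 / 2) ^ ((i - j) + (j - i))" .
  qed
  also have "\<dots> = 12 * 2 ^ L * (\<Sum>i\<le>L. (1 / 2) ^ ((j - i) + (i - j)))"
    by (simp only: sum_distrib_left add.commute)
  also have "\<dots> \<le> 12 * 2 ^ L * 3" by (intro mult_left_mono sum_half_dist) auto
  finally show ?thesis by simp
qed

text \<open>Schur test: row and column sums of the weight are at most 36 * 2 ^ L, and 1296 = 36 *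
  36.\<close>

lemma sum_weighted_le:
  fixes \<phi> :: "int \<Rightarrow> real"
  assumes j: "j \<le> L" and \<phi>: "\<And>x. 0 \<le> \<phi> x"
  defines "w \<equiv> scale_weight (2 ^ j) L"
  shows "(\<Sum>x\<in>grid L. \<Sum>y\<in>grid L. \<Sum>z\<in>grid L. w (x - y) * w (x - z) * \<phi> x) \<le> 1296 * (2 ^ L)\<^sup>2 * (\<Sum>x\<in>grid L. \<phi> x)"
    and "(\<Sum>x\<in>grid L. \<Sum>y\<in>grid L. \<Sum>z\<in>grid L. w (x - y) * w (x - z) * \<phi> y) \<le> 1296 * (2 ^ L)\<^sup>2 * (\<Sum>x\<in>grid L. \<phi> x)"
    and "(\<Sum>x\<in>grid L. \<Sum>y\<in>grid L. \<Sum>z\<in>grid L. w (x - y) * w (x - z) * \<phi> z) \<le> 1296 * (2 ^ L)\<^sup>2 * (\<Sum>x\<in>grid L. \<phi> x)"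
proof -
  define W where "W = (36 * 2 ^ L :: real)"
  have w0: "0 \<le> w u" for u by (simp add: w_def scale_weight_nonneg)
  have row: "(\<Sum>y\<in>grid L. w (x - y)) \<le> W" if "x \<in> grid L" for x
    unfolding w_def W_def by (rule sum_scale_weight_le[OF j that])
  have col: "(\<Sum>x\<in>grid L. w (x - y)) \<le> W" if "y \<in> grid L" for y
    using row[OF that] by (simp add: w_def scale_weight_uminus[of _ L _ y])
  have W0: "0 \<le> W" by (simp add: W_def)
  have W2: "W * W * S = 1296 * (2 ^ L)\<^sup>2 * S" for S by (simp add: W_def power2_eq_square)
  have "(\<Sum>x\<in>grid L. \<Sum>y\<in>grid L. \<Sum>z\<in>grid L. w (x - y) * w (x - z) * \<phi> x) =
      (\<Sum>x\<in>grid L. \<phi> x * ((\<Sum>y\<in>grid L. w (x - y)) * (\<Sum>z\<in>grid L. w (x - z))))"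
    by (simp only: sum_product sum_distrib_left mult.commute)
  also have "\<dots> \<le> (\<Sum>x\<in>grid L. \<phi> x * (W * W))"
    by (intro sum_mono mult_left_mono mult_mono row \<phi> W0 sum_nonneg w0)
  also have "\<dots> = W * W * (\<Sum>x\<in>grid L. \<phi> x)" by (simp only: sum_distrib_left mult.commute)
  finally show "(\<Sum>x\<in>grid L. \<Sum>y\<in>grid L. \<Sum>z\<in>grid L. w (x - y) * w (x - z) * \<phi> x) \<le> 1296 * (2 ^ L)\<^sup>2 * (\<Sum>x\<in>grid L. \<phi> x)"
    unfolding W2 .
  have y: "(\<Sum>x\<in>grid L. \<Sum>y\<in>grid L. \<Sum>z\<in>grid L. w (x - y) * w (x - z) * \<phi> y) \<le> W * W * (\<Sum>x\<in>grid L. \<phi> x)"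
  proof -
    have "(\<Sum>x\<in>grid L. \<Sum>y\<in>grid L. \<Sum>z\<in>grid L. w (x - y) * w (x - z) * \<phi> y) =
        (\<Sum>x\<in>grid L. \<Sum>y\<in>grid L. \<phi> y * w (x - y) * (\<Sum>z\<in>grid L. w (x - z)))"
      by (simp only: sum_distrib_left mult.assoc mult.commute mult.left_commute)
    also have "\<dots> \<le> (\<Sum>x\<in>grid L. \<Sum>y\<in>grid L. \<phi> y * w (x - y) * W)"
      by (intro sum_mono mult_left_mono mult_nonneg_nonneg row \<phi> w0)
    also have "\<dots> = (\<Sum>y\<in>grid L. \<Sum>x\<in>grid L. \<phi> y * w (x - y) * W)" by (rule sum.swap)
    also have "\<dots> = (\<Sum>y\<in>grid L. \<phi> y * W * (\<Sum>x\<in>grid L. w (x - y)))"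
      by (simp only: sum_distrib_left mult.assoc mult.commute mult.left_commute)
    also have "\<dots> \<le> (\<Sum>y\<in>grid L. \<phi> y * W * W)"
      by (intro sum_mono mult_left_mono mult_nonneg_nonneg col \<phi> W0)
    also have "\<dots> = W * W * (\<Sum>x\<in>grid L. \<phi> x)"
      by (simp only: sum_distrib_left mult.assoc mult.commute mult.left_commute)
    finally show ?thesis .
  qed
  then show "(\<Sum>x\<in>grid L. \<Sum>y\<in>grid L. \<Sum>z\<in>grid L. w (x - y) * w (x - z) * \<phi> y) \<le> 1296 * (2 ^ L)\<^sup>2 * (\<Sum>x\<in>grid L. \<phi> x)"
    unfolding W2 .
  have "(\<Sum>x\<in>grid L. \<Sum>y\<in>grid L. \<Sum>z\<in>grid L. w (x - y) * w (x - z) * \<phi> z) =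
      (\<Sum>x\<in>grid L. \<Sum>z\<in>grid L. \<Sum>y\<in>grid L. w (x - z) * w (x - y) * \<phi> z)"
    by (rule sum.cong[OF refl], subst sum.swap) (simp only: mult.commute)
  with y show "(\<Sum>x\<in>grid L. \<Sum>y\<in>grid L. \<Sum>z\<in>grid L. w (x - y) * w (x - z) * \<phi> z) \<le> 1296 * (2 ^ L)\<^sup>2 * (\<Sum>x\<in>grid L. \<phi> x)"
    unfolding W2 by simp
qed

text \<open>An absolute estimate: the kernel is replaced by the product of two weights. The form of
  \<open>dom\<close> leaves open which two of the three functions are paired by squares.\<close>

lemma norm_trilinear_le:
  assumes a: "symbol c A (2 ^ j) a" and c: "c \<ge> 1" and B: "132 * 2 ^ j \<le> B" and j: "j \<le> L"
    and dom: "\<And>x y z. x \<in> grid L \<Longrightarrow> y \<in> grid L \<Longrightarrow> z \<in> grid L \<Longrightarrow>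
      norm (f y) * norm (g z) * norm (h x) \<le> \<alpha> x + \<beta> y + \<gamma> z"
    and pos: "\<And>x. 0 \<le> \<alpha> x" "\<And>x. 0 \<le> \<beta> x" "\<And>x. 0 \<le> \<gamma> x"
  shows "2 ^ L * norm (trilinear B L a f g h) \<le>
    4 * 70225 * A * c ^ 4 * 1296 * ((\<Sum>x\<in>grid L. \<alpha> x) + (\<Sum>x\<in>grid L. \<beta> x) + (\<Sum>x\<in>grid L. \<gamma> x))"
proof -
  define w where "w = scale_weight (2 ^ j) L"
  define M where "M = 4 * 70225 * A * c ^ 4"
  have A: "0 \<le> A" using symbol_norm_le[OF a, of 0 0] norm_ge_zero order_trans by blast
  have M: "0 \<le> M" using A by (simp add: M_def)
  have w0: "0 \<le> w u" for u by (simp add: w_def scale_weight_nonneg)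
  have K: "norm (circle_kernel B L a x y z) \<le> M * (w (x - y) * w (x - z))" for x y z
  proof -
    have "(1::nat) \<le> 2 ^ j" "132 * int (2 ^ j) \<le> B" using B by auto
    from kernel_product_bound[OF a this c, of L "x - y" "x - z"] show ?thesis
      by (simp add: circle_kernel_def M_def w_def scale_weight_def mult.assoc)
  qed
  have "(\<Sum>x\<in>grid L. bilin L (circle_kernel B L a) f g x * h x) * (2 ^ L)\<^sup>2 =
      (\<Sum>x\<in>grid L. \<Sum>y\<in>grid L. \<Sum>z\<in>grid L. circle_kernel B L a x y z * f y * g z * h x)"
    by (simp add: bilin_def sum_divide_distrib[symmetric]) (simp only: sum_distrib_right)
  then have "2 ^ L * norm (trilinear B L a f g h) * (2 ^ L)\<^sup>2 =
      norm (\<Sum>x\<in>grid L. \<Sum>y\<in>grid L. \<Sum>z\<in>grid L. circle_kernel B L a x y z * f y * g z * h x)"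
  proof -
    assume eq: "(\<Sum>x\<in>grid L. bilin L (circle_kernel B L a) f g x * h x) * (2 ^ L)\<^sup>2 =
      (\<Sum>x\<in>grid L. \<Sum>y\<in>grid L. \<Sum>z\<in>grid L. circle_kernel B L a x y z * f y * g z * h x)"
    have "2 ^ L * norm (trilinear B L a f g h) * (2 ^ L)\<^sup>2 = norm (2 ^ L * trilinear B L a f g h * (2 ^ L)\<^sup>2)"
      by (simp add: norm_mult norm_power)
    then show ?thesis unfolding eq[symmetric] sum_bilin_circle_kernel .
  qed
  also have "\<dots> \<le> (\<Sum>x\<in>grid L. \<Sum>y\<in>grid L. \<Sum>z\<in>grid L. norm (circle_kernel B L a x y z * f y * g z * h x))"
    by (intro order_trans[OF norm_sum] sum_mono norm_sum)
  also have "\<dots> \<le> (\<Sum>x\<in>grid L. \<Sum>y\<in>grid L. \<Sum>z\<in>grid L.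
      M * (w (x - y) * w (x - z) * \<alpha> x) + M * (w (x - y) * w (x - z) * \<beta> y) + M * (w (x - y) * w (x - z) * \<gamma> z))"
  proof (intro sum_mono)
    fix x y z assume g: "x \<in> grid L" "y \<in> grid L" "z \<in> grid L"
    have "norm (circle_kernel B L a x y z * f y * g z * h x) =
        norm (circle_kernel B L a x y z) * (norm (f y) * norm (g z) * norm (h x))"
      by (simp add: norm_mult)
    also have "\<dots> \<le> M * (w (x - y) * w (x - z)) * (\<alpha> x + \<beta> y + \<gamma> z)"
      by (intro mult_mono K dom g mult_nonneg_nonneg M w0 norm_ge_zero)
    finally show "norm (circle_kernel B L a x y z * f y * g z * h x) \<le>
        M * (w (x - y) * w (x - z) * \<alpha> x) + M * (w (x - y) * w (x - z) * \<beta> y) + M * (w (x - y) * w (x - z) * \<gamma> z)"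
      by (simp add: algebra_simps)
  qed
  also have "\<dots> = M * (\<Sum>x\<in>grid L. \<Sum>y\<in>grid L. \<Sum>z\<in>grid L. w (x - y) * w (x - z) * \<alpha> x) +
      M * (\<Sum>x\<in>grid L. \<Sum>y\<in>grid L. \<Sum>z\<in>grid L. w (x - y) * w (x - z) * \<beta> y) +
      M * (\<Sum>x\<in>grid L. \<Sum>y\<in>grid L. \<Sum>z\<in>grid L. w (x - y) * w (x - z) * \<gamma> z)"
    by (simp only: sum.distrib sum_distrib_left)
  also have "\<dots> \<le> M * (1296 * (2 ^ L)\<^sup>2 * (\<Sum>x\<in>grid L. \<alpha> x)) + M * (1296 * (2 ^ L)\<^sup>2 * (\<Sum>x\<in>grid L. \<beta> x)) +
      M * (1296 * (2 ^ L)\<^sup>2 * (\<Sum>x\<in>grid L. \<gamma> x))"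
    unfolding w_def by (intro add_mono mult_left_mono sum_weighted_le j pos M)
  also have "\<dots> = (M * 1296 * ((\<Sum>x\<in>grid L. \<alpha> x) + (\<Sum>x\<in>grid L. \<beta> x) + (\<Sum>x\<in>grid L. \<gamma> x))) * (2 ^ L)\<^sup>2"
    by (simp add: algebra_simps)
  finally show ?thesis unfolding M_def by (rule mult_right_le_imp_le) simp
qed

section \<open>Frequency bands and the sum over the scales\<close>

lemma mult_le_half_squares: "a * b \<le> a\<^sup>2 / 2 + b\<^sup>2 / (2::real)"
  using sum_squares_bound[of a b] by simp

text \<open>8 is the multiple of 2 ^ j up to which the splitting bump equals 1. For the upper end,
  144 = 128 + 16 bounds s + t when one frequency is below 128 * 2 ^ j and the other below 16 * 2 ^
  j.\<close>

definition band :: "nat \<Rightarrow> int set" where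
  "band j = {n. 8 * 2 ^ j \<le> \<bar>n\<bar> \<and> \<bar>n\<bar> \<le> 144 * 2 ^ j}"

lemma finite_band [simp]: "finite (band j)"
  by (rule finite_subset[of _ "{- (144 * 2 ^ j)..144 * 2 ^ j}"]) (auto simp: band_def)

definition band_energy :: "nat \<Rightarrow> nat \<Rightarrow> (int \<Rightarrow> complex) \<Rightarrow> real" where
  "band_energy L j f = 2 ^ L * (\<Sum>n\<in>band j. (norm (dft L f n))\<^sup>2)"

text \<open>The ratio 144 / 8 = 18 is below 2 ^ 5, so the bands containing \<open>n\<close> have
  indices among five consecutive numbers.\<close>

lemma card_bands: "n \<noteq> 0 \<Longrightarrow> card {j. j \<le> J \<and> n \<in> band j} \<le> 5"
proof -
  assume "n \<noteq> 0"
  let ?S = "{j. j \<le> J \<and> n \<in> band j}"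
  show "card ?S \<le> 5"
  proof (cases "?S = {}")
    case False
    define j0 where "j0 = Min ?S"
    have j0: "j0 \<in> ?S" unfolding j0_def by (rule Min_in) (use False in auto)
    have "?S \<subseteq> {j0..<j0 + 5}"
    proof
      fix j assume j: "j \<in> ?S"
      have le: "j0 \<le> j" unfolding j0_def by (rule Min_le) (use j in auto)
      have "8 * 2 ^ j \<le> 144 * (2::int) ^ j0" using j j0 by (auto simp: band_def)
      moreover have "(2::int) ^ (j0 + 5) = 32 * 2 ^ j0" by (simp add: power_add)
      ultimately have "(2::int) ^ j < 2 ^ (j0 + 5)"
        using zero_less_power[of "2::int" j0] by linarith
      then have "j < j0 + 5" by (rule power_less_imp_less_exp[rotated]) simp
      with le show "j \<in> {j0..<j0 + 5}" by simp
    qed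
    then have "card ?S \<le> card {j0..<j0 + 5}" by (rule card_mono[rotated]) simp
    then show ?thesis by simp
  next
    case True
    show ?thesis unfolding True by simp
  qed
qed

lemma sum_band_energy_le:
  assumes "J + 10 \<le> L"
  shows "(\<Sum>j\<le>J. band_energy L j f) \<le> 5 * (\<Sum>x\<in>grid L. (norm (f x))\<^sup>2)"
proof -
  define T where "T = {- (144 * 2 ^ J)..144 * (2::int) ^ J} - {0}"
  \<comment> \<open>The frequencies in all bands differ by at most 288 * 2 ^ J; ten extra levels of
    the grid exclude aliasing.\<close>
  have LJ: "1024 * 2 ^ J \<le> (2::int) ^ L"
    using power_increasing[OF assms, of "2::int"] by (simp add: power_add)
  have sub: "band j \<subseteq> T" if "j \<le> J" for j
  proof
    fix n assume "n \<in> band j"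
    then have n: "8 * 2 ^ j \<le> \<bar>n\<bar>" "\<bar>n\<bar> \<le> 144 * 2 ^ j" by (auto simp: band_def)
    have "(2::int) ^ j \<le> 2 ^ J" "(0::int) < 2 ^ j" using that by (auto intro: power_increasing)
    then have "\<bar>n\<bar> \<le> 144 * 2 ^ J" "n \<noteq> 0" using n by linarith+
    then show "n \<in> T" unfolding T_def by auto
  qed
  have "(\<Sum>j\<le>J. \<Sum>n\<in>band j. (norm (dft L f n))\<^sup>2) = (\<Sum>j\<le>J. \<Sum>n\<in>T. of_bool (n \<in> band j) * (norm (dft L f n))\<^sup>2)"
  proof (rule sum.cong[OF refl])
    fix j assume "j \<in> {..J}"
    then show "(\<Sum>n\<in>band j. (norm (dft L f n))\<^sup>2) = (\<Sum>n\<in>T. of_bool (n \<in> band j) * (norm (dft L f n))\<^sup>2)"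
      using sub[of j] by (intro sum.mono_neutral_cong_left) (auto simp: T_def)
  qed
  also have "\<dots> = (\<Sum>n\<in>T. (\<Sum>j\<le>J. of_bool (n \<in> band j)) * (norm (dft L f n))\<^sup>2)"
    by (subst sum.swap) (simp only: sum_distrib_right)
  also have "\<dots> \<le> (\<Sum>n\<in>T. 5 * (norm (dft L f n))\<^sup>2)"
  proof (intro sum_mono mult_right_mono)
    fix n assume "n \<in> T"
    then have "n \<noteq> 0" by (simp add: T_def)
    have "(\<Sum>j\<le>J. of_bool (n \<in> band j)) = real (card {j \<in> {..J}. n \<in> band j})"
      by (rule card_as_sum[symmetric]) simp
    also have "\<dots> \<le> 5" using card_bands[OF \<open>n \<noteq> 0\<close>, of J] by simp
    finally show "(\<Sum>j\<le>J. of_bool (n \<in> band j)) \<le> (5::real)" .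
  qed simp
  finally have "(\<Sum>j\<le>J. band_energy L j f) \<le> 2 ^ L * (\<Sum>n\<in>T. 5 * (norm (dft L f n))\<^sup>2)"
    unfolding band_energy_def sum_distrib_left[symmetric] by (rule mult_left_mono) simp
  also have "\<dots> = 5 * (2 ^ L * (\<Sum>n\<in>T. (norm (dft L f n))\<^sup>2))"
    by (simp only: sum_distrib_left mult.left_commute)
  also have "\<dots> \<le> 5 * (\<Sum>x\<in>grid L. (norm (f x))\<^sup>2)"
  proof (intro mult_left_mono bessel_dft)
    fix s r assume "s \<in> T" "r \<in> T"
    then have "\<bar>s\<bar> \<le> 144 * 2 ^ J" "\<bar>r\<bar> \<le> 144 * 2 ^ J" by (auto simp: T_def)
    moreover have "(0::int) < 2 ^ J" by simp
    ultimately show "\<bar>s - r\<bar> < 2 ^ L" using LJ by linarith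
  qed (auto simp: T_def)
  finally show ?thesis .
qed

context
  fixes L J j :: nat and A :: real and a :: "int \<Rightarrow> int \<Rightarrow> complex" and B :: int
  assumes jJ: "j \<le> J" and JL: "J + 10 \<le> L" and BJ: "132 * 2 ^ J \<le> B" and a: "symbol 8 A (2 ^ j) a"
begin

abbreviation (input) band_proj where "band_proj \<equiv> freq_proj L (band j)"

lemma power_bounds: "(2::int) ^ j \<le> 2 ^ J" "1024 * 2 ^ J \<le> (2::int) ^ L" "(0::int) < 2 ^ j" "j \<le> L" "132 * 2 ^ j \<le> B"
proof -
  show p: "(2::int) ^ j \<le> 2 ^ J" using jJ by (intro power_increasing) auto
  show "1024 * 2 ^ J \<le> (2::int) ^ L" using power_increasing[OF JL, of "2::int"] by (simp add: power_add)
  show "132 * 2 ^ j \<le> B" using p BJ by linarith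
qed (use jJ JL in auto)

lemma dft_band_proj:
  assumes "\<bar>r\<bar> \<le> 256 * 2 ^ j" "r \<in> band j"
  shows "dft L (band_proj f) r = dft L f r"
proof -
  have "dft L (band_proj f) r = (if r \<in> band j then dft L f r else 0)"
  proof (rule dft_freq_proj)
    fix s assume "s \<in> band j"
    then have "\<bar>s\<bar> \<le> 144 * 2 ^ j" by (simp add: band_def)
    then show "\<bar>s - r\<bar> < 2 ^ L" using power_bounds assms(1) by linarith
  qed simp
  then show ?thesis using assms by simp
qed

lemma band_proj_energy: "(\<Sum>x\<in>grid L. (norm (band_proj f x))\<^sup>2) = band_energy L j f"
  unfolding band_energy_def
proof (rule sum_norm_freq_proj)
  fix s r assume "s \<in> band j" "r \<in> band j"
  then have "\<bar>s\<bar> \<le> 144 * 2 ^ j" "\<bar>r\<bar> \<le> 144 * 2 ^ j" by (auto simp: band_def)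
  then show "\<bar>s - r\<bar> < 2 ^ L" using power_bounds by linarith
qed simp

lemma small_sum:
  assumes "a s t \<noteq> 0"
  shows "\<bar>s\<bar> \<le> 256 * 2 ^ j" "\<bar>t\<bar> \<le> 256 * 2 ^ j" "\<bar>- s - t\<bar> \<le> 256 * 2 ^ j"
proof -
  have "\<not> (\<bar>s\<bar> \<ge> 128 * int (2 ^ j) \<or> \<bar>t\<bar> \<ge> 128 * int (2 ^ j))" using a assms by (auto simp: symbol_def)
  then have "\<bar>s\<bar> < 128 * 2 ^ j" "\<bar>t\<bar> < 128 * 2 ^ j" by auto
  then show "\<bar>s\<bar> \<le> 256 * 2 ^ j" "\<bar>t\<bar> \<le> 256 * 2 ^ j" "\<bar>- s - t\<bar> \<le> 256 * 2 ^ j" by linarith+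
qed

text \<open>The symbol sees \<open>f\<close> and \<open>g\<close> only at frequencies in the band,
  so both may be replaced by their band projections, whose product is split into squares while
  \<open>h\<close> is bounded by 1. The next two lemmas treat the other pairs in the same
  way.\<close>

lemma trilinear_band_12:
  assumes "\<And>s t. a s t \<noteq> 0 \<Longrightarrow> s \<in> band j \<and> t \<in> band j" and h: "\<And>x. x \<in> grid L \<Longrightarrow> norm (h x) \<le> 1"
  shows "2 ^ L * norm (trilinear B L a f g h) \<le> 4 * 70225 * A * 8 ^ 4 * 1296 * (band_energy L j f / 2 + band_energy L j g / 2)"
proof -
  have "trilinear B L a f g h = trilinear B L a (band_proj f) (band_proj g) h"
    unfolding trilinear_def
    by (intro sum.cong refl) (metis (no_types, lifting) assms(1) dft_band_proj small_sum(1,2) mult_eq_0_iff)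
  also have "2 ^ L * norm \<dots> \<le> 4 * 70225 * A * 8 ^ 4 * 1296 * ((\<Sum>x\<in>grid L. 0) + (\<Sum>x\<in>grid L. (norm (band_proj f x))\<^sup>2 / 2) + (\<Sum>x\<in>grid L. (norm (band_proj g x))\<^sup>2 / 2))"
  proof (rule norm_trilinear_le[OF a])
    fix x y z assume "x \<in> grid L"
    have "norm (band_proj f y) * norm (band_proj g z) * norm (h x) \<le> norm (band_proj f y) * norm (band_proj g z) * 1"
      by (intro mult_left_mono h \<open>x \<in> grid L\<close>) auto
    also have "\<dots> \<le> 0 + (norm (band_proj f y))\<^sup>2 / 2 + (norm (band_proj g z))\<^sup>2 / 2"
      using mult_le_half_squares[of "norm (band_proj f y)" "norm (band_proj g z)"] by simp
    finally show "norm (band_proj f y) * norm (band_proj g z) * norm (h x) \<le> 0 + (norm (band_proj f y))\<^sup>2 / 2 + (norm (band_proj g z))\<^sup>2 / 2" .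
  qed (use power_bounds in auto)
  finally show ?thesis by (simp only: sum_divide_distrib[symmetric] band_proj_energy) simp
qed

lemma trilinear_band_23:
  assumes "\<And>s t. a s t \<noteq> 0 \<Longrightarrow> t \<in> band j \<and> - s - t \<in> band j" and f: "\<And>x. x \<in> grid L \<Longrightarrow> norm (f x) \<le> 1"
  shows "2 ^ L * norm (trilinear B L a f g h) \<le> 4 * 70225 * A * 8 ^ 4 * 1296 * (band_energy L j g / 2 + band_energy L j h / 2)"
proof -
  have "trilinear B L a f g h = trilinear B L a f (band_proj g) (band_proj h)"
    unfolding trilinear_def
    by (intro sum.cong refl) (metis (no_types, lifting) assms(1) dft_band_proj small_sum(2,3) mult_eq_0_iff)
  also have "2 ^ L * norm \<dots> \<le> 4 * 70225 * A * 8 ^ 4 * 1296 * ((\<Sum>x\<in>grid L. (norm (band_proj h x))\<^sup>2 / 2) + (\<Sum>x\<in>grid L. 0) + (\<Sum>x\<in>grid L. (norm (band_proj g x))\<^sup>2 / 2))"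
  proof (rule norm_trilinear_le[OF a])
    fix x y z assume "y \<in> grid L"
    have "norm (f y) * (norm (band_proj g z) * norm (band_proj h x)) \<le> 1 * (norm (band_proj g z) * norm (band_proj h x))"
      by (intro mult_right_mono f \<open>y \<in> grid L\<close>) auto
    also have "\<dots> \<le> (norm (band_proj h x))\<^sup>2 / 2 + 0 + (norm (band_proj g z))\<^sup>2 / 2"
      using mult_le_half_squares[of "norm (band_proj g z)" "norm (band_proj h x)"] by simp
    finally show "norm (f y) * norm (band_proj g z) * norm (band_proj h x) \<le> (norm (band_proj h x))\<^sup>2 / 2 + 0 + (norm (band_proj g z))\<^sup>2 / 2"
      by (simp only: mult.assoc)
  qed (use power_bounds in auto)
  finally show ?thesis by (simp only: sum_divide_distrib[symmetric] band_proj_energy) (simp add: add.commute)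
qed

lemma trilinear_band_13:
  assumes "\<And>s t. a s t \<noteq> 0 \<Longrightarrow> s \<in> band j \<and> - s - t \<in> band j" and g: "\<And>x. x \<in> grid L \<Longrightarrow> norm (g x) \<le> 1"
  shows "2 ^ L * norm (trilinear B L a f g h) \<le> 4 * 70225 * A * 8 ^ 4 * 1296 * (band_energy L j f / 2 + band_energy L j h / 2)"
proof -
  have "trilinear B L a f g h = trilinear B L a (band_proj f) g (band_proj h)"
    unfolding trilinear_def
    by (intro sum.cong refl) (metis (no_types, lifting) assms(1) dft_band_proj small_sum(1,3) mult_eq_0_iff)
  also have "2 ^ L * norm \<dots> \<le> 4 * 70225 * A * 8 ^ 4 * 1296 * ((\<Sum>x\<in>grid L. (norm (band_proj h x))\<^sup>2 / 2) + (\<Sum>x\<in>grid L. (norm (band_proj f x))\<^sup>2 / 2) + (\<Sum>x\<in>grid L. 0))"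
  proof (rule norm_trilinear_le[OF a])
    fix x y z assume "z \<in> grid L"
    have "norm (g z) * (norm (band_proj f y) * norm (band_proj h x)) \<le> 1 * (norm (band_proj f y) * norm (band_proj h x))"
      by (intro mult_right_mono g \<open>z \<in> grid L\<close>) auto
    also have "\<dots> \<le> (norm (band_proj h x))\<^sup>2 / 2 + (norm (band_proj f y))\<^sup>2 / 2 + 0"
      using mult_le_half_squares[of "norm (band_proj f y)" "norm (band_proj h x)"] by simp
    finally show "norm (band_proj f y) * norm (g z) * norm (band_proj h x) \<le> (norm (band_proj h x))\<^sup>2 / 2 + (norm (band_proj f y))\<^sup>2 / 2 + 0"
      by (simp only: mult.assoc mult.left_commute)
  qed (use power_bounds in auto)
  finally show ?thesis by (simp only: sum_divide_distrib[symmetric] band_proj_energy) (simp add: add.commute)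
qed

end

text \<open>The annulus is split according to which frequency is small: none, s, or t. If s is
  small, then t is not, and hence neither is - s - t; so each part has two of the three frequencies
  in the band.\<close>

lemma cone_trilinear_le:
  assumes C: "0 \<le> C" and mm: "fdiff_decay C mm" "fdiff_decay C (\<lambda>s t. mm t s)" "\<And>s t. norm (mm s t) \<le> C"
    and JL: "J + 10 \<le> L" and BJ: "132 * 2 ^ J \<le> B" and j: "Suc i \<le> J"
    and bd: "\<And>x. x \<in> grid L \<Longrightarrow> norm (f x) \<le> 1 \<and> norm (g x) \<le> 1 \<and> norm (h x) \<le> 1"
  shows "2 ^ L * norm (trilinear B L (piece mm (Suc i)) f g h) \<le>
    4 * 70225 * (8 * C) * 8 ^ 4 * 1296 * (band_energy L (Suc i) f + band_energy L (Suc i) g + band_energy L (Suc i) h)"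
proof -
  define j where "j = Suc i"
  define R where "R = (2::nat) ^ j"
  define p where "p = piece mm j"
  define \<psi> where "\<psi> = bump R"
  define a1 where "a1 s t = p s t * (1 - \<psi> s) * (1 - \<psi> t)" for s t
  define a2 where "a2 s t = p s t * \<psi> s * 1" for s t
  define a3 where "a3 s t = p s t * 1 * \<psi> t" for s t
  define Q where "Q = 4 * 70225 * (8 * C) * 8 ^ 4 * (1296::real)"
  have R1: "1 \<le> R" by (simp add: R_def)
  have Ri: "int R = 2 ^ j" by (simp add: R_def)
  have sp: "symbol 4 (2 * C) R p" unfolding p_def R_def by (rule symbol_piece[OF C mm])
  have s1: "symbol 8 (8 * C) R a1"
    using symbol_mult_bumps[OF sp R1 smooth_seq_bump_2(2)[OF R1] smooth_seq_bump_2(2)[OF R1]]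
    by (simp add: a1_def[abs_def] \<psi>_def)
  have s2: "symbol 8 (8 * C) R a2"
    using symbol_mult_bumps[OF sp R1 smooth_seq_bump_2(1)[OF R1] smooth_seq_bump_2(3)[OF R1]]
    by (simp add: a2_def[abs_def] \<psi>_def)
  have s3: "symbol 8 (8 * C) R a3"
    using symbol_mult_bumps[OF sp R1 smooth_seq_bump_2(3)[OF R1] smooth_seq_bump_2(1)[OF R1]]
    by (simp add: a3_def[abs_def] \<psi>_def)
  have out: "\<bar>s\<bar> < 128 * 2 ^ j" "\<bar>t\<bar> < 128 * 2 ^ j" if "p s t \<noteq> 0" for s t
    using that piece_eq_0_outside[of j s t mm] unfolding p_def by (auto simp: not_le[symmetric])
  have inn: "32 * 2 ^ j < \<bar>s\<bar> \<or> 32 * 2 ^ j < \<bar>t\<bar>" if "p s t \<noteq> 0" for s t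
  proof (rule ccontr)
    assume "\<not> ?thesis"
    then have "\<bar>s\<bar> \<le> 64 * 2 ^ i" "\<bar>t\<bar> \<le> 64 * 2 ^ i" unfolding j_def power_Suc by linarith+
    then show False using that piece_eq_0_inside[of s i t mm] by (simp add: p_def j_def del: piece.simps)
  qed
  have lo: "\<bar>n\<bar> < 16 * 2 ^ j" if "\<psi> n \<noteq> 0" for n
    using that bump_eq_0[of R n] R1 Ri unfolding \<psi>_def by (auto simp: not_le[symmetric])
  have hi: "8 * 2 ^ j < \<bar>n\<bar>" if "1 - \<psi> n \<noteq> 0" for n
    using that bump_eq_1[of n R] R1 Ri unfolding \<psi>_def by (auto simp: not_le[symmetric])
  have b1: "s \<in> band j \<and> t \<in> band j" if "a1 s t \<noteq> 0" for s t
  proof -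
    have "p s t \<noteq> 0" "1 - \<psi> s \<noteq> 0" "1 - \<psi> t \<noteq> 0" using that by (auto simp: a1_def)
    then show ?thesis using out[of s t] hi[of s] hi[of t] unfolding band_def mem_Collect_eq by linarith
  qed
  have b2: "t \<in> band j \<and> - s - t \<in> band j" if "a2 s t \<noteq> 0" for s t
  proof -
    have "p s t \<noteq> 0" "\<psi> s \<noteq> 0" using that by (auto simp: a2_def)
    then show ?thesis using out[of s t] inn[of s t] lo[of s] unfolding band_def mem_Collect_eq by linarith
  qed
  have b3: "s \<in> band j \<and> - s - t \<in> band j" if "a3 s t \<noteq> 0" for s t
  proof -
    have "p s t \<noteq> 0" "\<psi> t \<noteq> 0" using that by (auto simp: a3_def)
    then show ?thesis using out[of s t] inn[of s t] lo[of t] unfolding band_def mem_Collect_eq by linarith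
  qed
  have split: "p s t = a1 s t + a2 s t + a3 s t" for s t
  proof -
    \<comment> \<open>The three parts add up to p plus this product. On the annulus some frequency
      exceeds 32 * 2 ^ j, while both bumps live below 16 * 2 ^ j.\<close>
    have "p s t * \<psi> s * \<psi> t = 0"
    proof (rule ccontr)
      assume "p s t * \<psi> s * \<psi> t \<noteq> 0"
      then have "p s t \<noteq> 0" "\<psi> s \<noteq> 0" "\<psi> t \<noteq> 0" by auto
      then show False using inn[of s t] lo[of s] lo[of t] by linarith
    qed
    then show ?thesis by (simp add: a1_def a2_def a3_def algebra_simps)
  qed
  have tri: "trilinear B L p f g h = trilinear B L a1 f g h + trilinear B L a2 f g h + trilinear B L a3 f g h"
    unfolding trilinear_def split by (simp only: distrib_right sum.distrib)
  have jJ: "j \<le> J" using j by (simp add: j_def)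
  have t1: "2 ^ L * norm (trilinear B L a1 f g h) \<le> Q * (band_energy L j f / 2 + band_energy L j g / 2)"
    unfolding Q_def by (rule trilinear_band_12[OF jJ JL BJ s1[unfolded R_def] b1]) (use bd in auto)
  have t2: "2 ^ L * norm (trilinear B L a2 f g h) \<le> Q * (band_energy L j g / 2 + band_energy L j h / 2)"
    unfolding Q_def by (rule trilinear_band_23[OF jJ JL BJ s2[unfolded R_def] b2]) (use bd in auto)
  have t3: "2 ^ L * norm (trilinear B L a3 f g h) \<le> Q * (band_energy L j f / 2 + band_energy L j h / 2)"
    unfolding Q_def by (rule trilinear_band_13[OF jJ JL BJ s3[unfolded R_def] b3]) (use bd in auto)
  have "norm (trilinear B L p f g h) \<le> norm (trilinear B L a1 f g h) + norm (trilinear B L a2 f g h) + norm (trilinear B L a3 f g h)"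
    unfolding tri using norm_triangle_ineq[of "trilinear B L a1 f g h + trilinear B L a2 f g h" "trilinear B L a3 f g h"]
      norm_triangle_ineq[of "trilinear B L a1 f g h" "trilinear B L a2 f g h"] by linarith
  then have "2 ^ L * norm (trilinear B L p f g h) \<le>
      2 ^ L * (norm (trilinear B L a1 f g h) + norm (trilinear B L a2 f g h) + norm (trilinear B L a3 f g h))"
    by (rule mult_left_mono) simp
  also have "\<dots> \<le> Q * (band_energy L j f / 2 + band_energy L j g / 2) + Q * (band_energy L j g / 2 + band_energy L j h / 2) +
      Q * (band_energy L j f / 2 + band_energy L j h / 2)"
    unfolding distrib_left[of "2 ^ L"] by (intro add_mono t1 t2 t3)
  also have "\<dots> = Q * (band_energy L j f + band_energy L j g + band_energy L j h)" by (simp add: algebra_simps)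
  finally show ?thesis unfolding Q_def p_def j_def .
qed

text \<open>The first summand serves the regularity estimates. In the second, 6 covers the overlap 5
  of the bands and the extra 1 / 2 from piece 0.\<close>

definition cz_const :: "real \<Rightarrow> real" where
  "cz_const C = 2 * kernel_const C + 6 * (4 * 70225 * (8 * C) * 8 ^ 4 * 1296)"

theorem cz_kernel_circle_kernel:
  assumes C: "0 \<le> C" and mm: "fdiff_decay C mm" "fdiff_decay C (\<lambda>s t. mm t s)" "\<And>s t. norm (mm s t) \<le> C"
    and JL: "J + 10 \<le> L" and BJ: "132 * 2 ^ J \<le> B"
  shows "cz_kernel (cz_const C) L (circle_kernel B L (truncated mm J))"
proof -
  define Q where "Q = 4 * 70225 * (8 * C) * 8 ^ 4 * (1296::real)"
  have Q: "0 \<le> Q" using C by (simp add: Q_def)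
  have cc: "cz_const C = 2 * kernel_const C + 6 * Q" by (simp add: cz_const_def Q_def)
  have K: "0 \<le> kernel_const C" by (rule kernel_const_nonneg[OF C])
  have weaken: "2 * kernel_const C / 2 ^ k * near_weight L k x y z \<le> cz_const C / 2 ^ k * near_weight L k x y z" for k x y z
    using Q near_weight_nonneg[of L k x y z] by (intro mult_right_mono divide_right_mono) (auto simp: cc)
  have reg: "(cell L k y = cell L k w \<and> \<not> near L k x y \<longrightarrow>
          norm (circle_kernel B L (truncated mm J) x y z - circle_kernel B L (truncated mm J) x w z) \<le> cz_const C / 2 ^ k * near_weight L k x y z) \<and>
       (cell L k z = cell L k w \<and> \<not> near L k x z \<longrightarrow>
          norm (circle_kernel B L (truncated mm J) x y z - circle_kernel B L (truncated mm J) x y w) \<le> cz_const C / 2 ^ k * near_weight L k x y z) \<and>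
       (cell L k x = cell L k w \<and> \<not> (near L k x y \<and> near L k x z) \<longrightarrow>
          norm (circle_kernel B L (truncated mm J) x y z - circle_kernel B L (truncated mm J) w y z) \<le> cz_const C / 2 ^ k * near_weight L k x y z)"
    if "k \<le> L" "x \<in> grid L" "y \<in> grid L" "z \<in> grid L" "w \<in> grid L" for k x y z w
    using circle_kernel_regular[OF C mm BJ that] order_trans[OF _ weaken] by metis
  have l2: "norm (\<Sum>x\<in>grid L. bilin L (circle_kernel B L (truncated mm J)) f g x * h x) \<le>
         cz_const C * (\<Sum>x\<in>grid L. (norm (f x))\<^sup>2 + (norm (g x))\<^sup>2 + (norm (h x))\<^sup>2)"
    if bd: "\<forall>x\<in>grid L. norm (f x) \<le> 1 \<and> norm (g x) \<le> 1 \<and> norm (h x) \<le> 1" for f g h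
  proof -
    define e where "e F = (\<Sum>x\<in>grid L. (norm (F x))\<^sup>2)" for F :: "int \<Rightarrow> complex"
    have e0: "0 \<le> e F" for F by (simp add: e_def sum_nonneg)
    have bE: "0 \<le> band_energy L j F" for j F by (simp add: band_energy_def sum_nonneg)
    have "trilinear B L (truncated mm J) f g h = (\<Sum>j\<le>J. trilinear B L (piece mm j) f g h)"
    proof -
      have "trilinear B L (truncated mm J) f g h =
          (\<Sum>s\<in>{- B..B}. \<Sum>t\<in>{- B..B}. \<Sum>j\<le>J. piece mm j s t * dft L f s * dft L g t * dft L h (- s - t))"
        by (simp only: trilinear_def truncated_eq_sum sum_distrib_right)
      also have "\<dots> = (\<Sum>s\<in>{- B..B}. \<Sum>j\<le>J. \<Sum>t\<in>{- B..B}. piece mm j s t * dft L f s * dft L g t * dft L h (- s - t))"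
        by (rule sum.cong[OF refl], rule sum.swap)
      also have "\<dots> = (\<Sum>j\<le>J. trilinear B L (piece mm j) f g h)"
        unfolding trilinear_def by (rule sum.swap)
      finally show ?thesis .
    qed
    then have "norm (\<Sum>x\<in>grid L. bilin L (circle_kernel B L (truncated mm J)) f g x * h x) =
        2 ^ L * norm (\<Sum>j\<le>J. trilinear B L (piece mm j) f g h)"
      unfolding sum_bilin_circle_kernel by (simp add: norm_mult norm_power)
    also have "\<dots> \<le> 2 ^ L * (\<Sum>j\<le>J. norm (trilinear B L (piece mm j) f g h))"
      by (intro mult_left_mono norm_sum) simp
    also have "\<dots> = (\<Sum>j\<le>J. 2 ^ L * norm (trilinear B L (piece mm j) f g h))" by (simp only: sum_distrib_left)
    also have "\<dots> \<le> (\<Sum>j\<le>J. Q * (band_energy L j f + band_energy L j g + band_energy L j h) +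
        (if j = 0 then Q * (e g / 2 + e h / 2) else 0))"
    proof (rule sum_mono)
      fix j assume j: "j \<in> {..J}"
      show "2 ^ L * norm (trilinear B L (piece mm j) f g h) \<le>
        Q * (band_energy L j f + band_energy L j g + band_energy L j h) + (if j = 0 then Q * (e g / 2 + e h / 2) else 0)"
      proof (cases j)
        case 0
        have s0: "symbol 4 (2 * C) (2 ^ 0) (piece mm 0)" by (rule symbol_piece[OF C mm])
        have "(1::int) \<le> 2 ^ J" by simp
        then have B0: "132 * 2 ^ 0 \<le> B" using BJ unfolding power_0 by linarith
        \<comment> \<open>Piece 0 contains low frequencies, so no band is available; being a single
          scale, it can be estimated absolutely.\<close>
        have "2 ^ L * norm (trilinear B L (piece mm 0) f g h) \<le> 4 * 70225 * (2 * C) * 4 ^ 4 * 1296 *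
            ((\<Sum>x\<in>grid L. (norm (h x))\<^sup>2 / 2) + (\<Sum>x\<in>grid L. 0) + (\<Sum>x\<in>grid L. (norm (g x))\<^sup>2 / 2))"
        proof (rule norm_trilinear_le[OF s0 _ B0])
          fix x y z assume "y \<in> grid L"
          have "norm (f y) * (norm (g z) * norm (h x)) \<le> 1 * (norm (g z) * norm (h x))"
            by (intro mult_right_mono) (use bd \<open>y \<in> grid L\<close> in auto)
          also have "\<dots> \<le> (norm (h x))\<^sup>2 / 2 + 0 + (norm (g z))\<^sup>2 / 2"
            using mult_le_half_squares[of "norm (g z)" "norm (h x)"] by simp
          finally show "norm (f y) * norm (g z) * norm (h x) \<le> (norm (h x))\<^sup>2 / 2 + 0 + (norm (g z))\<^sup>2 / 2"
            by (simp only: mult.assoc)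
        qed auto
        also have "\<dots> = 4 * 70225 * (2 * C) * 4 ^ 4 * 1296 * (e g / 2 + e h / 2)"
          by (simp add: e_def sum_divide_distrib add.commute)
        also have "\<dots> \<le> Q * (e g / 2 + e h / 2)"
          unfolding Q_def using C e0[of g] e0[of h] by (intro mult_right_mono) auto
        also have "\<dots> \<le> Q * (band_energy L 0 f + band_energy L 0 g + band_energy L 0 h) + Q * (e g / 2 + e h / 2)"
          using Q bE by (simp add: add_increasing)
        finally show ?thesis by (simp add: 0)
      next
        case (Suc i)
        have "Suc i \<le> J" using j Suc by simp
        from cone_trilinear_le[OF C mm JL BJ this, of f g h] bd show ?thesis
          unfolding Suc Q_def by (simp del: piece.simps)
      qed
    qed
    also have "\<dots> = Q * ((\<Sum>j\<le>J. band_energy L j f) + (\<Sum>j\<le>J. band_energy L j g) + (\<Sum>j\<le>J. band_energy L j h)) + Q * (e g / 2 + e h / 2)"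
      by (simp add: sum.distrib sum_distrib_left distrib_left)
    also have "\<dots> \<le> Q * (5 * e f + 5 * e g + 5 * e h) + Q * (e g / 2 + e h / 2)"
      unfolding e_def by (intro add_mono mult_left_mono sum_band_energy_le JL Q order_refl)
    also have "\<dots> \<le> 6 * Q * (e f + e g + e h)"
    proof -
      have "Q * (5 * e f + 5 * e g + 5 * e h + (e g / 2 + e h / 2)) \<le> Q * (6 * (e f + e g + e h))"
        using e0[of f] e0[of g] e0[of h] by (intro mult_left_mono Q) auto
      then show ?thesis by (simp add: algebra_simps)
    qed
    also have "\<dots> \<le> cz_const C * (e f + e g + e h)"
      using K e0 by (intro mult_right_mono add_nonneg_nonneg) (auto simp: cc)
    finally show ?thesis by (simp add: e_def sum.distrib)
  qed
  show ?thesis unfolding cz_kernel_def using reg l2 K Q cc by auto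
qed

section \<open>Trigonometric polynomials on the circle\<close>

lemma coifman_meyer_fdiff_decay:
  assumes "coifman_meyer m"
  obtains C where "0 \<le> C" "fdiff_decay C (\<lambda>s t. m (of_int s, of_int t))"
    "fdiff_decay C (\<lambda>s t. m (of_int t, of_int s))" "\<And>s t. norm (m (of_int s, of_int t)) \<le> C"
proof -
  obtain C1 where C1: "0 \<le> C1"
    "\<And>k s t R. \<lbrakk>k \<le> 4; 0 < R; \<And>u. real_of_int s \<le> u \<Longrightarrow> u \<le> real_of_int s + real k \<Longrightarrow> R \<le> max \<bar>u\<bar> \<bar>real_of_int t\<bar>\<rbrakk>
       \<Longrightarrow> norm ((fdiff ^^ k) (\<lambda>s. m (of_int s, of_int t)) s) \<le> C1 / R ^ k"
    "\<And>k s t R. \<lbrakk>k \<le> 4; 0 < R; \<And>u. real_of_int t \<le> u \<Longrightarrow> u \<le> real_of_int t + real k \<Longrightarrow> R \<le> max \<bar>real_of_int s\<bar> \<bar>u\<bar>\<rbrakk>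
       \<Longrightarrow> norm ((fdiff ^^ k) (\<lambda>t. m (of_int s, of_int t)) t) \<le> C1 / R ^ k"
    using coifman_meyer_fdiff_bound[OF assms] by blast
  obtain C2 where C2: "\<And>z. norm (m z) \<le> C2"
    using assms unfolding coifman_meyer_def bounded_iff by blast
  have "0 \<le> C2" using C2[of 0] norm_ge_zero order_trans by blast
  have w: "C1 / R ^ k \<le> (C1 + C2) / R ^ k" if "0 < R" for R :: real and k :: nat
    using that \<open>0 \<le> C2\<close> by (intro divide_right_mono) auto
  show thesis
  proof (rule that[of "C1 + C2"])
    show "0 \<le> C1 + C2" using C1(1) \<open>0 \<le> C2\<close> by simp
    show "norm (m (of_int s, of_int t)) \<le> C1 + C2" for s t using C2[of "(of_int s, of_int t)"] C1(1) by simp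
    show "fdiff_decay (C1 + C2) (\<lambda>s t. m (of_int s, of_int t))"
      unfolding fdiff_decay_def
    proof (intro allI impI, elim conjE)
      fix k :: nat and s t :: int and R :: real
      assume "k \<le> 4" "0 < R" "\<forall>u. real_of_int s \<le> u \<and> u \<le> real_of_int s + real k \<longrightarrow> R \<le> max \<bar>u\<bar> \<bar>real_of_int t\<bar>"
      then show "norm ((fdiff ^^ k) (\<lambda>s. m (of_int s, of_int t)) s) \<le> (C1 + C2) / R ^ k"
        by (intro order_trans[OF C1(2) w]) auto
    qed
    show "fdiff_decay (C1 + C2) (\<lambda>s t. m (of_int t, of_int s))"
      unfolding fdiff_decay_def
    proof (intro allI impI, elim conjE)
      fix k :: nat and s t :: int and R :: real
      assume "k \<le> 4" "0 < R" "\<forall>u. real_of_int s \<le> u \<and> u \<le> real_of_int s + real k \<longrightarrow> R \<le> max \<bar>u\<bar> \<bar>real_of_int t\<bar>"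
      then show "norm ((fdiff ^^ k) (\<lambda>s. m (of_int t, of_int s)) s) \<le> (C1 + C2) / R ^ k"
        by (intro order_trans[OF C1(3) w]) (auto simp: max.commute)
    qed
  qed
qed

definition trig_poly :: "nat \<Rightarrow> (int \<Rightarrow> complex) \<Rightarrow> real \<Rightarrow> complex" where
  "trig_poly D c x = (\<Sum>s\<in>{- int D..int D}. c s * cis (2 * pi * x * of_int s))"

definition Lambda_poly :: "(real \<times> real \<Rightarrow> complex) \<Rightarrow> nat \<Rightarrow> (int \<Rightarrow> complex) \<Rightarrow> (int \<Rightarrow> complex) \<Rightarrow> real \<Rightarrow> complex" where
  "Lambda_poly m D c d x = (\<Sum>s\<in>{- int D..int D}. \<Sum>t\<in>{- int D..int D}.
     m (of_int s, of_int t) * c s * d t * cis (2 * pi * x * of_int (s + t)))"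

definition sample :: "nat \<Rightarrow> (real \<Rightarrow> complex) \<Rightarrow> int \<Rightarrow> complex" where
  "sample L F y = F (of_int y / 2 ^ L)"

lemma cis_sample: "cis (2 * pi * (of_int y / 2 ^ L) * of_int s) = unit_root L (s * y)"
  by (simp add: unit_root_def ac_simps)

lemma sample_trig_poly: "sample L (trig_poly D c) = (\<lambda>y. \<Sum>s\<in>{- int D..int D}. c s * unit_root L (s * y))"
  by (intro ext) (simp only: sample_def trig_poly_def cis_sample)

text \<open>D < 2 ^ D, so the cutoff is 1 at all frequencies of the polynomials, and
  \<open>L\<close> is large enough to exclude aliasing. Hence passing to the grid is exact.\<close>

lemma bilin_sample_trig_poly:
  assumes L: "D + 10 \<le> L"
  shows "bilin L (circle_kernel (132 * 2 ^ D) L (truncated (\<lambda>s t. m (of_int s, of_int t)) D))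
      (sample L (trig_poly D c)) (sample L (trig_poly D d)) x = sample L (Lambda_poly m D c d) x"
proof -
  let ?mm = "\<lambda>s t. m (of_int s, of_int t)" and ?B = "132 * (2::int) ^ D" and ?D = "{- int D..int D}"
  have D2: "int D < 2 ^ D" using of_nat_less_two_power[of D] by simp
  have LD: "1024 * 2 ^ D \<le> (2::int) ^ L"
    using power_increasing[OF L, of "2::int"] by (simp add: power_add)
  have dft: "dft L (sample L (trig_poly D e)) r = (if r \<in> ?D then e r else 0)" if "r \<in> {- ?B..?B}" for e r
    unfolding sample_trig_poly
  proof (rule dft_trig_poly)
    fix s assume "s \<in> ?D"
    then have "\<bar>s\<bar> \<le> int D" by auto
    moreover have "\<bar>r\<bar> \<le> ?B" using that by auto
    ultimately show "\<bar>s - r\<bar> < 2 ^ L" using LD D2 by linarith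
  qed simp
  have "int D \<le> ?B" using D2 by linarith
  then have sub: "?D \<subseteq> {- ?B..?B}" by auto
  have "bilin L (circle_kernel ?B L (truncated ?mm D)) (sample L (trig_poly D c)) (sample L (trig_poly D d)) x =
      (\<Sum>s\<in>{- ?B..?B}. \<Sum>t\<in>{- ?B..?B}. truncated ?mm D s t * (if s \<in> ?D then c s else 0) * (if t \<in> ?D then d t else 0) *
        unit_root L ((s + t) * x))"
    unfolding bilin_circle_kernel by (intro sum.cong refl) (simp only: dft)
  also have "\<dots> = (\<Sum>s\<in>?D. \<Sum>t\<in>{- ?B..?B}. truncated ?mm D s t * (if s \<in> ?D then c s else 0) * (if t \<in> ?D then d t else 0) *
        unit_root L ((s + t) * x))"
    by (rule sum.mono_neutral_right) (use sub in auto)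
  also have "\<dots> = (\<Sum>s\<in>?D. \<Sum>t\<in>?D. ?mm s t * c s * d t * unit_root L ((s + t) * x))"
  proof (rule sum.cong[OF refl])
    fix s assume s: "s \<in> ?D"
    show "(\<Sum>t\<in>{- ?B..?B}. truncated ?mm D s t * (if s \<in> ?D then c s else 0) * (if t \<in> ?D then d t else 0) *
        unit_root L ((s + t) * x)) = (\<Sum>t\<in>?D. ?mm s t * c s * d t * unit_root L ((s + t) * x))"
    proof (rule sum.mono_neutral_cong_right)
      fix t assume t: "t \<in> ?D"
      have "\<bar>s\<bar> \<le> int D" "\<bar>t\<bar> \<le> int D" using s t by auto
      then have "\<bar>s\<bar> \<le> 64 * 2 ^ D" "\<bar>t\<bar> \<le> 64 * 2 ^ D" using D2 by linarith+
      then show "truncated ?mm D s t * (if s \<in> ?D then c s else 0) * (if t \<in> ?D then d t else 0) *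
        unit_root L ((s + t) * x) = ?mm s t * c s * d t * unit_root L ((s + t) * x)"
        using s t by (simp add: truncated_def cutoff_eq_1)
    qed (use sub in auto)
  qed
  also have "\<dots> = sample L (Lambda_poly m D c d) x"
    by (simp only: sample_def Lambda_poly_def cis_sample)
  finally show ?thesis .
qed

text \<open>A bound for the Riemann sums of the p-th power on all fine grids: the form in which the
  grid estimates read a norm.\<close>

definition grid_norm_le :: "real \<Rightarrow> (real \<Rightarrow> complex) \<Rightarrow> real \<Rightarrow> bool" where
  "grid_norm_le p F a \<longleftrightarrow> (\<forall>\<^sub>F L in sequentially. (\<Sum>y\<in>grid L. norm (sample L F y) powr p) \<le> a powr p * 2 ^ L)"

section \<open>Measure on the circle and Riemann sums\<close>

lemma space_circle [simp]: "space circle = {0..<1}"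
  by (simp add: circle_def)

lemma measurable_circle_borel: "f \<in> borel_measurable borel \<Longrightarrow> f \<in> borel_measurable circle"
  unfolding circle_def by (intro measurable_restrict_space1 measurable_completion) simp

lemma measurable_circle_continuous: "continuous_on UNIV f \<Longrightarrow> f \<in> borel_measurable circle"
  by (intro measurable_circle_borel borel_measurable_continuous_onI)

lemma sets_circle_interval [measurable]: "{a..<b} \<inter> {0..<1} \<in> sets circle"
  by (auto simp: circle_def sets_restrict_space)

lemma measure_circle_interval:
  assumes "0 \<le> a" "a \<le> b" "b \<le> 1"
  shows "measure circle {a..<b} = b - a" "{a..<b} \<in> sets circle"
proof -
  have sub: "{a..<b} \<subseteq> {0..<1}" using assms by auto
  then have "{a..<b} \<inter> {0..<1} = {a..<b}" by blast
  then show "{a..<b} \<in> sets circle" using sets_circle_interval[of a b] by metis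
  have "measure circle {a..<b} = measure lebesgue {a..<b}"
    unfolding circle_def by (rule measure_restrict_space) (use sub in auto)
  then show "measure circle {a..<b} = b - a" using assms by simp
qed

interpretation circle: finite_measure circle
proof
  have "emeasure circle {0..<1} = emeasure lebesgue {0..<1::real}"
    unfolding circle_def by (rule emeasure_restrict_space) auto
  then show "emeasure circle (space circle) \<noteq> \<infinity>" by simp
qed

lemma measure_circle_space: "measure circle {0..<1} = 1"
  using measure_circle_interval[of 0 1] by simp

text \<open>Grid sums are integrals of step functions, so that dominated convergence can give the
  limit of the Riemann sums.\<close>

lemma integral_step_circle:
  fixes G :: "real \<Rightarrow> 'a::{banach,second_countable_topology}"
  defines "s \<equiv> \<lambda>L (x::real). G (of_int \<lfloor>2 ^ L * x\<rfloor> / 2 ^ L)"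
  shows "s L \<in> borel_measurable circle" "integral\<^sup>L circle (s L) = (\<Sum>y\<in>grid L. G (of_int y / 2 ^ L)) /\<^sub>R 2 ^ L"
proof -
  let ?I = "\<lambda>y. {of_int y / 2 ^ L..<(of_int y + 1) / 2 ^ L :: real}"
  define S where "S x = (\<Sum>y\<in>grid L. indicator (?I y) x *\<^sub>R G (of_int y / 2 ^ L))" for x
  have I: "measure circle (?I y) = 1 / 2 ^ L" "?I y \<in> sets circle" if "y \<in> grid L" for y
  proof -
    have "0 \<le> real_of_int y" "real_of_int (y + 1) \<le> real_of_int (2 ^ L)"
      using that by (auto simp: grid_def simp del: of_int_add of_int_power)
    then have "0 \<le> of_int y / (2::real) ^ L" "of_int y / 2 ^ L \<le> (of_int y + 1) / (2::real) ^ L" "(of_int y + 1) / (2::real) ^ L \<le> 1"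
      by (auto simp: divide_right_mono)
    from measure_circle_interval[OF this] show "measure circle (?I y) = 1 / 2 ^ L" "?I y \<in> sets circle"
      by (auto simp: diff_divide_distrib[symmetric])
  qed
  have sS: "s L x = S x" if "x \<in> space circle" for x
  proof -
    define n where "n = \<lfloor>2 ^ L * x\<rfloor>"
    have x: "0 \<le> x" "x < 1" using that by auto
    then have "0 \<le> n" "n < 2 ^ L" by (auto simp: n_def floor_less_iff)
    then have n: "n \<in> grid L" by (simp add: grid_def)
    have iff: "x \<in> ?I y \<longleftrightarrow> y = n" for y
    proof -
      have "x \<in> ?I y \<longleftrightarrow> of_int y \<le> 2 ^ L * x \<and> 2 ^ L * x < of_int y + 1"
        by (auto simp: divide_le_eq less_divide_eq mult.commute)
      also have "\<dots> \<longleftrightarrow> y = n" unfolding n_def by linarith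
      finally show ?thesis .
    qed
    have "S x = (\<Sum>y\<in>grid L. if y = n then G (of_int y / 2 ^ L) else 0)"
      unfolding S_def by (intro sum.cong refl) (simp add: indicator_def iff del: atLeastLessThan_iff)
    then show ?thesis using n by (simp add: s_def n_def)
  qed
  have Smeas: "S \<in> borel_measurable circle"
    unfolding S_def by (intro borel_measurable_sum borel_measurable_scaleR borel_measurable_indicator borel_measurable_const I)
  then show "s L \<in> borel_measurable circle" by (subst measurable_cong[OF sS])
  have int: "integrable circle (\<lambda>x. indicator (?I y) x *\<^sub>R G (of_int y / 2 ^ L))" if "y \<in> grid L" for y
    by (intro integrable_scaleR_left integrable_real_indicator I that) (simp add: circle.emeasure_finite less_top[symmetric])
  have "integral\<^sup>L circle (s L) = integral\<^sup>L circle S" by (rule Bochner_Integration.integral_cong) (use sS in auto)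
  also have "\<dots> = (\<Sum>y\<in>grid L. \<integral>x. indicator (?I y) x *\<^sub>R G (of_int y / 2 ^ L) \<partial>circle)"
    unfolding S_def by (rule Bochner_Integration.integral_sum) (rule int)
  also have "\<dots> = (\<Sum>y\<in>grid L. (1 / 2 ^ L) *\<^sub>R G (of_int y / 2 ^ L))"
  proof (rule sum.cong[OF refl])
    fix y assume y: "y \<in> grid L"
    have "(\<integral>x. indicator (?I y) x *\<^sub>R G (of_int y / 2 ^ L) \<partial>circle) = (\<integral>x. indicator (?I y) x \<partial>circle) *\<^sub>R G (of_int y / 2 ^ L)"
      by (rule integral_scaleR_left) (intro integrable_real_indicator I y, simp add: circle.emeasure_finite less_top[symmetric])
    also have "(\<integral>x. indicator (?I y) x \<partial>circle) = measure circle (?I y \<inter> space circle)"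
      by (rule Bochner_Integration.integral_indicator)
    also have "?I y \<inter> space circle = ?I y" using sets.sets_into_space[OF I(2)[OF y]] by blast
    finally show "(\<integral>x. indicator (?I y) x *\<^sub>R G (of_int y / 2 ^ L) \<partial>circle) = (1 / 2 ^ L) *\<^sub>R G (of_int y / 2 ^ L)"
      by (simp only: I(1)[OF y])
  qed
  finally show "integral\<^sup>L circle (s L) = (\<Sum>y\<in>grid L. G (of_int y / 2 ^ L)) /\<^sub>R 2 ^ L"
    by (simp add: scaleR_right.sum divide_inverse)
qed

lemma riemann_sums_circle:
  fixes G :: "real \<Rightarrow> 'a::{banach,second_countable_topology}"
  assumes G: "continuous_on UNIV G"
  shows "(\<lambda>L. (\<Sum>y\<in>grid L. G (of_int y / 2 ^ L)) /\<^sub>R 2 ^ L) \<longlonglongrightarrow> integral\<^sup>L circle G" "integrable circle G"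
proof -
  have "compact (G ` {0..1})" by (intro compact_continuous_image continuous_on_subset[OF G]) auto
  then obtain b where "\<forall>x\<in>{0..1}. norm (G x) \<le> b"
    using compact_imp_bounded[of "G ` {0..1}"] by (auto simp: bounded_iff)
  then have b: "norm (G x) \<le> b" if "0 \<le> x" "x \<le> 1" for x using that by simp
  define s where "s L x = G (of_int \<lfloor>2 ^ L * x\<rfloor> / 2 ^ L)" for L :: nat and x :: real
  have int: "integrable circle G"
    by (rule circle.integrable_const_bound[where B = b])
       (use b in \<open>auto intro!: AE_I2 measurable_circle_continuous G\<close>)
  have "(\<lambda>L. integral\<^sup>L circle (s L)) \<longlonglongrightarrow> integral\<^sup>L circle G"
  proof (rule integral_dominated_convergence[where w = "\<lambda>_. b"])
    show "G \<in> borel_measurable circle" using int by simp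
    show "s L \<in> borel_measurable circle" for L unfolding s_def by (rule integral_step_circle)
    show "integrable circle (\<lambda>_. b)" by simp
    show "AE x in circle. (\<lambda>L. s L x) \<longlonglongrightarrow> G x"
    proof (intro AE_I2)
      fix x :: real
      have "(\<lambda>L. of_int \<lfloor>2 ^ L * x\<rfloor> / 2 ^ L) \<longlonglongrightarrow> x"
      proof (rule tendsto_sandwich)
        show "\<forall>\<^sub>F L in sequentially. x - (1 / 2) ^ L \<le> of_int \<lfloor>2 ^ L * x\<rfloor> / 2 ^ L"
        proof (intro always_eventually allI)
          fix L :: nat
          have "2 ^ L * x - 1 \<le> of_int \<lfloor>2 ^ L * x\<rfloor>" by linarith
          then have "(2 ^ L * x - 1) / 2 ^ L \<le> of_int \<lfloor>2 ^ L * x\<rfloor> / 2 ^ L" by (rule divide_right_mono) simp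
          then show "x - (1 / 2) ^ L \<le> of_int \<lfloor>2 ^ L * x\<rfloor> / 2 ^ L" by (simp add: diff_divide_distrib power_one_over)
        qed
        show "\<forall>\<^sub>F L in sequentially. of_int \<lfloor>2 ^ L * x\<rfloor> / 2 ^ L \<le> x"
        proof (intro always_eventually allI)
          fix L :: nat
          have "of_int \<lfloor>2 ^ L * x\<rfloor> / 2 ^ L \<le> (2 ^ L * x) / 2 ^ L" by (intro divide_right_mono) auto
          then show "of_int \<lfloor>2 ^ L * x\<rfloor> / 2 ^ L \<le> x" by simp
        qed
        have "(\<lambda>L. x - (1 / 2) ^ L) \<longlonglongrightarrow> x - 0" by (intro tendsto_intros LIMSEQ_realpow_zero) auto
        then show "(\<lambda>L. x - (1 / 2) ^ L) \<longlonglongrightarrow> x" by simp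
      qed simp
      moreover have "isCont G x" using G by (simp add: continuous_on_eq_continuous_at)
      ultimately show "(\<lambda>L. s L x) \<longlonglongrightarrow> G x" unfolding s_def by (rule isCont_tendsto_compose[rotated])
    qed
    show "AE x in circle. norm (s L x) \<le> b" for L
    proof (intro AE_I2)
      fix x assume x: "x \<in> space circle"
      then have "0 \<le> \<lfloor>2 ^ L * x\<rfloor>" by simp
      moreover have "of_int \<lfloor>2 ^ L * x\<rfloor> \<le> (2::real) ^ L * 1"
        using x by (intro order_trans[OF of_int_floor_le] mult_left_mono) auto
      ultimately show "norm (s L x) \<le> b" unfolding s_def by (intro b) auto
    qed
  qed
  then show "(\<lambda>L. (\<Sum>y\<in>grid L. G (of_int y / 2 ^ L)) /\<^sub>R 2 ^ L) \<longlonglongrightarrow> integral\<^sup>L circle G"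
    unfolding s_def integral_step_circle .
  show "integrable circle G" by (rule int)
qed

lemma continuous_Lambda_poly: "continuous_on UNIV (Lambda_poly m D c d)"
  unfolding Lambda_poly_def by (intro continuous_intros)

theorem Lambda_poly_weak:
  assumes m: "coifman_meyer m" and pp: "1 / p = 1 / p1 + 1 / p2" "1 \<le> p1" "1 \<le> p2"
  obtains K where "0 < K"
    "\<And>D c d a b l. \<lbrakk>0 < a; 0 < b; 0 < l; grid_norm_le p1 (trig_poly D c) a; grid_norm_le p2 (trig_poly D d) b\<rbrakk> \<Longrightarrow>
       measure circle {x \<in> space circle. norm (Lambda_poly m D c d x) > l} \<le> K * (a * b / l) powr p"
proof -
  note p = hoelder_exponents[OF pp]
  obtain C where C: "0 \<le> C" "fdiff_decay C (\<lambda>s t. m (of_int s, of_int t))"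
    "fdiff_decay C (\<lambda>s t. m (of_int t, of_int s))" "\<And>s t. norm (m (of_int s, of_int t)) \<le> C"
    using coifman_meyer_fdiff_decay[OF m] by blast
  obtain K where K: "0 < K" "\<And>L Kr f g a b l. \<lbrakk>cz_kernel (cz_const C) L Kr; 0 < a; 0 < b; 0 < l;
       (\<Sum>x\<in>grid L. norm (f x) powr p1) \<le> a powr p1 * 2 ^ L;
       (\<Sum>x\<in>grid L. norm (g x) powr p2) \<le> b powr p2 * 2 ^ L\<rbrakk> \<Longrightarrow>
       card {x \<in> grid L. norm (bilin L Kr f g x) > l} \<le> K * (a * b / l) powr p * 2 ^ L"
    using grid_weak_bound[OF pp] by blast
  show thesis
  proof (rule that[of "K * 2 powr p"])
    show "0 < K * 2 powr p" using K by simp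
    fix D c d and a b l :: real
    assume *: "0 < a" "0 < b" "0 < l" "grid_norm_le p1 (trig_poly D c) a" "grid_norm_le p2 (trig_poly D d) b"
    let ?F = "Lambda_poly m D c d"
    \<comment> \<open>A continuous function between the indicators of v > l and v > l / 2, since the
      Riemann sums are taken of continuous functions. The gap between the two levels costs the
      factor 2 powr p.\<close>
    define cut where "cut v = min 1 (max 0 ((v - l / 2) / (l / 2)))" for v :: real
    have chi: "0 \<le> cut v" "v > l \<Longrightarrow> cut v = 1" "cut v \<le> of_bool (v > l / 2)" for v
      using *(3) by (auto simp: cut_def divide_le_0_iff field_simps)
    have cont: "continuous_on UNIV (\<lambda>x. cut (norm (?F x)))"
      unfolding cut_def using *(3) by (intro continuous_intros continuous_on_subset[OF continuous_Lambda_poly]) auto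
    have EE: "{x \<in> space circle. norm (?F x) > l} \<inter> space circle = {x \<in> space circle. norm (?F x) > l}" by auto
    have meas: "{x \<in> space circle. norm (?F x) > l} \<in> sets circle"
      using measurable_circle_continuous[OF continuous_Lambda_poly, of m D c d] by measurable
    have "measure circle {x \<in> space circle. norm (?F x) > l} =
        (\<integral>x. indicator {x \<in> space circle. norm (?F x) > l} x \<partial>circle)"
      by (simp only: Bochner_Integration.integral_indicator EE)
    also have "\<dots> \<le> (\<integral>x. cut (norm (?F x)) \<partial>circle)"
    proof (rule integral_mono)
      show "integrable circle (indicator {x \<in> space circle. norm (?F x) > l} :: real \<Rightarrow> real)"
        using meas by (intro integrable_real_indicator) (auto simp: circle.emeasure_finite less_top[symmetric])
      show "integrable circle (\<lambda>x. cut (norm (?F x)))" by (rule riemann_sums_circle[OF cont])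
      show "indicator {x \<in> space circle. norm (?F x) > l} x \<le> cut (norm (?F x))" for x
        using chi by (auto simp: indicator_def)
    qed
    also have "\<dots> \<le> K * (a * b / (l / 2)) powr p"
    proof (rule tendsto_upperbound[OF riemann_sums_circle(1)[OF cont]])
      have "\<forall>\<^sub>F L in sequentially. D + 10 \<le> L" by (rule eventually_ge_at_top)
      then show "\<forall>\<^sub>F L in sequentially. (\<Sum>y\<in>grid L. cut (norm (?F (of_int y / 2 ^ L)))) /\<^sub>R 2 ^ L \<le> K * (a * b / (l / 2)) powr p"
        using *(4,5) unfolding grid_norm_le_def
      proof eventually_elim
        case (elim L)
        let ?Kr = "circle_kernel (132 * 2 ^ D) L (truncated (\<lambda>s t. m (of_int s, of_int t)) D)"
        have cz: "cz_kernel (cz_const C) L ?Kr"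
          by (rule cz_kernel_circle_kernel[OF C elim(1)]) simp
        have "(\<Sum>y\<in>grid L. cut (norm (?F (of_int y / 2 ^ L)))) \<le> (\<Sum>y\<in>grid L. of_bool (norm (sample L ?F y) > l / 2))"
          unfolding sample_def by (intro sum_mono chi)
        also have "\<dots> = card {y \<in> grid L. norm (sample L ?F y) > l / 2}" by (rule card_as_sum[symmetric]) simp
        also have "\<dots> = card {y \<in> grid L. norm (bilin L ?Kr (sample L (trig_poly D c)) (sample L (trig_poly D d)) y) > l / 2}"
          by (simp only: bilin_sample_trig_poly[OF elim(1)])
        also have "\<dots> \<le> K * (a * b / (l / 2)) powr p * 2 ^ L"
          by (rule K(2)[OF cz *(1,2) _ elim(2,3)]) (use *(3) in simp)
        finally show ?case by (simp add: divide_simps)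
      qed
    qed simp
    also have "\<dots> = K * 2 powr p * (a * b / l) powr p"
    proof -
      have "a * b / (l / 2) = 2 * (a * b / l)" by simp
      then show ?thesis using * by (simp only: powr_mult mult.assoc)
    qed
    finally show "measure circle {x \<in> space circle. norm (?F x) > l} \<le> K * 2 powr p * (a * b / l) powr p" .
  qed
qed

theorem Lambda_poly_strong:
  assumes m: "coifman_meyer m" and pp: "1 / p = 1 / p1 + 1 / p2" "1 < p1" "1 < p2"
  obtains K where "0 < K"
    "\<And>D c d a b. \<lbrakk>0 < a; 0 < b; grid_norm_le p1 (trig_poly D c) a; grid_norm_le p2 (trig_poly D d) b\<rbrakk> \<Longrightarrow>
       integrable circle (\<lambda>x. norm (Lambda_poly m D c d x) powr p) \<and>
       (\<integral>x. norm (Lambda_poly m D c d x) powr p \<partial>circle) \<le> K * (a * b) powr p"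
proof -
  have "1 \<le> p1" "1 \<le> p2" using pp by auto
  note p = hoelder_exponents[OF pp(1) this]
  obtain C where C: "0 \<le> C" "fdiff_decay C (\<lambda>s t. m (of_int s, of_int t))"
    "fdiff_decay C (\<lambda>s t. m (of_int t, of_int s))" "\<And>s t. norm (m (of_int s, of_int t)) \<le> C"
    using coifman_meyer_fdiff_decay[OF m] by blast
  obtain K where K: "0 < K" "\<And>L Kr f g a b. \<lbrakk>cz_kernel (cz_const C) L Kr; 0 < a; 0 < b;
       (\<Sum>x\<in>grid L. norm (f x) powr p1) \<le> a powr p1 * 2 ^ L;
       (\<Sum>x\<in>grid L. norm (g x) powr p2) \<le> b powr p2 * 2 ^ L\<rbrakk> \<Longrightarrow>
       (\<Sum>x\<in>grid L. norm (bilin L Kr f g x) powr p) \<le> K * (a * b) powr p * 2 ^ L"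
    using grid_strong_bound[OF pp] by blast
  show thesis
  proof (rule that[OF K(1)])
    fix D c d and a b :: real
    assume *: "0 < a" "0 < b" "grid_norm_le p1 (trig_poly D c) a" "grid_norm_le p2 (trig_poly D d) b"
    let ?F = "Lambda_poly m D c d"
    have cont: "continuous_on UNIV (\<lambda>x. norm (?F x) powr p)"
      using p by (intro continuous_on_powr' continuous_intros continuous_on_subset[OF continuous_Lambda_poly]) auto
    have "(\<integral>x. norm (?F x) powr p \<partial>circle) \<le> K * (a * b) powr p"
    proof (rule tendsto_upperbound[OF riemann_sums_circle(1)[OF cont]])
      have "\<forall>\<^sub>F L in sequentially. D + 10 \<le> L" by (rule eventually_ge_at_top)
      then show "\<forall>\<^sub>F L in sequentially. (\<Sum>y\<in>grid L. norm (?F (of_int y / 2 ^ L)) powr p) /\<^sub>R 2 ^ L \<le> K * (a * b) powr p"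
        using *(3,4) unfolding grid_norm_le_def
      proof eventually_elim
        case (elim L)
        let ?Kr = "circle_kernel (132 * 2 ^ D) L (truncated (\<lambda>s t. m (of_int s, of_int t)) D)"
        have cz: "cz_kernel (cz_const C) L ?Kr"
          by (rule cz_kernel_circle_kernel[OF C elim(1)]) simp
        have "(\<Sum>y\<in>grid L. norm (sample L ?F y) powr p) =
            (\<Sum>y\<in>grid L. norm (bilin L ?Kr (sample L (trig_poly D c)) (sample L (trig_poly D d)) y) powr p)"
          by (simp only: bilin_sample_trig_poly[OF elim(1)])
        also have "\<dots> \<le> K * (a * b) powr p * 2 ^ L"
          by (rule K(2)[OF cz *(1,2) elim(2,3)])
        finally show ?case by (simp add: divide_simps sample_def)
      qed
    qed simp
    then show "integrable circle (\<lambda>x. norm (?F x) powr p) \<and> (\<integral>x. norm (?F x) powr p \<partial>circle) \<le> K * (a * b) powr p"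
      using riemann_sums_circle(2)[OF cont] by simp
  qed
qed

section \<open>Fejer means\<close>

definition fejer_coeff :: "(real \<Rightarrow> complex) \<Rightarrow> nat \<Rightarrow> int \<Rightarrow> complex" where
  "fejer_coeff f n s = (if \<bar>s\<bar> \<le> int n then of_real (fejer_weight n s) * fourier_coeff f s else 0)"

text \<open>Written as a square to make it visibly nonnegative; \<open>fejer_kernel_eq\<close>
  recovers its Fourier coefficients.\<close>

definition fejer_kernel :: "nat \<Rightarrow> real \<Rightarrow> real" where
  "fejer_kernel n u = (norm (\<Sum>k\<le>n. cis (2 * pi * u * real k)))\<^sup>2 / (real n + 1)"

lemma trig_poly_extend:
  assumes "\<And>s. \<bar>s\<bar> > int n \<Longrightarrow> c s = 0" "n \<le> D"
  shows "trig_poly D c = trig_poly n c"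
  unfolding trig_poly_def fun_eq_iff
  by (intro allI sum.mono_neutral_right) (use assms in auto)

lemma Lambda_poly_extend:
  assumes c: "\<And>s. \<bar>s\<bar> > int n \<Longrightarrow> c s = 0" and d: "\<And>s. \<bar>s\<bar> > int n \<Longrightarrow> d s = 0" and D: "n \<le> D"
  shows "Lambda_poly m D c d = Lambda_poly m n c d"
proof
  fix x
  let ?D = "{- int D..int D}" and ?n = "{- int n..int n}"
  let ?T = "\<lambda>s t. m (of_int s, of_int t) * c s * d t * cis (2 * pi * x * of_int (s + t))"
  have sub: "?n \<subseteq> ?D" using D by auto
  have "(\<Sum>s\<in>?D. \<Sum>t\<in>?D. ?T s t) = (\<Sum>s\<in>?n. \<Sum>t\<in>?D. ?T s t)"
    by (rule sum.mono_neutral_right) (use sub c in auto)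
  also have "\<dots> = (\<Sum>s\<in>?n. \<Sum>t\<in>?n. ?T s t)"
    by (rule sum.cong[OF refl], rule sum.mono_neutral_right) (use sub d in auto)
  finally show "Lambda_poly m D c d x = Lambda_poly m n c d x" by (simp only: Lambda_poly_def)
qed

lemma fejer_coeff_eq_0: "\<bar>s\<bar> > int n \<Longrightarrow> fejer_coeff f n s = 0"
  by (simp add: fejer_coeff_def)

lemma Lambda_mean_eq_Lambda_poly:
  assumes "n \<le> D"
  shows "Lambda_mean m f g n = Lambda_poly m D (fejer_coeff f n) (fejer_coeff g n)"
proof -
  have "Lambda_mean m f g n x = Lambda_poly m n (fejer_coeff f n) (fejer_coeff g n) x" for x
    unfolding Lambda_mean_def Lambda_poly_def Lambda_term_def
    by (intro sum.cong refl) (auto simp: fejer_coeff_def)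
  then show ?thesis using Lambda_poly_extend[OF fejer_coeff_eq_0 fejer_coeff_eq_0 assms] by (simp add: fun_eq_iff)
qed

text \<open>The difference s occurs n + 1 - |s| times. The induction step adds one row and one
  column, which contribute every difference of the larger range exactly once.\<close>

lemma sum_differences:
  fixes G :: "int \<Rightarrow> complex"
  shows "(\<Sum>k\<in>{0..int n}. \<Sum>l\<in>{0..int n}. G (k - l)) = (\<Sum>s\<in>{- int n..int n}. of_int (int n + 1 - \<bar>s\<bar>) * G s)"
proof (induction n)
  case (Suc n)
  let ?N = "int n + 1"
  have I: "{0..int (Suc n)} = insert ?N {0..int n}" by auto
  have J: "{- int (Suc n)..int (Suc n)} = insert (- ?N) (insert ?N {- int n..int n})" by auto
  have pos: "(\<Sum>l\<in>{0..int n}. G (?N - l)) = (\<Sum>s\<in>{1..?N}. G s)"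
    by (rule sum.reindex_bij_witness[of _ "\<lambda>s. ?N - s" "\<lambda>l. ?N - l"]) auto
  have neg: "(\<Sum>k\<in>{0..int n}. G (k - ?N)) = (\<Sum>s\<in>{- ?N..- 1}. G s)"
    by (rule sum.reindex_bij_witness[of _ "\<lambda>s. ?N + s" "\<lambda>l. l - ?N"]) auto
  have "{- ?N..?N} = {- ?N..- 1} \<union> insert 0 {1..?N}" by auto
  then have all: "(\<Sum>s\<in>{- ?N..?N}. G s) = (\<Sum>s\<in>{- ?N..- 1}. G s) + (G 0 + (\<Sum>s\<in>{1..?N}. G s))"
    by (simp only:) (subst sum.union_disjoint, auto)
  have all': "(\<Sum>s\<in>{- ?N..?N}. G s) = G (- ?N) + (G ?N + (\<Sum>s\<in>{- int n..int n}. G s))"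
  proof -
    have "{- ?N..?N} = insert (- ?N) (insert ?N {- int n..int n})" by auto
    then show ?thesis by simp
  qed
  have "(\<Sum>k\<in>{0..int (Suc n)}. \<Sum>l\<in>{0..int (Suc n)}. G (k - l)) =
      (\<Sum>l\<in>{0..int n}. G (?N - l)) + G 0 + ((\<Sum>k\<in>{0..int n}. G (k - ?N)) + (\<Sum>k\<in>{0..int n}. \<Sum>l\<in>{0..int n}. G (k - l)))"
    unfolding I by (simp add: sum.distrib add.commute)
  also have "\<dots> = (\<Sum>s\<in>{- ?N..?N}. G s) + (\<Sum>s\<in>{- int n..int n}. of_int (int n + 1 - \<bar>s\<bar>) * G s)"
    unfolding pos neg all Suc by simp
  also have "\<dots> = G (- ?N) + (G ?N + (\<Sum>s\<in>{- int n..int n}. G s + of_int (int n + 1 - \<bar>s\<bar>) * G s))"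
    unfolding all' by (simp add: sum.distrib)
  also have "(\<Sum>s\<in>{- int n..int n}. G s + of_int (int n + 1 - \<bar>s\<bar>) * G s) =
      (\<Sum>s\<in>{- int n..int n}. of_int (int (Suc n) + 1 - \<bar>s\<bar>) * G s)"
    by (intro sum.cong refl) (simp add: algebra_simps)
  also have "G (- ?N) + (G ?N + \<dots>) = (\<Sum>s\<in>{- int (Suc n)..int (Suc n)}. of_int (int (Suc n) + 1 - \<bar>s\<bar>) * G s)"
    unfolding J by simp
  finally show ?case .
qed simp

lemma fejer_kernel_eq:
  "complex_of_real (fejer_kernel n u) = (\<Sum>s\<in>{- int n..int n}. of_real (fejer_weight n s) * cis (2 * pi * u * of_int s))"
proof -
  let ?E = "\<lambda>s::int. cis (2 * pi * u * of_int s)"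
  have S: "(\<Sum>k\<le>n. cis (2 * pi * u * real k)) = (\<Sum>k\<in>{0..int n}. ?E k)"
    by (rule sum.reindex_bij_witness[of _ nat int]) auto
  have "complex_of_real ((norm (\<Sum>k\<in>{0..int n}. ?E k))\<^sup>2) = (\<Sum>k\<in>{0..int n}. ?E k) * cnj (\<Sum>k\<in>{0..int n}. ?E k)"
    by (rule complex_norm_square)
  also have "\<dots> = (\<Sum>k\<in>{0..int n}. \<Sum>l\<in>{0..int n}. ?E (k - l))"
    by (simp add: sum_product cis_cnj cis_mult algebra_simps)
  also have "\<dots> = (\<Sum>s\<in>{- int n..int n}. of_int (int n + 1 - \<bar>s\<bar>) * ?E s)" by (rule sum_differences)
  finally have "complex_of_real (fejer_kernel n u) = (\<Sum>s\<in>{- int n..int n}. of_int (int n + 1 - \<bar>s\<bar>) * ?E s) / of_real (real n + 1)"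
    unfolding fejer_kernel_def S by simp
  also have "\<dots> = (\<Sum>s\<in>{- int n..int n}. of_real (fejer_weight n s) * ?E s)"
    unfolding sum_divide_distrib
  proof (intro sum.cong refl)
    fix s
    have "fejer_weight n s = of_int (int n + 1 - \<bar>s\<bar>) / (real n + 1)" by (simp add: fejer_weight_def field_simps)
    then have "complex_of_real (fejer_weight n s) = of_int (int n + 1 - \<bar>s\<bar>) / of_real (real n + 1)"
      by (simp only: of_real_divide of_real_of_int_eq)
    then show "of_int (int n + 1 - \<bar>s\<bar>) * ?E s / of_real (real n + 1) = of_real (fejer_weight n s) * ?E s" by simp
  qed
  finally show ?thesis .
qed

lemma fejer_kernel_nonneg: "0 \<le> fejer_kernel n u"
  by (simp add: fejer_kernel_def)

lemma fejer_kernel_le: "fejer_kernel n u \<le> real n + 1"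
proof -
  have "norm (\<Sum>k\<le>n. cis (2 * pi * u * real k)) \<le> (\<Sum>k\<le>n. 1)" by (rule sum_norm_le) simp
  then have "(norm (\<Sum>k\<le>n. cis (2 * pi * u * real k)))\<^sup>2 \<le> (real n + 1)\<^sup>2" by (intro power_mono) auto
  then show ?thesis by (simp add: fejer_kernel_def divide_le_eq power2_eq_square)
qed

lemma continuous_fejer_kernel: "continuous_on UNIV (\<lambda>y. fejer_kernel n (x - y))"
  unfolding fejer_kernel_def by (intro continuous_intros) auto

text \<open>On grids with more than |s| points the Riemann sums vanish exactly.\<close>

lemma integral_cis_circle:
  assumes "s \<noteq> 0"
  shows "(\<integral>y. cis (2 * pi * y * of_int s) \<partial>circle) = 0"
proof -
  have cont: "continuous_on UNIV (\<lambda>y. cis (2 * pi * y * of_int s))" by (intro continuous_intros)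
  have "(\<lambda>L. (\<Sum>y\<in>grid L. cis (2 * pi * (of_int y / 2 ^ L) * of_int s)) /\<^sub>R 2 ^ L) \<longlonglongrightarrow> 0"
  proof (rule tendsto_eventually)
    have "\<forall>\<^sub>F L in sequentially. nat \<bar>s\<bar> \<le> L" by (rule eventually_ge_at_top)
    then show "\<forall>\<^sub>F L in sequentially. (\<Sum>y\<in>grid L. cis (2 * pi * (of_int y / 2 ^ L) * of_int s)) /\<^sub>R 2 ^ L = 0"
    proof eventually_elim
      case (elim L)
      have "int L < 2 ^ L" using of_nat_less_two_power[of L] by simp
      then have "\<bar>s\<bar> < 2 ^ L" using elim by linarith
      from sum_unit_root[OF this] assms show ?case by (simp only: cis_sample) simp
    qed
  qed
  from LIMSEQ_unique[OF riemann_sums_circle(1)[OF cont] this] show ?thesis .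
qed

lemma integral_fejer_kernel: "(\<integral>y. fejer_kernel n (x - y) \<partial>circle) = 1"
proof -
  have int: "integrable circle (\<lambda>y. cis (2 * pi * y * of_int (- s)))" for s
    by (rule riemann_sums_circle) (intro continuous_intros)
  have "complex_of_real (\<integral>y. fejer_kernel n (x - y) \<partial>circle) = (\<integral>y. complex_of_real (fejer_kernel n (x - y)) \<partial>circle)"
    by (rule integral_complex_of_real[symmetric])
  also have "\<dots> = (\<integral>y. (\<Sum>s\<in>{- int n..int n}. of_real (fejer_weight n s) * cis (2 * pi * x * of_int s) * cis (2 * pi * y * of_int (- s))) \<partial>circle)"
    unfolding fejer_kernel_eq
    by (intro Bochner_Integration.integral_cong sum.cong refl) (simp add: cis_mult algebra_simps)
  also have "\<dots> = (\<Sum>s\<in>{- int n..int n}. \<integral>y. of_real (fejer_weight n s) * cis (2 * pi * x * of_int s) * cis (2 * pi * y * of_int (- s)) \<partial>circle)"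
    by (rule Bochner_Integration.integral_sum) (intro integrable_mult_right int)
  also have "\<dots> = (\<Sum>s\<in>{- int n..int n}. of_real (fejer_weight n s) * cis (2 * pi * x * of_int s) * (\<integral>y. cis (2 * pi * y * of_int (- s)) \<partial>circle))"
    by (intro sum.cong refl Bochner_Integration.integral_mult_right int)
  also have "\<dots> = (\<Sum>s\<in>{- int n..int n}. if s = 0 then 1 else 0)"
  proof (rule sum.cong[OF refl])
    fix s
    show "of_real (fejer_weight n s) * cis (2 * pi * x * of_int s) * (\<integral>y. cis (2 * pi * y * of_int (- s)) \<partial>circle) = (if s = 0 then 1 else 0)"
    proof (cases "s = 0")
      case True
      then show ?thesis by (simp add: fejer_weight_def measure_circle_space)
    next
      case False
      then show ?thesis using integral_cis_circle[of "- s"] by simp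
    qed
  qed
  finally show ?thesis by simp
qed

text \<open>The degree is below \<open>2 ^ L\<close>, so only frequency 0 survives on the grid. Mass
  1 on the grid for every real \<open>y\<close> is what bounds the sampled Fejer means with constant
  1.\<close>

lemma sum_grid_fejer_kernel:
  assumes "int n < 2 ^ L"
  shows "(\<Sum>x\<in>grid L. fejer_kernel n (of_int x / 2 ^ L - y)) = 2 ^ L"
proof -
  have "complex_of_real (\<Sum>x\<in>grid L. fejer_kernel n (of_int x / 2 ^ L - y)) =
      (\<Sum>x\<in>grid L. \<Sum>s\<in>{- int n..int n}. of_real (fejer_weight n s) * cis (- (2 * pi * y * of_int s)) * unit_root L (s * x))"
    unfolding of_real_sum fejer_kernel_eq cis_sample[symmetric]
    by (intro sum.cong refl) (simp add: cis_mult algebra_simps)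
  also have "\<dots> = (\<Sum>s\<in>{- int n..int n}. \<Sum>x\<in>grid L. of_real (fejer_weight n s) * cis (- (2 * pi * y * of_int s)) * unit_root L (s * x))"
    by (rule sum.swap)
  also have "\<dots> = (\<Sum>s\<in>{- int n..int n}. of_real (fejer_weight n s) * cis (- (2 * pi * y * of_int s)) * (\<Sum>x\<in>grid L. unit_root L (s * x)))"
    by (simp only: sum_distrib_left)
  also have "\<dots> = (\<Sum>s\<in>{- int n..int n}. if s = 0 then 2 ^ L else 0)"
  proof (rule sum.cong[OF refl])
    fix s assume "s \<in> {- int n..int n}"
    then have "\<bar>s\<bar> \<le> int n" by auto
    then have "\<bar>s\<bar> < 2 ^ L" using assms by linarith
    then show "of_real (fejer_weight n s) * cis (- (2 * pi * y * of_int s)) * (\<Sum>x\<in>grid L. unit_root L (s * x)) = (if s = 0 then 2 ^ L else 0)"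
      by (subst sum_unit_root) (auto simp: fejer_weight_def)
  qed
  also have "\<dots> = complex_of_real (2 ^ L)" by simp
  finally show ?thesis by (simp only: of_real_eq_iff)
qed

lemma integrable_mult_bounded:
  fixes f g :: "real \<Rightarrow> 'a::{real_normed_algebra,banach,second_countable_topology}"
  assumes "integrable circle f" "g \<in> borel_measurable circle" "\<And>x. norm (g x) \<le> M"
  shows "integrable circle (\<lambda>x. f x * g x)"
proof (rule Bochner_Integration.integrable_bound)
  show "integrable circle (\<lambda>x. M * norm (f x))" using assms by (intro integrable_mult_right integrable_norm)
  show "(\<lambda>x. f x * g x) \<in> borel_measurable circle" using assms by (intro borel_measurable_times) auto
  show "AE x in circle. norm (f x * g x) \<le> norm (M * norm (f x))"
  proof (intro AE_I2)
    fix x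
    have "norm (f x * g x) \<le> norm (f x) * M"
      by (rule order_trans[OF norm_mult_ineq]) (intro mult_left_mono assms norm_ge_zero)
    then show "norm (f x * g x) \<le> norm (M * norm (f x))" by (simp add: mult.commute)
  qed
qed

lemma Lp_integrable:
  assumes "f \<in> Lp p" "1 \<le> p"
  shows "integrable circle f"
proof (rule Bochner_Integration.integrable_bound)
  show "integrable circle (\<lambda>x. 1 + norm (f x) powr p)" using assms by (auto simp: Lp_def)
  show "f \<in> borel_measurable circle" using assms by (simp add: Lp_def)
  show "AE x in circle. norm (f x) \<le> norm (1 + norm (f x) powr p)"
  proof (intro AE_I2)
    fix x
    have "norm (f x) \<le> 1 + norm (f x) powr p"
    proof (cases "norm (f x) \<le> 1")
      case False
      then have "norm (f x) powr 1 \<le> norm (f x) powr p" using assms by (intro powr_mono) auto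
      then show ?thesis using False by simp
    qed (simp add: add_increasing2)
    then show "norm (f x) \<le> norm (1 + norm (f x) powr p)" by simp
  qed
qed

text \<open>Convexity in tangent form, from Young's inequality with the weights 1 / p and 1 - 1 /
  p.\<close>

lemma powr_tangent_le:
  fixes t a p :: real
  assumes "0 \<le> t" "0 < a" "1 \<le> p"
  shows "a powr p + p * a powr (p - 1) * (t - a) \<le> t powr p"
proof (cases "t = 0")
  case True
  have "a powr (p - 1) * a = a powr p" using assms by (simp add: powr_diff)
  then have "a powr p + p * a powr (p - 1) * (0 - a) = (1 - p) * a powr p" by (simp add: algebra_simps)
  also have "\<dots> \<le> 0" using assms by (intro mult_nonpos_nonneg) auto
  finally show ?thesis using True by simp
next
  case False
  then have t: "0 < t" using assms by simp
  have "(t powr p) powr (1 / p) * (a powr p) powr (1 - 1 / p) \<le> 1 / p * t powr p + (1 - 1 / p) * a powr p"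
    by (rule Youngs_inequality_0) (use assms t in auto)
  then have "t * a powr (p - 1) \<le> 1 / p * t powr p + (1 - 1 / p) * a powr p"
    using assms t by (simp add: powr_powr right_diff_distrib)
  then have "p * (t * a powr (p - 1)) \<le> p * (1 / p * t powr p + (1 - 1 / p) * a powr p)"
    using assms by (intro mult_left_mono) auto
  then have "p * (t * a powr (p - 1)) \<le> t powr p + (p - 1) * a powr p"
    using assms by (simp add: distrib_left right_diff_distrib left_diff_distrib)
  moreover have "a powr (p - 1) * a = a powr p" using assms by (simp add: powr_diff)
  ultimately show ?thesis by (simp add: algebra_simps)
qed

lemma trig_poly_fejer_eq_integral:
  assumes "integrable circle f"
  shows "trig_poly n (fejer_coeff f n) x = (\<integral>y. f y * complex_of_real (fejer_kernel n (x - y)) \<partial>circle)"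
proof -
  have cisb: "(\<lambda>y. cis (a * y)) \<in> borel_measurable circle" for a
    by (rule measurable_circle_continuous) (intro continuous_intros)
  have int: "integrable circle (\<lambda>y. f y * cis (- 2 * pi * of_int s * y))" for s
    by (rule integrable_mult_bounded[OF assms cisb, where M = 1]) simp
  have "trig_poly n (fejer_coeff f n) x =
      (\<Sum>s\<in>{- int n..int n}. of_real (fejer_weight n s) * cis (2 * pi * x * of_int s) * (\<integral>y. f y * cis (- 2 * pi * of_int s * y) \<partial>circle))"
    unfolding trig_poly_def fourier_coeff_def[symmetric] by (intro sum.cong refl) (auto simp: fejer_coeff_def)
  also have "\<dots> = (\<Sum>s\<in>{- int n..int n}. \<integral>y. of_real (fejer_weight n s) * cis (2 * pi * x * of_int s) * (f y * cis (- 2 * pi * of_int s * y)) \<partial>circle)"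
    by (intro sum.cong refl Bochner_Integration.integral_mult_right[symmetric] int)
  also have "\<dots> = (\<integral>y. (\<Sum>s\<in>{- int n..int n}. of_real (fejer_weight n s) * cis (2 * pi * x * of_int s) * (f y * cis (- 2 * pi * of_int s * y))) \<partial>circle)"
    by (rule Bochner_Integration.integral_sum[symmetric]) (intro integrable_mult_right int)
  also have "\<dots> = (\<integral>y. f y * complex_of_real (fejer_kernel n (x - y)) \<partial>circle)"
  proof (intro Bochner_Integration.integral_cong refl)
    fix y
    have e: "cis (2 * pi * (x - y) * of_int s) = cis (2 * pi * x * of_int s) * cis (- 2 * pi * of_int s * y)" for s :: int
      by (simp add: cis_mult algebra_simps)
    show "(\<Sum>s\<in>{- int n..int n}. of_real (fejer_weight n s) * cis (2 * pi * x * of_int s) * (f y * cis (- 2 * pi * of_int s * y))) =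
        f y * complex_of_real (fejer_kernel n (x - y))"
      unfolding fejer_kernel_eq sum_distrib_left e by (intro sum.cong refl) (simp only: mult.assoc mult.left_commute)
  qed
  finally show ?thesis .
qed

text \<open>Jensen's inequality for the Fejer kernel as a probability density in \<open>y\<close>,
  by integrating the tangent at the mean \<open>a\<close>.\<close>

lemma fejer_jensen:
  fixes p :: real
  assumes f: "f \<in> Lp p" and p: "1 \<le> p"
  shows "norm (trig_poly n (fejer_coeff f n) x) powr p \<le> (\<integral>y. norm (f y) powr p * fejer_kernel n (x - y) \<partial>circle)"
proof -
  have fi: "integrable circle f" by (rule Lp_integrable[OF f p])
  have fp: "integrable circle (\<lambda>y. norm (f y) powr p)" using f by (simp add: Lp_def)
  have ker: "(\<lambda>y. fejer_kernel n (x - y)) \<in> borel_measurable circle"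
    by (rule measurable_circle_continuous[OF continuous_fejer_kernel])
  have kb: "norm (fejer_kernel n (x - y)) \<le> real n + 1" for y
    using fejer_kernel_nonneg[of n "x - y"] fejer_kernel_le[of n "x - y"] by simp
  have ki: "integrable circle (\<lambda>y. fejer_kernel n (x - y))" by (rule riemann_sums_circle[OF continuous_fejer_kernel])
  have i1: "integrable circle (\<lambda>y. norm (f y) * fejer_kernel n (x - y))"
    by (rule integrable_mult_bounded[OF integrable_norm[OF fi] ker kb])
  have ip: "integrable circle (\<lambda>y. norm (f y) powr p * fejer_kernel n (x - y))"
    by (rule integrable_mult_bounded[OF fp ker kb])
  define a where "a = (\<integral>y. norm (f y) * fejer_kernel n (x - y) \<partial>circle)"
  have a0: "0 \<le> a" unfolding a_def by (intro Bochner_Integration.integral_nonneg mult_nonneg_nonneg norm_ge_zero fejer_kernel_nonneg)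
  have "norm (trig_poly n (fejer_coeff f n) x) \<le> (\<integral>y. norm (f y * complex_of_real (fejer_kernel n (x - y))) \<partial>circle)"
    unfolding trig_poly_fejer_eq_integral[OF fi] by (rule integral_norm_bound)
  also have "\<dots> = a" unfolding a_def
    by (intro Bochner_Integration.integral_cong refl) (simp add: norm_mult fejer_kernel_nonneg)
  finally have le: "norm (trig_poly n (fejer_coeff f n) x) \<le> a" .
  have "norm (trig_poly n (fejer_coeff f n) x) powr p \<le> a powr p"
    using le p by (intro powr_mono2) auto
  also have "a powr p \<le> (\<integral>y. norm (f y) powr p * fejer_kernel n (x - y) \<partial>circle)"
  proof (cases "a = 0")
    case True
    then show ?thesis using p
      by (auto intro!: Bochner_Integration.integral_nonneg mult_nonneg_nonneg fejer_kernel_nonneg)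
  next
    case False
    then have a: "0 < a" using a0 by simp
    define b where "b = p * a powr (p - 1)"
    have lin: "(\<integral>y. a powr p * fejer_kernel n (x - y) + (b * (norm (f y) * fejer_kernel n (x - y)) - b * a * fejer_kernel n (x - y)) \<partial>circle) = a powr p"
    proof -
      have "(\<integral>y. a powr p * fejer_kernel n (x - y) + (b * (norm (f y) * fejer_kernel n (x - y)) - b * a * fejer_kernel n (x - y)) \<partial>circle) =
          a powr p * (\<integral>y. fejer_kernel n (x - y) \<partial>circle) +
          (b * (\<integral>y. norm (f y) * fejer_kernel n (x - y) \<partial>circle) - b * a * (\<integral>y. fejer_kernel n (x - y) \<partial>circle))"
        using ki i1 by simp
      then show ?thesis by (simp add: integral_fejer_kernel a_def)
    qed
    have "(\<integral>y. a powr p * fejer_kernel n (x - y) + (b * (norm (f y) * fejer_kernel n (x - y)) - b * a * fejer_kernel n (x - y)) \<partial>circle)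
        \<le> (\<integral>y. norm (f y) powr p * fejer_kernel n (x - y) \<partial>circle)"
    proof (rule integral_mono)
      show "integrable circle (\<lambda>y. a powr p * fejer_kernel n (x - y) + (b * (norm (f y) * fejer_kernel n (x - y)) - b * a * fejer_kernel n (x - y)))"
        by (intro Bochner_Integration.integrable_add Bochner_Integration.integrable_diff integrable_mult_right ki i1)
      fix y
      have "(a powr p + b * (norm (f y) - a)) * fejer_kernel n (x - y) \<le> norm (f y) powr p * fejer_kernel n (x - y)"
        unfolding b_def by (intro mult_right_mono powr_tangent_le fejer_kernel_nonneg) (use a p in auto)
      then show "a powr p * fejer_kernel n (x - y) + (b * (norm (f y) * fejer_kernel n (x - y)) - b * a * fejer_kernel n (x - y))
          \<le> norm (f y) powr p * fejer_kernel n (x - y)" by (simp add: algebra_simps)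
    qed (rule ip)
    then show ?thesis unfolding lin .
  qed
  finally show ?thesis .
qed

lemma sum_grid_fejer_le:
  fixes p :: real
  assumes f: "f \<in> Lp p" and p: "1 \<le> p" and n: "int n < 2 ^ L"
  shows "(\<Sum>x\<in>grid L. norm (sample L (trig_poly n (fejer_coeff f n)) x) powr p) \<le> 2 ^ L * (\<integral>y. norm (f y) powr p \<partial>circle)"
proof -
  have fp: "integrable circle (\<lambda>y. norm (f y) powr p)" using f by (simp add: Lp_def)
  have ip: "integrable circle (\<lambda>y. norm (f y) powr p * fejer_kernel n (x - y))" for x
  proof (rule integrable_mult_bounded[OF fp])
    show "(\<lambda>y. fejer_kernel n (x - y)) \<in> borel_measurable circle"
      by (rule measurable_circle_continuous[OF continuous_fejer_kernel])
    show "norm (fejer_kernel n (x - y)) \<le> real n + 1" for y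
      using fejer_kernel_nonneg[of n "x - y"] fejer_kernel_le[of n "x - y"] by simp
  qed
  have "(\<Sum>x\<in>grid L. norm (sample L (trig_poly n (fejer_coeff f n)) x) powr p) \<le>
      (\<Sum>x\<in>grid L. \<integral>y. norm (f y) powr p * fejer_kernel n (of_int x / 2 ^ L - y) \<partial>circle)"
    unfolding sample_def by (intro sum_mono fejer_jensen f p)
  also have "\<dots> = (\<integral>y. (\<Sum>x\<in>grid L. norm (f y) powr p * fejer_kernel n (of_int x / 2 ^ L - y)) \<partial>circle)"
    by (rule Bochner_Integration.integral_sum[symmetric]) (rule ip)
  also have "\<dots> = (\<integral>y. norm (f y) powr p * 2 ^ L \<partial>circle)"
    by (simp only: sum_distrib_left[symmetric] sum_grid_fejer_kernel[OF n])
  also have "\<dots> = 2 ^ L * (\<integral>y. norm (f y) powr p \<partial>circle)" by simp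
  finally show ?thesis .
qed

lemma eventually_less_two_power: "\<forall>\<^sub>F L in sequentially. int n < 2 ^ L"
proof -
  have "\<forall>\<^sub>F L in sequentially. n \<le> L" by (rule eventually_ge_at_top)
  then show ?thesis
  proof eventually_elim
    case (elim L)
    have "int L < 2 ^ L" using of_nat_less_two_power[of L] by simp
    then show ?case using elim by linarith
  qed
qed

lemma grid_norm_le_fejer:
  fixes p :: real
  assumes f: "f \<in> Lp p" and p: "1 \<le> p" and a: "(\<integral>y. norm (f y) powr p \<partial>circle) \<le> a powr p" and n: "n \<le> D"
  shows "grid_norm_le p (trig_poly D (fejer_coeff f n)) a"
  unfolding grid_norm_le_def
  using eventually_less_two_power[of n]
proof eventually_elim
  case (elim L)
  have e: "trig_poly D (fejer_coeff f n) = trig_poly n (fejer_coeff f n)"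
    by (rule trig_poly_extend[OF fejer_coeff_eq_0 n])
  have "(\<Sum>x\<in>grid L. norm (sample L (trig_poly n (fejer_coeff f n)) x) powr p) \<le> 2 ^ L * (\<integral>y. norm (f y) powr p \<partial>circle)"
    by (rule sum_grid_fejer_le[OF f p elim])
  also have "\<dots> \<le> 2 ^ L * a powr p" by (intro mult_left_mono a) simp
  finally show ?case unfolding e by (simp add: mult.commute)
qed

section \<open>Convergence in measure\<close>

definition tail_measure :: "(real \<Rightarrow> complex) \<Rightarrow> real \<Rightarrow> real" where
  "tail_measure F l = measure circle {x \<in> space circle. norm (F x) > l}"

lemma tail_set_measurable:
  "F \<in> borel_measurable circle \<Longrightarrow> {x \<in> space circle. norm (F x) > l} \<in> sets circle"
  by measurable

lemma tail_measure_nonneg: "0 \<le> tail_measure F l"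
  by (simp add: tail_measure_def)

lemma tail_measure_mono:
  assumes "F \<in> borel_measurable circle" "l \<le> l'"
  shows "tail_measure F l' \<le> tail_measure F l"
  unfolding tail_measure_def
  by (rule circle.finite_measure_mono[OF _ tail_set_measurable[OF assms(1)]]) (use assms(2) in auto)

lemma tail_measure_add:
  assumes "F \<in> borel_measurable circle" "G \<in> borel_measurable circle" "\<And>x. norm (H x) \<le> norm (F x) + norm (G x)"
  shows "tail_measure H (a + b) \<le> tail_measure F a + tail_measure G b"
proof -
  note sets = tail_set_measurable[OF assms(1), of a] tail_set_measurable[OF assms(2), of b]
  have "{x \<in> space circle. norm (H x) > a + b} \<subseteq> {x \<in> space circle. norm (F x) > a} \<union> {x \<in> space circle. norm (G x) > b}"
  proof
    fix x assume "x \<in> {x \<in> space circle. norm (H x) > a + b}"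
    then show "x \<in> {x \<in> space circle. norm (F x) > a} \<union> {x \<in> space circle. norm (G x) > b}"
      using assms(3)[of x] by fastforce
  qed
  then have "tail_measure H (a + b) \<le> measure circle ({x \<in> space circle. norm (F x) > a} \<union> {x \<in> space circle. norm (G x) > b})"
    unfolding tail_measure_def by (rule circle.finite_measure_mono) (intro sets.Un sets)
  also have "\<dots> \<le> tail_measure F a + tail_measure G b"
    unfolding tail_measure_def by (rule measure_Un_le[OF sets])
  finally show ?thesis .
qed

lemma tail_measure_tendsto_0:
  assumes meas: "\<And>k. F k \<in> borel_measurable circle" and ae: "AE x in circle. (\<lambda>k. F k x) \<longlonglongrightarrow> 0" and e: "0 < e"
  shows "(\<lambda>k. tail_measure (F k) e) \<longlonglongrightarrow> 0"
proof -
  let ?E = "\<lambda>k. {x \<in> space circle. norm (F k x) > e}"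
  have E: "?E k \<in> sets circle" for k by (rule tail_set_measurable[OF meas])
  have "(\<lambda>k. \<integral>x. indicator (?E k) x \<partial>circle) \<longlonglongrightarrow> (\<integral>x. (0::real) \<partial>circle)"
  proof (rule integral_dominated_convergence[where w = "\<lambda>_. 1"])
    show "(indicator (?E k) :: real \<Rightarrow> real) \<in> borel_measurable circle" for k
      by (rule borel_measurable_indicator[OF E])
    show "AE x in circle. (\<lambda>k. indicator (?E k) x :: real) \<longlonglongrightarrow> 0"
      using ae
    proof eventually_elim
      case (elim x)
      have "\<forall>\<^sub>F k in sequentially. norm (F k x) < e"
        using tendsto_norm[OF elim] e by (intro order_tendstoD(2)) auto
      then have "\<forall>\<^sub>F k in sequentially. indicator (?E k) x = (0::real)"
        by eventually_elim (auto simp: indicator_def)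
      then show ?case by (rule tendsto_eventually)
    qed
    show "AE x in circle. norm (indicator (?E k) x :: real) \<le> 1" for k by (intro AE_I2) (simp add: indicator_def)
  qed auto
  moreover have "(\<integral>x. indicator (?E k) x \<partial>circle) = tail_measure (F k) e" for k
  proof -
    have "?E k \<inter> space circle = ?E k" by auto
    then show ?thesis unfolding tail_measure_def by (simp only: Bochner_Integration.integral_indicator)
  qed
  ultimately show ?thesis by simp
qed

lemma converges_in_measure_iff:
  "converges_in_measure F h \<longleftrightarrow> h \<in> borel_measurable circle \<and> (\<forall>e>0. (\<lambda>n. tail_measure (\<lambda>x. F n x - h x) e) \<longlonglongrightarrow> 0)"
  by (simp add: converges_in_measure_def tail_measure_def)

text \<open>Borel--Cantelli: almost every point lies in only finitely many exceptional sets, so its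
  telescoping series is dominated by a geometric one.\<close>

lemma AE_summable_differences:
  assumes meas: "\<And>n. F n \<in> borel_measurable circle"
    and small: "\<And>k. tail_measure (\<lambda>x. F (Suc k) x - F k x) ((1/2) ^ k) \<le> (1/2) ^ k"
  shows "AE x in circle. convergent (\<lambda>k. F k x)"
proof -
  let ?A = "\<lambda>k. {x \<in> space circle. norm (F (Suc k) x - F k x) > (1/2) ^ k}"
  have "AE x in circle. \<forall>\<^sub>F k in sequentially. x \<in> space circle - ?A k"
  proof (rule borel_cantelli_AE1)
    show "?A k \<in> sets circle" for k by (rule tail_set_measurable) (intro borel_measurable_diff meas)
    show "emeasure circle (?A k) < \<infinity>" for k by (simp add: circle.emeasure_finite less_top[symmetric])
    show "summable (\<lambda>k. measure circle (?A k))"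
      by (rule summable_comparison_test'[where g = "\<lambda>k. (1/2) ^ k"])
         (use small in \<open>auto simp: tail_measure_def intro: summable_geometric\<close>)
  qed
  then show ?thesis
  proof eventually_elim
    case (elim x)
    have "\<forall>\<^sub>F k in sequentially. norm (F (Suc k) x - F k x) \<le> (1/2) ^ k"
      using elim by eventually_elim auto
    then have "summable (\<lambda>k. F (Suc k) x - F k x)"
      by (rule summable_comparison_test_ev) (rule summable_geometric, simp)
    then have "convergent (\<lambda>n. \<Sum>k<n. F (Suc k) x - F k x)" by (simp add: summable_iff_convergent)
    then have "convergent (\<lambda>n. F n x - F 0 x)" by (simp only: sum_lessThan_telescope[of "\<lambda>k. F k x"])
    then have "convergent (\<lambda>n. (F n x - F 0 x) + F 0 x)" by (intro convergent_add convergent_const)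
    then show ?case by simp
  qed
qed

lemma strict_mono_above:
  obtains r :: "nat \<Rightarrow> nat" where "strict_mono r" "\<And>k. N k \<le> r k"
proof (rule that[of "\<lambda>k. k + (\<Sum>i\<le>k. N i)"])
  show "strict_mono (\<lambda>k. k + (\<Sum>i\<le>k. N i))" by (intro strict_monoI_Suc) simp
  show "N k \<le> k + (\<Sum>i\<le>k. N i)" for k
    using member_le_sum[of k "{..k}" N] by simp
qed

text \<open>The limit is defined along a subsequence with geometrically small increments, where it
  exists almost everywhere; the Cauchy property then carries the convergence to the full
  sequence.\<close>

lemma Cauchy_in_measure_convergent:
  assumes meas: "\<And>n. F n \<in> borel_measurable circle"
    and cauchy: "\<And>e. 0 < e \<Longrightarrow> \<exists>N. \<forall>n\<ge>N. \<forall>k\<ge>N. tail_measure (\<lambda>x. F n x - F k x) e \<le> e"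
  obtains h where "converges_in_measure F h"
proof -
  have "\<forall>k. \<exists>N. \<forall>i\<ge>N. \<forall>j\<ge>N. tail_measure (\<lambda>x. F i x - F j x) ((1/2) ^ k) \<le> (1/2) ^ k"
    using cauchy by simp
  then obtain N where N: "\<And>k i j. N k \<le> i \<Longrightarrow> N k \<le> j \<Longrightarrow> tail_measure (\<lambda>x. F i x - F j x) ((1/2) ^ k) \<le> (1/2) ^ k"
    by metis
  obtain r where r: "strict_mono r" "\<And>k. N k \<le> r k" using strict_mono_above by blast
  define h where "h x = lim (\<lambda>k. F (r k) x)" for x
  have hm: "h \<in> borel_measurable circle" unfolding h_def by (rule borel_measurable_lim_metric[OF meas])
  have "AE x in circle. convergent (\<lambda>k. F (r k) x)"
  proof (rule AE_summable_differences[OF meas])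
    fix k
    have "r k \<le> r (Suc k)" using r(1) by (simp add: strict_mono_leD)
    then show "tail_measure (\<lambda>x. F (r (Suc k)) x - F (r k) x) ((1/2) ^ k) \<le> (1/2) ^ k"
      using r(2)[of k] by (intro N) auto
  qed
  then have "AE x in circle. (\<lambda>k. F (r k) x - h x) \<longlonglongrightarrow> 0"
    by eventually_elim (simp add: convergent_LIMSEQ_iff h_def LIM_zero)
  then have sub: "(\<lambda>k. tail_measure (\<lambda>x. F (r k) x - h x) e) \<longlonglongrightarrow> 0" if "0 < e" for e
    by (rule tail_measure_tendsto_0[rotated]) (intro borel_measurable_diff meas hm that)+
  have "(\<lambda>n. tail_measure (\<lambda>x. F n x - h x) e) \<longlonglongrightarrow> 0" if e: "0 < e" for e
  proof (rule LIMSEQ_I)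
    fix d :: real assume d: "0 < d"
    \<comment> \<open>\<open>cauchy\<close> ties the level and the measure to the same number, so
      \<open>c\<close> has to be at most e / 2 and at most d / 2.\<close>
    define c where "c = min (e / 2) (d / 2)"
    have c: "0 < c" using e d by (simp add: c_def)
    obtain M where M: "\<And>n k. M \<le> n \<Longrightarrow> M \<le> k \<Longrightarrow> tail_measure (\<lambda>x. F n x - F k x) c \<le> c"
      using cauchy[OF c] by blast
    have "\<forall>\<^sub>F k in sequentially. tail_measure (\<lambda>x. F (r k) x - h x) (e / 2) < d / 2"
      using sub[of "e / 2"] e d by (intro order_tendstoD(2)) auto
    then obtain k0 where k0: "\<And>k. k0 \<le> k \<Longrightarrow> tail_measure (\<lambda>x. F (r k) x - h x) (e / 2) < d / 2"
      unfolding eventually_sequentially by blast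
    define k where "k = max k0 M"
    have "norm (tail_measure (\<lambda>x. F n x - h x) e - 0) < d" if n: "M \<le> n" for n
    proof -
      have "M \<le> r k" using strict_mono_imp_increasing[OF r(1), of k] by (simp add: k_def)
      have "tail_measure (\<lambda>x. F n x - h x) (e / 2 + e / 2) \<le> tail_measure (\<lambda>x. F n x - F (r k) x) (e / 2) + tail_measure (\<lambda>x. F (r k) x - h x) (e / 2)"
      proof (rule tail_measure_add)
        show "norm (F n x - h x) \<le> norm (F n x - F (r k) x) + norm (F (r k) x - h x)" for x
          using norm_triangle_ineq[of "F n x - F (r k) x" "F (r k) x - h x"] by simp
      qed (intro borel_measurable_diff meas hm)+
      moreover have "tail_measure (\<lambda>x. F n x - F (r k) x) (e / 2) \<le> tail_measure (\<lambda>x. F n x - F (r k) x) c"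
        by (rule tail_measure_mono) (intro borel_measurable_diff meas, simp add: c_def)
      moreover have "\<dots> \<le> c" by (rule M[OF n \<open>M \<le> r k\<close>])
      moreover have "c \<le> d / 2" by (simp add: c_def)
      moreover have "tail_measure (\<lambda>x. F (r k) x - h x) (e / 2) < d / 2" by (rule k0) (simp add: k_def)
      ultimately show ?thesis using tail_measure_nonneg[of "\<lambda>x. F n x - h x" e] by simp
    qed
    then show "\<exists>n0. \<forall>n\<ge>n0. norm (tail_measure (\<lambda>x. F n x - h x) e - 0) < d" by blast
  qed
  then have "converges_in_measure F h" using hm by (simp add: converges_in_measure_iff)
  then show thesis by (rule that)
qed

lemma converges_in_measure_AE_subseq:
  assumes conv: "converges_in_measure F h" and meas: "\<And>n. F n \<in> borel_measurable circle"
  obtains r :: "nat \<Rightarrow> nat" where "strict_mono r" "AE x in circle. (\<lambda>k. F (r k) x) \<longlonglongrightarrow> h x"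
proof -
  have hm: "h \<in> borel_measurable circle" and lim: "\<And>e. 0 < e \<Longrightarrow> (\<lambda>n. tail_measure (\<lambda>x. F n x - h x) e) \<longlonglongrightarrow> 0"
    using conv by (auto simp: converges_in_measure_iff)
  have "\<forall>k. \<exists>N. \<forall>n\<ge>N. tail_measure (\<lambda>x. F n x - h x) ((1/2) ^ k) < (1/2) ^ k"
  proof
    fix k :: nat
    have "\<forall>\<^sub>F n in sequentially. tail_measure (\<lambda>x. F n x - h x) ((1/2) ^ k) < (1/2) ^ k"
      using lim[of "(1/2) ^ k"] by (intro order_tendstoD(2)) auto
    then show "\<exists>N. \<forall>n\<ge>N. tail_measure (\<lambda>x. F n x - h x) ((1/2) ^ k) < (1/2) ^ k"
      by (simp only: eventually_sequentially)
  qed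
  then obtain N where N: "\<And>k n. N k \<le> n \<Longrightarrow> tail_measure (\<lambda>x. F n x - h x) ((1/2) ^ k) < (1/2) ^ k" by metis
  obtain r where r: "strict_mono r" "\<And>k. N k \<le> r k" using strict_mono_above by blast
  let ?A = "\<lambda>k. {x \<in> space circle. norm (F (r k) x - h x) > (1/2) ^ k}"
  have "AE x in circle. \<forall>\<^sub>F k in sequentially. x \<in> space circle - ?A k"
  proof (rule borel_cantelli_AE1)
    show "?A k \<in> sets circle" for k by (rule tail_set_measurable) (intro borel_measurable_diff meas hm)
    show "emeasure circle (?A k) < \<infinity>" for k by (simp add: circle.emeasure_finite less_top[symmetric])
    show "summable (\<lambda>k. measure circle (?A k))"
      by (rule summable_comparison_test'[where g = "\<lambda>k. (1/2) ^ k"])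
         (use N r(2) in \<open>auto simp: tail_measure_def intro: summable_geometric less_imp_le\<close>)
  qed
  then have "AE x in circle. (\<lambda>k. F (r k) x) \<longlonglongrightarrow> h x"
  proof eventually_elim
    case (elim x)
    have "\<forall>\<^sub>F k in sequentially. norm (F (r k) x - h x) \<le> (1/2) ^ k"
      using elim by eventually_elim auto
    moreover have "(\<lambda>k. (1/2) ^ k :: real) \<longlonglongrightarrow> 0" by (rule LIMSEQ_realpow_zero) auto
    ultimately have "(\<lambda>k. F (r k) x - h x) \<longlonglongrightarrow> 0" by (rule Lim_null_comparison)
    then show ?case by (rule LIM_zero_cancel)
  qed
  then show thesis using that r(1) by blast
qed

section \<open>Norm convergence of the Fejer means\<close>

lemma Lp_1_iff: "f \<in> Lp 1 \<longleftrightarrow> integrable circle f"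
  unfolding Lp_def using integrable_norm_iff[of f circle] by (auto simp: borel_measurable_integrable)

lemma fejer_coeff_tendsto: "(\<lambda>n. fejer_coeff f n s) \<longlonglongrightarrow> fourier_coeff f s"
proof -
  have "(\<lambda>n. 1 - \<bar>real_of_int s\<bar> * inverse (real (Suc n))) \<longlonglongrightarrow> 1 - \<bar>real_of_int s\<bar> * 0"
    by (intro tendsto_intros LIMSEQ_inverse_real_of_nat)
  then have "(\<lambda>n. fejer_weight n s) \<longlonglongrightarrow> 1" by (simp add: fejer_weight_def divide_inverse add.commute)
  then have "(\<lambda>n. of_real (fejer_weight n s) * fourier_coeff f s) \<longlonglongrightarrow> of_real 1 * fourier_coeff f s"
    by (intro tendsto_intros)
  moreover have "\<forall>\<^sub>F n in sequentially. of_real (fejer_weight n s) * fourier_coeff f s = fejer_coeff f n s"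
    using eventually_ge_at_top[of "nat \<bar>s\<bar>"] by eventually_elim (auto simp: fejer_coeff_def)
  ultimately show ?thesis by (simp add: Lim_transform_eventually)
qed

text \<open>The Fejer weights lie between 0 and 1. This dominates the tails of the error uniformly
  in \<open>n\<close>.\<close>

lemma norm_fejer_coeff_diff_le: "norm (fejer_coeff f n s - fourier_coeff f s) \<le> norm (fourier_coeff f s)"
proof (cases "\<bar>s\<bar> \<le> int n")
  case True
  have "\<bar>real_of_int s\<bar> \<le> real n" using True by linarith
  then have q: "\<bar>real_of_int s\<bar> / (real n + 1) \<le> 1" by simp
  have "fejer_coeff f n s - fourier_coeff f s = - (of_real (\<bar>of_int s\<bar> / (real n + 1)) * fourier_coeff f s)"
    using True by (simp add: fejer_coeff_def fejer_weight_def algebra_simps)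
  then have "norm (fejer_coeff f n s - fourier_coeff f s) = \<bar>of_int s\<bar> / (real n + 1) * norm (fourier_coeff f s)"
    by (simp only: norm_minus_cancel norm_mult norm_of_real) simp
  also have "\<dots> \<le> 1 * norm (fourier_coeff f s)" by (intro mult_right_mono q) simp
  finally show ?thesis by simp
qed (simp add: fejer_coeff_def)

lemma finite_int_subset_interval:
  assumes "finite (A :: int set)"
  obtains n where "A \<subseteq> {- int n..int n}"
proof (rule that[of "nat (\<Sum>a\<in>A. \<bar>a\<bar>)"])
  show "A \<subseteq> {- int (nat (\<Sum>a\<in>A. \<bar>a\<bar>))..int (nat (\<Sum>a\<in>A. \<bar>a\<bar>))}"
  proof
    fix a assume "a \<in> A"
    then have "\<bar>a\<bar> \<le> (\<Sum>a\<in>A. \<bar>a\<bar>)" by (intro member_le_sum assms) auto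
    then show "a \<in> {- int (nat (\<Sum>a\<in>A. \<bar>a\<bar>))..int (nat (\<Sum>a\<in>A. \<bar>a\<bar>))}" by auto
  qed
qed

lemma parseval_sample_trig_poly:
  assumes "2 * int D < 2 ^ L"
  shows "(\<Sum>y\<in>grid L. (norm (sample L (trig_poly D c) y))\<^sup>2) = 2 ^ L * (\<Sum>s\<in>{- int D..int D}. (norm (c s))\<^sup>2)"
  unfolding sample_trig_poly
proof (rule parseval_trig_poly)
  fix s r assume "s \<in> {- int D..int D}" "r \<in> {- int D..int D}"
  then have "\<bar>s - r\<bar> \<le> 2 * int D" by auto
  then show "\<bar>s - r\<bar> < 2 ^ L" using assms by linarith
qed simp

text \<open>Parseval on a grid fine enough for degree \<open>n\<close>, combined with the bound for
  the sampled Fejer means.\<close>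

lemma sum_fejer_coeff_le:
  assumes "f \<in> Lp 2"
  shows "(\<Sum>s\<in>{- int n..int n}. (norm (fejer_coeff f n s))\<^sup>2) \<le> (\<integral>y. norm (f y) powr 2 \<partial>circle)"
proof -
  obtain L where "int (2 * n) < 2 ^ L" using eventually_happens'[OF _ eventually_less_two_power[of "2 * n"]] by auto
  then have L: "2 * int n < 2 ^ L" by simp
  then have "int n < 2 ^ L" by linarith
  then have "(\<Sum>y\<in>grid L. norm (sample L (trig_poly n (fejer_coeff f n)) y) powr 2) \<le> 2 ^ L * (\<integral>y. norm (f y) powr 2 \<partial>circle)"
    by (intro sum_grid_fejer_le assms) auto
  then have "2 ^ L * (\<Sum>s\<in>{- int n..int n}. (norm (fejer_coeff f n s))\<^sup>2) \<le> 2 ^ L * (\<integral>y. norm (f y) powr 2 \<partial>circle)"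
    unfolding parseval_sample_trig_poly[OF L, symmetric] by simp
  then show ?thesis by simp
qed

lemma bessel:
  assumes f: "f \<in> Lp 2" and A: "finite A"
  shows "(\<Sum>s\<in>A. (norm (fourier_coeff f s))\<^sup>2) \<le> (\<integral>y. norm (f y) powr 2 \<partial>circle)"
proof (rule LIMSEQ_le_const2)
  show "(\<lambda>n. \<Sum>s\<in>A. (norm (fejer_coeff f n s))\<^sup>2) \<longlonglongrightarrow> (\<Sum>s\<in>A. (norm (fourier_coeff f s))\<^sup>2)"
    by (intro tendsto_intros fejer_coeff_tendsto)
  obtain N where N: "A \<subseteq> {- int N..int N}" using finite_int_subset_interval[OF A] by blast
  have "(\<Sum>s\<in>A. (norm (fejer_coeff f n s))\<^sup>2) \<le> (\<integral>y. norm (f y) powr 2 \<partial>circle)" if n: "N \<le> n" for n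
  proof -
    have "(\<Sum>s\<in>A. (norm (fejer_coeff f n s))\<^sup>2) \<le> (\<Sum>s\<in>{- int n..int n}. (norm (fejer_coeff f n s))\<^sup>2)"
      by (rule sum_mono2) (use N n in auto)
    then show ?thesis using sum_fejer_coeff_le[OF f, of n] by linarith
  qed
  then show "\<exists>N. \<forall>n\<ge>N. (\<Sum>s\<in>A. (norm (fejer_coeff f n s))\<^sup>2) \<le> (\<integral>y. norm (f y) powr 2 \<partial>circle)" by blast
qed

text \<open>A finite set \<open>B\<close> carries all but e / 2 of the energy. On \<open>B\<close>
  the coefficients converge one by one; off \<open>B\<close> the error is dominated by the
  coefficients of \<open>f\<close>.\<close>

lemma fejer_coeff_l2_convergent:
  assumes f: "f \<in> Lp 2" and e: "0 < e"
  obtains N where "\<And>n A. N \<le> n \<Longrightarrow> finite A \<Longrightarrow> (\<Sum>s\<in>A. (norm (fejer_coeff f n s - fourier_coeff f s))\<^sup>2) \<le> e"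
proof -
  define c where "c s = (norm (fourier_coeff f s))\<^sup>2" for s
  have bdd: "bdd_above (sum c ` {A. finite A})"
    using bessel[OF f] unfolding c_def by (intro bdd_aboveI2) auto
  define S where "S = (SUP A\<in>{A. finite A}. sum c A)"
  have "\<exists>B\<in>{A. finite A}. S - e / 2 < sum c B"
    using less_cSUP_iff[OF _ bdd, of "S - e / 2"] e by (force simp: S_def)
  then obtain B where B: "finite B" "S - e / 2 < sum c B" by auto
  have "(\<lambda>n. \<Sum>s\<in>B. (norm (fejer_coeff f n s - fourier_coeff f s))\<^sup>2) \<longlonglongrightarrow> (\<Sum>s\<in>B. (norm (fourier_coeff f s - fourier_coeff f s))\<^sup>2)"
    by (intro tendsto_intros fejer_coeff_tendsto)
  then have "\<forall>\<^sub>F n in sequentially. (\<Sum>s\<in>B. (norm (fejer_coeff f n s - fourier_coeff f s))\<^sup>2) < e / 2"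
    using e by (intro order_tendstoD(2)) auto
  then obtain N where N: "\<And>n. N \<le> n \<Longrightarrow> (\<Sum>s\<in>B. (norm (fejer_coeff f n s - fourier_coeff f s))\<^sup>2) < e / 2"
    unfolding eventually_sequentially by blast
  show thesis
  proof (rule that)
    fix n and A :: "int set"
    assume n: "N \<le> n" and A: "finite A"
    let ?d = "\<lambda>s. (norm (fejer_coeff f n s - fourier_coeff f s))\<^sup>2"
    have "sum ?d A \<le> sum ?d (B \<union> (A - B))" by (rule sum_mono2) (use A B in auto)
    also have "\<dots> = sum ?d B + sum ?d (A - B)" by (rule sum.union_disjoint) (use A B in auto)
    finally have 1: "sum ?d A \<le> sum ?d B + sum ?d (A - B)" .
    have "sum ?d (A - B) \<le> sum c (A - B)"
      unfolding c_def by (intro sum_mono power_mono norm_fejer_coeff_diff_le) auto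
    moreover have "sum c B + sum c (A - B) = sum c (B \<union> (A - B))"
      by (rule sum.union_disjoint[symmetric]) (use A B in auto)
    moreover have "sum c (B \<union> (A - B)) \<le> S"
      unfolding S_def by (rule cSUP_upper[OF _ bdd]) (use A B in auto)
    ultimately show "sum ?d A \<le> e" using 1 N[OF n] B(2) by linarith
  qed
qed

text \<open>Cauchy--Schwarz and Parseval on the grid turn smallness of the coefficients in l^2 into
  smallness of the grid means.\<close>

lemma grid_norm_le_1_I:
  assumes "0 \<le> e" and bound: "(\<Sum>s\<in>{- int D..int D}. (norm (c s))\<^sup>2) \<le> e\<^sup>2"
  shows "grid_norm_le 1 (trig_poly D c) e"
  unfolding grid_norm_le_def using eventually_less_two_power[of "2 * D"]
proof eventually_elim
  case (elim L)
  let ?F = "sample L (trig_poly D c)"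
  have "(\<Sum>y\<in>grid L. norm (?F y))\<^sup>2 \<le> (\<Sum>y\<in>grid L. (norm (?F y))\<^sup>2) * card (grid L)"
    by (rule sum_squared_le_sum_of_squares)
  also have "\<dots> = 2 ^ L * (\<Sum>s\<in>{- int D..int D}. (norm (c s))\<^sup>2) * 2 ^ L"
    using elim by (subst parseval_sample_trig_poly) (auto simp: grid_def)
  also have "\<dots> \<le> 2 ^ L * e\<^sup>2 * 2 ^ L" by (intro mult_right_mono mult_left_mono bound) auto
  also have "\<dots> = (e * 2 ^ L)\<^sup>2" by (simp add: power2_eq_square)
  finally have "(\<Sum>y\<in>grid L. norm (?F y)) \<le> e * 2 ^ L"
    by (rule power2_le_imp_le) (use assms in auto)
  then show ?case using assms by simp
qed

lemma grid_norm_le_1_add: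
  assumes "grid_norm_le 1 F a" "grid_norm_le 1 G b" "0 \<le> a" "0 \<le> b" "\<And>x. norm (H x) \<le> norm (F x) + norm (G x)"
  shows "grid_norm_le 1 H (a + b)"
  using assms(1,2) unfolding grid_norm_le_def
proof eventually_elim
  case (elim L)
  have "(\<Sum>y\<in>grid L. norm (sample L H y)) \<le> (\<Sum>y\<in>grid L. norm (sample L F y) + norm (sample L G y))"
    unfolding sample_def by (intro sum_mono assms(5))
  also have "\<dots> \<le> a * 2 ^ L + b * 2 ^ L"
    unfolding sum.distrib using elim assms(3,4) by (intro add_mono) auto
  finally show ?case using assms(3,4) by (simp add: distrib_right)
qed

lemma trig_poly_diff: "trig_poly D (\<lambda>s. c s - d s) x = trig_poly D c x - trig_poly D d x"
  by (simp add: trig_poly_def left_diff_distrib sum_subtractf)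

lemma trig_poly_add: "trig_poly D (\<lambda>s. c s + d s) x = trig_poly D c x + trig_poly D d x"
  by (simp add: trig_poly_def distrib_right sum.distrib)

lemma grid_norm_le_fejer_diff:
  assumes f: "f \<in> Lp 1" and a: "(\<integral>y. norm (f y) \<partial>circle) \<le> a" and n: "n \<le> D" "k \<le> D"
  shows "grid_norm_le 1 (trig_poly D (\<lambda>s. fejer_coeff f n s - fejer_coeff f k s)) (a + a)"
proof -
  have "0 \<le> (\<integral>y. norm (f y) \<partial>circle)" by simp
  then have a0: "0 \<le> a" using a by linarith
  then have a': "(\<integral>y. norm (f y) powr 1 \<partial>circle) \<le> a powr 1" using a by simp
  show ?thesis
    by (rule grid_norm_le_1_add[OF grid_norm_le_fejer[OF f _ a' n(1)] grid_norm_le_fejer[OF f _ a' n(2)] a0 a0])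
       (simp_all add: trig_poly_diff norm_triangle_ineq4)
qed

lemma fejer_Cauchy_L2:
  assumes f: "f \<in> Lp 2" and e: "0 < e"
  obtains N where "\<And>n k D. N \<le> n \<Longrightarrow> N \<le> k \<Longrightarrow> grid_norm_le 1 (trig_poly D (\<lambda>s. fejer_coeff f n s - fejer_coeff f k s)) e"
proof -
  obtain N where N: "\<And>n A. N \<le> n \<Longrightarrow> finite A \<Longrightarrow> (\<Sum>s\<in>A. (norm (fejer_coeff f n s - fourier_coeff f s))\<^sup>2) \<le> e\<^sup>2 / 4"
    using fejer_coeff_l2_convergent[OF f, of "e\<^sup>2 / 4"] e by auto
  show thesis
  proof (rule that)
    fix n k D assume nk: "N \<le> n" "N \<le> k"
    let ?I = "{- int D..int D}"
    show "grid_norm_le 1 (trig_poly D (\<lambda>s. fejer_coeff f n s - fejer_coeff f k s)) e"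
    proof (rule grid_norm_le_1_I)
      have sq: "(norm (u - v))\<^sup>2 \<le> 2 * (norm (u - w))\<^sup>2 + 2 * (norm (v - w))\<^sup>2" for u v w :: complex
      proof -
        have "(norm (u - v))\<^sup>2 \<le> (norm (u - w) + norm (v - w))\<^sup>2"
          using norm_triangle_ineq4[of "u - w" "v - w"] by (intro power_mono) auto
        then show ?thesis using sum_squares_bound[of "norm (u - w)" "norm (v - w)"] by (simp add: power2_sum)
      qed
      have "(\<Sum>s\<in>?I. (norm (fejer_coeff f n s - fejer_coeff f k s))\<^sup>2) \<le>
          (\<Sum>s\<in>?I. 2 * (norm (fejer_coeff f n s - fourier_coeff f s))\<^sup>2 + 2 * (norm (fejer_coeff f k s - fourier_coeff f s))\<^sup>2)"
        by (intro sum_mono sq)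
      also have "\<dots> \<le> 2 * (e\<^sup>2 / 4) + 2 * (e\<^sup>2 / 4)"
        unfolding sum.distrib sum_distrib_left[symmetric] by (intro add_mono mult_left_mono N nk) auto
      finally show "(\<Sum>s\<in>?I. (norm (fejer_coeff f n s - fejer_coeff f k s))\<^sup>2) \<le> e\<^sup>2" by simp
    qed (use e in simp)
  qed
qed

lemma fejer_coeff_add:
  assumes f: "integrable circle f" and g: "integrable circle g"
  shows "fejer_coeff (\<lambda>x. f x + g x) n s = fejer_coeff f n s + fejer_coeff g n s"
proof -
  have cisb: "(\<lambda>y. cis (- 2 * pi * of_int s * y)) \<in> borel_measurable circle"
    by (rule measurable_circle_continuous) (intro continuous_intros)
  have int: "integrable circle (\<lambda>y. h y * cis (- 2 * pi * of_int s * y))" if "integrable circle h" for h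
    by (rule integrable_mult_bounded[OF that cisb, where M = 1]) simp
  show ?thesis
    using Bochner_Integration.integral_add[OF int[OF f] int[OF g]]
    by (simp add: fejer_coeff_def fourier_coeff_def distrib_right distrib_left)
qed

lemma truncation_approximates:
  assumes f: "integrable circle f" and e: "0 < e"
  obtains g where "g \<in> Lp 2" "integrable circle g" "(\<integral>x. norm (f x - g x) \<partial>circle) \<le> e"
proof -
  have fm: "f \<in> borel_measurable circle" using f by simp
  define g where "g k x = (if norm (f x) \<le> real k then f x else 0)" for k x
  have gm: "g k \<in> borel_measurable circle" for k
    unfolding g_def using fm by measurable
  have gb: "norm (g k x) \<le> real k" for k x by (simp add: g_def)
  have "(\<lambda>k. \<integral>x. norm (f x - g k x) \<partial>circle) \<longlonglongrightarrow> (\<integral>x. (0::real) \<partial>circle)"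
  proof (rule integral_dominated_convergence[where w = "\<lambda>x. norm (f x)"])
    show "AE x in circle. (\<lambda>k. norm (f x - g k x)) \<longlonglongrightarrow> 0"
    proof (intro AE_I2)
      fix x
      obtain k0 :: nat where "norm (f x) \<le> real k0" using real_arch_simple by blast
      then have "\<forall>\<^sub>F k in sequentially. norm (f x - g k x) = 0"
        using eventually_ge_at_top[of k0] by (elim eventually_mono) (auto simp: g_def)
      then show "(\<lambda>k. norm (f x - g k x)) \<longlonglongrightarrow> 0" by (rule tendsto_eventually)
    qed
    show "AE x in circle. norm (norm (f x - g k x)) \<le> norm (f x)" for k by (intro AE_I2) (simp add: g_def)
    show "(\<lambda>x. norm (f x - g k x)) \<in> borel_measurable circle" for k
      by (rule measurable_compose[OF borel_measurable_diff[OF fm gm] borel_measurable_norm])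
  qed (use f in auto)
  then have "\<forall>\<^sub>F k in sequentially. (\<integral>x. norm (f x - g k x) \<partial>circle) < e"
    using e by (intro order_tendstoD(2)) auto
  then obtain k where k: "(\<integral>x. norm (f x - g k x) \<partial>circle) < e"
    using eventually_happens'[OF sequentially_bot] by blast
  show thesis
  proof (rule that)
    show "g k \<in> Lp 2"
      unfolding Lp_def
    proof (intro CollectI conjI)
      show "integrable circle (\<lambda>x. norm (g k x) powr 2)"
        by (rule circle.integrable_const_bound[where B = "real k powr 2"])
           (use gb gm in \<open>auto intro!: AE_I2 powr_mono2\<close>)
    qed (rule gm)
    show "integrable circle (g k)"
      by (rule circle.integrable_const_bound[where B = "real k"]) (use gb gm in auto)
    show "(\<integral>x. norm (f x - g k x) \<partial>circle) \<le> e" using k by simp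
  qed
qed

text \<open>Density argument: a truncation of \<open>f\<close> lies in L^2, where the coefficients
  converge, and the Fejer means of the remainder are uniformly small in L^1. The degree
  \<open>D\<close> is left free so that means of different order can enter
  \<open>Lambda_poly\<close> at a common degree.\<close>

lemma fejer_Cauchy:
  assumes f: "integrable circle f" and e: "0 < e"
  obtains N where "\<And>n k D. \<lbrakk>N \<le> n; N \<le> k; n \<le> D; k \<le> D\<rbrakk> \<Longrightarrow>
    grid_norm_le 1 (trig_poly D (\<lambda>s. fejer_coeff f n s - fejer_coeff f k s)) e"
proof -
  obtain g where g: "g \<in> Lp 2" "integrable circle g" "(\<integral>x. norm (f x - g x) \<partial>circle) \<le> e / 4"
    using truncation_approximates[OF f, of "e / 4"] e by auto
  obtain N where N: "\<And>n k D. N \<le> n \<Longrightarrow> N \<le> k \<Longrightarrow> grid_norm_le 1 (trig_poly D (\<lambda>s. fejer_coeff g n s - fejer_coeff g k s)) (e / 2)"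
    using fejer_Cauchy_L2[OF g(1), of "e / 2"] e by auto
  define h where "h x = f x - g x" for x
  have hi: "integrable circle h" unfolding h_def by (intro Bochner_Integration.integrable_diff f g)
  have fe: "fejer_coeff f n s = fejer_coeff g n s + fejer_coeff h n s" for n s
    using fejer_coeff_add[OF g(2) hi, of n s] by (simp add: h_def)
  show thesis
  proof (rule that)
    fix n k D assume *: "N \<le> n" "N \<le> k" "n \<le> D" "k \<le> D"
    have "grid_norm_le 1 (trig_poly D (\<lambda>s. fejer_coeff f n s - fejer_coeff f k s)) (e / 2 + (e / 4 + e / 4))"
    proof (rule grid_norm_le_1_add)
      show "grid_norm_le 1 (trig_poly D (\<lambda>s. fejer_coeff g n s - fejer_coeff g k s)) (e / 2)" using * by (intro N)
      show "grid_norm_le 1 (trig_poly D (\<lambda>s. fejer_coeff h n s - fejer_coeff h k s)) (e / 4 + e / 4)"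
        by (rule grid_norm_le_fejer_diff) (use hi g(3) * in \<open>auto simp: Lp_1_iff h_def\<close>)
      fix x
      have "(\<lambda>s. fejer_coeff f n s - fejer_coeff f k s) =
          (\<lambda>s. (fejer_coeff g n s - fejer_coeff g k s) + (fejer_coeff h n s - fejer_coeff h k s))"
        by (simp add: fe fun_eq_iff)
      then show "norm (trig_poly D (\<lambda>s. fejer_coeff f n s - fejer_coeff f k s) x) \<le>
          norm (trig_poly D (\<lambda>s. fejer_coeff g n s - fejer_coeff g k s) x) + norm (trig_poly D (\<lambda>s. fejer_coeff h n s - fejer_coeff h k s) x)"
        by (simp only: trig_poly_add[of D "\<lambda>s. fejer_coeff g n s - fejer_coeff g k s" "\<lambda>s. fejer_coeff h n s - fejer_coeff h k s"] norm_triangle_ineq)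
    qed (use e in auto)
    then show "grid_norm_le 1 (trig_poly D (\<lambda>s. fejer_coeff f n s - fejer_coeff f k s)) e" by simp
  qed
qed

section \<open>The operator on \<open>L\<^sup>p\<close> spaces\<close>

lemma measurable_Lambda_poly: "Lambda_poly m D c d \<in> borel_measurable circle"
  by (rule measurable_circle_continuous[OF continuous_Lambda_poly])

lemma measurable_Lambda_mean: "Lambda_mean m f g n \<in> borel_measurable circle"
  unfolding Lambda_mean_eq_Lambda_poly[OF order_refl] by (rule measurable_Lambda_poly)

lemma Lambda_poly_diff:
  "Lambda_poly m D c d x - Lambda_poly m D c' d' x =
     Lambda_poly m D (\<lambda>s. c s - c' s) d x + Lambda_poly m D c' (\<lambda>s. d s - d' s) x"
  unfolding Lambda_poly_def sum_subtractf[symmetric] sum.distrib[symmetric]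
  by (intro sum.cong refl) (simp add: algebra_simps)

lemma Lambda_mean_Cauchy_in_measure:
  assumes m: "coifman_meyer m" and f: "integrable circle f" and g: "integrable circle g" and e: "0 < e"
  shows "\<exists>N. \<forall>n\<ge>N. \<forall>k\<ge>N. tail_measure (\<lambda>x. Lambda_mean m f g n x - Lambda_mean m f g k x) e \<le> e"
proof -
  obtain K where K: "0 < K" "\<And>D c d a b l. \<lbrakk>0 < a; 0 < b; 0 < l; grid_norm_le 1 (trig_poly D c) a; grid_norm_le 1 (trig_poly D d) b\<rbrakk> \<Longrightarrow>
       tail_measure (Lambda_poly m D c d) l \<le> K * (a * b / l) powr (1 / 2)"
    using Lambda_poly_weak[OF m, of "1 / 2" 1 1] unfolding tail_measure_def by auto
  \<comment> \<open>The summand 1 keeps \<open>b\<close> positive when both functions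
    vanish.\<close>
  define b where "b = (\<integral>x. norm (f x) \<partial>circle) + (\<integral>x. norm (g x) \<partial>circle) + 1"
  have fg0: "0 \<le> (\<integral>x. norm (f x) \<partial>circle)" "0 \<le> (\<integral>x. norm (g x) \<partial>circle)" by simp_all
  then have b: "0 < b" unfolding b_def by linarith
  \<comment> \<open>Chosen so that the weak type bound at level e / 2 becomes e / 2 for each of the
    two terms of \<open>Lambda_poly_diff\<close>.\<close>
  define d where "d = (e / (2 * K))\<^sup>2 * (e / 2) / b"
  have d: "0 < d" using e K(1) b by (simp add: d_def)
  have "d * b / (e / 2) = (e / (2 * K))\<^sup>2" using e b by (simp add: d_def)
  moreover have "((e / (2 * K))\<^sup>2) powr (1 / 2) = e / (2 * K)"
    using e K(1) by (simp add: powr_half_sqrt)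
  ultimately have Kd: "K * (d * b / (e / 2)) powr (1 / 2) = e / 2" using K(1) by simp
  have Kd': "K * (b * d / (e / 2)) powr (1 / 2) = e / 2" using Kd by (simp only: mult.commute[of b d])
  obtain N1 where N1: "\<And>n k D. \<lbrakk>N1 \<le> n; N1 \<le> k; n \<le> D; k \<le> D\<rbrakk> \<Longrightarrow>
      grid_norm_le 1 (trig_poly D (\<lambda>s. fejer_coeff f n s - fejer_coeff f k s)) d"
    using fejer_Cauchy[OF f d] by blast
  obtain N2 where N2: "\<And>n k D. \<lbrakk>N2 \<le> n; N2 \<le> k; n \<le> D; k \<le> D\<rbrakk> \<Longrightarrow>
      grid_norm_le 1 (trig_poly D (\<lambda>s. fejer_coeff g n s - fejer_coeff g k s)) d"
    using fejer_Cauchy[OF g d] by blast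
  have fb: "grid_norm_le 1 (trig_poly D (fejer_coeff f n)) b" and gb: "grid_norm_le 1 (trig_poly D (fejer_coeff g n)) b"
    if "n \<le> D" for n D
    using that f g fg0 b by (auto intro!: grid_norm_le_fejer simp: Lp_1_iff b_def)
  have "tail_measure (\<lambda>x. Lambda_mean m f g n x - Lambda_mean m f g k x) e \<le> e" if n: "max N1 N2 \<le> n" and k: "max N1 N2 \<le> k" for n k
  proof -
    define D where "D = max n k"
    have D: "n \<le> D" "k \<le> D" by (auto simp: D_def)
    let ?P = "Lambda_poly m D (\<lambda>s. fejer_coeff f n s - fejer_coeff f k s) (fejer_coeff g n)"
    let ?Q = "Lambda_poly m D (fejer_coeff f k) (\<lambda>s. fejer_coeff g n s - fejer_coeff g k s)"
    have "tail_measure (\<lambda>x. Lambda_mean m f g n x - Lambda_mean m f g k x) (e / 2 + e / 2) \<le> tail_measure ?P (e / 2) + tail_measure ?Q (e / 2)"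
    proof (rule tail_measure_add[OF measurable_Lambda_poly measurable_Lambda_poly])
      show "norm (Lambda_mean m f g n x - Lambda_mean m f g k x) \<le> norm (?P x) + norm (?Q x)" for x
        unfolding Lambda_mean_eq_Lambda_poly[OF D(1)] Lambda_mean_eq_Lambda_poly[OF D(2)] Lambda_poly_diff
        by (rule norm_triangle_ineq)
    qed
    moreover have "tail_measure ?P (e / 2) \<le> K * (d * b / (e / 2)) powr (1 / 2)"
      by (rule K(2)[OF d b _ N1 gb]) (use e n k D in auto)
    moreover have "tail_measure ?Q (e / 2) \<le> K * (b * d / (e / 2)) powr (1 / 2)"
      by (rule K(2)[OF b d _ fb N2]) (use e n k D in auto)
    ultimately show ?thesis unfolding Kd Kd' by simp
  qed
  then show ?thesis by blast
qed

lemma has_Lambda_exists: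
  assumes "coifman_meyer m" "f \<in> Lp p1" "g \<in> Lp p2" "1 \<le> p1" "1 \<le> p2"
  obtains h where "has_Lambda m f g h"
proof -
  have "integrable circle f" "integrable circle g" using assms by (auto intro: Lp_integrable)
  then show thesis
    using Cauchy_in_measure_convergent[OF measurable_Lambda_mean Lambda_mean_Cauchy_in_measure[OF assms(1)]] that
    unfolding has_Lambda_def by blast
qed

lemma Lp_norm_nonneg: "0 \<le> Lp_norm p f"
  by (simp add: Lp_norm_def)

lemma integral_le_Lp_norm_powr:
  assumes "0 < p" "0 \<le> e"
  shows "(\<integral>x. norm (f x) powr p \<partial>circle) \<le> (Lp_norm p f + e) powr p"
proof -
  have "(\<integral>x. norm (f x) powr p \<partial>circle) = Lp_norm p f powr p"
    using assms by (simp add: Lp_norm_def powr_powr)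
  also have "\<dots> \<le> (Lp_norm p f + e) powr p"
    using assms by (intro powr_mono2) (auto simp: Lp_norm_nonneg)
  finally show ?thesis .
qed

text \<open>The bounds for polynomials take positive numbers, while a norm may be 0. The norms are
  therefore enlarged by \<open>e\<close>, which tends to 0 here.\<close>

lemma le_mult_of_perturbed:
  fixes X A B C :: real
  assumes "\<And>e. 0 < e \<Longrightarrow> X \<le> C * ((A + e) * (B + e))"
  shows "X \<le> C * A * B"
proof -
  have "((\<lambda>e. C * ((A + e) * (B + e))) \<longlongrightarrow> C * ((A + 0) * (B + 0))) (at_right 0)"
    by (intro tendsto_intros)
  then have "X \<le> C * ((A + 0) * (B + 0))"
    by (rule tendsto_lowerbound) (use assms in \<open>auto simp: eventually_at_right_less eventually_at_filter\<close>)
  then show ?thesis by simp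
qed

text \<open>Fatou's lemma along an almost everywhere convergent subsequence carries the integral
  bound of the Fejer means to every representative \<open>h\<close>, whether or not p is below
  1.\<close>

lemma maps_boundedly_strong:
  assumes m: "coifman_meyer m" and pp: "1 / p = 1 / p1 + 1 / p2" "1 < p1" "1 < p2"
  shows "maps_boundedly (has_Lambda m) (Lp p1) (Lp_norm p1) (Lp p2) (Lp_norm p2) (Lp p) (Lp_norm p)"
proof -
  have p12: "1 \<le> p1" "1 \<le> p2" using pp by auto
  note p = hoelder_exponents[OF pp(1) p12]
  obtain K where K: "0 < K"
    "\<And>D c d a b. \<lbrakk>0 < a; 0 < b; grid_norm_le p1 (trig_poly D c) a; grid_norm_le p2 (trig_poly D d) b\<rbrakk> \<Longrightarrow>
       integrable circle (\<lambda>x. norm (Lambda_poly m D c d x) powr p) \<and>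
       (\<integral>x. norm (Lambda_poly m D c d x) powr p \<partial>circle) \<le> K * (a * b) powr p"
    using Lambda_poly_strong[OF m pp] by blast
  have main: "h \<in> Lp p \<and> Lp_norm p h \<le> K powr (1 / p) * Lp_norm p1 f * Lp_norm p2 g"
    if f: "f \<in> Lp p1" and g: "g \<in> Lp p2" and h: "has_Lambda m f g h" for f g h
  proof -
    let ?F = "Lambda_mean m f g"
    have conv: "converges_in_measure ?F h" using h by (simp add: has_Lambda_def)
    then have hm: "h \<in> borel_measurable circle" by (simp add: converges_in_measure_def)
    obtain r :: "nat \<Rightarrow> nat" where r: "AE x in circle. (\<lambda>k. ?F (r k) x) \<longlonglongrightarrow> h x"
      using converges_in_measure_AE_subseq[OF conv measurable_Lambda_mean] by blast
    have bound: "integrable circle (\<lambda>x. norm (h x) powr p) \<and>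
        (\<integral>x. norm (h x) powr p \<partial>circle) \<le> K * ((Lp_norm p1 f + e) * (Lp_norm p2 g + e)) powr p" if e: "0 < e" for e
    proof -
      let ?B = "K * ((Lp_norm p1 f + e) * (Lp_norm p2 g + e)) powr p"
      have ab: "0 < Lp_norm p1 f + e" "0 < Lp_norm p2 g + e" using e by (auto intro: add_nonneg_pos Lp_norm_nonneg)
      have "(\<integral>\<^sup>+x. ennreal (norm (h x) powr p) \<partial>circle) = (\<integral>\<^sup>+x. liminf (\<lambda>k. ennreal (norm (?F (r k) x) powr p)) \<partial>circle)"
      proof (rule nn_integral_cong_AE)
        show "AE x in circle. ennreal (norm (h x) powr p) = liminf (\<lambda>k. ennreal (norm (?F (r k) x) powr p))"
          using r
        proof eventually_elim
          case (elim x)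
          have "(\<lambda>k. ennreal (norm (?F (r k) x) powr p)) \<longlonglongrightarrow> ennreal (norm (h x) powr p)"
            by (intro tendsto_ennrealI tendsto_powr' tendsto_norm elim tendsto_const) (use p in auto)
          then show ?case by (rule lim_imp_Liminf[OF sequentially_bot, symmetric])
        qed
      qed
      also have "\<dots> \<le> liminf (\<lambda>k. \<integral>\<^sup>+x. ennreal (norm (?F (r k) x) powr p) \<partial>circle)"
      proof (rule nn_integral_liminf)
        fix k
        note [measurable] = measurable_Lambda_mean[of m f g "r k"]
        show "(\<lambda>x. ennreal (norm (?F (r k) x) powr p)) \<in> borel_measurable circle" by measurable
      qed
      also have "\<dots> \<le> ennreal ?B"
      proof (rule Liminf_le)
        show "\<forall>\<^sub>F k in sequentially. (\<integral>\<^sup>+x. ennreal (norm (?F (r k) x) powr p) \<partial>circle) \<le> ennreal ?B"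
        proof (intro always_eventually allI)
          fix k
          have "integrable circle (\<lambda>x. norm (?F (r k) x) powr p) \<and> (\<integral>x. norm (?F (r k) x) powr p \<partial>circle) \<le> ?B"
            unfolding Lambda_mean_eq_Lambda_poly[OF order_refl]
            by (intro K(2) ab grid_norm_le_fejer f g p12 order_refl integral_le_Lp_norm_powr) (use p12 e in auto)
          then show "(\<integral>\<^sup>+x. ennreal (norm (?F (r k) x) powr p) \<partial>circle) \<le> ennreal ?B"
            by (subst nn_integral_eq_integral) (auto intro: ennreal_leI)
        qed
      qed simp
      finally have le: "(\<integral>\<^sup>+x. ennreal (norm (h x) powr p) \<partial>circle) \<le> ennreal ?B" .
      have hpm: "(\<lambda>x. norm (h x) powr p) \<in> borel_measurable circle" using hm by measurable
      have int: "integrable circle (\<lambda>x. norm (h x) powr p)"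
        by (rule integrableI_nonneg[OF hpm]) (use le in \<open>auto intro: le_less_trans\<close>)
      moreover have "ennreal (\<integral>x. norm (h x) powr p \<partial>circle) \<le> ennreal ?B"
        using le int by (subst (asm) nn_integral_eq_integral) auto
      ultimately show ?thesis using K(1) by (simp add: ennreal_le_iff)
    qed
    have "Lp_norm p h \<le> K powr (1 / p) * ((Lp_norm p1 f + e) * (Lp_norm p2 g + e))" if e: "0 < e" for e
    proof -
      have ab: "0 < Lp_norm p1 f + e" "0 < Lp_norm p2 g + e" using e by (auto intro: add_nonneg_pos Lp_norm_nonneg)
      have "Lp_norm p h \<le> (K * ((Lp_norm p1 f + e) * (Lp_norm p2 g + e)) powr p) powr (1 / p)"
        unfolding Lp_norm_def[of p h] using bound[OF e] p by (intro powr_mono2) auto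
      also have "\<dots> = K powr (1 / p) * ((Lp_norm p1 f + e) * (Lp_norm p2 g + e))"
        using ab p K(1) by (simp add: powr_mult powr_powr)
      finally show ?thesis .
    qed
    then have "Lp_norm p h \<le> K powr (1 / p) * Lp_norm p1 f * Lp_norm p2 g" by (rule le_mult_of_perturbed)
    moreover have "h \<in> Lp p" using bound[of 1] hm by (simp add: Lp_def)
    ultimately show ?thesis by simp
  qed
  show ?thesis
    unfolding maps_boundedly_def
  proof (intro exI[of _ "K powr (1 / p)"] ballI conjI)
    fix f g assume "f \<in> Lp p1" "g \<in> Lp p2"
    then show "\<exists>h. has_Lambda m f g h" "\<forall>h. has_Lambda m f g h \<longrightarrow> h \<in> Lp p \<and> Lp_norm p h \<le> K powr (1 / p) * Lp_norm p1 f * Lp_norm p2 g"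
      using has_Lambda_exists[OF m _ _ p12] main by blast+
  qed
qed

text \<open>A level of \<open>h\<close> is shared equally between a Fejer mean and the error, whose
  tail measure tends to 0; halving the level is the factor 2 in \<open>C\<close>.\<close>

lemma maps_boundedly_weak:
  assumes m: "coifman_meyer m" and pp: "1 / p = 1 / p1 + 1 / p2" "1 \<le> p1" "1 \<le> p2"
  shows "maps_boundedly (has_Lambda m) (Lp p1) (Lp_norm p1) (Lp p2) (Lp_norm p2) (weak_Lp p) (weak_Lp_norm p)"
proof -
  note p = hoelder_exponents[OF pp]
  obtain K where K: "0 < K" "\<And>D c d a b l. \<lbrakk>0 < a; 0 < b; 0 < l; grid_norm_le p1 (trig_poly D c) a; grid_norm_le p2 (trig_poly D d) b\<rbrakk> \<Longrightarrow>
       tail_measure (Lambda_poly m D c d) l \<le> K * (a * b / l) powr p"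
    using Lambda_poly_weak[OF m pp] unfolding tail_measure_def by blast
  define C where "C = K powr (1 / p) * 2"
  have main: "h \<in> weak_Lp p \<and> weak_Lp_norm p h \<le> C * Lp_norm p1 f * Lp_norm p2 g"
    if f: "f \<in> Lp p1" and g: "g \<in> Lp p2" and h: "has_Lambda m f g h" for f g h
  proof -
    let ?F = "Lambda_mean m f g"
    have hm: "h \<in> borel_measurable circle" and lim: "\<And>l. 0 < l \<Longrightarrow> (\<lambda>n. tail_measure (\<lambda>x. ?F n x - h x) l) \<longlonglongrightarrow> 0"
      using h by (auto simp: has_Lambda_def converges_in_measure_iff)
    have "level_quantity p h l \<le> C * ((Lp_norm p1 f + e) * (Lp_norm p2 g + e))" if l: "0 < l" and e: "0 < e" for l e
    proof -
      let ?a = "Lp_norm p1 f + e" and ?b = "Lp_norm p2 g + e"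
      have ab: "0 < ?a" "0 < ?b" using e by (auto intro: add_nonneg_pos Lp_norm_nonneg)
      let ?B = "K * (?a * ?b / (l / 2)) powr p"
      have "tail_measure h l \<le> ?B + tail_measure (\<lambda>x. ?F n x - h x) (l / 2)" for n
      proof -
        have "tail_measure h (l / 2 + l / 2) \<le> tail_measure (?F n) (l / 2) + tail_measure (\<lambda>x. ?F n x - h x) (l / 2)"
        proof (rule tail_measure_add)
          show "norm (h x) \<le> norm (?F n x) + norm (?F n x - h x)" for x
            using norm_triangle_ineq4[of "?F n x" "?F n x - h x"] by simp
        qed (intro borel_measurable_diff measurable_Lambda_mean hm)+
        moreover have "tail_measure (?F n) (l / 2) \<le> ?B"
          unfolding Lambda_mean_eq_Lambda_poly[OF order_refl]
          by (intro K(2) ab grid_norm_le_fejer f g pp order_refl integral_le_Lp_norm_powr) (use pp e l in auto)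
        ultimately show ?thesis by simp
      qed
      moreover have "(\<lambda>n. ?B + tail_measure (\<lambda>x. ?F n x - h x) (l / 2)) \<longlonglongrightarrow> ?B + 0"
        by (intro tendsto_intros lim) (use l in simp)
      ultimately have "tail_measure h l \<le> ?B + 0" by (intro LIMSEQ_le_const) auto
      then have "tail_measure h l powr (1 / p) \<le> ?B powr (1 / p)"
        using p by (intro powr_mono2) (auto simp: tail_measure_nonneg)
      also have "?B powr (1 / p) = K powr (1 / p) * (?a * ?b / (l / 2))"
        using ab p K(1) l by (simp add: powr_mult powr_powr)
      finally have "l * tail_measure h l powr (1 / p) \<le> l * (K powr (1 / p) * (?a * ?b / (l / 2)))"
        using l by (intro mult_left_mono) auto
      also have "\<dots> = C * (?a * ?b)" using l by (simp add: C_def)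
      finally show ?thesis by (simp only: level_quantity_def tail_measure_def)
    qed
    then have lev: "level_quantity p h l \<le> C * Lp_norm p1 f * Lp_norm p2 g" if "0 < l" for l
      using that by (intro le_mult_of_perturbed) auto
    then have "bdd_above (level_quantity p h ` {0<..})" by (intro bdd_aboveI2) auto
    moreover have "weak_Lp_norm p h \<le> C * Lp_norm p1 f * Lp_norm p2 g"
      unfolding weak_Lp_norm_def by (rule cSUP_least) (use lev in auto)
    ultimately show ?thesis using hm by (simp add: weak_Lp_def)
  qed
  show ?thesis
    unfolding maps_boundedly_def
  proof (intro exI[of _ C] ballI conjI)
    fix f g assume "f \<in> Lp p1" "g \<in> Lp p2"
    then show "\<exists>h. has_Lambda m f g h" "\<forall>h. has_Lambda m f g h \<longrightarrow> h \<in> weak_Lp p \<and> weak_Lp_norm p h \<le> C * Lp_norm p1 f * Lp_norm p2 g"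
      using has_Lambda_exists[OF m _ _ pp(2,3)] main by blast+
  qed
qed

theorem theorem5p8:
  fixes m :: "real \<times> real \<Rightarrow> complex" and p p1 p2 :: real
  assumes "coifman_meyer m"
    and "1 / p = 1 / p1 + 1 / p2"
  shows "(1 < p1 \<and> 1 < p2 \<longrightarrow>
            maps_boundedly (has_Lambda m) (Lp p1) (Lp_norm p1) (Lp p2) (Lp_norm p2)
              (Lp p) (Lp_norm p)) \<and>
         (1 \<le> p1 \<and> 1 \<le> p2 \<and> (p1 = 1 \<or> p2 = 1) \<longrightarrow>
            maps_boundedly (has_Lambda m) (Lp p1) (Lp_norm p1) (Lp p2) (Lp_norm p2)
              (weak_Lp p) (weak_Lp_norm p))"
  using maps_boundedly_strong[OF assms] maps_boundedly_weak[OF assms] by blast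

end
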